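(* Let $\mathsf L$ be either the Fokker--Planck operator $\mathsf L_1f:=\Delta_vf+\nabla_v\cdot(vf)$ or the linear BGK operator $\mathsf L_2f:=\rho_f\,\mathcal M-f$, where $\mathcal M(v)=(2\pi)^{-d/2}e^{-|v|^2/2}$ and $\rho_f:=\int_{\mathbb R^d}f\,dv$. Let $\lambda_\star$ be the number defined in the context. For any small $\varepsilon>0$ there exists some $L_\varepsilon>0$ such that, for any $L\in(0,L_\varepsilon]$ and $\mathcal X=[0,L)^d$ (with periodic boundary conditions), if $f$ solves $$\partial_tf+v\cdot\nabla_xf=\mathsf Lf,\qquad f(0,x,v)=f_0(x,v),\qquad x\in\mathcal X,\ v\in\mathbb R^d,\ t\ge0,$$ with $f_0\in\mathrm L^2(\mathcal X\times\mathbb R^d,dx\,d\gamma)$, then $$\|f(t,\cdot,\cdot)-\bar f\,\mathcal M\|_{\mathrm L^2(dx\,d\gamma)}^2\le(1+\varepsilon)\,\|f_0-\bar f\,\mathcal M\|_{\mathrm L^2(dx\,d\gamma)}^2\,e^{-\min\{2,\lambda_\star-\varepsilon\}\,t}\quad\text{for all }t\ge0,$$ with $\bar f:=\frac1{L^d}\iint_{\mathcal X\times\mathbb R^d}f_0(x,v)\,dx\,dv$.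
   Context: $d\gamma:=\mathcal M(v)^{-1}dv$ and $\|f\|^2_{\mathrm L^2(dx\,d\gamma)}=\iint_{\mathcal X\times\mathbb R^d}|f|^2\,dx\,d\gamma$. Mode-by-mode quantities: for fixed $\xi\in\mathbb R^d\setminus\{0\}$, on the complex Hilbert space $\mathrm L^2(d\gamma)$ of functions $F=F(v)$, with norm $\|\cdot\|$ and inner product $\langle\cdot,\cdot\rangle$, set $\mathsf TF:=i(v\cdot\xi)F$, $\Pi F:=\mathcal M\int_{\mathbb R^d}F\,dv$, and $$(\mathsf AF)(v):=-\frac{i\,\xi}{1+|\xi|^2}\cdot\int_{\mathbb R^d}w\,F(w)\,dw\;\mathcal M(v).$$ For $\delta>0$ let $\mathsf H_1[F]:=\frac12\|F\|^2+\delta\,\mathrm{Re}\langle\mathsf AF,F\rangle$ and $$\mathsf D[F]:=-\langle\mathsf LF,F\rangle+\delta\langle\mathsf{AT}\Pi F,F\rangle-\delta\,\mathrm{Re}\langle\mathsf{TA}F,F\rangle+\delta\,\mathrm{Re}\langle\mathsf{AT}(\mathrm{Id}-\Pi)F,F\rangle-\delta\,\mathrm{Re}\langle\mathsf{AL}F,F\rangle .$$ Let $\lambda(\xi)$ denote the optimal (largest) constant in the inequality $\mathsf D[F]\ge\lambda(\xi)\,\mathsf H_1[F]$ for all $F$ (for which $\mathsf D[F]$ is defined), corresponding to the best possible choice of $\delta>0$ for the given $\xi$. For $L>0$, $\lambda_L(\xi)$ denotes $\lambda(\xi)$ for $\xi$ limited to $(2\pi/L)\mathbb Z^d\setminus\{0\}$,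 and $$\lambda_\star:=\liminf_{L\to0_+}\ \inf_{\xi\in(2\pi/L)\mathbb Z^d\setminus\{0\}}\lambda_L(\xi).$$ *)

theory Defs
  imports "HOL-Analysis.Analysis"
begin

section \<open>Square-integrable functions\<close>

definition L2_fun :: "'a measure \<Rightarrow> ('a \<Rightarrow> complex) \<Rightarrow> bool" where
  "L2_fun \<mu> g \<longleftrightarrow> g \<in> borel_measurable \<mu> \<and> integrable \<mu> (\<lambda>z. (norm (g z))\<^sup>2)"

definition L2_normsq :: "'a measure \<Rightarrow> ('a \<Rightarrow> complex) \<Rightarrow> real" where
  "L2_normsq \<mu> g = (\<integral>z. (norm (g z))\<^sup>2 \<partial>\<mu>)"

definition L2_inner :: "'a measure \<Rightarrow> ('a \<Rightarrow> complex) \<Rightarrow> ('a \<Rightarrow> complex) \<Rightarrow> complex" where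
  "L2_inner \<mu> g h = (\<integral>z. g z * cnj (h z) \<partial>\<mu>)"


section \<open>Phase space\<close>

definition maxwellian :: "real ^ 'n \<Rightarrow> real" where
  "maxwellian v = (2 * pi) powr (- (real CARD('n) / 2)) * exp (- ((norm v)\<^sup>2) / 2)"

definition gamma :: "(real ^ 'n) measure" where
  "gamma = density lborel (\<lambda>v. ennreal (1 / maxwellian v))"

definition cell :: "real \<Rightarrow> (real ^ 'n) set" where
  "cell L = {x. \<forall>i. 0 \<le> x $ i \<and> x $ i < L}"

definition dx :: "real \<Rightarrow> (real ^ 'n) measure" where
  "dx L = restrict_space lborel (cell L)"

definition dx_dv :: "real \<Rightarrow> ((real ^ 'n) \<times> (real ^ 'n)) measure" where
  "dx_dv L = dx L \<Otimes>\<^sub>M lborel"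

definition dx_dgamma :: "real \<Rightarrow> ((real ^ 'n) \<times> (real ^ 'n)) measure" where
  "dx_dgamma L = dx L \<Otimes>\<^sub>M gamma"


section \<open>Collision operators\<close>

definition partial_deriv :: "'n \<Rightarrow> (real ^ 'n \<Rightarrow> complex) \<Rightarrow> real ^ 'n \<Rightarrow> complex" where
  "partial_deriv i g v = frechet_derivative g (at v) (axis i 1)"

definition rho :: "(real ^ 'n \<Rightarrow> complex) \<Rightarrow> complex" where
  "rho F = (\<integral>v. F v \<partial>lborel)"

definition fokker_planck :: "(real ^ 'n \<Rightarrow> complex) \<Rightarrow> real ^ 'n \<Rightarrow> complex" where
  "fokker_planck F v =
     (\<Sum>i\<in>UNIV. partial_deriv i (partial_deriv i F) v)
   + (\<Sum>i\<in>UNIV. partial_deriv i (\<lambda>w. complex_of_real (w $ i) * F w) v)"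

definition linear_bgk :: "(real ^ 'n \<Rightarrow> complex) \<Rightarrow> real ^ 'n \<Rightarrow> complex" where
  "linear_bgk F v = rho F * complex_of_real (maxwellian v) - F v"

definition C2 :: "('a::real_normed_vector \<Rightarrow> complex) \<Rightarrow> bool" where
  "C2 g \<longleftrightarrow>
     (\<forall>z. g differentiable at z) \<and>
     (\<forall>h z. (\<lambda>y. frechet_derivative g (at y) h) differentiable at z) \<and>
     (\<forall>h k. continuous_on UNIV
        (\<lambda>z. frechet_derivative (\<lambda>y. frechet_derivative g (at y) h) (at z) k))"

definition velocity_test :: "(real ^ 'n \<Rightarrow> complex) \<Rightarrow> bool" where
  "velocity_test \<psi> \<longleftrightarrow> C2 \<psi> \<and> (\<exists>R. \<forall>v. norm v > R \<longrightarrow> \<psi> v = 0)"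

text \<open>
  Both collision operators are formally symmetric for the pairing against
  \<open>d\<gamma> = M(v)\<^sup>-\<^sup>1 dv\<close>: the Fokker--Planck operator is \<open>F \<mapsto> div (M grad (F / M))\<close>, and
  the BGK operator is \<open>F \<mapsto> \<rho>\<^sub>F M - F\<close>.  Hence \<open>G = L F\<close> holds in the sense of
  distributions iff \<open>\<integral> F (L \<psi>) d\<gamma> = \<integral> G \<psi> d\<gamma>\<close> for all test functions \<open>\<psi>\<close>, where
  \<open>L \<psi>\<close> is given by the pointwise formula.  The predicate below is the graph of
  \<open>L\<close> on its maximal domain in \<open>L\<^sup>2(d\<gamma>)\<close>; \<open>G\<close> is determined by \<open>F\<close> up to a null set.
\<close>

definition collision_graph ::
  "((real ^ 'n \<Rightarrow> complex) \<Rightarrow> real ^ 'n \<Rightarrow> complex)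
     \<Rightarrow> (real ^ 'n \<Rightarrow> complex) \<Rightarrow> (real ^ 'n \<Rightarrow> complex) \<Rightarrow> bool" where
  "collision_graph Lop F G \<longleftrightarrow>
     L2_fun gamma F \<and> L2_fun gamma G \<and>
     (\<forall>\<psi>. velocity_test \<psi> \<longrightarrow>
        (\<integral>v. F v * Lop \<psi> v \<partial>gamma) = (\<integral>v. G v * \<psi> v \<partial>gamma))"


section \<open>Mode-by-mode functionals\<close>

definition op_T :: "real ^ 'n \<Rightarrow> (real ^ 'n \<Rightarrow> complex) \<Rightarrow> real ^ 'n \<Rightarrow> complex" where
  "op_T \<xi> F v = \<i> * complex_of_real (v \<bullet> \<xi>) * F v"

definition op_Pi :: "(real ^ 'n \<Rightarrow> complex) \<Rightarrow> real ^ 'n \<Rightarrow> complex" where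
  "op_Pi F v = complex_of_real (maxwellian v) * rho F"

definition op_A :: "real ^ 'n \<Rightarrow> (real ^ 'n \<Rightarrow> complex) \<Rightarrow> real ^ 'n \<Rightarrow> complex" where
  "op_A \<xi> F v =
     - (\<Sum>j\<in>UNIV. \<i> * complex_of_real (\<xi> $ j) / complex_of_real (1 + (norm \<xi>)\<^sup>2)
          * (\<integral>w. complex_of_real (w $ j) * F w \<partial>lborel))
     * complex_of_real (maxwellian v)"

definition H1 :: "real \<Rightarrow> real ^ 'n \<Rightarrow> (real ^ 'n \<Rightarrow> complex) \<Rightarrow> real" where
  "H1 \<delta> \<xi> F = 1 / 2 * L2_normsq gamma F + \<delta> * Re (L2_inner gamma (op_A \<xi> F) F)"

text \<open>
  The argument \<open>LF\<close> stands for the image of \<open>F\<close> under the (unbounded) collision operator.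
  The inner products \<open>\<langle>L F, F\<rangle>\<close> and \<open>\<langle>A T \<Pi> F, F\<rangle>\<close> are real; \<open>Re\<close> is
  only a type conversion there.  The function \<open>T (F - \<Pi> F)\<close> need not lie in \<open>L\<^sup>2(d\<gamma>)\<close>,
  but \<open>A\<close> only takes a first moment of it, which converges absolutely for all
  \<open>F\<close> in \<open>L\<^sup>2(d\<gamma>)\<close>.  So the functional is defined as soon as \<open>F\<close> is in the domain of \<open>L\<close>.
\<close>

definition dissipation ::
  "real \<Rightarrow> real ^ 'n \<Rightarrow> (real ^ 'n \<Rightarrow> complex) \<Rightarrow> (real ^ 'n \<Rightarrow> complex) \<Rightarrow> real" where
  "dissipation \<delta> \<xi> F LF =
     - Re (L2_inner gamma LF F)
     + \<delta> * Re (L2_inner gamma (op_A \<xi> (op_T \<xi> (op_Pi F))) F)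
     - \<delta> * Re (L2_inner gamma (op_T \<xi> (op_A \<xi> F)) F)
     + \<delta> * Re (L2_inner gamma (op_A \<xi> (op_T \<xi> (\<lambda>v. F v - op_Pi F v))) F)
     - \<delta> * Re (L2_inner gamma (op_A \<xi> LF) F)"

text \<open>
  Extended reals keep the suprema and infima meaningful: for a large \<open>\<delta>\<close>, where \<open>H1\<close> is
  indefinite, there may be no admissible constant at all.
\<close>

definition lambda_opt ::
  "((real ^ 'n \<Rightarrow> complex) \<Rightarrow> real ^ 'n \<Rightarrow> complex) \<Rightarrow> real ^ 'n \<Rightarrow> ereal" where
  "lambda_opt Lop \<xi> =
     (SUP \<delta>\<in>{0<..}. Sup (ereal ` {l. \<forall>F LF. collision_graph Lop F LF \<longrightarrow>
                                   dissipation \<delta> \<xi> F LF \<ge> l * H1 \<delta> \<xi> F}))"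

definition dual_lattice :: "real \<Rightarrow> (real ^ 'n) set" where
  "dual_lattice L = {\<xi>. \<forall>i. \<exists>k::int. \<xi> $ i = 2 * pi / L * real_of_int k}"

text \<open>
  Testing \<open>D \<ge> \<lambda> H1\<close> with \<open>M\<close> and with \<open>(v \<bullet> \<xi>) M\<close> gives \<open>\<lambda> \<le> 1\<close>, and \<open>\<lambda> = 0\<close>
  is admissible for small \<open>\<delta>\<close>.  So the lower limit lies in \<open>[0, 1]\<close> and the conversion to
  \<open>real\<close> loses nothing.
\<close>

definition lambda_star ::
  "((real ^ 'n \<Rightarrow> complex) \<Rightarrow> real ^ 'n \<Rightarrow> complex) \<Rightarrow> real" where
  "lambda_star Lop =
     real_of_ereal (Liminf (at_right 0) (\<lambda>L. INF \<xi>\<in>dual_lattice L - {0}. lambda_opt Lop \<xi>))"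


section \<open>Solutions of the kinetic equation\<close>

definition phase_test :: "real \<Rightarrow> ((real ^ 'n) \<times> (real ^ 'n) \<Rightarrow> complex) \<Rightarrow> bool" where
  "phase_test L \<psi> \<longleftrightarrow>
     C2 \<psi> \<and>
     (\<forall>x v i. \<psi> (x + axis i L, v) = \<psi> (x, v)) \<and>
     (\<exists>R. \<forall>x v. norm v > R \<longrightarrow> \<psi> (x, v) = 0)"

text \<open>
  Weak solutions in \<open>C([0,\<infinity>); L\<^sup>2(dx d\<gamma>))\<close> of \<open>\<partial>\<^sub>t f + v \<bullet> \<nabla>\<^sub>x f = L f\<close>.
  The transport operator is antisymmetric and \<open>L\<close> symmetric for the pairing against
  \<open>dx d\<gamma>\<close>, so
  \<open>d/dt \<integral>\<integral> f \<psi> dx d\<gamma> = \<integral>\<integral> f (v \<bullet> \<nabla>\<^sub>x \<psi> + L \<psi>) dx d\<gamma>\<close>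
  for all test functions; the periodic boundary condition is encoded by testing against
  functions that are periodic in \<open>x\<close>.
\<close>

definition kinetic_solution ::
  "((real ^ 'n \<Rightarrow> complex) \<Rightarrow> real ^ 'n \<Rightarrow> complex) \<Rightarrow> real
     \<Rightarrow> ((real ^ 'n) \<times> (real ^ 'n) \<Rightarrow> complex)
     \<Rightarrow> (real \<Rightarrow> (real ^ 'n) \<times> (real ^ 'n) \<Rightarrow> complex) \<Rightarrow> bool" where
  "kinetic_solution Lop L f0 f \<longleftrightarrow>
     (\<forall>t\<ge>0. L2_fun (dx_dgamma L) (f t)) \<and>
     (\<forall>t\<ge>0. ((\<lambda>s. L2_normsq (dx_dgamma L) (\<lambda>z. f s z - f t z)) \<longlongrightarrow> 0) (at t within {0..})) \<and>
     (AE z in dx_dgamma L. f 0 z = f0 z) \<and>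
     (\<forall>\<psi>. phase_test L \<psi> \<longrightarrow> (\<forall>t\<ge>0.
        ((\<lambda>s. \<integral>z. f s z * \<psi> z \<partial>dx_dgamma L) has_vector_derivative
         (\<integral>(x, v). f t (x, v) *
            (frechet_derivative (\<lambda>y. \<psi> (y, v)) (at x) v + Lop (\<lambda>w. \<psi> (x, w)) v) \<partial>dx_dgamma L))
        (at t within {0..})))"

definition mean_value :: "real \<Rightarrow> ((real ^ 'n) \<times> (real ^ 'n) \<Rightarrow> complex) \<Rightarrow> complex" where
  "mean_value L f0 = (\<integral>z. f0 z \<partial>dx_dv L) / complex_of_real (L ^ CARD('n))"

end

theory Submission
  imports Defs "HOL-Probability.Probability" "HOL-Real_Asymp.Real_Asymp"
begin

text \<open>
  Since \<open>min 2 (lambda_star Lop - \<epsilon>) \<le> 2\<close>, it suffices to prove decay of the squared norm at the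
  rate \<open>2\<close> with the constant \<open>1 + \<epsilon>\<close>. Write \<open>u = f / M\<close>. The weak equation, tested with the plane waves \<open>exp (- \<i> (k \<bullet> x + \<eta> \<bullet> v))\<close>,
  turns into a transport equation in \<open>\<eta>\<close>, which characteristics integrate.
  For Fokker--Planck this expresses the Fourier coefficients at time \<open>t\<close> by those at time \<open>0\<close>,
  and splitting the Gaussian kernel \<open>exp (- |\<eta> - \<eta>'|\<^sup>2 / 2)\<close> bounds the adjoint solution operator on the
  mode \<open>k\<close> by \<open>exp (- 2 |k|\<^sup>2 (t - 2 tanh (t / 2)))\<close> in the squared norm; for large \<open>|k|\<close> this is below
  \<open>(1 + \<epsilon>) exp (- 2 t)\<close>. For BGK the density of a mode satisfies a Volterra equation with
  kernel \<open>exp (- |k|\<^sup>2 s\<^sup>2 / 2)\<close> of mass \<open>O(1 / |k|)\<close>, and a \<open>T T\<^sup>*\<close> argument bounds its source in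
  \<open>L\<^sup>2(dt)\<close>, so that the gain term is a perturbation of size \<open>O(L)\<close> of pure damping \<open>exp (- t)\<close>.
  Trigonometric polynomials are dense, so these adjoint estimates bound the norm of \<open>u\<close>.
\<close>

section \<open>Square-integrable functions\<close>

text \<open>The solution is weak and merely continuous in time with values in L2, so no energy
  identity is at hand. Plane waves help because their coefficients are transported along explicit
  curves; the price is a limit in the test class, since a plane wave times the Maxwellian is not
  compactly supported in \<open>v\<close>. All nonzero \<open>k\<close> satisfy
  \<open>|k| \<ge> 2 pi / L\<close>, so a small cell leaves only large frequencies besides
  \<open>k = 0\<close>. The mode \<open>k = 0\<close> does not improve with \<open>L\<close>: by
  mass conservation and the spectral gap \<open>1\<close> of the collision operator its deviation
  from the mean decays like \<open>exp (- 2 t)\<close> in the squared norm, with constant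
  \<open>1\<close>. This is where the rate \<open>2\<close> comes from. The factor
  \<open>1 + \<epsilon>\<close> is spent on the other modes. For Fokker--Planck the function
  \<open>t - 2 tanh (t / 2)\<close> behaves like \<open>t^3 / 12\<close> at \<open>0\<close>, so for
  no fixed \<open>|k|\<close> is the bound below \<open>exp (- 2 t)\<close> at very short times; the
  factor covers \<open>t \<le> ln (1 + \<epsilon>) / 2\<close>. For BGK it covers the relative error
  \<open>(1 + 2 L)^2\<close> caused by the gain term.\<close>

definition L2_norm :: "'a measure \<Rightarrow> ('a \<Rightarrow> complex) \<Rightarrow> real" where
  "L2_norm \<mu> g = sqrt (L2_normsq \<mu> g)"

lemma L2_normsq_nonneg [simp]: "0 \<le> L2_normsq \<mu> g"
  by (simp add: L2_normsq_def)

lemma L2_norm_nonneg [simp]: "0 \<le> L2_norm \<mu> g"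
  by (simp add: L2_norm_def)

lemma L2_norm_power2: "(L2_norm \<mu> g)\<^sup>2 = L2_normsq \<mu> g"
  by (simp add: L2_norm_def)

lemma L2_fun_measurable [measurable_dest]: "L2_fun \<mu> g \<Longrightarrow> g \<in> borel_measurable \<mu>"
  by (simp add: L2_fun_def)

lemma L2_fun_mult_integrable:
  assumes "L2_fun \<mu> f" "L2_fun \<mu> g"
  shows "integrable \<mu> (\<lambda>z. f z * g z)"
proof (rule Bochner_Integration.integrable_bound)
  show "integrable \<mu> (\<lambda>z. (norm (f z))\<^sup>2 + (norm (g z))\<^sup>2)"
    using assms by (auto simp: L2_fun_def)
  show "(\<lambda>z. f z * g z) \<in> borel_measurable \<mu>"
    using assms by (auto simp: L2_fun_def)
  have "norm (f z * g z) \<le> (norm (f z))\<^sup>2 + (norm (g z))\<^sup>2" for z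
  proof -
    have "2 * (norm (f z) * norm (g z)) \<le> (norm (f z))\<^sup>2 + (norm (g z))\<^sup>2"
      using sum_squares_bound[of "norm (f z)" "norm (g z)"] by simp
    moreover have "0 \<le> norm (f z) * norm (g z)" by simp
    ultimately show ?thesis unfolding norm_mult by linarith
  qed
  then show "AE z in \<mu>. norm (f z * g z) \<le> norm ((norm (f z))\<^sup>2 + (norm (g z))\<^sup>2)"
    by auto
qed

lemma borel_measurable_cnj [measurable (raw)]:
  "f \<in> borel_measurable M \<Longrightarrow> (\<lambda>z. cnj (f z)) \<in> borel_measurable M"
  by (rule borel_measurable_continuous_on[of cnj]) (auto intro: continuous_intros)

lemma L2_fun_cnj: "L2_fun \<mu> f \<Longrightarrow> L2_fun \<mu> (\<lambda>z. cnj (f z))"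
  by (auto simp: L2_fun_def intro: borel_measurable_cnj)

lemma L2_fun_cmult: "L2_fun \<mu> f \<Longrightarrow> L2_fun \<mu> (\<lambda>z. c * f z)"
  by (auto simp: L2_fun_def norm_mult power_mult_distrib)

lemma L2_fun_add:
  assumes "L2_fun \<mu> f" "L2_fun \<mu> g"
  shows "L2_fun \<mu> (\<lambda>z. f z + g z)"
  unfolding L2_fun_def
proof
  show "(\<lambda>z. f z + g z) \<in> borel_measurable \<mu>"
    using assms by (auto simp: L2_fun_def)
  show "integrable \<mu> (\<lambda>z. (norm (f z + g z))\<^sup>2)"
  proof (rule Bochner_Integration.integrable_bound)
    show "integrable \<mu> (\<lambda>z. 2 * (norm (f z))\<^sup>2 + 2 * (norm (g z))\<^sup>2)"
      using assms by (auto simp: L2_fun_def)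
    show "(\<lambda>z. (norm (f z + g z))\<^sup>2) \<in> borel_measurable \<mu>"
      using assms by (auto simp: L2_fun_def)
    have "(norm (f z + g z))\<^sup>2 \<le> 2 * (norm (f z))\<^sup>2 + 2 * (norm (g z))\<^sup>2" for z
    proof -
      have "(norm (f z + g z))\<^sup>2 \<le> (norm (f z) + norm (g z))\<^sup>2"
        by (intro power_mono norm_triangle_ineq) auto
      also have "\<dots> \<le> 2 * (norm (f z))\<^sup>2 + 2 * (norm (g z))\<^sup>2"
        using sum_squares_bound[of "norm (f z)" "norm (g z)"] by (simp add: power2_sum)
      finally show ?thesis .
    qed
    then show "AE z in \<mu>. norm ((norm (f z + g z))\<^sup>2) \<le> norm (2 * (norm (f z))\<^sup>2 + 2 * (norm (g z))\<^sup>2)"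
      by auto
  qed
qed

lemma L2_fun_diff: "L2_fun \<mu> f \<Longrightarrow> L2_fun \<mu> g \<Longrightarrow> L2_fun \<mu> (\<lambda>z. f z - g z)"
  using L2_fun_add[of \<mu> f "\<lambda>z. -1 * g z"] L2_fun_cmult[of \<mu> g "-1"] by simp

lemma L2_fun_zero: "L2_fun \<mu> (\<lambda>z. 0)"
  by (simp add: L2_fun_def)

lemma L2_fun_sum:
  "(\<And>j. j \<in> J \<Longrightarrow> L2_fun \<mu> (f j)) \<Longrightarrow> L2_fun \<mu> (\<lambda>z. \<Sum>j\<in>J. f j z)"
  by (induction J rule: infinite_finite_induct) (auto intro: L2_fun_zero L2_fun_add)

lemma L2_fun_dominated:
  assumes "L2_fun \<mu> g" "f \<in> borel_measurable \<mu>" "\<And>z. z \<in> space \<mu> \<Longrightarrow> norm (f z) \<le> norm (g z)"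
  shows "L2_fun \<mu> f"
  unfolding L2_fun_def
proof
  show "integrable \<mu> (\<lambda>z. (norm (f z))\<^sup>2)"
  proof (rule Bochner_Integration.integrable_bound)
    show "integrable \<mu> (\<lambda>z. (norm (g z))\<^sup>2)" using assms(1) by (simp add: L2_fun_def)
    show "(\<lambda>z. (norm (f z))\<^sup>2) \<in> borel_measurable \<mu>" using assms(2) by simp
    show "AE z in \<mu>. norm ((norm (f z))\<^sup>2) \<le> norm ((norm (g z))\<^sup>2)"
      using assms(3) by (auto intro!: AE_I2 power_mono)
  qed
qed (rule assms(2))

lemma (in finite_measure) L2_fun_bounded:
  assumes "f \<in> borel_measurable M" "\<And>z. z \<in> space M \<Longrightarrow> norm (f z) \<le> B"
  shows "L2_fun M f"
proof (rule L2_fun_dominated)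
  show "L2_fun M (\<lambda>z. complex_of_real B)"
    by (simp add: L2_fun_def)
  show "norm (f z) \<le> norm (complex_of_real B)" if "z \<in> space M" for z
    using assms(2)[OF that] norm_ge_zero[of "f z"] by simp
qed fact

text \<open>Bilinear version without a conjugate, because test functions enter the weak equation
  unconjugated. The inequality is taken for nonnegative integrals, where no integrability has to be
  known, and then transferred to real numbers.\<close>

lemma L2_Cauchy_Schwarz:
  assumes f: "L2_fun \<mu> f" and g: "L2_fun \<mu> g"
  shows "norm (\<integral>z. f z * g z \<partial>\<mu>) \<le> L2_norm \<mu> f * L2_norm \<mu> g"
proof -
  have int: "integrable \<mu> (\<lambda>z. norm (f z) * norm (g z))"
    using integrable_norm[OF L2_fun_mult_integrable[OF f g]] by (simp add: norm_mult)
  have "(\<integral>\<^sup>+z. ennreal (norm (f z)) * ennreal (norm (g z)) \<partial>\<mu>)\<^sup>2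
      \<le> (\<integral>\<^sup>+z. ennreal (norm (f z))^2 \<partial>\<mu>) * (\<integral>\<^sup>+z. ennreal (norm (g z))^2 \<partial>\<mu>)"
    using f g by (intro Cauchy_Schwarz_nn_integral) (auto simp: L2_fun_def)
  moreover have "(\<integral>\<^sup>+z. ennreal (norm (f z)) * ennreal (norm (g z)) \<partial>\<mu>)
      = ennreal (\<integral>z. norm (f z) * norm (g z) \<partial>\<mu>)"
    using nn_integral_eq_integral[OF int] by (simp add: ennreal_mult'')
  moreover have "(\<integral>\<^sup>+z. ennreal (norm (h z))^2 \<partial>\<mu>) = ennreal (L2_normsq \<mu> h)" if "L2_fun \<mu> h" for h
    using that nn_integral_eq_integral[of \<mu> "\<lambda>z. (norm (h z))\<^sup>2"]
    by (simp add: L2_fun_def L2_normsq_def ennreal_power)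
  ultimately have "ennreal ((\<integral>z. norm (f z) * norm (g z) \<partial>\<mu>)\<^sup>2)
      \<le> ennreal (L2_normsq \<mu> f * L2_normsq \<mu> g)"
    using f g by (simp add: ennreal_power ennreal_mult'')
  then have "(\<integral>z. norm (f z) * norm (g z) \<partial>\<mu>)\<^sup>2 \<le> L2_normsq \<mu> f * L2_normsq \<mu> g"
    by (subst (asm) ennreal_le_iff) auto
  then have "(\<integral>z. norm (f z) * norm (g z) \<partial>\<mu>) \<le> L2_norm \<mu> f * L2_norm \<mu> g"
    unfolding L2_norm_def real_sqrt_mult[symmetric] by (rule real_le_rsqrt)
  moreover have "norm (\<integral>z. f z * g z \<partial>\<mu>) \<le> (\<integral>z. norm (f z) * norm (g z) \<partial>\<mu>)"
    using integral_norm_bound[of \<mu> "\<lambda>z. f z * g z"] by (simp add: norm_mult)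
  ultimately show ?thesis by linarith
qed

lemma L2_norm_cnj: "L2_norm \<mu> (\<lambda>z. cnj (f z)) = L2_norm \<mu> f"
  by (simp add: L2_norm_def L2_normsq_def)

lemma L2_norm_cmult: "L2_norm \<mu> (\<lambda>z. c * f z) = norm c * L2_norm \<mu> f"
  by (simp add: L2_norm_def L2_normsq_def norm_mult power_mult_distrib real_sqrt_mult)

lemma L2_normsq_eq_integral:
  "complex_of_real (L2_normsq \<mu> f) = (\<integral>z. f z * cnj (f z) \<partial>\<mu>)"
  unfolding L2_normsq_def complex_norm_square[symmetric] by (rule integral_complex_of_real[symmetric])

text \<open>For \<open>h = f + g\<close> the squared norm of \<open>h\<close> is the integral of
  \<open>f * cnj h\<close> plus that of \<open>g * cnj h\<close>. Cauchy--Schwarz bounds each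
  summand, and one factor of the norm of \<open>h\<close> cancels.\<close>

lemma L2_norm_triangle:
  assumes f: "L2_fun \<mu> f" and g: "L2_fun \<mu> g"
  shows "L2_norm \<mu> (\<lambda>z. f z + g z) \<le> L2_norm \<mu> f + L2_norm \<mu> g"
proof -
  let ?h = "\<lambda>z. f z + g z"
  have h: "L2_fun \<mu> ?h" by (rule L2_fun_add[OF f g])
  note ints = L2_fun_mult_integrable[OF f L2_fun_cnj[OF h]] L2_fun_mult_integrable[OF g L2_fun_cnj[OF h]]
  have "complex_of_real (L2_normsq \<mu> ?h) = (\<integral>z. f z * cnj (?h z) + g z * cnj (?h z) \<partial>\<mu>)"
    unfolding L2_normsq_eq_integral by (simp only: distrib_right)
  also have "\<dots> = (\<integral>z. f z * cnj (?h z) \<partial>\<mu>) + (\<integral>z. g z * cnj (?h z) \<partial>\<mu>)"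
    by (rule Bochner_Integration.integral_add[OF ints])
  finally have "norm (complex_of_real (L2_normsq \<mu> ?h)) \<le>
      norm (\<integral>z. f z * cnj (?h z) \<partial>\<mu>) + norm (\<integral>z. g z * cnj (?h z) \<partial>\<mu>)"
    by (metis norm_triangle_ineq)
  also have "\<dots> \<le> L2_norm \<mu> f * L2_norm \<mu> ?h + L2_norm \<mu> g * L2_norm \<mu> ?h"
    using L2_Cauchy_Schwarz[OF f L2_fun_cnj[OF h]] L2_Cauchy_Schwarz[OF g L2_fun_cnj[OF h]]
    by (simp add: L2_norm_cnj del: complex_cnj_add)
  finally have "L2_norm \<mu> ?h * L2_norm \<mu> ?h \<le> (L2_norm \<mu> f + L2_norm \<mu> g) * L2_norm \<mu> ?h"
    by (simp add: L2_norm_power2[symmetric] power2_eq_square ring_distribs norm_mult)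
  moreover have "0 \<le> L2_norm \<mu> ?h" "0 \<le> L2_norm \<mu> f + L2_norm \<mu> g" by simp_all
  ultimately show ?thesis
    by (metis mult_right_le_imp_le order_le_less)
qed

lemma L2_norm_triangle_diff:
  assumes f: "L2_fun \<mu> f" and g: "L2_fun \<mu> g"
  shows "\<bar>L2_norm \<mu> f - L2_norm \<mu> g\<bar> \<le> L2_norm \<mu> (\<lambda>z. f z - g z)"
proof -
  have "L2_norm \<mu> (\<lambda>z. f z - g z) = L2_norm \<mu> (\<lambda>z. g z - f z)"
    by (simp add: L2_norm_def L2_normsq_def norm_minus_commute)
  then show ?thesis
    using L2_norm_triangle[OF L2_fun_diff[OF f g] g] L2_norm_triangle[OF L2_fun_diff[OF g f] f]
    by simp
qed

lemma L2_norm_dominated: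
  assumes "L2_fun \<mu> g" "f \<in> borel_measurable \<mu>" "\<And>z. z \<in> space \<mu> \<Longrightarrow> norm (f z) \<le> norm (g z)"
  shows "L2_norm \<mu> f \<le> L2_norm \<mu> g"
proof -
  have "L2_fun \<mu> f" by (rule L2_fun_dominated[OF assms])
  then show ?thesis
    using assms(1,3) unfolding L2_norm_def L2_normsq_def
    by (intro real_sqrt_le_mono integral_mono power_mono) (auto simp: L2_fun_def)
qed

text \<open>Dominated convergence applied to the squares. This is the standard route to norm limits
  below: pointwise convergence together with one square-integrable majorant.\<close>

lemma L2_norm_tendsto_zero:
  assumes meas: "\<And>n. f n \<in> borel_measurable \<mu>" and W: "L2_fun \<mu> W"
    and bound: "\<And>n z. z \<in> space \<mu> \<Longrightarrow> norm (f n z) \<le> norm (W z)"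
    and lim: "AE z in \<mu>. (\<lambda>n. f n z) \<longlonglongrightarrow> 0"
  shows "(\<lambda>n::nat. L2_norm \<mu> (f n)) \<longlonglongrightarrow> 0"
proof -
  have "(\<lambda>n. L2_normsq \<mu> (f n)) \<longlonglongrightarrow> (\<integral>z. 0 \<partial>\<mu>)"
    unfolding L2_normsq_def
  proof (rule integral_dominated_convergence)
    show "integrable \<mu> (\<lambda>z. (norm (W z))\<^sup>2)" using W by (simp add: L2_fun_def)
    show "AE z in \<mu>. (\<lambda>n. (norm (f n z))\<^sup>2) \<longlonglongrightarrow> 0"
      using lim
    proof eventually_elim
      case (elim z)
      then have "(\<lambda>n. (norm (f n z))\<^sup>2) \<longlonglongrightarrow> (norm (0::complex))\<^sup>2"
        by (intro tendsto_intros)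
      then show ?case by simp
    qed
    show "(\<lambda>z. (norm (f n z))\<^sup>2) \<in> borel_measurable \<mu>" for n
      using meas[of n] by simp
    show "AE z in \<mu>. norm ((norm (f n z))\<^sup>2) \<le> (norm (W z))\<^sup>2" for n
      using bound by (auto intro!: AE_I2 power_mono)
  qed simp
  then have "(\<lambda>n. sqrt (L2_normsq \<mu> (f n))) \<longlonglongrightarrow> sqrt (\<integral>z. 0 \<partial>\<mu>)"
    by (rule tendsto_real_sqrt)
  then show ?thesis by (simp add: L2_norm_def)
qed

section \<open>The Gaussian measure\<close>

text \<open>Lebesgue measure is the image of a product of lines under the basis expansion, so
  product functions integrate factor by factor. Explicit Gaussian integrals and integrals over the
  cell are reduced to dimension one in this way.\<close>

lemma
  fixes F :: "'a::euclidean_space \<Rightarrow> real \<Rightarrow> complex"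
  assumes int: "\<And>b. b \<in> Basis \<Longrightarrow> integrable lborel (F b)"
  shows lborel_integrable_prod: "integrable lborel (\<lambda>x. \<Prod>b\<in>Basis. F b (x \<bullet> b))" (is ?A)
    and lborel_integral_prod:
      "(\<integral>x. (\<Prod>b\<in>Basis. F b (x \<bullet> b)) \<partial>lborel) = (\<Prod>b\<in>Basis. \<integral>t. F b t \<partial>lborel)" (is ?B)
proof -
  interpret product_sigma_finite "\<lambda>b::'a. lborel :: real measure" by standard
  let ?T = "\<lambda>f::'a \<Rightarrow> real. \<Sum>b\<in>Basis. f b *\<^sub>R b"
  have F: "F b \<in> borel_measurable borel" if "b \<in> Basis" for b
    using borel_measurable_integrable[OF int[OF that]] by simp
  have meas: "(\<lambda>x. \<Prod>b\<in>Basis. F b (x \<bullet> b)) \<in> borel_measurable borel"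
    using F by (intro borel_measurable_prod) (auto intro: measurable_compose[rotated])
  have T: "?T \<in> measurable (\<Pi>\<^sub>M b\<in>Basis. lborel) borel" by measurable
  have eq: "(\<Prod>b\<in>Basis. F b (?T f \<bullet> b)) = (\<Prod>b\<in>Basis. F b (f b))" for f
    by (intro prod.cong refl) simp
  show ?A
    by (subst lborel_eq) (simp add: integrable_distr_eq[OF T meas] eq product_integrable_prod int
        del: inner_sum_left_Basis)
  show ?B
    by (subst lborel_eq) (simp add: integral_distr[OF T meas] eq product_integral_prod int
        del: inner_sum_left_Basis)
qed

lemma maxwellian_pos [simp]: "0 < maxwellian v" and maxwellian_nonneg [simp]: "0 \<le> maxwellian v"
  and maxwellian_neq_0 [simp]: "maxwellian v \<noteq> 0"
  by (auto simp: maxwellian_def intro!: mult_nonneg_nonneg)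

lemma continuous_on_maxwellian: "continuous_on A maxwellian"
  unfolding maxwellian_def[abs_def] by (intro continuous_intros) auto

lemma borel_measurable_maxwellian [measurable]: "maxwellian \<in> borel_measurable borel"
  by (rule borel_measurable_continuous_onI[OF continuous_on_maxwellian])

lemma maxwellian_eq_prod:
  "maxwellian (v :: real ^ 'n) = (\<Prod>b\<in>Basis. std_normal_density (v \<bullet> b))"
proof -
  have "(\<Prod>b\<in>Basis. std_normal_density (v \<bullet> b))
      = (\<Prod>b\<in>(Basis :: (real^'n) set). 1 / sqrt (2 * pi)) * (\<Prod>b\<in>Basis. exp (- (v \<bullet> b)\<^sup>2 / 2))"
    unfolding prod.distrib[symmetric] std_normal_density_def ..
  also have "(\<Prod>b\<in>Basis. exp (- (v \<bullet> b)\<^sup>2 / 2)) = exp (- (norm v)\<^sup>2 / 2)"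
    unfolding exp_sum[OF finite_Basis, symmetric] power2_norm_eq_inner
    by (subst euclidean_inner[of v v]) (simp add: sum_negf sum_divide_distrib power2_eq_square)
  also have "(\<Prod>b\<in>(Basis :: (real^'n) set). 1 / sqrt (2 * pi)) = (2 * pi) powr (- (real CARD('n) / 2))"
    by (simp add: powr_minus powr_half_sqrt[symmetric] powr_powr inverse_eq_divide
        power_one_over powr_realpow[symmetric] mult.commute)
  finally show ?thesis by (simp add: maxwellian_def)
qed

definition gauss_measure :: "(real ^ 'n) measure" where
  "gauss_measure = density lborel (\<lambda>v. ennreal (maxwellian v))"

lemma sets_gauss [simp, measurable_cong]: "sets gauss_measure = sets borel"
  by (simp add: gauss_measure_def)

lemma space_gauss [simp]: "space gauss_measure = UNIV"
  by (simp add: gauss_measure_def)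

lemma integral_gauss:
  fixes f :: "real ^ 'n \<Rightarrow> complex"
  assumes "f \<in> borel_measurable borel"
  shows "(\<integral>v. f v \<partial>gauss_measure) = (\<integral>v. complex_of_real (maxwellian v) * f v \<partial>lborel)"
  using assms unfolding gauss_measure_def
  by (subst integral_density) (auto simp: scaleR_conv_of_real)

lemma cis_sum: "finite A \<Longrightarrow> cis (\<Sum>a\<in>A. f a) = (\<Prod>a\<in>A. cis (f a))"
  by (simp add: cis_conv_exp sum_distrib_left exp_sum)

lemma integrable_std_normal_cis:
  "integrable lborel (\<lambda>t. complex_of_real (std_normal_density t) * cis (a * t))"
proof (rule Bochner_Integration.integrable_bound)
  show "integrable lborel std_normal_density"
    using integrable_std_normal_moment[of 0] by simp
qed (auto simp: norm_mult cis_conv_exp)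

lemma integral_std_normal_cis:
  "(\<integral>t. complex_of_real (std_normal_density t) * cis (a * t) \<partial>lborel) = complex_of_real (exp (- a\<^sup>2 / 2))"
proof -
  have "(\<integral>t. complex_of_real (std_normal_density t) * cis (a * t) \<partial>lborel)
     = char std_normal_distribution a"
    unfolding char_def
    by (subst integral_density) (auto simp: scaleR_conv_of_real cis_conv_exp)
  then show ?thesis by (simp add: char_std_normal_distribution)
qed

text \<open>The Fourier transform of the Gaussian measure. Evaluated at a difference of two
  frequencies it is the Gram kernel of the plane waves, and in this role it enters every norm
  computation below.\<close>

definition gauss_char :: "real ^ 'n \<Rightarrow> real" where
  "gauss_char \<eta> = exp (- (norm \<eta>)\<^sup>2 / 2)"

lemma maxwellian_cis_eq_prod:
  "complex_of_real (maxwellian v) * cis (\<eta> \<bullet> v)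
    = (\<Prod>b\<in>Basis. complex_of_real (std_normal_density (v \<bullet> b)) * cis ((\<eta> \<bullet> b) * (v \<bullet> b)))"
  unfolding maxwellian_eq_prod by (subst euclidean_inner) (simp add: cis_sum prod.distrib)

lemma borel_measurable_cis [measurable (raw)]:
  "f \<in> borel_measurable M \<Longrightarrow> (\<lambda>z. cis (f z)) \<in> borel_measurable M"
  by (rule borel_measurable_continuous_on[of cis]) (auto intro: continuous_intros)

lemma integral_gauss_cis:
  "(\<integral>v. cis (\<eta> \<bullet> v) \<partial>gauss_measure) = complex_of_real (gauss_char \<eta>)"
proof -
  have "(\<integral>v. cis (\<eta> \<bullet> v) \<partial>gauss_measure) = (\<integral>v. complex_of_real (maxwellian v) * cis (\<eta> \<bullet> v) \<partial>lborel)"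
    by (rule integral_gauss) measurable
  also have "\<dots> = (\<Prod>b\<in>Basis. complex_of_real (exp (- (\<eta> \<bullet> b)\<^sup>2 / 2)))"
    unfolding maxwellian_cis_eq_prod
    by (subst lborel_integral_prod) (auto simp: integrable_std_normal_cis integral_std_normal_cis)
  also have "\<dots> = complex_of_real (gauss_char \<eta>)"
    unfolding of_real_prod[symmetric] exp_sum[OF finite_Basis, symmetric] gauss_char_def power2_norm_eq_inner
    by (subst euclidean_inner[of \<eta> \<eta>]) (simp add: sum_negf sum_divide_distrib power2_eq_square)
  finally show ?thesis .
qed

lemma integrable_maxwellian: "integrable lborel maxwellian"
proof -
  have "integrable lborel (\<lambda>v :: real^'n. complex_of_real (maxwellian v) * cis (0 \<bullet> v))"
    unfolding maxwellian_cis_eq_prod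
    by (rule lborel_integrable_prod) (auto simp: integrable_std_normal_cis)
  then show ?thesis using integrable_Re by fastforce
qed

lemma prob_space_gauss: "prob_space (gauss_measure :: (real ^ 'n) measure)"
proof
  have "complex_of_real (integral\<^sup>L lborel (maxwellian :: real^'n \<Rightarrow> real)) = 1"
  proof -
    have "complex_of_real (integral\<^sup>L lborel (maxwellian :: real^'n \<Rightarrow> real))
        = integral\<^sup>L lborel (\<lambda>v::real^'n. complex_of_real (maxwellian v) * cis (0 \<bullet> v))"
      by simp
    also have "\<dots> = (\<integral>v. cis ((0 :: real^'n) \<bullet> v) \<partial>gauss_measure)"
      by (rule integral_gauss[symmetric]) simp
    also have "\<dots> = 1" by (subst integral_gauss_cis) (simp add: gauss_char_def)
    finally show ?thesis .
  qed
  then have "integral\<^sup>L lborel (maxwellian :: real^'n \<Rightarrow> real) = 1"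
    using of_real_eq_1_iff by blast
  then show "emeasure (gauss_measure :: (real^'n) measure) (space gauss_measure) = 1"
    unfolding gauss_measure_def
    by (subst emeasure_density) (auto simp: nn_integral_eq_integral integrable_maxwellian)
qed

interpretation gauss: prob_space "gauss_measure :: (real ^ 'n) measure"
  by (rule prob_space_gauss)

text \<open>The squared norm is a sum of squared coordinates, and each of these is a product
  function with exponent \<open>2\<close> in one factor and \<open>0\<close> in the others; the
  one-dimensional normal moments then suffice.\<close>

lemma integrable_gauss_norm_power2: "integrable (gauss_measure :: (real ^ 'n) measure) (\<lambda>v. (norm v)\<^sup>2)"
proof -
  have "integrable lborel (\<lambda>v :: real^'n. \<Prod>b'\<in>Basis. complex_of_real
      (std_normal_density (v \<bullet> b') * (v \<bullet> b') ^ (if b' = b then 2 else 0)))" if "b \<in> Basis" for b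
    by (rule lborel_integrable_prod) (rule integrable_of_real, rule integrable_std_normal_moment)
  moreover have "(\<Prod>b'\<in>Basis. (v \<bullet> b') ^ (if b' = b then 2 else 0)) = (v \<bullet> b)\<^sup>2"
    if "b \<in> Basis" for b v :: "real^'n"
  proof -
    have "(\<Prod>b'\<in>Basis. (v \<bullet> b') ^ (if b' = b then 2 else 0)) = (\<Prod>b'\<in>Basis. if b' = b then (v \<bullet> b)\<^sup>2 else 1)"
      by (intro prod.cong) auto
    then show ?thesis using that by simp
  qed
  ultimately have "integrable lborel (\<lambda>v :: real^'n. maxwellian v * (v \<bullet> b)\<^sup>2)" if "b \<in> Basis" for b
    using that unfolding of_real_prod[symmetric] complex_of_real_integrable_eq prod.distrib maxwellian_eq_prod[symmetric]
    by simp
  then have "integrable lborel (\<lambda>v :: real^'n. \<Sum>b\<in>Basis. maxwellian v * (v \<bullet> b)\<^sup>2)"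
    by (intro Bochner_Integration.integrable_sum)
  also have "(\<lambda>v :: real^'n. \<Sum>b\<in>Basis. maxwellian v * (v \<bullet> b)\<^sup>2) = (\<lambda>v. maxwellian v * (norm v)\<^sup>2)"
    unfolding power2_norm_eq_inner
    by (subst (2) euclidean_inner) (simp add: sum_distrib_left power2_eq_square)
  finally show ?thesis
    unfolding gauss_measure_def by (subst integrable_density) auto
qed

section \<open>Phase space and plane waves\<close>

definition phase :: "real \<Rightarrow> ((real ^ 'n) \<times> (real ^ 'n)) measure" where
  "phase L = dx L \<Otimes>\<^sub>M gauss_measure"

lemma Basis_vec_real: "(Basis :: (real^'n) set) = range (\<lambda>i. axis i 1)"
  by (auto simp: Basis_vec_def)

lemma inner_axis_one: "x \<bullet> axis i (1::real) = x $ i"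
  by (simp add: inner_axis)

lemma indicator_cell_eq_prod:
  "(indicator (cell L) x :: complex) = (\<Prod>b\<in>Basis. indicator {0..<L} (x \<bullet> b))"
proof (cases "x \<in> cell L")
  case True
  then have "indicator {0..<L} (x \<bullet> b) = (1 :: complex)" if "b \<in> Basis" for b
    using that by (auto simp: cell_def Basis_vec_real inner_axis_one)
  then show ?thesis using True by simp
next
  case False
  then obtain i where i: "x $ i \<notin> {0..<L}" by (auto simp: cell_def not_le not_less)
  then have "\<exists>b\<in>Basis. indicator {0..<L} (x \<bullet> b) = (0::complex)"
    by (intro bexI[of _ "axis i 1"]) (auto simp: inner_axis_one Basis_vec_real)
  then show ?thesis using False by (simp add: prod_zero)
qed

lemma cell_measurable [measurable, simp]: "cell L \<in> sets borel"
proof -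
  have "cell L = (\<Inter>i. {x :: real^'n. 0 \<le> x $ i \<and> x $ i < L})" by (auto simp: cell_def)
  also have "\<dots> \<in> sets borel" by (intro sets.countable_INT'') measurable
  finally show ?thesis .
qed

lemma integral_indicator_cis:
  fixes a L :: real
  assumes "0 < L"
  shows "integrable lborel (\<lambda>t. indicator {0..<L} t * cis (a * t))" (is ?A)
    and "(\<integral>t. indicator {0..<L} t * cis (a * t) \<partial>lborel)
      = (if a = 0 then complex_of_real L else (cis (a * L) - 1) / (\<i> * complex_of_real a))" (is ?B)
proof -
  \<comment> \<open>Passing to the compact interval changes a null set only; there continuity gives
    integrability and the fundamental theorem applies.\<close>
  have AE: "AE t in lborel. indicator {0..<L} t * cis (a * t) = indicator {0..L} t *\<^sub>R cis (a * t)"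
    using AE_lborel_singleton[of L]
    by eventually_elim (auto simp: indicator_def)
  have int: "integrable lborel (\<lambda>t. indicator {0..L} t *\<^sub>R cis (a * t))"
  proof -
    have "continuous_on {0..L} (\<lambda>t. cis (a * t))" by (intro continuous_intros)
    then show ?thesis by (intro borel_integrable_compact) auto
  qed
  show ?A
    using int by (subst integrable_cong_AE[OF _ _ AE]) measurable
  have "(\<integral>t. indicator {0..<L} t * cis (a * t) \<partial>lborel) = (\<integral>t. indicator {0..L} t *\<^sub>R cis (a * t) \<partial>lborel)"
    by (rule integral_cong_AE[OF _ _ AE]) measurable
  also have "\<dots> = (if a = 0 then complex_of_real L else (cis (a * L) - 1) / (\<i> * complex_of_real a))"
  proof (cases "a = 0")
    case True
    then show ?thesis using assms by (simp add: scaleR_conv_of_real)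
  next
    case False
    have "(\<integral>t. indicator {0..L} t *\<^sub>R cis (a * t) \<partial>lborel)
      = cis (a * L) / (\<i> * complex_of_real a) - cis (a * 0) / (\<i> * complex_of_real a)"
    proof (rule integral_FTC_Icc)
      show "((\<lambda>t. cis (a * t) / (\<i> * complex_of_real a)) has_vector_derivative cis (a * t)) (at t within {0..L})" for t
        unfolding has_vector_derivative_def using False
        by (auto intro!: derivative_eq_intros has_derivative_cis simp: scaleR_conv_of_real field_simps)
    qed (use assms in \<open>auto intro!: continuous_intros\<close>)
    then show ?thesis using False by (simp add: diff_divide_distrib)
  qed
  finally show ?B .
qed

lemma sets_dx [measurable_cong]: "sets (dx L) = sets (restrict_space borel (cell L))"
  by (simp add: dx_def sets_restrict_space)

lemma space_dx [simp]: "space (dx L) = cell L"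
  by (simp add: dx_def space_restrict_space)

lemma measurable_dx: "f \<in> measurable borel N \<Longrightarrow> f \<in> measurable (dx L) N"
  unfolding measurable_cong_sets[OF sets_dx refl] by (rule measurable_restrict_space1)

text \<open>The integral factors over the coordinates. A nonzero lattice vector has a nonzero
  coordinate, and the corresponding exponential runs through a whole number of periods on
  \<open>[0, L)\<close>, so one factor vanishes.\<close>

lemma integral_dx_cis:
  fixes m :: "real ^ 'n"
  assumes L: "0 < L" and m: "m \<in> dual_lattice L"
  shows "integrable (dx L) (\<lambda>x. cis (m \<bullet> x))" (is ?A)
    and "(\<integral>x. cis (m \<bullet> x) \<partial>dx L) = (if m = 0 then complex_of_real (L ^ CARD('n)) else 0)" (is ?B)
proof -
  have eq: "indicator (cell L) x *\<^sub>R cis (m \<bullet> x)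
      = (\<Prod>b\<in>Basis. indicator {0..<L} (x \<bullet> b) * cis ((m \<bullet> b) * (x \<bullet> b)))" for x
  proof -
    have 1: "indicator (cell L) x *\<^sub>R cis (m \<bullet> x) = indicator (cell L) x * cis (m \<bullet> x)"
      by (simp add: indicator_def)
    have 2: "cis (m \<bullet> x) = (\<Prod>b\<in>Basis. cis ((m \<bullet> b) * (x \<bullet> b)))"
      by (subst euclidean_inner) (simp add: cis_sum)
    show ?thesis
      unfolding 1 unfolding indicator_cell_eq_prod prod.distrib 2 ..
  qed
  show ?A
    unfolding dx_def by (subst integrable_restrict_space)
      (auto simp: eq intro!: lborel_integrable_prod integral_indicator_cis L)
  have "(\<integral>x. cis (m \<bullet> x) \<partial>dx L) = (\<Prod>b\<in>Basis. \<integral>t. indicator {0..<L} t * cis ((m \<bullet> b) * t) \<partial>lborel)"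
    unfolding dx_def by (subst integral_restrict_space)
      (auto simp: eq intro!: lborel_integral_prod integral_indicator_cis L)
  also have "\<dots> = (if m = 0 then complex_of_real (L ^ CARD('n)) else 0)"
  proof (cases "m = 0")
    case True
    then show ?thesis using integral_indicator_cis(2)[OF L, of 0] by simp
  next
    case False
    then obtain b where b: "b \<in> Basis" "m \<bullet> b \<noteq> 0" by (metis euclidean_all_zero_iff)
    then obtain i where i: "b = axis i 1" by (auto simp: Basis_vec_real)
    obtain k :: int where "m $ i = 2 * pi / L * real_of_int k" using m by (auto simp: dual_lattice_def)
    then have "(m \<bullet> b) * L = 2 * pi * real_of_int k" using i L by (simp add: inner_axis_one)
    then have "cis ((m \<bullet> b) * L) = 1" by (simp add: cis_multiple_2pi)
    then have "(\<integral>t. indicator {0..<L} t * cis ((m \<bullet> b) * t) \<partial>lborel) = 0"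
      using integral_indicator_cis(2)[OF L, of "m \<bullet> b"] b by simp
    then have "(\<Prod>b\<in>Basis. \<integral>t. indicator {0..<L} t * cis ((m \<bullet> b) * t) \<partial>lborel) = 0"
      using b by (intro prod_zero) auto
    then show ?thesis using False by simp
  qed
  finally show ?B .
qed

lemma zero_in_dual_lattice [simp]: "0 \<in> dual_lattice L"
  by (auto simp: dual_lattice_def intro!: exI[of _ 0])

lemma dual_lattice_diff: "k \<in> dual_lattice L \<Longrightarrow> k' \<in> dual_lattice L \<Longrightarrow> k - k' \<in> dual_lattice L"
proof -
  assume k: "k \<in> dual_lattice L" "k' \<in> dual_lattice L"
  have "\<exists>j::int. (k - k') $ i = 2 * pi / L * real_of_int j" for i
  proof -
    obtain a b :: int where "k $ i = 2 * pi / L * real_of_int a" "k' $ i = 2 * pi / L * real_of_int b"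
      using k unfolding dual_lattice_def by blast
    then have "(k - k') $ i = 2 * pi / L * real_of_int (a - b)"
      by (simp add: right_diff_distrib)
    then show ?thesis by blast
  qed
  then show ?thesis by (simp add: dual_lattice_def)
qed

lemma dual_lattice_uminus: "k \<in> dual_lattice L \<Longrightarrow> - k \<in> dual_lattice L"
  using dual_lattice_diff[of 0 L k] by simp

lemma dual_lattice_add: "k \<in> dual_lattice L \<Longrightarrow> k' \<in> dual_lattice L \<Longrightarrow> k + k' \<in> dual_lattice L"
  using dual_lattice_diff[of k L "- k'"] dual_lattice_uminus[of k' L] by simp

lemma finite_measure_dx: "0 < L \<Longrightarrow> finite_measure (dx L :: (real^'n) measure)"
proof
  assume L: "0 < L"
  have "emeasure (dx L) (space (dx L :: (real^'n) measure)) = emeasure lborel (cell L :: (real^'n) set)"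
    by (simp add: dx_def emeasure_restrict_space space_restrict_space)
  also have "\<dots> \<le> emeasure lborel (cbox 0 (\<chi> i. L) :: (real^'n) set)"
    by (intro emeasure_mono) (auto simp: cell_def mem_box_cart less_imp_le)
  also have "\<dots> < \<infinity>" by (rule emeasure_lborel_cbox_finite)
  finally show "emeasure (dx L :: (real^'n) measure) (space (dx L)) \<noteq> \<infinity>" by simp
qed

lemma finite_measure_phase:
  assumes "0 < L" shows "finite_measure (phase L :: ((real^'n) \<times> (real^'n)) measure)"
proof -
  interpret D: finite_measure "dx L :: (real^'n) measure" by (rule finite_measure_dx[OF assms])
  show ?thesis unfolding phase_def
    by (rule finite_measure_pair_measure) (auto intro: D.finite_measure_axioms gauss.finite_measure_axioms)
qed

lemma integral_phase_mult:
  fixes f g :: "real^'n \<Rightarrow> complex"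
  assumes L: "0 < L" and f: "integrable (dx L) f" and g: "integrable gauss_measure g"
  shows "(\<integral>z. f (fst z) * g (snd z) \<partial>phase L) = (\<integral>x. f x \<partial>dx L) * (\<integral>v. g v \<partial>gauss_measure)"
    and "integrable (phase L) (\<lambda>z. f (fst z) * g (snd z))"
proof -
  interpret D: finite_measure "dx L :: (real^'n) measure" by (rule finite_measure_dx[OF L])
  interpret pair_sigma_finite "dx L :: (real^'n) measure" "gauss_measure :: (real^'n) measure"
    by standard
  have [measurable]: "f \<in> borel_measurable (dx L)" "g \<in> borel_measurable gauss_measure"
    using f g by auto
  have int: "integrable (dx L \<Otimes>\<^sub>M gauss_measure) (\<lambda>(x, v). f x * g v)"
  proof (rule Fubini_integrable)
    show "integrable (dx L) (\<lambda>x. \<integral>v. norm (case (x, v) of (x, v) \<Rightarrow> f x * g v) \<partial>gauss_measure)"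
      using f by (simp add: norm_mult)
  qed (use g in auto)
  then show "integrable (phase L) (\<lambda>z. f (fst z) * g (snd z))"
    by (simp add: phase_def case_prod_beta')
  have "(\<integral>z. f (fst z) * g (snd z) \<partial>phase L) = (\<integral>x. \<integral>v. f x * g v \<partial>gauss_measure \<partial>dx L)"
    unfolding phase_def using integral_fst'[OF int] by (simp add: case_prod_beta')
  then show "(\<integral>z. f (fst z) * g (snd z) \<partial>phase L) = (\<integral>x. f x \<partial>dx L) * (\<integral>v. g v \<partial>gauss_measure)"
    by simp
qed

text \<open>The sigma-algebra of \<open>phase L\<close> is a trace on the cell, so Borel
  measurability on the whole space has to be transported along the identity map.\<close>

lemma measurable_phase:
  "f \<in> measurable borel N \<Longrightarrow> f \<in> measurable (phase L :: ((real^'n) \<times> (real^'n)) measure) N"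
proof -
  assume f: "f \<in> measurable borel N"
  have "(\<lambda>z. z) \<in> measurable (phase L :: ((real^'n) \<times> (real^'n)) measure) (borel \<Otimes>\<^sub>M borel)"
    unfolding phase_def
    by (rule measurable_pair) (auto simp: comp_def intro: measurable_compose[OF measurable_fst measurable_dx])
  then have "(\<lambda>z. z) \<in> measurable (phase L :: ((real^'n) \<times> (real^'n)) measure) borel"
    by (simp add: borel_prod)
  from measurable_compose[OF this f] show ?thesis .
qed

lemma space_phase [simp]: "space (phase L) = cell L \<times> UNIV"
  by (simp add: phase_def space_pair_measure)

text \<open>The minus sign makes the integral against \<open>wave k \<eta>\<close> the Fourier
  coefficient at the frequency pair. Later \<open>k\<close> is confined to the dual lattice, while
  \<open>\<eta>\<close> is an arbitrary vector.\<close>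

definition wave :: "real ^ 'n \<Rightarrow> real ^ 'n \<Rightarrow> (real ^ 'n) \<times> (real ^ 'n) \<Rightarrow> complex" where
  "wave k \<eta> z = cis (- (k \<bullet> fst z + \<eta> \<bullet> snd z))"

lemma norm_wave [simp]: "norm (wave k \<eta> z) = 1"
  by (simp add: wave_def)

lemma wave_borel_measurable: "wave k \<eta> \<in> borel_measurable borel"
  unfolding wave_def[abs_def] by (intro borel_measurable_continuous_onI continuous_intros)

lemma wave_measurable [measurable]: "wave k \<eta> \<in> borel_measurable (phase L)"
  by (rule measurable_phase[OF wave_borel_measurable])

lemma wave_0_0 [simp]: "wave 0 0 z = 1"
  by (simp add: wave_def)

lemma L2_fun_wave: "0 < L \<Longrightarrow> L2_fun (phase L) (wave k \<eta>)"
  using finite_measure.L2_fun_bounded[OF finite_measure_phase, of L "wave k \<eta>" 1] by auto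

lemma cnj_wave: "cnj (wave k \<eta> z) = wave (- k) (- \<eta>) z"
  by (simp add: wave_def cis_cnj)

lemma wave_mult: "wave k \<eta> z * wave k' \<eta>' z = wave (k + k') (\<eta> + \<eta>') z"
  by (simp add: wave_def cis_mult inner_add_left algebra_simps)

lemma gauss_char_uminus [simp]: "gauss_char (- \<eta>) = gauss_char \<eta>"
  by (simp add: gauss_char_def)

lemma integral_wave:
  fixes k \<eta> :: "real^'n"
  assumes L: "0 < L" and k: "k \<in> dual_lattice L"
  shows "(\<integral>z. wave k \<eta> z \<partial>phase L)
    = (if k = 0 then complex_of_real (L ^ CARD('n) * gauss_char \<eta>) else 0)"
proof -
  have int: "integrable gauss_measure (\<lambda>v. cis ((- \<eta>) \<bullet> v))"
    by (rule gauss.integrable_const_bound[where B = 1]) auto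
  have "(\<integral>z. wave k \<eta> z \<partial>phase L) = (\<integral>z. cis ((- k) \<bullet> fst z) * cis ((- \<eta>) \<bullet> snd z) \<partial>phase L)"
    by (simp add: wave_def cis_mult)
  also have "\<dots> = (if k = 0 then complex_of_real (L ^ CARD('n) * gauss_char \<eta>) else 0)"
    unfolding integral_phase_mult(1)[OF L integral_dx_cis(1)[OF L dual_lattice_uminus[OF k]] int]
      integral_dx_cis(2)[OF L dual_lattice_uminus[OF k]] integral_gauss_cis by simp
  finally show ?thesis .
qed

lemma integral_wave_mult_cnj:
  fixes k k' \<eta> \<eta>' :: "real^'n"
  assumes L: "0 < L" and k: "k \<in> dual_lattice L" "k' \<in> dual_lattice L"
  shows "(\<integral>z. wave k \<eta> z * cnj (wave k' \<eta>' z) \<partial>phase L)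
    = (if k = k' then complex_of_real (L ^ CARD('n) * gauss_char (\<eta> - \<eta>')) else 0)"
  unfolding cnj_wave wave_mult using integral_wave[OF L dual_lattice_diff[OF k], of "\<eta> - \<eta>'"] by simp

section \<open>Density of trigonometric polynomials\<close>

text \<open>Trigonometric polynomials, periodic in \<open>x\<close> and almost periodic in
  \<open>v\<close>. Only sums and multiples are built in; products stay inside because frequencies
  add and the dual lattice is closed under addition.\<close>

inductive_set wave_span :: "real \<Rightarrow> ((real ^ 'n) \<times> (real ^ 'n) \<Rightarrow> complex) set" for L where
  wave: "k \<in> dual_lattice L \<Longrightarrow> wave k \<eta> \<in> wave_span L"
| add: "p \<in> wave_span L \<Longrightarrow> q \<in> wave_span L \<Longrightarrow> (\<lambda>z. p z + q z) \<in> wave_span L"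
| cmult: "p \<in> wave_span L \<Longrightarrow> (\<lambda>z. c * p z) \<in> wave_span L"

lemma wave_span_const: "(\<lambda>z. c) \<in> wave_span L"
  using wave_span.cmult[OF wave_span.wave[OF zero_in_dual_lattice, of 0], of c] by simp

lemma wave_span_mult:
  assumes "p \<in> wave_span L" "q \<in> wave_span L"
  shows "(\<lambda>z. p z * q z) \<in> wave_span L"
  using assms(1)
proof induction
  case (wave k \<eta>)
  from assms(2) show ?case
  proof induction
    case (wave k' \<eta>')
    then show ?case using wave_span.wave[OF dual_lattice_add[OF \<open>k \<in> dual_lattice L\<close>], of k' "\<eta> + \<eta>'"]
      by (simp add: wave_mult[abs_def])
  next
    case (add p q)
    then show ?case using wave_span.add by (simp add: ring_distribs)
  next
    case (cmult p c)
    then show ?case using wave_span.cmult[of "\<lambda>z. wave k \<eta> z * p z" L c] by (simp add: mult.left_commute)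
  qed
next
  case (add p q)
  then show ?case using wave_span.add by (simp add: ring_distribs)
next
  case (cmult p c)
  then show ?case using wave_span.cmult[of "\<lambda>z. p z * q z" L c] by (simp add: mult.assoc)
qed

lemma wave_span_borel_measurable: "p \<in> wave_span L \<Longrightarrow> p \<in> borel_measurable borel"
  by (induction rule: wave_span.induct) (auto intro: wave_borel_measurable)

lemma wave_span_bounded: "p \<in> wave_span L \<Longrightarrow> \<exists>B. \<forall>z. norm (p z) \<le> B"
proof (induction rule: wave_span.induct)
  case (wave k \<eta>)
  then show ?case by (intro exI[of _ 1]) simp
next
  case (add p q)
  then obtain B C where "\<forall>z. norm (p z) \<le> B" "\<forall>z. norm (q z) \<le> C" by blast
  then show ?case by (intro exI[of _ "B + C"]) (meson add_mono norm_triangle_le)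
next
  case (cmult p c)
  then obtain B where "\<forall>z. norm (p z) \<le> B" by blast
  then show ?case by (intro exI[of _ "norm c * B"]) (simp add: norm_mult mult_left_mono)
qed

lemma wave_span_L2:
  assumes "0 < L" "p \<in> wave_span L" shows "L2_fun (phase L) p"
proof -
  obtain B where "norm (p z) \<le> B" for z using wave_span_bounded[OF assms(2)] by blast
  then show ?thesis
    by (intro finite_measure.L2_fun_bounded[OF finite_measure_phase[OF assms(1)]]
        measurable_phase[OF wave_span_borel_measurable[OF assms(2)]])
qed

text \<open>A rectangular index set \<open>K \<times> H\<close> is used instead of a set of
  frequency pairs, so that the later estimates can treat each space frequency separately over the
  same finite set \<open>H\<close>.\<close>

lemma wave_span_normal_form:
  fixes p :: "(real ^ 'n) \<times> (real ^ 'n) \<Rightarrow> complex"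
  assumes "p \<in> wave_span L"
  shows "\<exists>K H c. finite K \<and> finite H \<and> K \<subseteq> dual_lattice L
    \<and> p = (\<lambda>z. \<Sum>k\<in>K. \<Sum>\<eta>\<in>H. c k \<eta> * wave k \<eta> z)"
  using assms
proof induction
  case (wave k \<eta>)
  then show ?case
    by (intro exI[of _ "{k}"] exI[of _ "{\<eta>}"] exI[of _ "\<lambda>_ _. 1"]) auto
next
  case (add p q)
  then obtain K H c K' H' c' where K: "finite K" "finite H" "K \<subseteq> dual_lattice L"
      "p = (\<lambda>z. \<Sum>k\<in>K. \<Sum>\<eta>\<in>H. c k \<eta> * wave k \<eta> z)"
    and K': "finite K'" "finite H'" "K' \<subseteq> dual_lattice L"
      "q = (\<lambda>z. \<Sum>k\<in>K'. \<Sum>\<eta>\<in>H'. c' k \<eta> * wave k \<eta> z)"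
    by blast
  \<comment> \<open>Zero coefficients extend both expansions to the unions of the index sets, after
    which they can be added termwise.\<close>
  have pad: "(\<Sum>k\<in>A. \<Sum>\<eta>\<in>B. a k \<eta> * w k \<eta>)
      = (\<Sum>k\<in>K \<union> K'. \<Sum>\<eta>\<in>H \<union> H'. (if k \<in> A \<and> \<eta> \<in> B then a k \<eta> else 0) * w k \<eta>)"
    if "A \<subseteq> K \<union> K'" "B \<subseteq> H \<union> H'" for A B :: "(real^'n) set" and a w :: "real^'n \<Rightarrow> real^'n \<Rightarrow> complex"
  proof -
    have "(\<Sum>\<eta>\<in>H \<union> H'. (if k \<in> A \<and> \<eta> \<in> B then a k \<eta> else 0) * w k \<eta>)
      = (if k \<in> A then \<Sum>\<eta>\<in>B. a k \<eta> * w k \<eta> else 0)" for k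
      using K K' that by (auto intro!: sum.mono_neutral_cong_right)
    then show ?thesis using K K' that by (auto intro!: sum.mono_neutral_cong_left)
  qed
  show ?case
  proof (intro exI conjI)
    show "(\<lambda>z. p z + q z) = (\<lambda>z. \<Sum>k\<in>K \<union> K'. \<Sum>\<eta>\<in>H \<union> H'.
       ((if k \<in> K \<and> \<eta> \<in> H then c k \<eta> else 0) + (if k \<in> K' \<and> \<eta> \<in> H' then c' k \<eta> else 0)) * wave k \<eta> z)"
      unfolding K(4) K'(4) ring_distribs sum.distrib
      by (intro ext arg_cong2[where f = "(+)"] pad) auto
  qed (use K K' in auto)
next
  case (cmult p d)
  then obtain K H c where K: "finite K" "finite H" "K \<subseteq> dual_lattice L"
      "p = (\<lambda>z. \<Sum>k\<in>K. \<Sum>\<eta>\<in>H. c k \<eta> * wave k \<eta> z)"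
    by blast
  show ?case
    by (intro exI[of _ K] exI[of _ H] exI[of _ "\<lambda>k \<eta>. d * c k \<eta>"])
      (use K in \<open>auto simp: sum_distrib_left mult.assoc\<close>)
qed

section \<open>The L2 closure of the trigonometric polynomials\<close>

definition wave_closure :: "real \<Rightarrow> ((real ^ 'n) \<times> (real ^ 'n) \<Rightarrow> complex) set" where
  "wave_closure L = {u. L2_fun (phase L) u \<and>
     (\<forall>e>0. \<exists>p\<in>wave_span L. L2_norm (phase L) (\<lambda>z. u z - p z) < e)}"

lemma wave_closure_L2: "u \<in> wave_closure L \<Longrightarrow> L2_fun (phase L) u"
  by (simp add: wave_closure_def)

lemma L2_norm_zero [simp]: "L2_norm \<mu> (\<lambda>z. 0) = 0"
  by (simp add: L2_norm_def L2_normsq_def)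

lemma wave_span_subset_closure: "0 < L \<Longrightarrow> p \<in> wave_span L \<Longrightarrow> p \<in> wave_closure L"
  by (auto simp: wave_closure_def wave_span_L2 intro!: bexI[of _ p])

lemma wave_closure_limit:
  assumes L: "0 < L" and u: "L2_fun (phase L) u" and f: "\<And>n. f n \<in> wave_closure L"
    and lim: "(\<lambda>n::nat. L2_norm (phase L) (\<lambda>z. u z - f n z)) \<longlonglongrightarrow> 0"
  shows "u \<in> wave_closure L"
  unfolding wave_closure_def
proof (intro CollectI conjI u allI impI)
  fix e :: real assume e: "0 < e"
  have "eventually (\<lambda>n. L2_norm (phase L) (\<lambda>z. u z - f n z) < e / 2) sequentially"
    using lim e by (intro order_tendstoD) auto
  then obtain n where n: "L2_norm (phase L) (\<lambda>z. u z - f n z) < e / 2"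
    by (auto simp: eventually_sequentially)
  obtain p where p: "p \<in> wave_span L" "L2_norm (phase L) (\<lambda>z. f n z - p z) < e / 2"
    using f[of n] e by (auto simp: wave_closure_def dest!: spec[of _ "e / 2"])
  have "L2_norm (phase L) (\<lambda>z. u z - p z) = L2_norm (phase L) (\<lambda>z. (u z - f n z) + (f n z - p z))"
    by simp
  also have "\<dots> \<le> L2_norm (phase L) (\<lambda>z. u z - f n z) + L2_norm (phase L) (\<lambda>z. f n z - p z)"
    using u wave_closure_L2[OF f] wave_span_L2[OF L p(1)]
    by (intro L2_norm_triangle L2_fun_diff) auto
  finally show "\<exists>p\<in>wave_span L. L2_norm (phase L) (\<lambda>z. u z - p z) < e"
    using n p by (intro bexI[of _ p]) auto
qed

lemma wave_closure_add:
  assumes L: "0 < L" and "u \<in> wave_closure L" "w \<in> wave_closure L"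
  shows "(\<lambda>z. u z + w z) \<in> wave_closure L"
  unfolding wave_closure_def
proof (intro CollectI conjI allI impI)
  show "L2_fun (phase L) (\<lambda>z. u z + w z)"
    using assms by (intro L2_fun_add wave_closure_L2)
  fix e :: real assume e: "0 < e"
  obtain p where p: "p \<in> wave_span L" "L2_norm (phase L) (\<lambda>z. u z - p z) < e / 2"
    using assms(2) e by (auto simp: wave_closure_def dest!: spec[of _ "e / 2"])
  obtain q where q: "q \<in> wave_span L" "L2_norm (phase L) (\<lambda>z. w z - q z) < e / 2"
    using assms(3) e by (auto simp: wave_closure_def dest!: spec[of _ "e / 2"])
  have "L2_norm (phase L) (\<lambda>z. (u z + w z) - (p z + q z)) = L2_norm (phase L) (\<lambda>z. (u z - p z) + (w z - q z))"
    by (simp add: algebra_simps)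
  also have "\<dots> \<le> L2_norm (phase L) (\<lambda>z. u z - p z) + L2_norm (phase L) (\<lambda>z. w z - q z)"
    using assms wave_closure_L2 wave_span_L2[OF L p(1)] wave_span_L2[OF L q(1)]
    by (intro L2_norm_triangle L2_fun_diff) auto
  finally show "\<exists>r\<in>wave_span L. L2_norm (phase L) (\<lambda>z. u z + w z - r z) < e"
    using p q by (intro bexI[of _ "\<lambda>z. p z + q z"] wave_span.add) auto
qed

lemma wave_closure_cmult:
  assumes L: "0 < L" and "u \<in> wave_closure L"
  shows "(\<lambda>z. c * u z) \<in> wave_closure L"
  unfolding wave_closure_def
proof (intro CollectI conjI allI impI)
  show "L2_fun (phase L) (\<lambda>z. c * u z)"
    using assms by (intro L2_fun_cmult wave_closure_L2)
  fix e :: real assume e: "0 < e"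
  then have "0 < e / (norm c + 1)" by (simp add: add_nonneg_pos)
  then obtain p where p: "p \<in> wave_span L" "L2_norm (phase L) (\<lambda>z. u z - p z) < e / (norm c + 1)"
    using assms(2) by (auto simp: wave_closure_def)
  have "L2_norm (phase L) (\<lambda>z. c * u z - c * p z) = norm c * L2_norm (phase L) (\<lambda>z. u z - p z)"
    by (simp add: right_diff_distrib[symmetric] L2_norm_cmult)
  also have "\<dots> \<le> (norm c + 1) * L2_norm (phase L) (\<lambda>z. u z - p z)"
    by (intro mult_right_mono) auto
  also have "\<dots> < e" using p by (simp add: pos_less_divide_eq add_nonneg_pos mult.commute)
  finally show "\<exists>r\<in>wave_span L. L2_norm (phase L) (\<lambda>z. c * u z - r z) < e"
    using p by (intro bexI[of _ "\<lambda>z. c * p z"] wave_span.cmult) auto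
qed

text \<open>The measure is finite, so constants are square integrable, and \<open>2 * B\<close>
  majorises the differences in dominated convergence.\<close>

lemma wave_closure_bounded_limit:
  assumes L: "0 < L" and u: "u \<in> borel_measurable (phase L)" and f: "\<And>n. f n \<in> wave_closure L"
    and bound: "\<And>n z. z \<in> space (phase L) \<Longrightarrow> norm (f n z) \<le> B"
      "\<And>z. z \<in> space (phase L) \<Longrightarrow> norm (u z) \<le> B"
    and lim: "AE z in phase L. (\<lambda>n::nat. f n z) \<longlonglongrightarrow> u z"
  shows "u \<in> wave_closure L"
proof (rule wave_closure_limit[OF L _ f])
  interpret finite_measure "phase L" by (rule finite_measure_phase[OF L])
  show "L2_fun (phase L) u" by (rule L2_fun_bounded[OF u bound(2)])
  show "(\<lambda>n. L2_norm (phase L) (\<lambda>z. u z - f n z)) \<longlonglongrightarrow> 0"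
  proof (rule L2_norm_tendsto_zero)
    show "(\<lambda>z. u z - f n z) \<in> borel_measurable (phase L)" for n
      using u L2_fun_measurable[OF wave_closure_L2[OF f[of n]]] by simp
    show "L2_fun (phase L) (\<lambda>z. complex_of_real (2 * B))"
      by (rule L2_fun_bounded[where B = "\<bar>2 * B\<bar>"]) auto
    show "norm (u z - f n z) \<le> norm (complex_of_real (2 * B))" if "z \<in> space (phase L)" for n z
      using bound(1)[OF that, of n] bound(2)[OF that] norm_triangle_ineq4[of "u z" "f n z"] by simp
    show "AE z in phase L. (\<lambda>n. u z - f n z) \<longlonglongrightarrow> 0"
      using lim
    proof eventually_elim
      case (elim z)
      from tendsto_diff[OF tendsto_const[of "u z"] elim] show ?case by simp
    qed
  qed
qed

text \<open>Intersections of sets become products of indicators, hence this closure property. The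
  error is split as \<open>u w - p q = u (w - q) + q (u - p)\<close>, so that each summand has one
  bounded factor.\<close>

lemma wave_closure_mult_bounded:
  assumes L: "0 < L" and u: "u \<in> wave_closure L" and w: "w \<in> wave_closure L"
    and bound: "\<And>z. z \<in> space (phase L) \<Longrightarrow> norm (u z) \<le> B"
      "\<And>z. z \<in> space (phase L) \<Longrightarrow> norm (w z) \<le> B"
  shows "(\<lambda>z. u z * w z) \<in> wave_closure L"
  unfolding wave_closure_def
proof (intro CollectI conjI allI impI)
  interpret finite_measure "phase L" by (rule finite_measure_phase[OF L])
  note L2u = wave_closure_L2[OF u] and L2w = wave_closure_L2[OF w]
  have prod_L2: "L2_fun (phase L) (\<lambda>z. g z * h z)" "L2_norm (phase L) (\<lambda>z. g z * h z) \<le> (\<bar>C\<bar> + 1) * L2_norm (phase L) h"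
    if g: "g \<in> borel_measurable (phase L)" "\<And>z. z \<in> space (phase L) \<Longrightarrow> norm (g z) \<le> C"
      and h: "L2_fun (phase L) h" for g h C
  proof -
    have le: "norm (g z * h z) \<le> norm (complex_of_real (\<bar>C\<bar> + 1) * h z)" if "z \<in> space (phase L)" for z
      using g(2)[OF that] by (auto simp: norm_mult intro!: mult_right_mono)
    have meas: "(\<lambda>z. g z * h z) \<in> borel_measurable (phase L)" using g h by auto
    show "L2_fun (phase L) (\<lambda>z. g z * h z)"
      by (rule L2_fun_dominated[OF L2_fun_cmult[OF h] meas le])
    show "L2_norm (phase L) (\<lambda>z. g z * h z) \<le> (\<bar>C\<bar> + 1) * L2_norm (phase L) h"
      using L2_norm_dominated[OF L2_fun_cmult[OF h] meas le]
      unfolding L2_norm_cmult by simp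
  qed
  show "L2_fun (phase L) (\<lambda>z. u z * w z)"
    by (rule prod_L2(1)[OF _ bound(1) L2w]) (use L2u in auto)
  fix e :: real assume e: "0 < e"
  then have "0 < e / 2 / (\<bar>B\<bar> + 1)" by simp
  then obtain q where q: "q \<in> wave_span L" "L2_norm (phase L) (\<lambda>z. w z - q z) < e / 2 / (\<bar>B\<bar> + 1)"
    using w unfolding wave_closure_def by blast
  \<comment> \<open>The order of choice matters: \<open>q\<close> is fixed before \<open>p\<close>,
    because the supremum \<open>C\<close> of \<open>q\<close>, which is unrelated to
    \<open>B\<close>, enters the accuracy demanded of \<open>p\<close>.\<close>
  obtain C where C: "norm (q z) \<le> C" for z using wave_span_bounded[OF q(1)] by blast
  have "0 < e / 2 / (\<bar>C\<bar> + 1)" using e by simp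
  then obtain p where p: "p \<in> wave_span L" "L2_norm (phase L) (\<lambda>z. u z - p z) < e / 2 / (\<bar>C\<bar> + 1)"
    using u unfolding wave_closure_def by blast
  note L2p = wave_span_L2[OF L p(1)] and L2q = wave_span_L2[OF L q(1)]
  have "L2_norm (phase L) (\<lambda>z. u z * w z - p z * q z)
      = L2_norm (phase L) (\<lambda>z. u z * (w z - q z) + q z * (u z - p z))"
    by (simp add: algebra_simps)
  also have "\<dots> \<le> L2_norm (phase L) (\<lambda>z. u z * (w z - q z)) + L2_norm (phase L) (\<lambda>z. q z * (u z - p z))"
    by (intro L2_norm_triangle prod_L2(1)[OF _ bound(1)] prod_L2(1)[OF _ C] L2_fun_diff L2u L2w L2p L2q
        L2_fun_measurable bound C)
  also have "\<dots> \<le> (\<bar>B\<bar> + 1) * L2_norm (phase L) (\<lambda>z. w z - q z) + (\<bar>C\<bar> + 1) * L2_norm (phase L) (\<lambda>z. u z - p z)"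
    by (intro add_mono prod_L2(2)[OF _ bound(1)] prod_L2(2)[OF _ C] L2_fun_diff L2u L2w L2p L2q L2_fun_measurable bound C)
  also have "\<dots> < e / 2 + e / 2"
  proof (rule add_strict_mono)
    show "(\<bar>B\<bar> + 1) * L2_norm (phase L) (\<lambda>z. w z - q z) < e / 2"
      using q(2) by (subst mult.commute, subst pos_less_divide_eq[symmetric]) simp_all
    show "(\<bar>C\<bar> + 1) * L2_norm (phase L) (\<lambda>z. u z - p z) < e / 2"
      using p(2) by (subst mult.commute, subst pos_less_divide_eq[symmetric]) simp_all
  qed
  finally show "\<exists>r\<in>wave_span L. L2_norm (phase L) (\<lambda>z. u z * w z - r z) < e"
    using p q by (intro bexI[of _ "\<lambda>z. p z * q z"] wave_span_mult) auto
qed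

section \<open>Indicators of slabs, boxes and Borel sets\<close>

lemma wave_span_cos:
  assumes "k \<in> dual_lattice L"
  shows "(\<lambda>z. complex_of_real (cos (k \<bullet> fst z + \<eta> \<bullet> snd z + a))) \<in> wave_span L"
proof -
  have "(\<lambda>z. complex_of_real (cos (k \<bullet> fst z + \<eta> \<bullet> snd z + a)))
      = (\<lambda>z. (cis a / 2) * wave (- k) (- \<eta>) z + (cis (- a) / 2) * wave k \<eta> z)"
  proof
    fix z
    have "complex_of_real (cos (\<theta> + a)) = (cis a / 2) * cis \<theta> + (cis (- a) / 2) * cis (- \<theta>)" for \<theta>
      by (simp add: complex_eq_iff cos_add field_simps)
    from this[of "k \<bullet> fst z + \<eta> \<bullet> snd z"]
    show "complex_of_real (cos (k \<bullet> fst z + \<eta> \<bullet> snd z + a))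
        = (cis a / 2) * wave (- k) (- \<eta>) z + (cis (- a) / 2) * wave k \<eta> z"
      by (simp add: wave_def add.commute)
  qed
  also have "\<dots> \<in> wave_span L"
    by (intro wave_span.intros assms dual_lattice_uminus)
  finally show ?thesis .
qed

lemma wave_span_real_polynomial:
  assumes "real_polynomial_function g" "(\<lambda>z. complex_of_real (q z)) \<in> wave_span L"
  shows "(\<lambda>z. complex_of_real (g (q z))) \<in> wave_span L"
  using assms(1)
proof induction
  case (linear f)
  then interpret bounded_linear f .
  have "f y = f 1 * y" for y using scaleR[of y 1] by simp
  then show ?case using wave_span.cmult[OF assms(2), of "f 1"] by (metis (no_types, lifting) ext of_real_mult)
next
  case (const c)
  then show ?case by (rule wave_span_const)
next
  case (add f g)
  then show ?case using wave_span.add by simp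
next
  case (mult f g)
  then show ?case using wave_span_mult by simp
qed

text \<open>Indicators of superlevel sets arise as bounded limits of polynomials in a real trigonometric
  polynomial, by the Weierstrass theorem on its compact range.\<close>

lemma indicator_superlevel_in_closure:
  assumes L: "0 < L" and q: "(\<lambda>z. complex_of_real (q z)) \<in> wave_span L"
  shows "indicator {z. c < q z} \<in> wave_closure L"
proof -
  obtain B where "norm (complex_of_real (q z)) \<le> B" for z using wave_span_bounded[OF q] by blast
  then have B: "q z \<in> {-B..B}" for z by (simp add: abs_le_iff minus_le_iff)
  \<comment> \<open>Continuous ramps increasing to the indicator of \<open>{y. c < y}\<close>; they
    vanish at \<open>c\<close>, which is why the superlevel set is the strict one.\<close>
  define G where "G n y = min 1 (real n * max 0 (y - c))" for n y
  have "\<exists>g. real_polynomial_function g \<and> (\<forall>y\<in>{-B..B}. \<bar>G n y - g y\<bar> < 1 / Suc n)" for n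
  proof -
    have "continuous_on {-B..B} (G n)" unfolding G_def by (intro continuous_intros)
    then obtain g where "real_polynomial_function g" "\<And>y. y \<in> {-B..B} \<Longrightarrow> \<bar>G n y - g y\<bar> < 1 / Suc n"
      by (rule Stone_Weierstrass_real_polynomial_function[OF compact_Icc]) auto
    then show ?thesis by blast
  qed
  then obtain g where g: "\<And>n. real_polynomial_function (g n)"
      "\<And>n y. y \<in> {-B..B} \<Longrightarrow> \<bar>G n y - g n y\<bar> < 1 / Suc n"
    by metis
  have q_meas: "q \<in> borel_measurable borel"
    using measurable_compose[OF wave_span_borel_measurable[OF q] borel_measurable_Re] by simp
  show ?thesis
  proof (rule wave_closure_bounded_limit[OF L])
    have "{z. c < q z} \<in> sets borel" using q_meas by measurable
    then show "indicator {z. c < q z} \<in> borel_measurable (phase L)"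
      by (intro measurable_phase borel_measurable_indicator)
    show "(\<lambda>z. complex_of_real (g n (q z))) \<in> wave_closure L" for n
      by (rule wave_span_subset_closure[OF L wave_span_real_polynomial[OF g(1) q]])
    show "norm (complex_of_real (g n (q z))) \<le> 2" for n z
    proof -
      have "\<bar>G n (q z)\<bar> \<le> 1" unfolding G_def by (simp add: abs_le_iff min_def)
      moreover have "1 / real (Suc n) \<le> 1" by simp
      ultimately have "\<bar>g n (q z)\<bar> \<le> 2" using g(2)[OF B[of z], of n] by linarith
      then show ?thesis by simp
    qed
    show "norm (indicator {z. c < q z} z :: complex) \<le> 2" for z by (simp add: indicator_def)
    have "(\<lambda>n. complex_of_real (g n (q z))) \<longlonglongrightarrow> indicator {z. c < q z} z" for z
    proof -
      have "(\<lambda>n. G n (q z)) \<longlonglongrightarrow> indicator {z. c < q z} z"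
      proof (cases "c < q z")
        case True
        have "eventually (\<lambda>n. 1 \<le> real n * (q z - c)) sequentially"
          using True by real_asymp
        then have "eventually (\<lambda>n. G n (q z) = 1) sequentially"
          by eventually_elim (use True in \<open>auto simp: G_def max_def\<close>)
        then show ?thesis using True by (simp add: tendsto_eventually)
      next
        case False
        then have "G n (q z) = 0" for n by (simp add: G_def)
        then show ?thesis using False by simp
      qed
      moreover have "(\<lambda>n. g n (q z) - G n (q z)) \<longlonglongrightarrow> 0"
      proof (rule Lim_null_comparison)
        show "eventually (\<lambda>n. norm (g n (q z) - G n (q z)) \<le> 1 / real (Suc n)) sequentially"
          using g(2)[OF B[of z]] by (auto simp: abs_minus_commute less_imp_le)
        show "(\<lambda>n. 1 / real (Suc n)) \<longlonglongrightarrow> 0" by real_asymp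
      qed
      ultimately have "(\<lambda>n. (g n (q z) - G n (q z)) + G n (q z)) \<longlonglongrightarrow> 0 + indicator {z. c < q z} z"
        by (intro tendsto_add)
      then have "(\<lambda>n. complex_of_real (g n (q z))) \<longlonglongrightarrow> complex_of_real (indicator {z. c < q z} z)"
        by (intro tendsto_of_real) simp
      then show ?thesis by (cases "c < q z") (simp_all add: indicator_def)
    qed
    then show "AE z in phase L. (\<lambda>n. complex_of_real (g n (q z))) \<longlonglongrightarrow> indicator {z. c < q z} z"
      by simp
  qed
qed


text \<open>Beyond \<open>pi\<close> the cosine rises again; the bound
  \<open>2 * pi - \<alpha>\<close> is the point where it reaches \<open>cos \<alpha>\<close> for the
  second time, without exceeding it.\<close>

lemma cos_gt_cos_iff:
  assumes "0 < \<alpha>" "\<alpha> \<le> pi" "\<bar>y\<bar> \<le> 2 * pi - \<alpha>"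
  shows "cos \<alpha> < cos y \<longleftrightarrow> \<bar>y\<bar> < \<alpha>"
proof -
  have cos_abs: "cos y = cos \<bar>y\<bar>" by (simp add: abs_if)
  show ?thesis
  proof (cases "\<bar>y\<bar> \<le> pi")
    case True
    then show ?thesis unfolding cos_abs using assms by (subst cos_mono_less_eq) auto
  next
    case False
    have "cos \<bar>y\<bar> = cos (2 * pi - \<bar>y\<bar>)" by (simp add: cos_diff)
    also have "\<dots> \<le> cos \<alpha>" using False assms by (intro cos_monotone_0_pi_le) auto
    finally show ?thesis unfolding cos_abs using False assms by auto
  qed
qed

lemma axis_dual_lattice: "axis i (2 * pi / L) \<in> dual_lattice L"
  by (auto simp: dual_lattice_def axis_def intro: exI[of _ 1] exI[of _ 0])

lemma inner_axis_real: "axis i a \<bullet> x = a * x $ i" for x :: "real ^ 'n"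
  by (simp add: inner_axis')

text \<open>Borel sets of the whole space, not sets of \<open>phase L\<close>, so that complements
  are taken in \<open>UNIV\<close> and boxes can serve as generators.\<close>

definition closure_sets :: "real \<Rightarrow> ((real ^ 'n) \<times> (real ^ 'n)) set set" where
  "closure_sets L = {A. A \<in> sets borel \<and> indicator A \<in> wave_closure L}"

lemma indicator_borel_measurable_phase: "A \<in> sets borel \<Longrightarrow> indicator A \<in> borel_measurable (phase L)"
  by (intro measurable_phase borel_measurable_indicator)

lemma AE_phase_fst:
  fixes P :: "real^'n \<Rightarrow> bool"
  assumes L: "0 < L" and ae: "AE x in dx L. P x" and P: "Measurable.pred borel P"
  shows "AE z in phase L. P (fst z)"
proof -
  interpret D: finite_measure "dx L :: (real^'n) measure" by (rule finite_measure_dx[OF L])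
  interpret pair_sigma_finite "dx L :: (real^'n) measure" "gauss_measure :: (real^'n) measure"
    by standard
  have [measurable]: "Measurable.pred (dx L) P" by (rule measurable_dx[OF P])
  show ?thesis
    unfolding phase_def
  proof (rule AE_pair_measure)
    show "AE x in dx L. AE y in gauss_measure. P (fst (x, y :: real^'n))"
      using ae by eventually_elim simp
  qed measurable
qed

text \<open>In a periodic coordinate a slab is an arc of the circle, hence a superlevel set of one
  cosine of period \<open>L\<close> centred at the midpoint of the slab.\<close>

lemma closure_sets_x_slab:
  fixes i :: "'n :: finite"
  assumes L: "0 < L"
  shows "{z :: (real^'n) \<times> (real^'n). a < fst z $ i \<and> fst z $ i < b} \<in> closure_sets L"
    (is "?A \<in> _")
proof -
  have A: "?A \<in> sets borel"
    by (intro borel_open open_Collect_conj open_Collect_less continuous_intros)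
  \<comment> \<open>Only the part of the slab inside the cell matters; clipping makes it at most one
    period wide.\<close>
  let ?a = "max a 0" and ?b = "min b L"
  have "indicator ?A \<in> wave_closure L"
  proof (cases "?a < ?b")
    case False
    then have "indicator ?A z = (0::complex)" if "z \<in> space (phase L)" for z
      using that by (auto simp: indicator_def cell_def dest!: spec[of _ i])
    then show ?thesis
      by (intro wave_closure_bounded_limit[OF L indicator_borel_measurable_phase[OF A],
          where f = "\<lambda>_ _. 0" and B = 0] wave_span_subset_closure[OF L wave_span_const[of 0]] AE_I2)
        simp_all
  next
    case True
    define m w where "m = (?a + ?b) / 2" and "w = ?b - ?a"
    have w: "0 < w" "w \<le> L" and m: "w / 2 \<le> m" "m \<le> L - w / 2"
    proof -
      have "m + w / 2 = ?b" "m - w / 2 = ?a" by (simp_all add: m_def w_def field_simps)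
      then show "0 < w" "w \<le> L" "w / 2 \<le> m" "m \<le> L - w / 2"
        using True by (auto simp: w_def)
    qed
    let ?q = "\<lambda>z :: (real^'n) \<times> (real^'n). cos (axis i (2 * pi / L) \<bullet> fst z + 0 \<bullet> snd z + (- (2 * pi / L * m)))"
    have iff: "cos (pi * w / L) < ?q z \<longleftrightarrow> ?a < fst z $ i \<and> fst z $ i < ?b" if "z \<in> space (phase L)" for z
    proof -
      define r where "r = fst z $ i - m"
      have "0 \<le> fst z $ i" "fst z $ i < L" using that by (auto simp: cell_def)
      then have "\<bar>r\<bar> \<le> L - w / 2" using m by (auto simp: r_def)
      then have "2 * pi / L * \<bar>r\<bar> \<le> 2 * pi / L * (L - w / 2)"
        using L by (intro mult_left_mono) auto
      then have "\<bar>2 * pi / L * r\<bar> \<le> 2 * pi - pi * w / L"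
        using L by (simp add: abs_mult field_simps)
      then have "cos (pi * w / L) < cos (2 * pi / L * r) \<longleftrightarrow> \<bar>2 * pi / L * r\<bar> < pi * w / L"
        using w L by (intro cos_gt_cos_iff) (auto simp: field_simps)
      also have "\<dots> \<longleftrightarrow> \<bar>r\<bar> < w / 2" using L by (simp add: abs_mult field_simps)
      also have "\<dots> \<longleftrightarrow> ?a < fst z $ i \<and> fst z $ i < ?b" unfolding m_def w_def r_def by (auto simp: abs_less_iff field_simps)
      finally show ?thesis by (simp add: r_def inner_axis_real right_diff_distrib)
    qed
    \<comment> \<open>On the face where the coordinate is \<open>0\<close> the two sets can differ:
      the clipped slab has the strict lower bound \<open>max a 0\<close>, whereas the original slab
      contains the face if \<open>a < 0 < b\<close>. The face is a null set.\<close>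
    have null: "AE z in phase L. fst z $ i \<noteq> 0"
    proof (rule AE_phase_fst[OF L])
      show "Measurable.pred borel (\<lambda>x :: real^'n. x $ i \<noteq> 0)" by measurable
      have "{x :: real^'n. x $ i = 0} \<in> null_sets lborel"
      proof -
        have "{x :: real^'n. x $ i = 0} \<in> null_sets lebesgue"
          using negligible_standard_hyperplane_cart negligible_iff_null_sets by blast
        moreover have "{x :: real^'n. x $ i = 0} \<in> sets lborel" by measurable
        ultimately show ?thesis by (simp add: null_sets_completion_iff)
      qed
      then show "AE x :: real^'n in dx L. x $ i \<noteq> 0"
        unfolding dx_def by (auto simp: AE_restrict_space_iff intro: AE_I' )
    qed
    show ?thesis
    proof (rule wave_closure_bounded_limit[OF L indicator_borel_measurable_phase[OF A]])
      show "indicator {z. cos (pi * w / L) < ?q z} \<in> wave_closure L" for n :: nat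
        by (intro indicator_superlevel_in_closure L wave_span_cos axis_dual_lattice)
      show "AE z in phase L. (\<lambda>n. indicator {z. cos (pi * w / L) < ?q z} z :: complex) \<longlonglongrightarrow> indicator ?A z"
        using null AE_space
      proof eventually_elim
        case (elim z)
        then have "fst z $ i < L" "0 < fst z $ i" by (auto simp: cell_def less_le)
        then show ?case using iff[OF elim(2)] by (simp add: indicator_def)
      qed
    qed (auto simp: indicator_def)
  qed
  then show ?thesis using A by (simp add: closure_sets_def)
qed

text \<open>Velocity is not periodic, so no single cosine isolates the slab. Stretching the period
  with \<open>n\<close> pushes the spurious copies of the slab to infinity, and the indicators
  converge pointwise.\<close>

lemma closure_sets_v_slab:
  fixes i :: "'n :: finite"
  assumes L: "0 < L"
  shows "{z :: (real^'n) \<times> (real^'n). a < snd z $ i \<and> snd z $ i < b} \<in> closure_sets L"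
    (is "?A \<in> _")
proof -
  have A: "?A \<in> sets borel"
    by (intro borel_open open_Collect_conj open_Collect_less continuous_intros)
  have "indicator ?A \<in> wave_closure L"
  proof (cases "a < b")
    case False
    then have "indicator ?A = (\<lambda>z. 0::complex)"
      by (auto simp: indicator_def)
    then show ?thesis
      using wave_span_subset_closure[OF L wave_span_const[of 0]] by simp
  next
    case True
    define m w where "m = (a + b) / 2" and "w = (b - a) / 2"
    have w: "0 < w" using True by (simp add: w_def)
    let ?q = "\<lambda>n. \<lambda>z :: (real^'n) \<times> (real^'n). cos (0 \<bullet> fst z + axis i (1 / real n) \<bullet> snd z + (- (m / real n)))"
    show ?thesis
    proof (rule wave_closure_bounded_limit[OF L indicator_borel_measurable_phase[OF A]])
      show "indicator {z. cos (w / real n) < ?q n z} \<in> wave_closure L" for n :: nat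
        by (intro indicator_superlevel_in_closure L wave_span_cos zero_in_dual_lattice)
      have "(\<lambda>n. indicator {z. cos (w / real n) < ?q n z} z :: complex) \<longlonglongrightarrow> indicator ?A z" for z
      proof (rule tendsto_eventually)
        let ?s = "snd z $ i - m"
        \<comment> \<open>From such an index on, both arguments of the cosine lie in
          \<open>[-1, 1]\<close>, well inside the first period, and the comparison of cosines is
          exact.\<close>
        have "eventually (\<lambda>n. \<bar>?s\<bar> + w \<le> real n) sequentially"
          using filterlim_real_sequentially by (auto simp: filterlim_at_top)
        then show "eventually (\<lambda>n. indicator {z. cos (w / real n) < ?q n z} z = (indicator ?A z :: complex)) sequentially"
        proof eventually_elim
          case (elim n)
          then have n: "0 < real n" using w by linarith
          have le1: "\<bar>?s / n\<bar> \<le> 1" "w / n \<le> 1" "0 < w / n" using elim n w by (auto simp: abs_divide)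
          have "cos (w / n) < cos (?s / n) \<longleftrightarrow> \<bar>?s / n\<bar> < w / n"
            by (rule cos_gt_cos_iff) (use le1 pi_gt3 in linarith)+
          also have "\<dots> \<longleftrightarrow> \<bar>?s\<bar> < w" using n by (simp add: abs_divide divide_less_cancel)
          also have "\<dots> \<longleftrightarrow> a < snd z $ i \<and> snd z $ i < b"
            unfolding m_def w_def by (auto simp: abs_less_iff field_simps)
          finally show ?case by (simp add: indicator_def inner_axis_real diff_divide_distrib)
        qed
      qed
      then show "AE z in phase L. (\<lambda>n. indicator {z. cos (w / real n) < ?q n z} z :: complex) \<longlonglongrightarrow> indicator ?A z"
        by simp
    qed (auto simp: indicator_def)
  qed
  then show ?thesis using A by (simp add: closure_sets_def)
qed

lemma closure_sets_UNIV: "0 < L \<Longrightarrow> UNIV \<in> closure_sets L"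
  using wave_span_subset_closure[OF _ wave_span_const[of 1]] by (simp add: closure_sets_def indicator_def[abs_def])

lemma closure_sets_Int:
  fixes A B :: "((real^'n) \<times> (real^'n)) set"
  assumes L: "0 < L" and "A \<in> closure_sets L" "B \<in> closure_sets L"
  shows "A \<inter> B \<in> closure_sets L"
proof -
  have "(\<lambda>z. indicator A z * indicator B z) \<in> wave_closure L"
  proof (rule wave_closure_mult_bounded[OF L])
    show "norm (indicator S z :: complex) \<le> 1" for S and z :: "(real^'n) \<times> (real^'n)"
      by (simp add: indicator_def)
    then show "norm (indicator S z :: complex) \<le> 1" for S and z :: "(real^'n) \<times> (real^'n)" .
  qed (use assms in \<open>auto simp: closure_sets_def\<close>)
  then show ?thesis using assms by (simp add: closure_sets_def indicator_inter_arith[abs_def] sets.Int)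
qed

lemma closure_sets_INT:
  assumes L: "0 < L" and "finite I" "\<And>i. i \<in> I \<Longrightarrow> A i \<in> closure_sets L"
  shows "(\<Inter>i\<in>I. A i) \<in> closure_sets L"
  using assms(2,3) by (induction rule: finite_induct) (auto intro: closure_sets_UNIV closure_sets_Int L)

lemma closure_sets_box:
  fixes a b :: "(real^'n) \<times> (real^'n)"
  assumes L: "0 < L"
  shows "box a b \<in> closure_sets L"
proof -
  have "box a b = (\<Inter>i\<in>UNIV. {z. fst a $ i < fst z $ i \<and> fst z $ i < fst b $ i}
      \<inter> {z. snd a $ i < snd z $ i \<and> snd z $ i < snd b $ i})"
  proof (rule set_eqI)
    fix z
    show "z \<in> box a b \<longleftrightarrow> z \<in> (\<Inter>i\<in>UNIV. {z. fst a $ i < fst z $ i \<and> fst z $ i < fst b $ i}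
      \<inter> {z. snd a $ i < snd z $ i \<and> snd z $ i < snd b $ i})"
      by (simp add: box_def Basis_prod_def ball_Un Basis_vec_real inner_prod_def inner_axis_one) blast
  qed
  also have "\<dots> \<in> closure_sets L"
    by (intro closure_sets_INT closure_sets_Int closure_sets_x_slab closure_sets_v_slab L) auto
  finally show ?thesis .
qed

text \<open>Open boxes are an intersection-stable generator of the Borel sets, so Dynkin's lemma
  leaves only complements and countable disjoint unions.\<close>

lemma closure_sets_borel:
  assumes L: "0 < L" and A: "A \<in> sets (borel :: ((real^'n) \<times> (real^'n)) measure)"
  shows "A \<in> closure_sets L"
proof -
  let ?G = "range (\<lambda>(a, b). box a b :: ((real^'n) \<times> (real^'n)) set)"
  have borel: "sets borel = sigma_sets UNIV ?G"
    unfolding borel_eq_box by (rule sets_measure_of) auto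
  have "Int_stable ?G" by (auto simp: Int_stable_def box_Int_box)
  moreover have "?G \<subseteq> Pow UNIV" by simp
  moreover have "A \<in> sigma_sets UNIV ?G" using A borel by simp
  ultimately show ?thesis
  proof (induction rule: sigma_sets_induct_disjoint)
    case (basic A)
    then show ?case using closure_sets_box[OF L] by auto
  next
    case empty
    then show ?case
      using wave_span_subset_closure[OF L wave_span_const[of 0]] by (simp add: closure_sets_def indicator_def[abs_def])
  next
    case (compl A)
    have "(\<lambda>z. indicator UNIV z + (- 1) * indicator A z) \<in> wave_closure L"
      using compl closure_sets_UNIV[OF L]
      by (intro wave_closure_add wave_closure_cmult L) (auto simp: closure_sets_def)
    also have "(\<lambda>z. indicator UNIV z + (- 1) * indicator A z) = (indicator (UNIV - A) :: _ \<Rightarrow> complex)"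
      by (auto simp: indicator_def)
    finally show ?case using compl by (auto simp: closure_sets_def)
  next
    case (union A)
    \<comment> \<open>Finite unions are obtained by adding indicators, which is where disjointness
      enters; the countable union is a bounded pointwise limit of these.\<close>
    have fin: "(\<Union>i<n. A i) \<in> closure_sets L" for n
    proof (induction n)
      case 0
      then show ?case
        using wave_span_subset_closure[OF L wave_span_const[of 0]] by (simp add: closure_sets_def indicator_def[abs_def])
    next
      case (Suc n)
      have "(\<lambda>z. indicator (\<Union>i<n. A i) z + indicator (A n) z) \<in> wave_closure L"
        using Suc union(3) by (intro wave_closure_add L) (auto simp: closure_sets_def)
      also have "(\<lambda>z. indicator (\<Union>i<n. A i) z + indicator (A n) z) = (indicator (\<Union>i<Suc n. A i) :: _ \<Rightarrow> complex)"
      proof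
        fix z
        have "z \<notin> A n" if "z \<in> A i" "i < n" for i
          using that disjoint_family_onD[OF union(1), of i n] by auto
        then show "indicator (\<Union>i<n. A i) z + indicator (A n) z = (indicator (\<Union>i<Suc n. A i) z :: complex)"
          by (auto simp: indicator_def less_Suc_eq)
      qed
      finally show ?case using Suc union(3)[of n] by (simp add: closure_sets_def lessThan_Suc sets.Un)
    qed
    have meas: "(\<Union>i. A i) \<in> sets borel" using union(3) by (auto simp: closure_sets_def)
    have "indicator (\<Union>i. A i) \<in> wave_closure L"
    proof (rule wave_closure_bounded_limit[OF L indicator_borel_measurable_phase[OF meas]])
      show "indicator (\<Union>i<n. A i) \<in> wave_closure L" for n using fin by (simp add: closure_sets_def)
      show "AE z in phase L. (\<lambda>n. indicator (\<Union>i<n. A i) z :: complex) \<longlonglongrightarrow> indicator (\<Union>i. A i) z"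
        by (intro AE_I2 LIMSEQ_indicator_UN)
    qed (auto simp: indicator_def)
    then show ?case using meas by (simp add: closure_sets_def)
  qed
qed


text \<open>Level sets of simple functions are measurable for the product sigma-algebra over the
  cell. Replacing them by Borel sets of the whole space makes the closure property of Borel sets
  applicable.\<close>

lemma sets_phase_eq_borel_Int:
  assumes "A \<in> sets (phase L :: ((real^'n) \<times> (real^'n)) measure)"
  shows "\<exists>B\<in>sets borel. A = B \<inter> space (phase L)"
proof -
  let ?R = "restrict_space (borel :: ((real^'n) \<times> (real^'n)) measure) (cell L \<times> UNIV)"
  have sub: "{a \<times> b |a b. a \<in> sets (dx L) \<and> b \<in> sets gauss_measure} \<subseteq> sets ?R"
  proof clarsimp
    fix a b :: "(real^'n) set" assume a: "a \<in> sets (dx L)" and b: "b \<in> sets borel"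
    then obtain a' where "a' \<in> sets borel" "a = a' \<inter> cell L"
      by (auto simp: sets_dx sets_restrict_space)
    then have "a \<times> b = (cell L \<times> UNIV) \<inter> (a' \<times> b)" "a' \<times> b \<in> sets (borel \<Otimes>\<^sub>M borel)"
      using b by auto
    then show "a \<times> b \<in> sets ?R"
      unfolding sets_restrict_space borel_prod by blast
  qed
  have space: "space (dx L) \<times> space gauss_measure = space ?R" by (simp add: space_restrict_space)
  have "sets (phase L) \<subseteq> sets ?R"
    unfolding phase_def sets_pair_measure space by (rule sets.sigma_sets_subset[OF sub])
  then show ?thesis using assms by (auto simp: sets_restrict_space)
qed

section \<open>Density and the dual description of the norm\<close>

lemma wave_closure_cong:
  assumes "u \<in> wave_closure L" "\<And>z. z \<in> space (phase L) \<Longrightarrow> u z = w z"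
  shows "w \<in> wave_closure L"
proof -
  have "L2_fun (phase L) w = L2_fun (phase L) u"
    unfolding L2_fun_def using assms(2)
    by (intro conj_cong measurable_cong Bochner_Integration.integrable_cong) simp_all
  moreover have "L2_norm (phase L) (\<lambda>z. w z - p z) = L2_norm (phase L) (\<lambda>z. u z - p z)" for p
    unfolding L2_norm_def L2_normsq_def using assms(2)
    by (intro arg_cong[where f = sqrt] Bochner_Integration.integral_cong) simp_all
  ultimately show ?thesis using assms(1) by (simp add: wave_closure_def)
qed

lemma wave_closure_sum:
  assumes "0 < L" "finite I" "\<And>i. i \<in> I \<Longrightarrow> f i \<in> wave_closure L"
  shows "(\<lambda>z. \<Sum>i\<in>I. f i z) \<in> wave_closure L"
  using assms(2,3)
  by (induction rule: finite_induct)
    (auto intro: wave_closure_add wave_span_subset_closure wave_span_const assms(1))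

theorem wave_span_dense:
  fixes u :: "(real^'n) \<times> (real^'n) \<Rightarrow> complex"
  assumes L: "0 < L" and u: "L2_fun (phase L) u"
  shows "u \<in> wave_closure L"
proof -
  have meas: "u \<in> borel_measurable (phase L)" using u by auto
  \<comment> \<open>The bound by twice \<open>u\<close> makes \<open>3 * u\<close> a
    square-integrable majorant of the differences; a constant would not do, as \<open>u\<close> may
    be unbounded.\<close>
  obtain F where "(\<forall>i. simple_function (phase L) (F i)) \<and> (\<forall>x\<in>space (phase L). (\<lambda>i. F i x) \<longlonglongrightarrow> u x)
      \<and> (\<forall>i. \<forall>x\<in>space (phase L). dist (F i x) 0 \<le> 2 * dist (u x) 0)"
    using borel_measurable_implies_sequence_metric[OF meas, of 0] by blast
  then have F: "\<And>i. simple_function (phase L) (F i)"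
      "\<And>z. z \<in> space (phase L) \<Longrightarrow> (\<lambda>i. F i z) \<longlonglongrightarrow> u z"
      "\<And>i z. z \<in> space (phase L) \<Longrightarrow> norm (F i z) \<le> 2 * norm (u z)"
    by (auto simp: dist_norm)
  have Fc: "F i \<in> wave_closure L" for i
  proof (rule wave_closure_cong)
    let ?S = "F i ` space (phase L)"
    have "indicator (F i -` {y} \<inter> space (phase L)) \<in> wave_closure L" for y
    proof -
      have "F i -` {y} \<inter> space (phase L) \<in> sets (phase L)" by (rule simple_functionD(2)[OF F(1)])
      from sets_phase_eq_borel_Int[OF this]
      obtain B where B: "B \<in> sets borel" "F i -` {y} \<inter> space (phase L) = B \<inter> space (phase L)"
        by (rule bexE)
      have "indicator B \<in> wave_closure L"
        using closure_sets_borel[OF L B(1)] by (simp add: closure_sets_def)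
      then show ?thesis
        unfolding B(2) by (rule wave_closure_cong) (simp add: indicator_def)
    qed
    then show "(\<lambda>z. \<Sum>y\<in>?S. y * indicator (F i -` {y} \<inter> space (phase L)) z) \<in> wave_closure L"
      by (rule wave_closure_sum[OF L simple_functionD(1)[OF F(1)] wave_closure_cmult[OF L]])
    show "(\<Sum>y\<in>?S. y * indicator (F i -` {y} \<inter> space (phase L)) z) = F i z" if z: "z \<in> space (phase L)" for z
    proof -
      have "(\<Sum>y\<in>?S. y * indicator (F i -` {y} \<inter> space (phase L)) z) = (\<Sum>y\<in>?S. if y = F i z then y else 0)"
        using z by (intro sum.cong) (auto simp: indicator_def)
      also have "\<dots> = F i z" using z simple_functionD(1)[OF F(1)] by simp
      finally show ?thesis .
    qed
  qed
  show ?thesis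
  proof (rule wave_closure_limit[OF L u Fc])
    show "(\<lambda>n. L2_norm (phase L) (\<lambda>z. u z - F n z)) \<longlonglongrightarrow> 0"
    proof (rule L2_norm_tendsto_zero)
      show "(\<lambda>z. u z - F n z) \<in> borel_measurable (phase L)" for n
        using meas L2_fun_measurable[OF wave_closure_L2[OF Fc[of n]]] by simp
      show "L2_fun (phase L) (\<lambda>z. 3 * u z)" by (rule L2_fun_cmult[OF u])
      show "norm (u z - F n z) \<le> norm (3 * u z)" if "z \<in> space (phase L)" for n z
        using F(3)[OF that, of n] norm_triangle_ineq4[of "u z" "F n z"] by (simp add: norm_mult)
      show "AE z in phase L. (\<lambda>n. u z - F n z) \<longlonglongrightarrow> 0"
      proof (rule AE_I2)
        fix z :: "(real^'n) \<times> (real^'n)" assume "z \<in> space (phase L)"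
        from tendsto_diff[OF tendsto_const[of "u z"] F(2)[OF this]]
        show "(\<lambda>n. u z - F n z) \<longlonglongrightarrow> 0" by simp
      qed
    qed
  qed
qed

text \<open>Take \<open>p\<close> close to \<open>cnj u\<close>: the integral is then close to the
  squared norm of \<open>u\<close>, while the hypothesis bounds it by \<open>B\<close> times nearly
  the norm of \<open>u\<close>. In this way estimates for the adjoint evolution of trigonometric
  polynomials become estimates for solutions.\<close>

theorem L2_norm_le_by_duality:
  fixes u :: "(real^'n) \<times> (real^'n) \<Rightarrow> complex"
  assumes L: "0 < L" and u: "L2_fun (phase L) u" and B: "0 \<le> B"
    and bound: "\<And>p. p \<in> wave_span L \<Longrightarrow> norm (\<integral>z. u z * p z \<partial>phase L) \<le> B * L2_norm (phase L) p"
  shows "L2_norm (phase L) u \<le> B"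
proof -
  let ?N = "L2_norm (phase L)"
  have le: "(?N u)\<^sup>2 \<le> B * ?N u + (B + ?N u) * e" if e: "0 < e" for e
  proof -
    obtain p where p: "p \<in> wave_span L" "?N (\<lambda>z. cnj (u z) - p z) < e"
      using wave_span_dense[OF L L2_fun_cnj[OF u]] e by (auto simp: wave_closure_def)
    note p2 = wave_span_L2[OF L p(1)]
    have d2: "L2_fun (phase L) (\<lambda>z. cnj (u z) - p z)" by (intro L2_fun_diff L2_fun_cnj u p2)
    have "?N p \<le> ?N (\<lambda>z. cnj (u z)) + ?N (\<lambda>z. cnj (u z) - p z)"
      using L2_norm_triangle_diff[OF L2_fun_cnj[OF u] p2] by simp
    then have Np: "?N p \<le> ?N u + e" using p(2) by (simp add: L2_norm_cnj)
    have "complex_of_real ((?N u)\<^sup>2) = (\<integral>z. u z * p z + u z * (cnj (u z) - p z) \<partial>phase L)"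
      unfolding L2_norm_power2 L2_normsq_eq_integral by (simp add: algebra_simps)
    also have "\<dots> = (\<integral>z. u z * p z \<partial>phase L) + (\<integral>z. u z * (cnj (u z) - p z) \<partial>phase L)"
      by (intro Bochner_Integration.integral_add L2_fun_mult_integrable u p2 d2)
    finally have eq: "complex_of_real ((?N u)\<^sup>2) = (\<integral>z. u z * p z \<partial>phase L) + (\<integral>z. u z * (cnj (u z) - p z) \<partial>phase L)" .
    have "norm (complex_of_real ((?N u)\<^sup>2)) \<le> norm (\<integral>z. u z * p z \<partial>phase L) + norm (\<integral>z. u z * (cnj (u z) - p z) \<partial>phase L)"
      unfolding eq by (rule norm_triangle_ineq)
    also have "\<dots> \<le> B * ?N p + ?N u * ?N (\<lambda>z. cnj (u z) - p z)"
      by (intro add_mono bound p L2_Cauchy_Schwarz u d2)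
    also have "\<dots> \<le> B * (?N u + e) + ?N u * e"
      using p(2) Np B by (intro add_mono mult_left_mono) auto
    finally show ?thesis by (simp add: algebra_simps norm_power)
  qed
  have "(?N u)\<^sup>2 \<le> B * ?N u"
  proof (rule field_le_epsilon)
    fix e :: real assume "0 < e"
    then have "0 < e / (B + ?N u + 1)" using B by (simp add: add_nonneg_pos)
    from le[OF this] have "(?N u)\<^sup>2 \<le> B * ?N u + (B + ?N u) * (e / (B + ?N u + 1))" .
    also have "(B + ?N u) * (e / (B + ?N u + 1)) \<le> e"
    proof -
      have "0 < B + ?N u + 1" using B by (simp add: add_nonneg_pos)
      then show ?thesis using \<open>0 < e\<close> by (simp add: pos_divide_le_eq algebra_simps)
    qed
    finally show "(?N u)\<^sup>2 \<le> B * ?N u + e" by simp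
  qed
  then show ?thesis
    using B L2_norm_nonneg[of "phase L" u]
    unfolding power2_eq_square using mult_right_le_imp_le[of "?N u" "?N u" B] by (cases "?N u = 0") auto
qed

section \<open>Dividing by the Maxwellian\<close>

lemma density_pair_snd:
  fixes g :: "real ^ 'n \<Rightarrow> real"
  assumes g: "g \<in> borel_measurable borel"
  shows "dx L \<Otimes>\<^sub>M density lborel (\<lambda>v. ennreal (g v)) = density (dx_dv L) (\<lambda>z. ennreal (g (snd z)))"
proof -
  have sf: "sigma_finite_measure (density lborel (\<lambda>v. ennreal (g v)))"
    using g by (subst sigma_finite_measure.sigma_finite_iff_density_finite[OF sigma_finite_lborel]) auto
  have "density (dx L) (\<lambda>_. 1) \<Otimes>\<^sub>M density lborel (\<lambda>v. ennreal (g v))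
      = density (dx L \<Otimes>\<^sub>M lborel) (\<lambda>(x, v). 1 * ennreal (g v))"
    using g by (intro pair_measure_density sf) (auto intro: sigma_finite_lborel)
  then show ?thesis by (simp add: density_1 dx_dv_def case_prod_beta')
qed

lemma phase_eq_density: "phase L = density (dx_dv L) (\<lambda>z. ennreal (maxwellian (snd z)))"
  unfolding phase_def gauss_measure_def by (rule density_pair_snd) measurable

lemma dx_dgamma_eq_density: "dx_dgamma L = density (dx_dv L) (\<lambda>z. ennreal (1 / maxwellian (snd z)))"
  unfolding dx_dgamma_def gamma_def by (rule density_pair_snd) measurable

lemma maxwellian_snd_dx_dv [measurable]:
  "(\<lambda>z. maxwellian (snd z)) \<in> borel_measurable (dx_dv L :: ((real^'n) \<times> (real^'n)) measure)"
  unfolding dx_dv_def by measurable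

lemma measurable_dx_dgamma_iff: "f \<in> measurable (dx_dgamma L) N \<longleftrightarrow> f \<in> measurable (dx_dv L) N"
  unfolding dx_dgamma_eq_density by simp

lemma measurable_phase_iff: "f \<in> measurable (phase L) N \<longleftrightarrow> f \<in> measurable (dx_dv L) N"
  unfolding phase_eq_density by simp

text \<open>Relative to Lebesgue measure the weights are \<open>1 / M\<close> and \<open>M\<close>.
  They differ by the factor \<open>1 / M\<^sup>2\<close>, which is exactly absorbed when both
  factors of a product, or a squared modulus, are divided by \<open>M\<close>.\<close>

lemma
  fixes h :: "(real ^ 'n) \<times> (real ^ 'n) \<Rightarrow> 'b :: {banach, second_countable_topology}"
  assumes h: "h \<in> borel_measurable (dx_dv L)"
  shows integrable_dx_dgamma_iff:
      "integrable (dx_dgamma L) h \<longleftrightarrow> integrable (phase L) (\<lambda>z. (1 / (maxwellian (snd z))\<^sup>2) *\<^sub>R h z)" (is ?A)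
    and integral_dx_dgamma_eq:
      "(\<integral>z. h z \<partial>dx_dgamma L) = (\<integral>z. (1 / (maxwellian (snd z))\<^sup>2) *\<^sub>R h z \<partial>phase L)" (is ?B)
proof -
  note [measurable] = h
  have eq: "maxwellian (snd z) *\<^sub>R (1 / (maxwellian (snd z))\<^sup>2) *\<^sub>R h z = (1 / maxwellian (snd z)) *\<^sub>R h z" for z
    by (simp add: power2_eq_square)
  have [measurable]: "(\<lambda>z. (1 / (maxwellian (snd z))\<^sup>2) *\<^sub>R h z) \<in> borel_measurable (dx_dv L)"
    "(\<lambda>z. 1 / maxwellian (snd z)) \<in> borel_measurable (dx_dv L :: ((real^'n) \<times> (real^'n)) measure)"
    by measurable
  show ?A
    unfolding dx_dgamma_eq_density phase_eq_density
    by (subst (1 2) integrable_density) (auto simp: eq simp del: scaleR_scaleR)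
  show ?B
    unfolding dx_dgamma_eq_density phase_eq_density
    by (subst (1 2) integral_density) (auto simp: eq simp del: scaleR_scaleR)
qed

definition over_M :: "((real ^ 'n) \<times> (real ^ 'n) \<Rightarrow> complex) \<Rightarrow> (real ^ 'n) \<times> (real ^ 'n) \<Rightarrow> complex" where
  "over_M f z = f z / complex_of_real (maxwellian (snd z))"

lemma over_M_measurable_iff:
  "over_M f \<in> borel_measurable (dx_dv L) \<longleftrightarrow> f \<in> borel_measurable (dx_dv L)"
proof
  assume "over_M f \<in> borel_measurable (dx_dv L)"
  then have "(\<lambda>z. over_M f z * complex_of_real (maxwellian (snd z))) \<in> borel_measurable (dx_dv L)"
    by measurable
  then show "f \<in> borel_measurable (dx_dv L)" by (simp add: over_M_def)
next
  assume "f \<in> borel_measurable (dx_dv L)"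
  then show "over_M f \<in> borel_measurable (dx_dv L)" unfolding over_M_def[abs_def] by measurable
qed

lemma L2_fun_over_M: "L2_fun (phase L) (over_M f) \<longleftrightarrow> L2_fun (dx_dgamma L) f"
proof (cases "f \<in> borel_measurable (dx_dv L)")
  case True
  then have "integrable (dx_dgamma L) (\<lambda>z. (norm (f z))\<^sup>2)
      \<longleftrightarrow> integrable (phase L) (\<lambda>z. (norm (over_M f z))\<^sup>2)"
    by (subst integrable_dx_dgamma_iff) (auto simp: over_M_def norm_divide power_divide)
  then show ?thesis using True
    by (simp add: L2_fun_def measurable_dx_dgamma_iff measurable_phase_iff over_M_measurable_iff)
next
  case False
  then show ?thesis
    by (simp add: L2_fun_def measurable_dx_dgamma_iff measurable_phase_iff over_M_measurable_iff)
qed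

lemma L2_normsq_over_M:
  assumes "L2_fun (dx_dgamma L) f"
  shows "L2_normsq (dx_dgamma L) f = L2_normsq (phase L) (over_M f)"
proof -
  have "f \<in> borel_measurable (dx_dv L)"
    using assms by (simp add: L2_fun_def measurable_dx_dgamma_iff)
  then show ?thesis unfolding L2_normsq_def
    by (subst integral_dx_dgamma_eq) (auto simp: over_M_def norm_divide power_divide)
qed

lemma integral_mult_over_M:
  assumes "f \<in> borel_measurable (dx_dv L)" "g \<in> borel_measurable (dx_dv L)"
  shows "(\<integral>z. f z * g z \<partial>dx_dgamma L) = (\<integral>z. over_M f z * over_M g z \<partial>phase L)"
  using assms by (subst integral_dx_dgamma_eq) (auto simp: over_M_def scaleR_conv_of_real power2_eq_square)

lemma integral_dx_dv_eq:
  assumes "f \<in> borel_measurable (dx_dv L)"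
  shows "(\<integral>z. f z \<partial>dx_dv L) = (\<integral>z. over_M f z \<partial>phase L)"
proof -
  have "over_M f \<in> borel_measurable (dx_dv L)" using assms by (simp add: over_M_measurable_iff)
  then show ?thesis
    unfolding phase_eq_density
    by (subst integral_density) (auto simp: over_M_def scaleR_conv_of_real)
qed

text \<open>Bilinear and not sesquilinear, as in the weak formulation; a conjugate is inserted by
  hand wherever a norm has to be recognised.\<close>

definition pairing :: "real \<Rightarrow> ((real ^ 'n) \<times> (real ^ 'n) \<Rightarrow> complex) \<Rightarrow> ((real ^ 'n) \<times> (real ^ 'n) \<Rightarrow> complex) \<Rightarrow> complex" where
  "pairing L u w = (\<integral>z. u z * w z \<partial>phase L)"

lemma pairing_le:
  "L2_fun (phase L) u \<Longrightarrow> L2_fun (phase L) w \<Longrightarrow> norm (pairing L u w) \<le> L2_norm (phase L) u * L2_norm (phase L) w"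
  unfolding pairing_def by (rule L2_Cauchy_Schwarz)

lemma pairing_diff_right:
  "L2_fun (phase L) u \<Longrightarrow> L2_fun (phase L) w \<Longrightarrow> L2_fun (phase L) w' \<Longrightarrow>
    pairing L u (\<lambda>z. w z - w' z) = pairing L u w - pairing L u w'"
  unfolding pairing_def by (simp add: ring_distribs L2_fun_mult_integrable)

lemma pairing_diff_left:
  "L2_fun (phase L) u \<Longrightarrow> L2_fun (phase L) u' \<Longrightarrow> L2_fun (phase L) w \<Longrightarrow>
    pairing L (\<lambda>z. u z - u' z) w = pairing L u w - pairing L u' w"
  unfolding pairing_def by (simp add: ring_distribs L2_fun_mult_integrable)

lemma pairing_cmult_right: "pairing L u (\<lambda>z. c * w z) = c * pairing L u w"
proof -
  have "pairing L u (\<lambda>z. c * w z) = (\<integral>z. c * (u z * w z) \<partial>phase L)"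
    unfolding pairing_def by (simp add: mult.left_commute)
  then show ?thesis by (simp add: pairing_def)
qed

lemma pairing_sum_right:
  assumes "L2_fun (phase L) u" "\<And>j. j \<in> J \<Longrightarrow> L2_fun (phase L) (w j)"
  shows "pairing L u (\<lambda>z. \<Sum>j\<in>J. w j z) = (\<Sum>j\<in>J. pairing L u (w j))"
proof -
  have "pairing L u (\<lambda>z. \<Sum>j\<in>J. w j z) = (\<integral>z. (\<Sum>j\<in>J. u z * w j z) \<partial>phase L)"
    unfolding pairing_def by (simp add: sum_distrib_left)
  also have "\<dots> = (\<Sum>j\<in>J. pairing L u (w j))"
    unfolding pairing_def using assms by (intro Bochner_Integration.integral_sum L2_fun_mult_integrable) auto
  finally show ?thesis .
qed

section \<open>Continuous curves in L2 and limits of weak equations\<close>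

definition L2_curve :: "real \<Rightarrow> (real \<Rightarrow> (real ^ 'n) \<times> (real ^ 'n) \<Rightarrow> complex) \<Rightarrow> bool" where
  "L2_curve L u \<longleftrightarrow> (\<forall>t\<ge>0. L2_fun (phase L) (u t)) \<and>
     (\<forall>t\<ge>0. ((\<lambda>s. L2_norm (phase L) (\<lambda>z. u s z - u t z)) \<longlongrightarrow> 0) (at t within {0..}))"

lemma L2_curve_L2: "L2_curve L u \<Longrightarrow> 0 \<le> t \<Longrightarrow> L2_fun (phase L) (u t)"
  by (simp add: L2_curve_def)

lemma L2_curve_norm_continuous:
  assumes "L2_curve L u"
  shows "continuous_on {0..} (\<lambda>t. L2_norm (phase L) (u t))"
  unfolding continuous_on_def
proof
  fix t :: real assume t: "t \<in> {0..}"
  have "((\<lambda>s. L2_norm (phase L) (u s) - L2_norm (phase L) (u t)) \<longlongrightarrow> 0) (at t within {0..})"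
  proof (rule Lim_null_comparison)
    show "((\<lambda>s. L2_norm (phase L) (\<lambda>z. u s z - u t z)) \<longlongrightarrow> 0) (at t within {0..})"
      using assms t by (simp add: L2_curve_def)
    show "eventually (\<lambda>s. norm (L2_norm (phase L) (u s) - L2_norm (phase L) (u t))
        \<le> L2_norm (phase L) (\<lambda>z. u s z - u t z)) (at t within {0..})"
      unfolding eventually_at_topological real_norm_def
      using assms t by (intro exI[of _ UNIV]) (auto intro!: L2_norm_triangle_diff L2_curve_L2)
  qed
  then show "((\<lambda>s. L2_norm (phase L) (u s)) \<longlongrightarrow> L2_norm (phase L) (u t)) (at t within {0..})"
    by (simp add: Lim_null[symmetric] LIM_zero_iff)
qed

lemma L2_curve_bounded:
  assumes "L2_curve L u"
  obtains B where "0 < B" "\<And>t. 0 \<le> t \<Longrightarrow> t \<le> T \<Longrightarrow> L2_norm (phase L) (u t) \<le> B"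
proof -
  have "compact ((\<lambda>t. L2_norm (phase L) (u t)) ` {0..T})"
    by (intro compact_continuous_image continuous_on_subset[OF L2_curve_norm_continuous[OF assms]]) auto
  then obtain B where "0 < B" "\<forall>x\<in>(\<lambda>t. L2_norm (phase L) (u t)) ` {0..T}. norm x \<le> B"
    using compact_imp_bounded bounded_pos by blast
  then show ?thesis using that[of B] by auto
qed

lemma L2_curve_pairing_continuous:
  assumes u: "L2_curve L u" and w: "L2_fun (phase L) w"
  shows "continuous_on {0..} (\<lambda>t. pairing L (u t) w)"
  unfolding continuous_on_def
proof
  fix t :: real assume t: "t \<in> {0..}"
  have "((\<lambda>s. pairing L (u s) w - pairing L (u t) w) \<longlongrightarrow> 0) (at t within {0..})"
  proof (rule Lim_null_comparison)
    have "((\<lambda>s. L2_norm (phase L) (\<lambda>z. u s z - u t z)) \<longlongrightarrow> 0) (at t within {0..})"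
      using u t by (simp add: L2_curve_def)
    then show "((\<lambda>s. L2_norm (phase L) (\<lambda>z. u s z - u t z) * L2_norm (phase L) w) \<longlongrightarrow> 0) (at t within {0..})"
      by (rule tendsto_mult_left_zero)
    have "norm (pairing L (u s) w - pairing L (u t) w)
        \<le> L2_norm (phase L) (\<lambda>z. u s z - u t z) * L2_norm (phase L) w" if "0 \<le> s" for s
      using u t w that
      by (subst pairing_diff_left[symmetric]) (auto intro!: L2_curve_L2 pairing_le L2_fun_diff)
    then show "eventually (\<lambda>s. norm (pairing L (u s) w - pairing L (u t) w)
        \<le> L2_norm (phase L) (\<lambda>z. u s z - u t z) * L2_norm (phase L) w) (at t within {0..})"
      unfolding eventually_at_topological by (intro exI[of _ UNIV]) auto
  qed
  then show "((\<lambda>s. pairing L (u s) w) \<longlongrightarrow> pairing L (u t) w) (at t within {0..})"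
    by (simp add: LIM_zero_iff)
qed

lemma has_vector_derivative_at_within_ray:
  fixes f :: "real \<Rightarrow> 'a :: real_normed_vector"
  assumes "(f has_vector_derivative d) (at t within {0..t + 1})" "0 \<le> t"
  shows "(f has_vector_derivative d) (at t within {0..})"
proof -
  have "at t within {0..t + 1} = at t within {0..}"
    by (rule at_within_nhd[of t "{..<t + 1}"]) auto
  then show ?thesis using assms by simp
qed

text \<open>On a bounded time interval the norm of \<open>u\<close> is bounded, so L2 convergence of
  the right-hand sides becomes uniform in time after pairing. Uniform convergence of the derivatives
  and pointwise convergence of the functions permit differentiating the limit.\<close>

lemma L2_weak_limit:
  assumes u: "L2_curve L u"
    and chi: "\<And>n. L2_fun (phase L) (\<phi>s n)" "L2_fun (phase L) \<phi>"
      "(\<lambda>n. L2_norm (phase L) (\<lambda>z. \<phi>s n z - \<phi> z)) \<longlonglongrightarrow> 0"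
    and w: "\<And>n. L2_fun (phase L) (ws n)" "L2_fun (phase L) w"
      "(\<lambda>n::nat. L2_norm (phase L) (\<lambda>z. ws n z - w z)) \<longlonglongrightarrow> 0"
    and der: "\<And>n t. 0 \<le> t \<Longrightarrow>
      ((\<lambda>s. pairing L (u s) (\<phi>s n)) has_vector_derivative pairing L (u t) (ws n)) (at t within {0..})"
    and t: "0 \<le> t"
  shows "((\<lambda>s. pairing L (u s) \<phi>) has_vector_derivative pairing L (u t) w) (at t within {0..})"
proof (rule has_vector_derivative_at_within_ray[OF _ t])
  \<comment> \<open>A bounded interval reaching past \<open>t\<close>: on it the norms are bounded,
    and near \<open>t\<close> it coincides with \<open>{0..}\<close>.\<close>
  let ?S = "{0..t + 1}"
  obtain B where B: "0 < B" "\<And>s. 0 \<le> s \<Longrightarrow> s \<le> t + 1 \<Longrightarrow> L2_norm (phase L) (u s) \<le> B"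
    using L2_curve_bounded[OF u] by blast
  have lim: "(\<lambda>n. pairing L (u s) (\<phi>s n)) \<longlonglongrightarrow> pairing L (u s) \<phi>" if s: "s \<in> ?S" for s
  proof -
    have us: "L2_fun (phase L) (u s)" using s by (intro L2_curve_L2[OF u]) auto
    have "(\<lambda>n. pairing L (u s) (\<phi>s n) - pairing L (u s) \<phi>) \<longlonglongrightarrow> 0"
    proof (rule Lim_null_comparison)
      show "(\<lambda>n. L2_norm (phase L) (u s) * L2_norm (phase L) (\<lambda>z. \<phi>s n z - \<phi> z)) \<longlonglongrightarrow> 0"
        using chi(3) by (rule tendsto_mult_right_zero)
      show "eventually (\<lambda>n. norm (pairing L (u s) (\<phi>s n) - pairing L (u s) \<phi>)
          \<le> L2_norm (phase L) (u s) * L2_norm (phase L) (\<lambda>z. \<phi>s n z - \<phi> z)) sequentially"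
        by (intro always_eventually allI)
          (simp add: pairing_diff_right[symmetric] us chi pairing_le L2_fun_diff)
    qed
    then show ?thesis by (simp add: LIM_zero_iff)
  qed
  have "\<exists>g. \<forall>s\<in>?S. (\<lambda>n. pairing L (u s) (\<phi>s n)) \<longlonglongrightarrow> g s
      \<and> (g has_derivative (\<lambda>h. h *\<^sub>R pairing L (u s) w)) (at s within ?S)"
  proof (rule has_derivative_sequence[where f' = "\<lambda>n s h. h *\<^sub>R pairing L (u s) (ws n)" and ?x0.0 = t])
    show "((\<lambda>s. pairing L (u s) (\<phi>s n)) has_derivative (\<lambda>h. h *\<^sub>R pairing L (u s) (ws n))) (at s within ?S)"
      if "s \<in> ?S" for n s
      using der[of s n] that
      by (auto simp: has_vector_derivative_def intro: has_derivative_subset)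
    show "(\<lambda>n. pairing L (u t) (\<phi>s n)) \<longlonglongrightarrow> pairing L (u t) \<phi>" using lim[of t] t by simp
    fix e :: real assume e: "0 < e"
    have "eventually (\<lambda>n. L2_norm (phase L) (\<lambda>z. ws n z - w z) < e / B) sequentially"
      using w(3) e B by (intro order_tendstoD) auto
    then show "\<forall>\<^sub>F n in sequentially. \<forall>s\<in>?S. \<forall>h.
        norm (h *\<^sub>R pairing L (u s) (ws n) - h *\<^sub>R pairing L (u s) w) \<le> e * norm h"
    proof (eventually_elim, intro ballI allI)
      fix n s and h :: real
      assume n: "L2_norm (phase L) (\<lambda>z. ws n z - w z) < e / B" and s: "s \<in> ?S"
      have us: "L2_fun (phase L) (u s)" using s by (intro L2_curve_L2[OF u]) auto
      have "norm (pairing L (u s) (ws n) - pairing L (u s) w)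
          \<le> L2_norm (phase L) (u s) * L2_norm (phase L) (\<lambda>z. ws n z - w z)"
        by (simp add: pairing_diff_right[symmetric] us w pairing_le L2_fun_diff)
      also have "\<dots> \<le> B * (e / B)" using B s n by (intro mult_mono) auto
      finally have "norm (pairing L (u s) (ws n) - pairing L (u s) w) \<le> e" using B by simp
      then have "\<bar>h\<bar> * norm (pairing L (u s) (ws n) - pairing L (u s) w) \<le> \<bar>h\<bar> * e"
        by (intro mult_left_mono) auto
      then show "norm (h *\<^sub>R pairing L (u s) (ws n) - h *\<^sub>R pairing L (u s) w) \<le> e * norm h"
        by (simp add: scaleR_right_diff_distrib[symmetric] mult.commute[of e])
    qed
  qed (use t in auto)
  then obtain g where g: "\<And>s. s \<in> ?S \<Longrightarrow> (\<lambda>n. pairing L (u s) (\<phi>s n)) \<longlonglongrightarrow> g s"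
      "\<And>s. s \<in> ?S \<Longrightarrow> (g has_derivative (\<lambda>h. h *\<^sub>R pairing L (u s) w)) (at s within ?S)"
    by blast
  have "g s = pairing L (u s) \<phi>" if "s \<in> ?S" for s
    using LIMSEQ_unique[OF g(1)[OF that] lim[OF that]] .
  then show "((\<lambda>s. pairing L (u s) \<phi>) has_vector_derivative pairing L (u t) w) (at t within ?S)"
    unfolding has_vector_derivative_def using t
    by (intro has_derivative_transform[OF _ _ g(2)]) auto
qed

section \<open>Test functions\<close>

text \<open>The exponent \<open>Suc n\<close> is at least \<open>2\<close>, which smooths the kink
  of the positive part; at \<open>0\<close> the difference quotient is bounded by a positive power
  of the increment.\<close>

lemma DERIV_pos_part_power:
  assumes "1 \<le> n"
  shows "((\<lambda>s::real. (max 0 s) ^ Suc n) has_field_derivative real (Suc n) * (max 0 s) ^ n) (at s)"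
proof -
  consider "s < 0" | "s = 0" | "0 < s" by linarith
  then show ?thesis
  proof cases
    case 1
    have "((\<lambda>s::real. 0) has_field_derivative real (Suc n) * (max 0 s) ^ n) (at s)"
      using 1 assms by (simp add: power_0_left)
    moreover have "eventually (\<lambda>x. (max 0 x) ^ Suc n = 0) (nhds s)"
      using eventually_nhds_in_open[of "{..<0}" s] 1 by (auto elim!: eventually_mono)
    ultimately show ?thesis
      by (subst DERIV_cong_ev[OF refl _ refl, where g = "\<lambda>s. 0"]) auto
  next
    case 2
    have "(\<lambda>h::real. ((max 0 (0 + h)) ^ Suc n - (max 0 0) ^ Suc n) / h) \<midarrow>0\<rightarrow> 0"
    proof (rule Lim_null_comparison)
      show "eventually (\<lambda>h::real. norm (((max 0 (0 + h)) ^ Suc n - (max 0 0) ^ Suc n) / h) \<le> \<bar>h\<bar> ^ n) (at 0)"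
        by (intro always_eventually allI) (auto simp: max_def abs_mult)
      have "((\<lambda>h::real. \<bar>h\<bar> ^ n) \<longlongrightarrow> \<bar>0\<bar> ^ n) (at 0)" by (intro tendsto_intros)
      then show "((\<lambda>h::real. \<bar>h\<bar> ^ n) \<longlongrightarrow> 0) (at 0)" using assms by (simp add: power_0_left)
    qed
    then show ?thesis using 2 assms by (simp add: has_field_derivative_def[symmetric] DERIV_def power_0_left)
  next
    case 3
    have "((\<lambda>s. s ^ Suc n) has_field_derivative real (Suc n) * s ^ n) (at s)"
      using DERIV_pow[of "Suc n" s] by simp
    moreover have "eventually (\<lambda>x. (max 0 x) ^ Suc n = x ^ Suc n) (nhds s)"
      using eventually_nhds_in_open[of "{0<..}" s] 3 by (auto elim!: eventually_mono)
    ultimately show ?thesis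
      using 3 by (subst DERIV_cong_ev[OF refl _ refl, where g = "\<lambda>s. s ^ Suc n"]) auto
  qed
qed

text \<open>\<open>C2\<close> speaks about \<open>frechet_derivative\<close>, which is a choice
  operator; explicit derivatives determine it by uniqueness.\<close>

lemma C2I:
  fixes g :: "'a::real_normed_vector \<Rightarrow> complex"
  assumes 1: "\<And>z. (g has_derivative g' z) (at z)"
    and 2: "\<And>h z. ((\<lambda>y. g' y h) has_derivative g'' h z) (at z)"
    and 3: "\<And>h k. continuous_on UNIV (\<lambda>z. g'' h z k)"
  shows "C2 g"
proof -
  have eq1: "frechet_derivative g (at z) = g' z" for z
    using frechet_derivative_at[OF 1] by simp
  have eq2: "frechet_derivative (\<lambda>y. g' y h) (at z) = g'' h z" for h z
    using frechet_derivative_at[OF 2] by simp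
  show ?thesis
    unfolding C2_def eq1 eq2 using 1 2 3 by (auto simp: differentiable_def)
qed

lemma has_derivative_norm_power2 [derivative_intros]:
  fixes f :: "'a::real_normed_vector \<Rightarrow> 'b::real_inner"
  assumes "(f has_derivative f') (at x within S)"
  shows "((\<lambda>x. (norm (f x))\<^sup>2) has_derivative (\<lambda>h. 2 * (f x \<bullet> f' h))) (at x within S)"
  unfolding power2_norm_eq_inner
  by (rule has_derivative_eq_rhs[OF has_derivative_inner[OF assms assms]])
    (simp add: inner_commute fun_eq_iff)

text \<open>The test class asks for joint smoothness in \<open>(x, v)\<close>. Writing the radial
  weight as a function of the squared norm avoids the singularity of the norm at the origin.\<close>

lemma C2_wave_radial:
  fixes k \<eta> :: "real ^ 'n"
  assumes d1: "\<And>s. (\<phi> has_real_derivative \<phi>' s) (at s)" and d2: "\<And>s. (\<phi>' has_real_derivative \<phi>'' s) (at s)"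
    and c: "continuous_on UNIV \<phi>''"
  shows "C2 (\<lambda>z. wave k \<eta> z * complex_of_real (\<phi> ((norm (snd z))\<^sup>2)))"
proof -
  define l where "l = (\<lambda>h :: (real^'n) \<times> (real^'n). - (k \<bullet> fst h + \<eta> \<bullet> snd h))"
  define s where "s = (\<lambda>z :: (real^'n) \<times> (real^'n). (norm (snd z))\<^sup>2)"
  have dl: "(l has_derivative l) (at z)" for z
    unfolding l_def by (auto intro!: derivative_eq_intros)
  have dw: "((\<lambda>z. cis (l z)) has_derivative (\<lambda>h. complex_of_real (l h) * \<i> * cis (l z))) (at z)" for z
    by (auto intro!: derivative_eq_intros dl simp: scaleR_conv_of_real)
  have ds: "(s has_derivative (\<lambda>h. 2 * (snd z \<bullet> snd h))) (at z)" for z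
    unfolding s_def by (auto intro!: derivative_eq_intros)
  have dcomp: "((\<lambda>z. complex_of_real (f (s z))) has_derivative
      (\<lambda>h. complex_of_real (f' (s z) * (2 * (snd z \<bullet> snd h))))) (at z)"
    if "\<And>s. (f has_real_derivative f' s) (at s)" for f f' z
  proof -
    have "((\<lambda>z. f (s z)) has_derivative (\<lambda>h. (2 * (snd z \<bullet> snd h)) * f' (s z))) (at z)"
      using DERIV_compose_FDERIV[OF that ds] by simp
    from bounded_linear.has_derivative[OF bounded_linear_of_real this]
    show ?thesis by (rule has_derivative_eq_rhs) (simp add: fun_eq_iff mult.commute)
  qed
  have cs: "continuous_on UNIV s" unfolding s_def by (intro continuous_intros)
  have cphi: "continuous_on UNIV (\<lambda>z. f (s z))" if "continuous_on UNIV f" for f :: "real \<Rightarrow> real"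
    by (rule continuous_on_compose2[OF that cs]) auto
  have c0: "continuous_on UNIV \<phi>" "continuous_on UNIV \<phi>'"
    by (auto intro!: continuous_at_imp_continuous_on DERIV_isCont[OF d1] DERIV_isCont[OF d2])
  \<comment> \<open>\<open>g1\<close> and \<open>g2\<close> are the first and second derivatives,
    with the directions kept as arguments.\<close>
  define g1 where "g1 z h = cis (l z) * (complex_of_real (l h) * \<i> * complex_of_real (\<phi> (s z))
      + complex_of_real (\<phi>' (s z) * (2 * (snd z \<bullet> snd h))))" for z h
  define g2 where "g2 h z e = complex_of_real (l e) * \<i> * cis (l z) * (complex_of_real (l h) * \<i> * complex_of_real (\<phi> (s z))
      + complex_of_real (\<phi>' (s z) * (2 * (snd z \<bullet> snd h))))
      + cis (l z) * (complex_of_real (l h) * \<i> * complex_of_real (\<phi>' (s z) * (2 * (snd z \<bullet> snd e)))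
        + (complex_of_real (\<phi>'' (s z) * (2 * (snd z \<bullet> snd e))) * complex_of_real (2 * (snd z \<bullet> snd h))
           + complex_of_real (\<phi>' (s z)) * complex_of_real (2 * (snd e \<bullet> snd h))))" for h z e
  have "C2 (\<lambda>z. cis (l z) * complex_of_real (\<phi> (s z)))"
  proof (rule C2I[of _ g1 g2])
    show "((\<lambda>z. cis (l z) * complex_of_real (\<phi> (s z))) has_derivative g1 z) (at z)" for z
      unfolding g1_def[abs_def]
      by (rule has_derivative_eq_rhs[OF has_derivative_mult[OF dw dcomp[OF d1]]])
        (simp add: fun_eq_iff algebra_simps)
    show "((\<lambda>y. g1 y h) has_derivative g2 h z) (at z)" for h z
      unfolding g1_def[abs_def] g2_def[abs_def] of_real_mult[of "\<phi>' _"]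
      by (rule has_derivative_eq_rhs[OF has_derivative_mult[OF dw has_derivative_add[OF
          has_derivative_mult_right[OF dcomp[OF d1]] has_derivative_mult[OF dcomp[OF d2]
          bounded_linear.has_derivative[OF bounded_linear_of_real has_derivative_mult_right[OF
            has_derivative_inner_left[OF has_derivative_snd[OF has_derivative_ident]]]]]]]])
        (simp add: fun_eq_iff algebra_simps)
    show "continuous_on UNIV (\<lambda>z. g2 h z e)" for h e
      unfolding g2_def l_def
      by (intro continuous_intros cphi c c0)
  qed
  then show ?thesis by (simp add: wave_def l_def s_def)
qed

lemma has_derivative_cis_radial:
  fixes \<eta> :: "real ^ 'n" and p :: "real ^ 'n \<Rightarrow> complex"
  assumes "(p has_derivative p') (at v)"
  shows "((\<lambda>w. C * cis (- (\<eta> \<bullet> w)) * p w) has_derivative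
    (\<lambda>h. C * cis (- (\<eta> \<bullet> v)) * (p' h - \<i> * complex_of_real (\<eta> \<bullet> h) * p v))) (at v)"
proof -
  have "((\<lambda>w. cis (- (\<eta> \<bullet> w))) has_derivative (\<lambda>h. complex_of_real (- (\<eta> \<bullet> h)) * \<i> * cis (- (\<eta> \<bullet> v)))) (at v)"
    by (auto intro!: derivative_eq_intros simp: scaleR_conv_of_real)
  from has_derivative_mult[OF has_derivative_mult_right[OF this, of C] assms]
  show ?thesis by (rule has_derivative_eq_rhs) (simp add: fun_eq_iff algebra_simps)
qed

lemma partial_derivI: "(g has_derivative g') (at v) \<Longrightarrow> partial_deriv i g v = g' (axis i 1)"
  unfolding partial_deriv_def using frechet_derivative_at by metis

text \<open>Kept general in the profile \<open>\<phi>\<close> so that Maxwellian and cutoff can be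
  inserted together. The divergence of \<open>v\<close> gives the dimension times
  \<open>\<phi>\<close>, and the imaginary part collects the terms in which exactly one derivative
  falls on the exponential.\<close>

lemma fokker_planck_cis_radial:
  fixes \<eta> v :: "real ^ 'n"
  assumes d1: "\<And>s. (\<phi> has_real_derivative \<phi>' s) (at s)" and d2: "\<And>s. (\<phi>' has_real_derivative \<phi>'' s) (at s)"
  defines "s \<equiv> (norm v)\<^sup>2"
  shows "fokker_planck (\<lambda>w. C * cis (- (\<eta> \<bullet> w)) * complex_of_real (\<phi> ((norm w)\<^sup>2))) v
    = C * cis (- (\<eta> \<bullet> v)) *
      (complex_of_real (- (norm \<eta>)\<^sup>2 * \<phi> s + 2 * real CARD('n) * \<phi>' s + 4 * s * \<phi>'' s + real CARD('n) * \<phi> s + 2 * s * \<phi>' s)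
       - \<i> * complex_of_real ((\<eta> \<bullet> v) * (4 * \<phi>' s + \<phi> s)))"
proof -
  let ?e = "\<lambda>w. C * cis (- (\<eta> \<bullet> w))"
  let ?F = "\<lambda>w. ?e w * complex_of_real (\<phi> ((norm w)\<^sup>2))"
  have dr: "((\<lambda>w. complex_of_real (f ((norm w)\<^sup>2))) has_derivative
      (\<lambda>h. complex_of_real (f' ((norm v)\<^sup>2) * (2 * (v \<bullet> h))))) (at v)"
    if "\<And>s. (f has_real_derivative f' s) (at s)" for f f' and v :: "real^'n"
  proof -
    have "((\<lambda>z::real^'n. (norm z)\<^sup>2) has_derivative (\<lambda>h. 2 * (v \<bullet> h))) (at v)"
      by (auto intro!: derivative_eq_intros)
    from DERIV_compose_FDERIV[OF that this]
    have "((\<lambda>z::real^'n. f ((norm z)\<^sup>2)) has_derivative (\<lambda>h. (2 * (v \<bullet> h)) * f' ((norm v)\<^sup>2))) (at v)" by simp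
    from bounded_linear.has_derivative[OF bounded_linear_of_real this]
    show ?thesis by (rule has_derivative_eq_rhs) (simp add: fun_eq_iff mult.commute)
  qed
  have comp: "((\<lambda>w. complex_of_real (w $ i)) has_derivative (\<lambda>h. complex_of_real (h $ i))) (at v)" for i and v :: "real^'n"
    by (intro bounded_linear.has_derivative[OF bounded_linear_of_real]
        bounded_linear.has_derivative[OF bounded_linear_vec_nth] has_derivative_ident)
  have p1: "partial_deriv i ?F w = ?e w * (complex_of_real (\<phi>' ((norm w)\<^sup>2)) * complex_of_real (2 * w $ i)
      - \<i> * complex_of_real (\<eta> $ i) * complex_of_real (\<phi> ((norm w)\<^sup>2)))" for i w
    by (subst partial_derivI[OF has_derivative_cis_radial[OF dr[OF d1]]]) (simp add: inner_axis)
  have p2: "partial_deriv i (partial_deriv i ?F) v = ?e v *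
     (complex_of_real (\<phi>'' s * (2 * v $ i)) * complex_of_real (2 * v $ i) + complex_of_real (\<phi>' s) * 2
       - \<i> * complex_of_real (\<eta> $ i) * complex_of_real (\<phi>' s * (2 * v $ i))
       - \<i> * complex_of_real (\<eta> $ i) * (complex_of_real (\<phi>' s) * complex_of_real (2 * v $ i)
      - \<i> * complex_of_real (\<eta> $ i) * complex_of_real (\<phi> s)))" for i
  proof -
    have "((\<lambda>w. complex_of_real (\<phi>' ((norm w)\<^sup>2)) * complex_of_real (2 * w $ i)
      - \<i> * complex_of_real (\<eta> $ i) * complex_of_real (\<phi> ((norm w)\<^sup>2))) has_derivative
      (\<lambda>h. complex_of_real (\<phi>'' s * (2 * (v \<bullet> h))) * complex_of_real (2 * v $ i)
         + complex_of_real (\<phi>' s) * (2 * complex_of_real (h $ i))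
       - \<i> * complex_of_real (\<eta> $ i) * complex_of_real (\<phi>' s * (2 * (v \<bullet> h))))) (at v)"
      unfolding of_real_mult[of 2] s_def
      by (rule has_derivative_eq_rhs[OF has_derivative_diff[OF
            has_derivative_mult[OF dr[OF d2] has_derivative_mult_right[OF comp]]
            has_derivative_mult_right[OF dr[OF d1]]]])
        (simp add: fun_eq_iff algebra_simps)
    from partial_derivI[OF has_derivative_cis_radial[OF this]]
    show ?thesis unfolding p1 by (simp add: inner_axis s_def)
  qed
  have p3: "partial_deriv i (\<lambda>w. complex_of_real (w $ i) * ?F w) v = ?e v *
      (complex_of_real (\<phi> s) + complex_of_real (v $ i) * (complex_of_real (\<phi>' s * (2 * v $ i))
        - \<i> * complex_of_real (\<eta> $ i) * complex_of_real (\<phi> s)))" for i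
    by (subst partial_derivI[OF has_derivative_mult[OF comp has_derivative_cis_radial[OF dr[OF d1]]]])
      (simp add: inner_axis s_def algebra_simps)
  have sums: "(\<Sum>i\<in>UNIV. v $ i * v $ i) = s" "(\<Sum>i\<in>UNIV. \<eta> $ i * v $ i) = \<eta> \<bullet> v"
    "(\<Sum>i\<in>UNIV. \<eta> $ i * \<eta> $ i) = (norm \<eta>)\<^sup>2"
    unfolding s_def power2_norm_eq_inner inner_vec_def by simp_all
  have "fokker_planck ?F v = (\<Sum>i\<in>UNIV. ?e v *
     (complex_of_real (4 * \<phi>'' s * (v $ i * v $ i) + 2 * \<phi>' s - \<phi> s * (\<eta> $ i * \<eta> $ i) + \<phi> s + 2 * \<phi>' s * (v $ i * v $ i))
       - \<i> * complex_of_real ((\<eta> $ i * v $ i) * (4 * \<phi>' s + \<phi> s))))"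
    unfolding fokker_planck_def p2 p3 sum.distrib[symmetric]
    by (intro sum.cong refl) (simp add: complex_eq_iff algebra_simps)
  also have "\<dots> = ?e v * (complex_of_real (\<Sum>i\<in>UNIV. 4 * \<phi>'' s * (v $ i * v $ i) + 2 * \<phi>' s - \<phi> s * (\<eta> $ i * \<eta> $ i) + \<phi> s + 2 * \<phi>' s * (v $ i * v $ i))
       - \<i> * complex_of_real (\<Sum>i\<in>UNIV. (\<eta> $ i * v $ i) * (4 * \<phi>' s + \<phi> s)))"
    unfolding of_real_sum sum_distrib_left sum_subtractf right_diff_distrib ..
  also have "(\<Sum>i\<in>UNIV. 4 * \<phi>'' s * (v $ i * v $ i) + 2 * \<phi>' s - \<phi> s * (\<eta> $ i * \<eta> $ i) + \<phi> s + 2 * \<phi>' s * (v $ i * v $ i))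
     = - (norm \<eta>)\<^sup>2 * \<phi> s + 2 * real CARD('n) * \<phi>' s + 4 * s * \<phi>'' s + real CARD('n) * \<phi> s + 2 * s * \<phi>' s"
    unfolding sum.distrib sum_subtractf sum_distrib_left[symmetric] sums by simp
  also have "(\<Sum>i\<in>UNIV. (\<eta> $ i * v $ i) * (4 * \<phi>' s + \<phi> s)) = (\<eta> \<bullet> v) * (4 * \<phi>' s + \<phi> s)"
    unfolding sum_distrib_right[symmetric] sums ..
  finally show ?thesis .
qed

text \<open>The argument stands for the squared norm of \<open>v\<close>. The cube is the lowest
  integer power of the positive part whose second derivative is continuous, and \<open>Suc n\<close>
  keeps the radius positive.\<close>

definition cutoff :: "nat \<Rightarrow> real \<Rightarrow> real" where
  "cutoff n s = (max 0 (1 - s / (real (Suc n))\<^sup>2)) ^ 3"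

definition cutoff' :: "nat \<Rightarrow> real \<Rightarrow> real" where
  "cutoff' n s = - (3 / (real (Suc n))\<^sup>2) * (max 0 (1 - s / (real (Suc n))\<^sup>2)) ^ 2"

definition cutoff'' :: "nat \<Rightarrow> real \<Rightarrow> real" where
  "cutoff'' n s = (6 / ((real (Suc n))\<^sup>2)\<^sup>2) * max 0 (1 - s / (real (Suc n))\<^sup>2)"

lemma DERIV_pos_part_ramp:
  fixes r :: real
  assumes "1 \<le> n"
  shows "((\<lambda>s. (max 0 (1 - s / r)) ^ Suc n) has_real_derivative
    - (real (Suc n) / r) * (max 0 (1 - s / r)) ^ n) (at s)"
proof -
  have "((\<lambda>s. 1 - s / r) has_real_derivative (- (1 / r))) (at s)"
    by (cases "r = 0") (auto intro!: derivative_eq_intros simp: field_simps)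
  from DERIV_chain2[OF DERIV_pos_part_power[OF assms] this] show ?thesis by (simp add: field_simps)
qed

lemma DERIV_cutoff: "(cutoff n has_real_derivative cutoff' n s) (at s)"
  using DERIV_pos_part_ramp[of 2 "(real (Suc n))\<^sup>2" s] unfolding cutoff_def[abs_def] cutoff'_def
  by (simp add: numeral_3_eq_3)

lemma DERIV_cutoff': "(cutoff' n has_real_derivative cutoff'' n s) (at s)"
proof -
  define r where "r = (real (Suc n))\<^sup>2"
  have "((\<lambda>s. - (3 / r) * (max 0 (1 - s / r)) ^ Suc 1) has_real_derivative
      - (3 / r) * (- (real (Suc 1) / r) * (max 0 (1 - s / r)) ^ 1)) (at s)"
    by (rule DERIV_cmult[OF DERIV_pos_part_ramp]) simp
  moreover have "- (3 / r) * (- (real (Suc 1) / r) * m ^ 1) = 6 / r\<^sup>2 * m" for m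
    by (simp add: power2_eq_square)
  ultimately show ?thesis unfolding cutoff'_def[abs_def] cutoff''_def r_def[symmetric]
    by (simp add: numeral_2_eq_2)
qed

lemma continuous_on_cutoff: "continuous_on A (cutoff n)"
  unfolding cutoff_def[abs_def] by (intro continuous_intros) auto

lemma continuous_on_cutoff': "continuous_on A (cutoff' n)"
  unfolding cutoff'_def[abs_def] by (intro continuous_intros) auto

lemma continuous_on_cutoff'': "continuous_on A (cutoff'' n)"
  unfolding cutoff''_def[abs_def] by (intro continuous_intros) auto

text \<open>On the support \<open>s\<close> is at most the squared radius \<open>r\<close>, and each
  derivative gains a factor \<open>1 / r\<close>, so the products with \<open>s\<close> stay bounded
  uniformly in \<open>n\<close>. Such products arise when the second-order operator acts on a radial
  function.\<close>

lemma cutoff_bounds: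
  assumes "0 \<le> s"
  shows "\<bar>cutoff n s\<bar> \<le> 1" "\<bar>cutoff' n s\<bar> \<le> 3" "\<bar>s * cutoff' n s\<bar> \<le> 3" "\<bar>s * cutoff'' n s\<bar> \<le> 6"
proof -
  define r where "r = (real (Suc n))\<^sup>2"
  define m where "m = max 0 (1 - s / r)"
  have r: "1 \<le> r" unfolding r_def by (simp add: one_le_power)
  have m: "0 \<le> m" "m \<le> 1" using assms r by (auto simp: m_def)
  have m2: "0 \<le> m\<^sup>2" "m\<^sup>2 \<le> 1" using m by (auto simp: power_le_one)
  have sm: "0 \<le> s / r * m" "s / r * m \<le> 1"
  proof -
    show "0 \<le> s / r * m" using assms r m by simp
    show "s / r * m \<le> 1"
    proof (cases "s / r \<le> 1")
      case True
      then show ?thesis using m assms r by (intro mult_le_one) auto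
    next
      case False
      then show ?thesis by (simp add: m_def)
    qed
  qed
  have c: "cutoff n s = m ^ 3" "cutoff' n s = - (3 / r * m\<^sup>2)" "cutoff'' n s = 6 / r / r * m"
    by (simp_all add: cutoff_def cutoff'_def cutoff''_def m_def r_def[symmetric] power2_eq_square[of r] del: of_nat_Suc)
  show "\<bar>cutoff n s\<bar> \<le> 1" unfolding c using m by (simp add: power_le_one)
  have "3 / r * m\<^sup>2 \<le> 3 * 1" using r m2 by (intro mult_mono) (auto simp: divide_le_eq)
  then show "\<bar>cutoff' n s\<bar> \<le> 3" unfolding c using r by simp
  have "s / r * m * m \<le> 1" by (rule mult_le_one[OF sm(2) m])
  moreover have "0 \<le> s / r * m * m" by (rule mult_nonneg_nonneg[OF sm(1) m(1)])
  moreover have "s * cutoff' n s = - 3 * (s / r * m * m)" unfolding c by (simp add: power2_eq_square)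
  ultimately show "\<bar>s * cutoff' n s\<bar> \<le> 3" by simp
  have "s / r * m * (1 / r) \<le> 1" using r by (intro mult_le_one[OF sm(2)]) auto
  moreover have "0 \<le> s / r * m * (1 / r)" using r by (intro mult_nonneg_nonneg[OF sm(1)]) simp
  moreover have "s * cutoff'' n s = 6 * (s / r * m * (1 / r))" unfolding c by simp
  ultimately show "\<bar>s * cutoff'' n s\<bar> \<le> 6" by simp
qed

lemma cutoff_tendsto: "(\<lambda>n. cutoff n s) \<longlonglongrightarrow> 1" "(\<lambda>n. cutoff' n s) \<longlonglongrightarrow> 0" "(\<lambda>n. cutoff'' n s) \<longlonglongrightarrow> 0"
proof -
  have m: "(\<lambda>n. max 0 (1 - s / (real (Suc n))\<^sup>2)) \<longlonglongrightarrow> max 0 1"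
    by (intro tendsto_max tendsto_const) real_asymp
  from tendsto_power[OF m, of 3] show "(\<lambda>n. cutoff n s) \<longlonglongrightarrow> 1" by (simp add: cutoff_def)
  have "(\<lambda>n. - (3 / (real (Suc n))\<^sup>2)) \<longlonglongrightarrow> 0" by real_asymp
  from tendsto_mult[OF this tendsto_power[OF m, of 2]] show "(\<lambda>n. cutoff' n s) \<longlonglongrightarrow> 0" by (simp add: cutoff'_def)
  have "(\<lambda>n. 6 / (real (Suc n)) ^ 4) \<longlonglongrightarrow> 0" by real_asymp
  from tendsto_mult[OF this m] show "(\<lambda>n. cutoff'' n s) \<longlonglongrightarrow> 0" by (simp add: cutoff''_def)
qed

lemma cutoff_eq_0: "(real (Suc n))\<^sup>2 < s \<Longrightarrow> cutoff n s = 0"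
  by (simp add: cutoff_def max_def divide_le_eq not_le)

context
  fixes c :: real
begin

text \<open>Maxwellian times cutoff as a function of the squared norm, with \<open>c\<close> in the
  place of the normalising constant.\<close>

definition profile :: "nat \<Rightarrow> real \<Rightarrow> real" where
  "profile n s = c * exp (- s / 2) * cutoff n s"

definition profile' :: "nat \<Rightarrow> real \<Rightarrow> real" where
  "profile' n s = c * exp (- s / 2) * (cutoff' n s - cutoff n s / 2)"

definition profile'' :: "nat \<Rightarrow> real \<Rightarrow> real" where
  "profile'' n s = c * exp (- s / 2) * (cutoff'' n s - cutoff' n s + cutoff n s / 4)"

lemma DERIV_profile: "(profile n has_real_derivative profile' n s) (at s)"
  unfolding profile_def[abs_def] profile'_def
  by (auto intro!: derivative_eq_intros DERIV_cutoff simp: field_simps)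

lemma DERIV_profile': "(profile' n has_real_derivative profile'' n s) (at s)"
  unfolding profile'_def[abs_def] profile''_def
  by (auto intro!: derivative_eq_intros DERIV_cutoff DERIV_cutoff' simp: field_simps)

lemma continuous_on_profile'': "continuous_on A (profile'' n)"
  unfolding profile''_def[abs_def]
  by (intro continuous_intros continuous_on_cutoff continuous_on_cutoff' continuous_on_cutoff'') auto

end

text \<open>The admissible substitute for a plane wave: after division by the Maxwellian it is the
  wave times a cutoff, which tends to the wave itself.\<close>

definition test_wave :: "real ^ 'n \<Rightarrow> real ^ 'n \<Rightarrow> nat \<Rightarrow> (real ^ 'n) \<times> (real ^ 'n) \<Rightarrow> complex" where
  "test_wave k \<eta> n z = wave k \<eta> z * complex_of_real (maxwellian (snd z) * cutoff n ((norm (snd z))\<^sup>2))"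

lemma maxwellian_cutoff_eq_profile:
  "maxwellian (v :: real^'n) * cutoff n ((norm v)\<^sup>2) = profile ((2 * pi) powr (- (real CARD('n) / 2))) n ((norm v)\<^sup>2)"
  by (simp add: maxwellian_def profile_def)

lemma phase_test_test_wave:
  fixes k \<eta> :: "real ^ 'n"
  assumes L: "0 < L" and k: "k \<in> dual_lattice L"
  shows "phase_test L (test_wave k \<eta> n)"
  unfolding phase_test_def
proof (intro conjI allI)
  show "C2 (test_wave k \<eta> n)"
    unfolding test_wave_def[abs_def] maxwellian_cutoff_eq_profile
    by (rule C2_wave_radial[OF DERIV_profile DERIV_profile' continuous_on_profile''])
  show "test_wave k \<eta> n (x + axis i L, v) = test_wave k \<eta> n (x, v)" for x v i
  proof -
    \<comment> \<open>Periodicity is the point where the dual lattice enters: \<open>k\<close>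
      paired with a period is an integer multiple of \<open>2 * pi\<close>.\<close>
    obtain j :: int where "k $ i = 2 * pi / L * real_of_int j" using k unfolding dual_lattice_def by blast
    then have "k \<bullet> axis i L = 2 * pi * real_of_int j" using L by (simp add: inner_axis)
    then have "cis (- (k \<bullet> axis i L)) = 1" by (simp add: cis_multiple_2pi cis_cnj[symmetric])
    moreover have "wave k \<eta> (x + axis i L, v) = wave k \<eta> (x, v) * cis (- (k \<bullet> axis i L))"
      by (simp add: wave_def cis_mult inner_add_right algebra_simps)
    ultimately show ?thesis by (simp add: test_wave_def)
  qed
  show "\<exists>R. \<forall>x v. R < norm v \<longrightarrow> test_wave k \<eta> n (x, v) = 0"
  proof (intro exI[of _ "real (Suc n)"] allI impI)
    fix x v :: "real^'n" assume "real (Suc n) < norm v"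
    then have "(real (Suc n))\<^sup>2 < (norm v)\<^sup>2" by (intro power_strict_mono) auto
    then show "test_wave k \<eta> n (x, v) = 0" by (simp add: test_wave_def cutoff_eq_0 del: of_nat_Suc)
  qed
qed

lemma transport_test_wave:
  "frechet_derivative (\<lambda>y. test_wave k \<eta> n (y, v)) (at x) v
    = - \<i> * complex_of_real (k \<bullet> v) * test_wave k \<eta> n (x, v)"
proof -
  let ?a = "complex_of_real (maxwellian v * cutoff n ((norm v)\<^sup>2))"
  have "((\<lambda>y. cis (- (k \<bullet> y + \<eta> \<bullet> v)) * ?a) has_derivative
    (\<lambda>h. - \<i> * complex_of_real (k \<bullet> h) * cis (- (k \<bullet> x + \<eta> \<bullet> v)) * ?a)) (at x)"
    by (auto intro!: derivative_eq_intros simp: scaleR_conv_of_real fun_eq_iff algebra_simps)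
  from fun_cong[OF frechet_derivative_at[OF this, symmetric], of v] show ?thesis
    by (simp add: test_wave_def wave_def)
qed

lemma test_wave_borel_measurable: "test_wave k \<eta> n \<in> borel_measurable borel"
proof -
  have "continuous_on UNIV (\<lambda>z. cutoff n ((norm (snd z))\<^sup>2))"
    by (rule continuous_on_compose2[OF continuous_on_cutoff]) (auto intro!: continuous_intros)
  moreover have "continuous_on UNIV (\<lambda>z. maxwellian (snd z))"
    by (rule continuous_on_compose2[OF continuous_on_maxwellian]) (auto intro!: continuous_intros)
  ultimately show ?thesis unfolding test_wave_def[abs_def] wave_def
    by (intro borel_measurable_continuous_onI continuous_intros)
qed

text \<open>A consequence of the finite second moments of the Gaussian. Linear growth is the right
  class here, since transport and derivatives in the frequency each bring down one factor of
  \<open>v\<close>.\<close>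

lemma L2_fun_linear_growth:
  fixes f :: "(real ^ 'n) \<times> (real ^ 'n) \<Rightarrow> complex"
  assumes L: "0 < L" and f: "f \<in> borel_measurable (phase L)"
    and bound: "\<And>z. norm (f z) \<le> B * (1 + norm (snd z))"
  shows "L2_fun (phase L) f"
proof (rule L2_fun_dominated)
  have int: "integrable gauss_measure (\<lambda>v :: real^'n. complex_of_real ((1 + norm v)\<^sup>2))"
  proof (rule Bochner_Integration.integrable_bound)
    show "integrable gauss_measure (\<lambda>v :: real^'n. 2 + 2 * (norm v)\<^sup>2)"
      by (intro Bochner_Integration.integrable_add integrable_mult_right integrable_gauss_norm_power2) simp_all
    have "(1 + norm v)\<^sup>2 \<le> 2 + 2 * (norm v)\<^sup>2" for v :: "real^'n"
      using sum_squares_bound[of 1 "norm v"] by (simp add: power2_sum)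
    then show "AE v :: real^'n in gauss_measure. norm (complex_of_real ((1 + norm v)\<^sup>2)) \<le> norm (2 + 2 * (norm v)\<^sup>2)"
      by (intro AE_I2) (simp add: norm_of_real del: of_real_power of_real_add)
  qed measurable
  have "integrable (dx L) (\<lambda>x :: real^'n. 1 :: complex)"
    using integral_dx_cis(1)[OF L zero_in_dual_lattice] by simp
  from integral_phase_mult(2)[OF L this int]
  have "integrable (phase L) (\<lambda>z :: (real^'n) \<times> (real^'n). 1 * complex_of_real ((1 + norm (snd z))\<^sup>2))" .
  then have "integrable (phase L) (\<lambda>z :: (real^'n) \<times> (real^'n). (1 + norm (snd z))\<^sup>2)"
    unfolding mult_1 complex_of_real_integrable_eq .
  moreover have "(\<lambda>z :: (real^'n) \<times> (real^'n). complex_of_real (1 + norm (snd z))) \<in> borel_measurable (phase L)"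
    by (intro measurable_phase borel_measurable_continuous_onI continuous_intros)
  ultimately have "L2_fun (phase L) (\<lambda>z :: (real^'n) \<times> (real^'n). complex_of_real (1 + norm (snd z)))"
    by (simp add: L2_fun_def norm_of_real del: of_real_add)
  then show "L2_fun (phase L) (\<lambda>z :: (real^'n) \<times> (real^'n). complex_of_real B * complex_of_real (1 + norm (snd z)))"
    by (rule L2_fun_cmult)
  show "norm (f z) \<le> norm (complex_of_real B * complex_of_real (1 + norm (snd z)))" for z
    by (rule order_trans[OF bound[of z]]) (simp only: of_real_mult[symmetric] norm_of_real abs_ge_self)
qed fact

section \<open>From admissible test functions to plane waves\<close>

lemma kinetic_solution_pairing:
  assumes sol: "kinetic_solution Lop L f0 f" and test: "phase_test L \<psi>"
    and meas: "\<psi> \<in> borel_measurable borel" "W \<in> borel_measurable borel"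
    and W: "\<And>x v. frechet_derivative (\<lambda>y. \<psi> (y, v)) (at x) v + Lop (\<lambda>w. \<psi> (x, w)) v = W (x, v)"
    and t: "0 \<le> t"
  shows "((\<lambda>s. pairing L (over_M (f s)) (over_M \<psi>)) has_vector_derivative
    pairing L (over_M (f t)) (over_M W)) (at t within {0..})"
proof -
  have m: "\<psi> \<in> borel_measurable (dx_dv L)" "W \<in> borel_measurable (dx_dv L)"
    using measurable_phase[OF meas(1), of L] measurable_phase[OF meas(2), of L]
    by (simp_all add: measurable_phase_iff)
  have fm: "f s \<in> borel_measurable (dx_dv L)" if "0 \<le> s" for s
    using sol that by (simp add: kinetic_solution_def L2_fun_def measurable_dx_dgamma_iff)
  have "((\<lambda>s. \<integral>z. f s z * \<psi> z \<partial>dx_dgamma L) has_vector_derivative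
         (\<integral>(x, v). f t (x, v) *
            (frechet_derivative (\<lambda>y. \<psi> (y, v)) (at x) v + Lop (\<lambda>w. \<psi> (x, w)) v) \<partial>dx_dgamma L))
        (at t within {0..})"
    using sol test t unfolding kinetic_solution_def by blast
  moreover have "(\<integral>(x, v). f t (x, v) *
      (frechet_derivative (\<lambda>y. \<psi> (y, v)) (at x) v + Lop (\<lambda>w. \<psi> (x, w)) v) \<partial>dx_dgamma L)
      = pairing L (over_M (f t)) (over_M W)"
    unfolding W pairing_def using integral_mult_over_M[OF fm[OF t] m(2)] by (simp add: case_prod_beta')
  ultimately have "((\<lambda>s. \<integral>z. f s z * \<psi> z \<partial>dx_dgamma L) has_vector_derivative
      pairing L (over_M (f t)) (over_M W)) (at t within {0..})" by simp
  then show ?thesis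
    by (rule has_vector_derivative_transform[rotated 2])
      (use t in \<open>auto simp: pairing_def integral_mult_over_M[OF fm m(1)]\<close>)
qed

lemma kinetic_solution_curve:
  assumes "kinetic_solution Lop L f0 f"
  shows "L2_curve L (\<lambda>t. over_M (f t))"
  unfolding L2_curve_def
proof (intro conjI allI impI)
  fix t :: real assume t: "0 \<le> t"
  show "L2_fun (phase L) (over_M (f t))"
    using assms t by (simp add: kinetic_solution_def L2_fun_over_M)
  have L2: "L2_fun (dx_dgamma L) (f s)" if "0 \<le> s" for s
    using assms that by (simp add: kinetic_solution_def)
  have "((\<lambda>s. sqrt (L2_normsq (dx_dgamma L) (\<lambda>z. f s z - f t z))) \<longlongrightarrow> sqrt 0) (at t within {0..})"
    using assms t by (intro tendsto_real_sqrt) (auto simp: kinetic_solution_def)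
  moreover have "sqrt (L2_normsq (dx_dgamma L) (\<lambda>z. f s z - f t z)) = L2_norm (phase L) (\<lambda>z. over_M (f s) z - over_M (f t) z)"
    if "0 \<le> s" for s
    unfolding L2_norm_def L2_normsq_over_M[OF L2_fun_diff[OF L2[OF that] L2[OF t]]]
    by (simp add: over_M_def[abs_def] diff_divide_distrib)
  then have "eventually (\<lambda>s. sqrt (L2_normsq (dx_dgamma L) (\<lambda>z. f s z - f t z))
      = L2_norm (phase L) (\<lambda>z. over_M (f s) z - over_M (f t) z)) (at t within {0..})"
    unfolding eventually_at_topological by (intro exI[of _ UNIV]) auto
  ultimately show "((\<lambda>s. L2_norm (phase L) (\<lambda>z. over_M (f s) z - over_M (f t) z)) \<longlongrightarrow> 0) (at t within {0..})"
    unfolding real_sqrt_zero by (rule Lim_transform_eventually)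
qed

text \<open>The limiting argument shared by both operators. After division by the Maxwellian the
  adjoint generator maps the truncated wave to \<open>ws n\<close>; pointwise convergence with a
  uniform linear bound gives L2 convergence, and the weak equation survives the limit.\<close>

lemma kinetic_solution_wave:
  fixes k \<eta> :: "real ^ 'n"
  assumes sol: "kinetic_solution Lop L f0 f" and L: "0 < L" and k: "k \<in> dual_lattice L"
    and ws: "\<And>n. ws n \<in> borel_measurable borel"
      "\<And>n x v. - \<i> * complex_of_real (k \<bullet> v) * test_wave k \<eta> n (x, v) + Lop (\<lambda>w. test_wave k \<eta> n (x, w)) v
        = complex_of_real (maxwellian v) * ws n (x, v)"
    and bound: "\<And>n z. norm (ws n z) \<le> B * (1 + norm (snd z))"
    and lim: "\<And>z. (\<lambda>n. ws n z) \<longlonglongrightarrow> w z"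
    and t: "0 \<le> t"
  shows "((\<lambda>s. pairing L (over_M (f s)) (wave k \<eta>)) has_vector_derivative
    pairing L (over_M (f t)) w) (at t within {0..})"
proof -
  interpret finite_measure "phase L :: ((real^'n) \<times> (real^'n)) measure" by (rule finite_measure_phase[OF L])
  have over_test: "over_M (test_wave k \<eta> n) = (\<lambda>z. wave k \<eta> z * complex_of_real (cutoff n ((norm (snd z))\<^sup>2)))" for n
    by (simp add: over_M_def[abs_def] test_wave_def fun_eq_iff)
  have over_ws: "over_M (\<lambda>z. complex_of_real (maxwellian (snd z)) * ws n z) = ws n" for n
    by (simp add: over_M_def[abs_def])
  have wm: "w \<in> borel_measurable (phase L)"
    by (rule borel_measurable_LIMSEQ_metric[OF measurable_phase[OF ws(1)] lim])
  have boundw: "norm (w z) \<le> B * (1 + norm (snd z))" for z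
    by (rule LIMSEQ_le_const2[OF tendsto_norm[OF lim[of z]]]) (use bound in auto)
  have cutoff_le: "\<bar>cutoff n ((norm (snd z))\<^sup>2)\<bar> \<le> 1" for n and z :: "(real^'n) \<times> (real^'n)"
    by (rule cutoff_bounds(1)) simp
  have tm: "over_M (test_wave k \<eta> n) \<in> borel_measurable (phase L)" for n
    using measurable_phase[OF test_wave_borel_measurable, of k \<eta> n L]
    by (simp add: measurable_phase_iff over_M_measurable_iff)
  show ?thesis
  proof (rule L2_weak_limit[OF kinetic_solution_curve[OF sol]])
    show "L2_fun (phase L) (over_M (test_wave k \<eta> n))" for n
      by (rule L2_fun_bounded[OF tm, where B = 1]) (simp add: over_test norm_mult cutoff_le)
    show "L2_fun (phase L) (wave k \<eta>)" by (rule L2_fun_wave[OF L])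
    show "(\<lambda>n. L2_norm (phase L) (\<lambda>z. over_M (test_wave k \<eta> n) z - wave k \<eta> z)) \<longlonglongrightarrow> 0"
    proof (rule L2_norm_tendsto_zero)
      show "L2_fun (phase L) (\<lambda>z :: (real^'n) \<times> (real^'n). 2)" by (rule L2_fun_bounded[where B = 2]) auto
      show "(\<lambda>z. over_M (test_wave k \<eta> n) z - wave k \<eta> z) \<in> borel_measurable (phase L)" for n
        using tm[of n] by simp
      have "norm (over_M (test_wave k \<eta> n) z) \<le> 1" for n z
        by (simp add: over_test norm_mult cutoff_le)
      then show "norm (over_M (test_wave k \<eta> n) z - wave k \<eta> z) \<le> norm (2::complex)" for n z
        using norm_triangle_ineq4[of "over_M (test_wave k \<eta> n) z" "wave k \<eta> z"] by (simp add: add_increasing order_trans)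

      have "(\<lambda>n. over_M (test_wave k \<eta> n) z - wave k \<eta> z) \<longlonglongrightarrow> wave k \<eta> z * complex_of_real 1 - wave k \<eta> z" for z
        unfolding over_test by (intro tendsto_intros cutoff_tendsto)
      then show "AE z in phase L. (\<lambda>n. over_M (test_wave k \<eta> n) z - wave k \<eta> z) \<longlonglongrightarrow> 0" by simp
    qed
    show "L2_fun (phase L) (ws n)" for n by (rule L2_fun_linear_growth[OF L measurable_phase[OF ws(1)] bound])
    show "L2_fun (phase L) w" by (rule L2_fun_linear_growth[OF L wm boundw])
    show "(\<lambda>n. L2_norm (phase L) (\<lambda>z. ws n z - w z)) \<longlonglongrightarrow> 0"
    proof (rule L2_norm_tendsto_zero)
      let ?W = "\<lambda>z :: (real^'n) \<times> (real^'n). complex_of_real (2 * B * (1 + norm (snd z)))"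
      have Wm: "?W \<in> borel_measurable (phase L)"
        by (intro measurable_phase borel_measurable_continuous_onI continuous_intros)
      show "L2_fun (phase L) ?W"
        by (rule L2_fun_linear_growth[OF L Wm, where B = "\<bar>2 * B\<bar>"]) (simp add: norm_mult abs_mult del: of_real_add)
      show "(\<lambda>z. ws n z - w z) \<in> borel_measurable (phase L)" for n
        using measurable_phase[OF ws(1), of n L] wm by simp
      show "norm (ws n z - w z) \<le> norm (?W z)" for n z
        using norm_triangle_ineq4[of "ws n z" "w z"] bound[of n z] boundw[of z] abs_ge_self[of "2 * B * (1 + norm (snd z))"]
        unfolding norm_of_real by linarith
      show "AE z in phase L. (\<lambda>n. ws n z - w z) \<longlonglongrightarrow> 0"
        using tendsto_diff[OF lim tendsto_const, of z "w z" for z] by simp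
    qed
    show "((\<lambda>s. pairing L (over_M (f s)) (over_M (test_wave k \<eta> n))) has_vector_derivative
        pairing L (over_M (f t)) (ws n)) (at t within {0..})" if "0 \<le> t" for n t
    proof -
      have "(\<lambda>z. complex_of_real (maxwellian (snd z)) * ws n z) \<in> borel_measurable borel"
        using ws(1)[of n] borel_measurable_continuous_onI[OF continuous_on_compose2[OF continuous_on_maxwellian[of UNIV]
            continuous_on_snd[OF continuous_on_id]]] by measurable
      from kinetic_solution_pairing[OF sol phase_test_test_wave[OF L k] test_wave_borel_measurable this _ that]
      show ?thesis unfolding over_ws transport_test_wave using ws(2) by simp
    qed
  qed (rule t)
qed

section \<open>The weak equation tested with plane waves\<close>

lemma tendsto_fp_remainder:
  "(\<lambda>n. a * cutoff n s + b * cutoff' n s + c * (s * cutoff'' n s) + d * (s * cutoff' n s)) \<longlonglongrightarrow> a"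
proof -
  have "(\<lambda>n. a * cutoff n s + b * cutoff' n s + c * (s * cutoff'' n s) + d * (s * cutoff' n s))
    \<longlonglongrightarrow> a * 1 + b * 0 + c * (s * 0) + d * (s * 0)"
    by (intro tendsto_intros cutoff_tendsto)
  then show ?thesis by simp
qed

text \<open>On a Gaussian profile the terms quadratic in \<open>v\<close> cancel, because
  \<open>4 s \<phi>''\<close> and \<open>2 s \<phi>'\<close> compensate. What is left is affine in
  \<open>v\<close>, and since multiplication by \<open>v\<close> is a derivative in
  \<open>\<eta>\<close>, the equation becomes first order in frequency.\<close>

lemma fokker_planck_wave:
  fixes k \<eta> :: "real ^ 'n"
  assumes sol: "kinetic_solution fokker_planck L f0 f" and L: "0 < L" and k: "k \<in> dual_lattice L"
    and t: "0 \<le> t"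
  shows "((\<lambda>s. pairing L (over_M (f s)) (wave k \<eta>)) has_vector_derivative
    pairing L (over_M (f t)) (\<lambda>z. (\<i> * complex_of_real ((\<eta> - k) \<bullet> snd z) - complex_of_real ((norm \<eta>)\<^sup>2)) * wave k \<eta> z))
    (at t within {0..})"
proof -
  define d where "d = real CARD('n)"
  \<comment> \<open>The general formula with the Maxwellian divided out. The terms carrying a factor
    \<open>s\<close> but no derivative of the cutoff have already cancelled.\<close>
  define re where "re n s = - (norm \<eta>)\<^sup>2 * cutoff n s + 2 * d * cutoff' n s + 4 * (s * cutoff'' n s)
      + (- 2) * (s * cutoff' n s)" for n s
  define im where "im n v = (\<eta> \<bullet> v) * (cutoff n ((norm v)\<^sup>2) - 4 * cutoff' n ((norm v)\<^sup>2)) - (k \<bullet> v) * cutoff n ((norm v)\<^sup>2)"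
    for n and v :: "real^'n"
  define ws where "ws n z = (complex_of_real (re n ((norm (snd z))\<^sup>2)) + \<i> * complex_of_real (im n (snd z))) * wave k \<eta> z" for n z
  \<comment> \<open>The constants come from the cutoff bounds: \<open>6 * d\<close> is
    \<open>2 * d * 3\<close>, \<open>30\<close> is \<open>4 * 6 + 2 * 3\<close>, and
    \<open>13\<close> is \<open>1 + 4 * 3\<close>.\<close>
  let ?K = "(norm \<eta>)\<^sup>2 + 6 * d + 30 + 13 * norm \<eta> + norm k"
  show ?thesis
  proof (rule kinetic_solution_wave[OF sol L k _ _ _ _ t, where ws = ws and B = ?K])
    show "ws n \<in> borel_measurable borel" for n
    proof -
      have "continuous_on UNIV (\<lambda>z::(real^'n)\<times>(real^'n). h ((norm (snd z))\<^sup>2))" if "continuous_on UNIV h" for h :: "real \<Rightarrow> real"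
        by (rule continuous_on_compose2[OF that]) (auto intro!: continuous_intros)
      note c = this[OF continuous_on_cutoff, of n] this[OF continuous_on_cutoff', of n] this[OF continuous_on_cutoff'', of n]
      show ?thesis
        unfolding ws_def[abs_def] re_def im_def wave_def
        by (intro borel_measurable_continuous_onI continuous_intros c)
    qed
    show "- \<i> * complex_of_real (k \<bullet> v) * test_wave k \<eta> n (x, v) + fokker_planck (\<lambda>w. test_wave k \<eta> n (x, w)) v
        = complex_of_real (maxwellian v) * ws n (x, v)" for n x v
    proof -
      let ?c = "(2 * pi) powr (- (real CARD('n) / 2))"
      let ?s = "(norm v)\<^sup>2"
      have "test_wave k \<eta> n (x, w) = cis (- (k \<bullet> x)) * cis (- (\<eta> \<bullet> w)) * complex_of_real (profile ?c n ((norm w)\<^sup>2))" for w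
        unfolding test_wave_def snd_conv maxwellian_cutoff_eq_profile by (simp add: wave_def cis_mult)
      then have "fokker_planck (\<lambda>w. test_wave k \<eta> n (x, w)) v = cis (- (k \<bullet> x)) * cis (- (\<eta> \<bullet> v)) *
      (complex_of_real (- (norm \<eta>)\<^sup>2 * profile ?c n ?s + 2 * real CARD('n) * profile' ?c n ?s + 4 * ?s * profile'' ?c n ?s
          + real CARD('n) * profile ?c n ?s + 2 * ?s * profile' ?c n ?s)
       - \<i> * complex_of_real ((\<eta> \<bullet> v) * (4 * profile' ?c n ?s + profile ?c n ?s)))"
        using fokker_planck_cis_radial[OF DERIV_profile DERIV_profile'] by simp
      also have "- (norm \<eta>)\<^sup>2 * profile ?c n ?s + 2 * real CARD('n) * profile' ?c n ?s + 4 * ?s * profile'' ?c n ?s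
          + real CARD('n) * profile ?c n ?s + 2 * ?s * profile' ?c n ?s = maxwellian v * re n ?s"
        by (simp add: profile_def profile'_def profile''_def re_def maxwellian_def d_def algebra_simps)
      also have "(\<eta> \<bullet> v) * (4 * profile' ?c n ?s + profile ?c n ?s) = maxwellian v * ((\<eta> \<bullet> v) * (4 * cutoff' n ?s - cutoff n ?s))"
        by (simp add: profile_def profile'_def maxwellian_def algebra_simps)
      also have "cis (- (k \<bullet> x)) * cis (- (\<eta> \<bullet> v)) = wave k \<eta> (x, v)"
        by (simp add: wave_def cis_mult)
      finally show ?thesis
        unfolding ws_def im_def test_wave_def by (simp add: algebra_simps)
    qed
    show "norm (ws n z) \<le> ?K * (1 + norm (snd z))" for n z
    proof -
      define s where "s = (norm (snd z))\<^sup>2"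
      have s: "0 \<le> s" by (simp add: s_def)
      note cb = cutoff_bounds[OF s, of n]
      have "\<bar>- (norm \<eta>)\<^sup>2 * cutoff n s\<bar> \<le> (norm \<eta>)\<^sup>2 * 1"
        unfolding abs_mult using cb by (intro mult_mono) auto
      moreover have "\<bar>2 * d * cutoff' n s\<bar> \<le> 2 * d * 3"
        unfolding abs_mult using cb by (intro mult_mono) (auto simp: d_def)
      ultimately have re: "\<bar>re n s\<bar> \<le> (norm \<eta>)\<^sup>2 + 6 * d + 30"
        unfolding re_def using cb by linarith
      have "\<bar>cutoff n s - 4 * cutoff' n s\<bar> \<le> 13" using cb by linarith
      then have "\<bar>(\<eta> \<bullet> snd z) * (cutoff n s - 4 * cutoff' n s)\<bar> \<le> (norm \<eta> * norm (snd z)) * 13"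
        unfolding abs_mult by (intro mult_mono Cauchy_Schwarz_ineq2) auto
      moreover have "\<bar>(k \<bullet> snd z) * cutoff n s\<bar> \<le> (norm k * norm (snd z)) * 1"
        unfolding abs_mult using cb by (intro mult_mono Cauchy_Schwarz_ineq2) auto
      ultimately have im: "\<bar>im n (snd z)\<bar> \<le> (13 * norm \<eta> + norm k) * norm (snd z)"
        unfolding im_def s_def[symmetric] by (simp add: algebra_simps)
      have "norm (ws n z) \<le> \<bar>re n s\<bar> + \<bar>im n (snd z)\<bar>"
        unfolding ws_def s_def[symmetric] norm_mult
        using norm_triangle_ineq[of "complex_of_real (re n s)" "\<i> * complex_of_real (im n (snd z))"]
        by (simp add: norm_mult)
      also have "\<dots> \<le> ((norm \<eta>)\<^sup>2 + 6 * d + 30) + (13 * norm \<eta> + norm k) * norm (snd z)"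
        by (rule add_mono[OF re im])
      also have "\<dots> \<le> ?K * (1 + norm (snd z))"
      proof -
        have "0 \<le> ((norm \<eta>)\<^sup>2 + 6 * d + 30) * norm (snd z)" "0 \<le> 13 * norm \<eta> + norm k"
          by (auto simp: d_def)
        then show ?thesis by (simp add: algebra_simps)
      qed
      finally show ?thesis .
    qed
    show "(\<lambda>n. ws n z) \<longlonglongrightarrow> (\<i> * complex_of_real ((\<eta> - k) \<bullet> snd z) - complex_of_real ((norm \<eta>)\<^sup>2)) * wave k \<eta> z" for z
    proof -
      have "(\<lambda>n. im n (snd z)) \<longlonglongrightarrow> (\<eta> \<bullet> snd z) * (1 - 4 * 0) - (k \<bullet> snd z) * 1"
        unfolding im_def by (intro tendsto_intros cutoff_tendsto)
      then have im: "(\<lambda>n. im n (snd z)) \<longlonglongrightarrow> (\<eta> - k) \<bullet> snd z" by (simp add: inner_diff_left)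
      have re: "(\<lambda>n. re n ((norm (snd z))\<^sup>2)) \<longlonglongrightarrow> - (norm \<eta>)\<^sup>2"
        unfolding re_def by (rule tendsto_fp_remainder)
      have "(\<lambda>n. ws n z) \<longlonglongrightarrow> (complex_of_real (- (norm \<eta>)\<^sup>2) + \<i> * complex_of_real ((\<eta> - k) \<bullet> snd z)) * wave k \<eta> z"
        unfolding ws_def by (intro tendsto_intros im re)
      then show ?thesis by simp
    qed
  qed
qed

text \<open>The gain term replaces the velocity profile by its Gaussian average. This produces the
  coefficient \<open>gauss_char \<eta>\<close> in front of the wave with velocity frequency
  \<open>0\<close>; loss and transport only multiply the original wave.\<close>

lemma linear_bgk_wave:
  fixes k \<eta> :: "real ^ 'n"
  assumes sol: "kinetic_solution linear_bgk L f0 f" and L: "0 < L" and k: "k \<in> dual_lattice L"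
    and t: "0 \<le> t"
  shows "((\<lambda>s. pairing L (over_M (f s)) (wave k \<eta>)) has_vector_derivative
    pairing L (over_M (f t)) (\<lambda>z. complex_of_real (gauss_char \<eta>) * wave k 0 z
      - (1 + \<i> * complex_of_real (k \<bullet> snd z)) * wave k \<eta> z)) (at t within {0..})"
proof -
  \<comment> \<open>The velocity average of the truncated wave, without its space factor; it tends
    to \<open>gauss_char \<eta>\<close>.\<close>
  define g where "g n = (\<integral>v. cis (- (\<eta> \<bullet> v)) * complex_of_real (cutoff n ((norm v)\<^sup>2)) \<partial>gauss_measure)" for n
  have cm [measurable]: "(\<lambda>v::real^'n. cutoff n ((norm v)\<^sup>2)) \<in> borel_measurable borel" for n
    by (intro borel_measurable_continuous_onI continuous_on_compose2[OF continuous_on_cutoff] continuous_intros) auto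
  have cb: "\<bar>cutoff n ((norm v)\<^sup>2)\<bar> \<le> 1" for n and v :: "real^'n" by (rule cutoff_bounds) simp
  have g_lim: "g \<longlonglongrightarrow> complex_of_real (gauss_char \<eta>)"
  proof -
    have "g \<longlonglongrightarrow> (\<integral>v. cis (- (\<eta> \<bullet> v)) \<partial>gauss_measure)"
      unfolding g_def[abs_def]
    proof (rule integral_dominated_convergence[where w = "\<lambda>_. 1"])
      show "AE v in gauss_measure. (\<lambda>n. cis (- (\<eta> \<bullet> v)) * complex_of_real (cutoff n ((norm v)\<^sup>2))) \<longlonglongrightarrow> cis (- (\<eta> \<bullet> v))"
      proof (rule AE_I2)
        fix v
        have "(\<lambda>n. cis (- (\<eta> \<bullet> v)) * complex_of_real (cutoff n ((norm v)\<^sup>2))) \<longlonglongrightarrow> cis (- (\<eta> \<bullet> v)) * complex_of_real 1"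
          by (intro tendsto_intros cutoff_tendsto)
        then show "(\<lambda>n. cis (- (\<eta> \<bullet> v)) * complex_of_real (cutoff n ((norm v)\<^sup>2))) \<longlonglongrightarrow> cis (- (\<eta> \<bullet> v))" by simp
      qed
    qed (auto simp: norm_mult cb)
    then show ?thesis using integral_gauss_cis[of "- \<eta>"] by simp
  qed
  have g_le: "norm (g n) \<le> 1" for n
  proof -
    let ?h = "\<lambda>v. cis (- (\<eta> \<bullet> v)) * complex_of_real (cutoff n ((norm v)\<^sup>2))"
    have "integrable gauss_measure (\<lambda>v. norm (?h v))"
      by (rule gauss.integrable_const_bound[where B = 1]) (auto simp: norm_mult cb)
    then have "(\<integral>v. norm (?h v) \<partial>gauss_measure) \<le> 1"
      by (rule gauss.integral_le_const) (auto simp: norm_mult cb)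
    then show ?thesis unfolding g_def by (rule order_trans[OF integral_norm_bound])
  qed
  define ws where "ws n z = g n * wave k 0 z
      - (1 + \<i> * complex_of_real (k \<bullet> snd z)) * (wave k \<eta> z * complex_of_real (cutoff n ((norm (snd z))\<^sup>2)))" for n z
  show ?thesis
  proof (rule kinetic_solution_wave[OF sol L k _ _ _ _ t, where ws = ws and B = "2 + norm k"])
    show "ws n \<in> borel_measurable borel" for n
    proof -
      have c: "continuous_on UNIV (\<lambda>z::(real^'n)\<times>(real^'n). cutoff n ((norm (snd z))\<^sup>2))"
        by (rule continuous_on_compose2[OF continuous_on_cutoff]) (auto intro!: continuous_intros)
      show ?thesis
        unfolding ws_def[abs_def] wave_def
        by (intro borel_measurable_continuous_onI continuous_intros c)
    qed
    show "- \<i> * complex_of_real (k \<bullet> v) * test_wave k \<eta> n (x, v) + linear_bgk (\<lambda>w. test_wave k \<eta> n (x, w)) v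
        = complex_of_real (maxwellian v) * ws n (x, v)" for n x v
    proof -
      have "rho (\<lambda>w. test_wave k \<eta> n (x, w)) = (\<integral>w. complex_of_real (maxwellian w) *
          (wave k 0 (x, v) * (cis (- (\<eta> \<bullet> w)) * complex_of_real (cutoff n ((norm w)\<^sup>2)))) \<partial>lborel)"
        unfolding rho_def test_wave_def wave_def
        by (intro Bochner_Integration.integral_cong refl) (simp add: cis_mult algebra_simps)
      also have "\<dots> = (\<integral>w. wave k 0 (x, v) * (cis (- (\<eta> \<bullet> w)) * complex_of_real (cutoff n ((norm w)\<^sup>2))) \<partial>gauss_measure)"
        by (rule integral_gauss[symmetric]) measurable
      also have "\<dots> = wave k 0 (x, v) * g n" by (simp add: g_def)
      finally show ?thesis
        unfolding linear_bgk_def ws_def test_wave_def by (simp add: algebra_simps)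
    qed
    show "norm (ws n z) \<le> (2 + norm k) * (1 + norm (snd z))" for n z
    proof -
      have "norm (1 + \<i> * complex_of_real (k \<bullet> snd z)) \<le> 1 + norm k * norm (snd z)"
        using norm_triangle_ineq[of 1 "\<i> * complex_of_real (k \<bullet> snd z)"] Cauchy_Schwarz_ineq2[of k "snd z"]
        by (simp add: norm_mult)
      then have B: "norm ((1 + \<i> * complex_of_real (k \<bullet> snd z)) * (wave k \<eta> z * complex_of_real (cutoff n ((norm (snd z))\<^sup>2))))
          \<le> (1 + norm k * norm (snd z)) * 1"
        unfolding norm_mult[of "1 + _"] by (intro mult_mono) (auto simp: norm_mult cb)
      have A: "norm (g n * wave k 0 z) \<le> 1" using g_le[of n] by (simp add: norm_mult)
      have C: "norm (ws n z) \<le> norm (g n * wave k 0 z)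
          + norm ((1 + \<i> * complex_of_real (k \<bullet> snd z)) * (wave k \<eta> z * complex_of_real (cutoff n ((norm (snd z))\<^sup>2))))"
        unfolding ws_def by (rule norm_triangle_ineq4)
      have "norm (ws n z) \<le> 1 + (1 + norm k * norm (snd z)) * 1"
        by (rule order_trans[OF C add_mono[OF A B]])
      also have "\<dots> \<le> (2 + norm k) * (1 + norm (snd z))" by (simp add: algebra_simps)
      finally show ?thesis .
    qed
    show "(\<lambda>n. ws n z) \<longlonglongrightarrow> complex_of_real (gauss_char \<eta>) * wave k 0 z
        - (1 + \<i> * complex_of_real (k \<bullet> snd z)) * wave k \<eta> z" for z
    proof -
      have "(\<lambda>n. ws n z) \<longlonglongrightarrow> complex_of_real (gauss_char \<eta>) * wave k 0 z
        - (1 + \<i> * complex_of_real (k \<bullet> snd z)) * (wave k \<eta> z * complex_of_real 1)"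
        unfolding ws_def by (intro tendsto_intros cutoff_tendsto g_lim)
      then show ?thesis by simp
    qed
  qed
qed

section \<open>Difference quotients along moving frequencies\<close>

lemma pairing_tendsto:
  assumes L2: "\<And>n. L2_fun (phase L) (us n)" "L2_fun (phase L) u" "\<And>n. L2_fun (phase L) (ws n)" "L2_fun (phase L) w"
    and u: "(\<lambda>n::nat. L2_norm (phase L) (\<lambda>z. us n z - u z)) \<longlonglongrightarrow> 0"
    and w: "(\<lambda>n::nat. L2_norm (phase L) (\<lambda>z. ws n z - w z)) \<longlonglongrightarrow> 0"
  shows "(\<lambda>n. pairing L (us n) (ws n)) \<longlonglongrightarrow> pairing L u w"
proof -
  let ?N = "L2_norm (phase L)"
  have "(\<lambda>n. pairing L (us n) (ws n) - pairing L u w) \<longlonglongrightarrow> 0"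
  proof (rule Lim_null_comparison)
    have "norm (pairing L (us n) (ws n) - pairing L u w)
        \<le> ?N (\<lambda>z. us n z - u z) * ?N (\<lambda>z. ws n z - w z) + ?N (\<lambda>z. us n z - u z) * ?N w + ?N u * ?N (\<lambda>z. ws n z - w z)" for n
    proof -
      note d1 = L2_fun_diff[OF L2(1)[of n] L2(2)] and d2 = L2_fun_diff[OF L2(3)[of n] L2(4)]
      define A where "A = pairing L (\<lambda>z. us n z - u z) (\<lambda>z. ws n z - w z)"
      define B where "B = pairing L (\<lambda>z. us n z - u z) w"
      define C where "C = pairing L u (\<lambda>z. ws n z - w z)"
      have "A = pairing L (us n) (\<lambda>z. ws n z - w z) - C"
        unfolding A_def C_def by (rule pairing_diff_left[OF L2(1) L2(2) d2])
      moreover have "pairing L (us n) (\<lambda>z. ws n z - w z) = pairing L (us n) (ws n) - pairing L (us n) w"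
        by (rule pairing_diff_right[OF L2(1) L2(3) L2(4)])
      moreover have "B = pairing L (us n) w - pairing L u w"
        unfolding B_def by (rule pairing_diff_left[OF L2(1) L2(2) L2(4)])
      ultimately have "pairing L (us n) (ws n) - pairing L u w = A + B + C" by simp
      also have "norm (A + B + C) \<le> norm A + norm B + norm C"
        by (rule order_trans[OF norm_triangle_ineq add_right_mono[OF norm_triangle_ineq]])
      also have "\<dots> \<le> ?N (\<lambda>z. us n z - u z) * ?N (\<lambda>z. ws n z - w z) + ?N (\<lambda>z. us n z - u z) * ?N w + ?N u * ?N (\<lambda>z. ws n z - w z)"
        unfolding A_def B_def C_def
        by (rule add_mono[OF add_mono[OF pairing_le[OF d1 d2] pairing_le[OF d1 L2(4)]] pairing_le[OF L2(2) d2]])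
      finally show ?thesis .
    qed
    then show "eventually (\<lambda>n. norm (pairing L (us n) (ws n) - pairing L u w)
        \<le> ?N (\<lambda>z. us n z - u z) * ?N (\<lambda>z. ws n z - w z) + ?N (\<lambda>z. us n z - u z) * ?N w + ?N u * ?N (\<lambda>z. ws n z - w z)) sequentially"
      by simp
    have "(\<lambda>n. ?N (\<lambda>z. us n z - u z) * ?N (\<lambda>z. ws n z - w z) + ?N (\<lambda>z. us n z - u z) * ?N w + ?N u * ?N (\<lambda>z. ws n z - w z))
      \<longlonglongrightarrow> 0 * 0 + 0 * ?N w + ?N u * 0"
      by (intro tendsto_intros u w)
    then show "(\<lambda>n. ?N (\<lambda>z. us n z - u z) * ?N (\<lambda>z. ws n z - w z) + ?N (\<lambda>z. us n z - u z) * ?N w + ?N u * ?N (\<lambda>z. ws n z - w z))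
      \<longlonglongrightarrow> 0" by simp
  qed
  then show ?thesis by (simp add: LIM_zero_iff)
qed

lemma norm_cis_diff_le: "norm (cis a - cis b) \<le> \<bar>a - b\<bar>"
proof -
  have "norm (cis a - cis b) \<le> 1 * norm (a - b)"
  proof (rule differentiable_bound[of UNIV])
    show "(cis has_derivative (\<lambda>h. h *\<^sub>R (\<i> * cis x))) (at x within UNIV)" for x
      by (auto intro!: derivative_eq_intros)
    show "onorm (\<lambda>h. h *\<^sub>R (\<i> * cis x)) \<le> 1" for x
      by (rule onorm_le) (simp add: norm_mult)
  qed auto
  then show ?thesis by simp
qed

text \<open>Reducing to sequences makes dominated convergence available for the difference
  quotients.\<close>

lemma has_vector_derivative_sequentiallyI:
  fixes U :: "real \<Rightarrow> 'a :: real_normed_vector"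
  assumes "\<And>X. (\<And>n. X n \<in> S - {t}) \<Longrightarrow> X \<longlonglongrightarrow> t \<Longrightarrow> (\<lambda>n. (1 / (X n - t)) *\<^sub>R (U (X n) - U t)) \<longlonglongrightarrow> d"
  shows "(U has_vector_derivative d) (at t within S)"
proof -
  have "((\<lambda>s. (1 / (s - t)) *\<^sub>R (U s - U t)) \<longlongrightarrow> d) (at t within S)"
    unfolding tendsto_at_iff_sequentially comp_def using assms by blast
  then have lim: "((\<lambda>s. (1 / (s - t)) *\<^sub>R (U s - U t) - d) \<longlongrightarrow> 0) (at t within S)"
    by (rule LIM_zero)
  have "((\<lambda>s. (U s - U t - (s - t) *\<^sub>R d) /\<^sub>R norm (s - t)) \<longlongrightarrow> 0) (at t within S)"
  proof (rule tendsto_norm_zero_cancel, rule Lim_transform_eventually[OF tendsto_norm_zero[OF lim]])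
    show "eventually (\<lambda>s. norm ((1 / (s - t)) *\<^sub>R (U s - U t) - d) = norm ((U s - U t - (s - t) *\<^sub>R d) /\<^sub>R norm (s - t))) (at t within S)"
      unfolding eventually_at_filter
    proof (intro always_eventually allI impI)
      fix s assume "s \<noteq> t"
      then have "(1 / (s - t)) *\<^sub>R (U s - U t) - d = (1 / (s - t)) *\<^sub>R (U s - U t - (s - t) *\<^sub>R d)"
        by (simp add: scaleR_right_diff_distrib)
      then show "norm ((1 / (s - t)) *\<^sub>R (U s - U t) - d) = norm ((U s - U t - (s - t) *\<^sub>R d) /\<^sub>R norm (s - t))"
        by (simp add: divide_inverse)
    qed
  qed
  then show ?thesis
    unfolding has_vector_derivative_def has_derivative_at_within
    by (simp add: bounded_linear_scaleR_left)
qed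

section \<open>Integration along characteristics\<close>

lemma has_vector_derivative_sequentiallyD:
  fixes U :: "real \<Rightarrow> 'a :: real_normed_vector"
  assumes "(U has_vector_derivative d) (at t within S)" "\<And>n. X n \<in> S - {t}" "X \<longlonglongrightarrow> t"
  shows "(\<lambda>n. (1 / (X n - t)) *\<^sub>R (U (X n) - U t)) \<longlonglongrightarrow> d"
proof -
  have "((\<lambda>y. norm ((U y - U t) - (y - t) *\<^sub>R d) / norm (y - t)) \<longlongrightarrow> 0) (at t within S)"
    using assms(1) unfolding has_vector_derivative_def has_derivative_iff_norm by blast
  then have "(\<lambda>n. norm ((U (X n) - U t) - (X n - t) *\<^sub>R d) / norm (X n - t)) \<longlonglongrightarrow> 0"
    using assms(2,3) unfolding tendsto_at_iff_sequentially comp_def by blast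
  moreover have "norm ((U (X n) - U t) - (X n - t) *\<^sub>R d) / norm (X n - t)
      = norm ((1 / (X n - t)) *\<^sub>R (U (X n) - U t) - d)" for n
  proof -
    have "X n \<noteq> t" using assms(2)[of n] by auto
    then have "(1 / (X n - t)) *\<^sub>R (U (X n) - U t) - d = (1 / (X n - t)) *\<^sub>R ((U (X n) - U t) - (X n - t) *\<^sub>R d)"
      by (simp add: scaleR_right_diff_distrib)
    then show ?thesis by simp
  qed
  ultimately have "(\<lambda>n. norm ((1 / (X n - t)) *\<^sub>R (U (X n) - U t) - d)) \<longlonglongrightarrow> 0" by simp
  then show ?thesis by (rule LIM_zero_cancel[OF tendsto_norm_zero_cancel])
qed

text \<open>A product rule. The weak equation differentiates against a fixed wave only, so the
  quotient is split into a part with frozen frequency and a part in which the moving wave is paired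
  with \<open>u (X n)\<close>. The second part converges because both of its factors converge in
  norm.\<close>

lemma pairing_path_derivative:
  fixes p :: "real \<Rightarrow> real ^ 'n"
  assumes u: "L2_curve L u" and L: "0 < L" and t: "0 \<le> t"
    and d: "((\<lambda>s. pairing L (u s) (wave k (p t))) has_vector_derivative D) (at t within {0..})"
    and p: "(p has_vector_derivative p') (at t)"
  shows "((\<lambda>s. pairing L (u s) (wave k (p s))) has_vector_derivative
    D + pairing L (u t) (\<lambda>z. - \<i> * complex_of_real (p' \<bullet> snd z) * wave k (p t) z)) (at t within {0..})"
proof (rule has_vector_derivative_sequentiallyI)
  fix X assume X: "\<And>n::nat. X n \<in> {0..} - {t}" "X \<longlonglongrightarrow> t"
  define q where "q n = (1 / (X n - t)) *\<^sub>R (p (X n) - p t)" for n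
  define w where "w n z = complex_of_real (1 / (X n - t)) * (wave k (p (X n)) z - wave k (p t) z)" for n z
  define w' where "w' z = - \<i> * complex_of_real (p' \<bullet> snd z) * wave k (p t) z" for z
  have ne: "X n \<noteq> t" and nn: "0 \<le> X n" for n using X(1)[of n] by auto
  have q: "q \<longlonglongrightarrow> p'" unfolding q_def
    by (rule has_vector_derivative_sequentiallyD[OF p]) (use ne X(2) in auto)
  obtain B where B: "0 < B" "\<And>n. norm (q n) \<le> B"
    using BseqE[OF convergent_imp_Bseq[OF convergentI[OF q]]] by metis
  have w_lim: "(\<lambda>n. w n z) \<longlonglongrightarrow> w' z" for z
  proof -
    have "((\<lambda>s. wave k (p s) z) has_vector_derivative w' z) (at t)"
      unfolding wave_def w'_def has_vector_derivative_def
      by (auto intro!: derivative_eq_intros p[unfolded has_vector_derivative_def] simp: scaleR_conv_of_real[where 'a = complex])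
    from has_vector_derivative_sequentiallyD[OF this _ X(2)] ne
    show ?thesis by (simp add: w_def scaleR_conv_of_real)
  qed
  \<comment> \<open>A chord of the unit circle is no longer than its arc, so the quotients of waves
    grow at most linearly in \<open>v\<close>, uniformly in \<open>n\<close>.\<close>
  have w_bound: "norm (w n z) \<le> B * (1 + norm (snd z))" for n z
  proof -
    have "norm (w n z) \<le> \<bar>1 / (X n - t)\<bar> * \<bar>(p (X n) - p t) \<bullet> snd z\<bar>"
      unfolding w_def norm_mult norm_of_real wave_def
      by (intro mult_left_mono order_trans[OF norm_cis_diff_le]) (auto simp: inner_diff_left)
    also have "\<dots> = \<bar>q n \<bullet> snd z\<bar>" by (simp add: q_def abs_mult)
    also have "\<dots> \<le> norm (q n) * norm (snd z)" by (rule Cauchy_Schwarz_ineq2)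
    also have "\<dots> \<le> B * (1 + norm (snd z))" using B by (intro mult_mono) auto
    finally show ?thesis .
  qed
  have wm: "w n \<in> borel_measurable (phase L)" for n unfolding w_def[abs_def] by measurable
  have w2: "L2_fun (phase L) (w n)" for n by (rule L2_fun_linear_growth[OF L wm w_bound])
  have wm': "w' \<in> borel_measurable (phase L)" by (rule borel_measurable_LIMSEQ_metric[OF wm w_lim])
  have w_bound': "norm (w' z) \<le> B * (1 + norm (snd z))" for z
    by (rule LIMSEQ_le_const2[OF tendsto_norm[OF w_lim[of z]]]) (use w_bound in auto)
  have w2': "L2_fun (phase L) w'" by (rule L2_fun_linear_growth[OF L wm' w_bound'])
  have W: "L2_fun (phase L) (\<lambda>z :: (real^'n) \<times> (real^'n). complex_of_real (2 * B * (1 + norm (snd z))))"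
    by (rule L2_fun_linear_growth[OF L, where B = "2 * B"])
      (use B in \<open>auto simp: norm_mult abs_mult intro!: measurable_phase borel_measurable_continuous_onI continuous_intros simp del: of_real_add\<close>)
  have "(\<lambda>n. pairing L (u (X n)) (w n)) \<longlonglongrightarrow> pairing L (u t) w'"
  proof (rule pairing_tendsto)
    show "(\<lambda>n. L2_norm (phase L) (\<lambda>z. u (X n) z - u t z)) \<longlonglongrightarrow> 0"
      using u t X unfolding L2_curve_def tendsto_at_iff_sequentially comp_def by blast
    show "(\<lambda>n. L2_norm (phase L) (\<lambda>z. w n z - w' z)) \<longlonglongrightarrow> 0"
    proof (rule L2_norm_tendsto_zero[OF _ W])
      show "(\<lambda>z. w n z - w' z) \<in> borel_measurable (phase L)" for n using wm wm' by simp
      show "norm (w n z - w' z) \<le> norm (complex_of_real (2 * B * (1 + norm (snd z))))" for n z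
        using norm_triangle_ineq4[of "w n z" "w' z"] w_bound[of n z] w_bound'[of z] abs_ge_self[of "2 * B * (1 + norm (snd z))"]
        unfolding norm_of_real by linarith
      show "AE z in phase L. (\<lambda>n. w n z - w' z) \<longlonglongrightarrow> 0"
        using tendsto_diff[OF w_lim tendsto_const, of z "w' z" for z] by simp
    qed
  qed (use L2_curve_L2[OF u] nn t w2 w2' in auto)
  from tendsto_add[OF has_vector_derivative_sequentiallyD[OF d X] this]
  show "(\<lambda>n. (1 / (X n - t)) *\<^sub>R (pairing L (u (X n)) (wave k (p (X n))) - pairing L (u t) (wave k (p t))))
      \<longlonglongrightarrow> D + pairing L (u t) (\<lambda>z. - \<i> * complex_of_real (p' \<bullet> snd z) * wave k (p t) z)"
    unfolding w_def[abs_def] pairing_cmult_right w'_def[abs_def]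
    by (simp add: pairing_diff_right L2_curve_L2[OF u nn] L2_fun_wave[OF L] scaleR_conv_of_real algebra_simps add_divide_distrib[symmetric] diff_divide_distrib[symmetric])
qed

text \<open>The characteristic through \<open>\<eta>\<close> followed back over a time
  \<open>s\<close>. It solves \<open>p' = k - p\<close> and relaxes to \<open>k\<close>; along it
  the term linear in \<open>v\<close> disappears from the equation for the coefficients.\<close>

definition fp_path :: "real ^ 'n \<Rightarrow> real ^ 'n \<Rightarrow> real \<Rightarrow> real ^ 'n" where
  "fp_path k \<eta> s = exp (- s) *\<^sub>R \<eta> + (1 - exp (- s)) *\<^sub>R k"

text \<open>The integral of the squared norm of \<open>fp_path k \<eta>\<close> over
  \<open>[0, s]\<close>, that is, the damping collected along the characteristic, in closed
  form.\<close>

definition fp_rate :: "real ^ 'n \<Rightarrow> real ^ 'n \<Rightarrow> real \<Rightarrow> real" where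
  "fp_rate k \<eta> s = (norm \<eta>)\<^sup>2 * (1 - exp (- (2 * s))) / 2 + (\<eta> \<bullet> k) * (1 - exp (- s))\<^sup>2
     + (norm k)\<^sup>2 * (s - 2 * (1 - exp (- s)) + (1 - exp (- (2 * s))) / 2)"

lemma DERIV_fp_rate: "(fp_rate k \<eta> has_real_derivative (norm (fp_path k \<eta> s))\<^sup>2) (at s)"
proof -
  have "(fp_rate k \<eta> has_real_derivative
      (norm \<eta>)\<^sup>2 * exp (- (2 * s)) + (\<eta> \<bullet> k) * (2 * (1 - exp (- s)) * exp (- s))
      + (norm k)\<^sup>2 * (1 - 2 * exp (- s) + exp (- (2 * s)))) (at s)"
    unfolding fp_rate_def[abs_def]
    by (auto intro!: derivative_eq_intros simp: algebra_simps)
  moreover have "(norm (fp_path k \<eta> s))\<^sup>2 = (norm \<eta>)\<^sup>2 * exp (- (2 * s)) + (\<eta> \<bullet> k) * (2 * (1 - exp (- s)) * exp (- s))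
      + (norm k)\<^sup>2 * (1 - 2 * exp (- s) + exp (- (2 * s)))"
  proof -
    have e2: "exp (- (2 * s)) = exp (- s) * exp (- s)" by (simp add: exp_add[symmetric])
    show ?thesis
      unfolding fp_path_def power2_norm_eq_inner e2
      by (simp add: inner_add_left inner_add_right inner_commute algebra_simps)
  qed
  ultimately show ?thesis by simp
qed

theorem fokker_planck_wave_formula:
  fixes k \<eta> :: "real ^ 'n"
  assumes sol: "kinetic_solution fokker_planck L f0 f" and L: "0 < L" and k: "k \<in> dual_lattice L"
    and T: "0 \<le> T"
  shows "pairing L (over_M (f T)) (wave k \<eta>)
    = complex_of_real (exp (- fp_rate k \<eta> T)) * pairing L (over_M (f 0)) (wave k (fp_path k \<eta> T))"
proof -
  \<comment> \<open>The characteristic is run forwards in time so that it ends in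
    \<open>\<eta>\<close> at \<open>T\<close>; then \<open>p' = p - k\<close>, which cancels the
    first moment in \<open>fokker_planck_wave\<close>.\<close>
  define p where "p \<tau> = fp_path k \<eta> (T - \<tau>)" for \<tau>
  define U where "U \<tau> = pairing L (over_M (f \<tau>)) (wave k (p \<tau>))" for \<tau>
  note curve = kinetic_solution_curve[OF sol]
  have dp: "(p has_vector_derivative (p \<tau> - k)) (at \<tau>)" for \<tau>
    unfolding p_def[abs_def] fp_path_def has_vector_derivative_def
    by (auto intro!: derivative_eq_intros simp: algebra_simps)
  have dU: "(U has_vector_derivative - complex_of_real ((norm (p \<tau>))\<^sup>2) * U \<tau>) (at \<tau> within {0..})" if \<tau>: "0 \<le> \<tau>" for \<tau>
  proof -
    have lin: "L2_fun (phase L) (\<lambda>z. \<i> * complex_of_real (a \<bullet> snd z) * wave k (p \<tau>) z)" for a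
    proof (rule L2_fun_linear_growth[OF L])
      have "(\<lambda>z :: (real^'n) \<times> (real^'n). a \<bullet> snd z) \<in> borel_measurable (phase L)"
        by (intro measurable_phase borel_measurable_continuous_onI continuous_intros)
      then show "(\<lambda>z. \<i> * complex_of_real (a \<bullet> snd z) * wave k (p \<tau>) z) \<in> borel_measurable (phase L)"
        by measurable
      show "norm (\<i> * complex_of_real (a \<bullet> snd z) * wave k (p \<tau>) z) \<le> norm a * (1 + norm (snd z))" for z
        using Cauchy_Schwarz_ineq2[of a "snd z"] by (simp add: norm_mult distrib_left add_increasing)
    qed
    let ?a = "p \<tau> - k"
    have "pairing L (over_M (f \<tau>)) (\<lambda>z. (\<i> * complex_of_real (?a \<bullet> snd z) - complex_of_real ((norm (p \<tau>))\<^sup>2)) * wave k (p \<tau>) z)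
        + pairing L (over_M (f \<tau>)) (\<lambda>z. - \<i> * complex_of_real (?a \<bullet> snd z) * wave k (p \<tau>) z)
      = - complex_of_real ((norm (p \<tau>))\<^sup>2) * U \<tau>"
    proof -
      have 1: "(\<lambda>z. - \<i> * complex_of_real (?a \<bullet> snd z) * wave k (p \<tau>) z)
          = (\<lambda>z. (- 1) * (\<i> * complex_of_real (?a \<bullet> snd z) * wave k (p \<tau>) z))" by simp
      show ?thesis
        unfolding left_diff_distrib 1 pairing_cmult_right
        using pairing_diff_right[OF L2_curve_L2[OF curve \<tau>] lin[of ?a] L2_fun_cmult[OF L2_fun_wave[OF L]]]
        by (simp add: pairing_cmult_right U_def)
    qed
    then show ?thesis
      using pairing_path_derivative[OF curve L \<tau> fokker_planck_wave[OF sol L k \<tau>] dp]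
      unfolding U_def[abs_def] by simp
  qed
  \<comment> \<open>The integrating factor for the remaining damping; \<open>V\<close> turns out to
    be constant on \<open>[0, T]\<close>.\<close>
  define V where "V \<tau> = complex_of_real (exp (- fp_rate k \<eta> (T - \<tau>))) * U \<tau>" for \<tau>
  have dV: "(V has_vector_derivative 0) (at \<tau> within {0..T})" if \<tau>: "\<tau> \<in> {0..T}" for \<tau>
  proof -
    have "((\<lambda>\<tau>. fp_rate k \<eta> (T - \<tau>)) has_real_derivative (norm (p \<tau>))\<^sup>2 * (- 1)) (at \<tau>)"
      unfolding p_def by (rule DERIV_chain2[OF DERIV_fp_rate]) (auto intro!: derivative_eq_intros)
    from has_field_derivative_at_within[OF DERIV_chain2[OF DERIV_exp DERIV_minus[OF this]], of "{0..T}"]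
    have "((\<lambda>\<tau>. exp (- fp_rate k \<eta> (T - \<tau>))) has_real_derivative
        exp (- fp_rate k \<eta> (T - \<tau>)) * (norm (p \<tau>))\<^sup>2) (at \<tau> within {0..T})"
      by simp
    then have e: "((\<lambda>\<tau>. complex_of_real (exp (- fp_rate k \<eta> (T - \<tau>)))) has_vector_derivative
        complex_of_real (exp (- fp_rate k \<eta> (T - \<tau>)) * (norm (p \<tau>))\<^sup>2)) (at \<tau> within {0..T})"
      by (intro has_vector_derivative_of_real) (simp add: has_real_derivative_iff_has_vector_derivative)
    have "(U has_vector_derivative - complex_of_real ((norm (p \<tau>))\<^sup>2) * U \<tau>) (at \<tau> within {0..T})"
      using \<tau> by (intro has_vector_derivative_within_subset[OF dU]) auto
    from has_vector_derivative_mult[OF e this]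
    show ?thesis unfolding V_def[abs_def] by (simp add: algebra_simps)
  qed
  have "V T = V 0"
  proof -
    obtain c where "\<And>\<tau>. \<tau> \<in> {0..T} \<Longrightarrow> V \<tau> = c"
      by (rule has_vector_derivative_zero_constant[of "{0..T}" V, OF _ dV]) auto
    then show ?thesis using T by simp
  qed
  moreover have "V T = pairing L (over_M (f T)) (wave k \<eta>)"
    by (simp add: V_def U_def p_def fp_path_def fp_rate_def)
  moreover have "V 0 = complex_of_real (exp (- fp_rate k \<eta> T)) * pairing L (over_M (f 0)) (wave k (fp_path k \<eta> T))"
    by (simp add: V_def U_def p_def)
  ultimately show ?thesis by simp
qed

text \<open>Duhamel's formula. Free transport moves the frequency along a line in direction
  \<open>k\<close>, and \<open>exp s\<close> compensates the loss term. The gain term stays as a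
  source, which involves the solution only through its density, the coefficient at velocity
  frequency \<open>0\<close>.\<close>

theorem linear_bgk_wave_formula:
  fixes k \<eta> :: "real ^ 'n"
  assumes sol: "kinetic_solution linear_bgk L f0 f" and L: "0 < L" and k: "k \<in> dual_lattice L"
    and T: "0 \<le> T"
  shows "((\<lambda>s. complex_of_real (exp s * gauss_char (\<eta> + (T - s) *\<^sub>R k)) * pairing L (over_M (f s)) (wave k 0))
    has_integral complex_of_real (exp T) * pairing L (over_M (f T)) (wave k \<eta>)
      - pairing L (over_M (f 0)) (wave k (\<eta> + T *\<^sub>R k))) {0..T}"
proof -
  define p where "p \<tau> = \<eta> + (T - \<tau>) *\<^sub>R k" for \<tau>
  define U where "U \<tau> = pairing L (over_M (f \<tau>)) (wave k (p \<tau>))" for \<tau>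
  note curve = kinetic_solution_curve[OF sol]
  have dp: "(p has_vector_derivative - k) (at \<tau>)" for \<tau>
    unfolding p_def[abs_def] has_vector_derivative_def
    by (auto intro!: derivative_eq_intros simp: algebra_simps)
  have dU: "(U has_vector_derivative complex_of_real (gauss_char (p \<tau>)) * pairing L (over_M (f \<tau>)) (wave k 0) - U \<tau>)
      (at \<tau> within {0..})" if \<tau>: "0 \<le> \<tau>" for \<tau>
  proof -
    have lin: "L2_fun (phase L) (\<lambda>z. \<i> * complex_of_real (k \<bullet> snd z) * wave k (p \<tau>) z)"
    proof (rule L2_fun_linear_growth[OF L])
      have "(\<lambda>z :: (real^'n) \<times> (real^'n). k \<bullet> snd z) \<in> borel_measurable (phase L)"
        by (intro measurable_phase borel_measurable_continuous_onI continuous_intros)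
      then show "(\<lambda>z. \<i> * complex_of_real (k \<bullet> snd z) * wave k (p \<tau>) z) \<in> borel_measurable (phase L)"
        by measurable
      show "norm (\<i> * complex_of_real (k \<bullet> snd z) * wave k (p \<tau>) z) \<le> norm k * (1 + norm (snd z))" for z
        using Cauchy_Schwarz_ineq2[of k "snd z"] by (simp add: norm_mult distrib_left add_increasing)
    qed
    have gen: "(\<lambda>z. complex_of_real (gauss_char (p \<tau>)) * wave k 0 z - (1 + \<i> * complex_of_real (k \<bullet> snd z)) * wave k (p \<tau>) z)
        = (\<lambda>z. (complex_of_real (gauss_char (p \<tau>)) * wave k 0 z - wave k (p \<tau>) z) - \<i> * complex_of_real (k \<bullet> snd z) * wave k (p \<tau>) z)"
      by (simp add: algebra_simps)
    have tr: "(\<lambda>z. - \<i> * complex_of_real (- k \<bullet> snd z) * wave k (p \<tau>) z) = (\<lambda>z. \<i> * complex_of_real (k \<bullet> snd z) * wave k (p \<tau>) z)"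
      by simp
    have "pairing L (over_M (f \<tau>)) (\<lambda>z. complex_of_real (gauss_char (p \<tau>)) * wave k 0 z
          - (1 + \<i> * complex_of_real (k \<bullet> snd z)) * wave k (p \<tau>) z)
        + pairing L (over_M (f \<tau>)) (\<lambda>z. - \<i> * complex_of_real (- k \<bullet> snd z) * wave k (p \<tau>) z)
      = complex_of_real (gauss_char (p \<tau>)) * pairing L (over_M (f \<tau>)) (wave k 0) - U \<tau>"
      unfolding gen tr
      by (simp add: pairing_diff_right pairing_cmult_right L2_curve_L2[OF curve \<tau>] lin L2_fun_diff L2_fun_cmult L2_fun_wave[OF L] U_def)
    then show ?thesis
      using pairing_path_derivative[OF curve L \<tau> linear_bgk_wave[OF sol L k \<tau>] dp]
      unfolding U_def[abs_def] by simp
  qed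
  have "((\<lambda>\<tau>. complex_of_real (exp \<tau>) * U \<tau>) has_vector_derivative
      complex_of_real (exp \<tau> * gauss_char (p \<tau>)) * pairing L (over_M (f \<tau>)) (wave k 0)) (at \<tau> within {0..T})"
    if \<tau>: "\<tau> \<in> {0..T}" for \<tau>
  proof -
    have "(exp has_real_derivative exp \<tau>) (at \<tau> within {0..T})"
      by (auto intro!: derivative_eq_intros)
    then have e: "((\<lambda>\<tau>. complex_of_real (exp \<tau>)) has_vector_derivative complex_of_real (exp \<tau>)) (at \<tau> within {0..T})"
      by (intro has_vector_derivative_of_real) (simp add: has_real_derivative_iff_has_vector_derivative)
    have "(U has_vector_derivative complex_of_real (gauss_char (p \<tau>)) * pairing L (over_M (f \<tau>)) (wave k 0) - U \<tau>) (at \<tau> within {0..T})"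
      using \<tau> by (intro has_vector_derivative_within_subset[OF dU]) auto
    from has_vector_derivative_mult[OF e this]
    show ?thesis by (simp add: algebra_simps)
  qed
  from fundamental_theorem_of_calculus[OF T this]
  show ?thesis by (simp add: U_def p_def)
qed

section \<open>Estimates for a single Fokker--Planck mode\<close>

lemma gauss_integrable_bounded:
  fixes f :: "real ^ 'n \<Rightarrow> complex"
  assumes "f \<in> borel_measurable borel" "\<And>v. norm (f v) \<le> B"
  shows "integrable gauss_measure f"
  using assms by (intro gauss.integrable_const_bound[where B = B]) auto

lemma integral_gauss_cis': "(\<integral>v. cis (- (\<eta> \<bullet> v)) \<partial>gauss_measure) = complex_of_real (gauss_char \<eta>)"
  using integral_gauss_cis[of "- \<eta>"] by simp

lemma integrable_gauss_cis: "integrable gauss_measure (\<lambda>v. cis (- (\<eta> \<bullet> v)))"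
  by (rule gauss_integrable_bounded[where B = 1]) auto

lemma L2_gauss_sum: "finite J \<Longrightarrow> L2_fun gauss_measure (\<lambda>v. \<Sum>j\<in>J. a j * cis (- (b j \<bullet> v)))"
  by (intro L2_fun_sum L2_fun_cmult gauss.L2_fun_bounded[where B = 1]) auto

text \<open>Only differences of the frequencies \<open>b j\<close> occur on the right, so a shift
  common to all of them leaves the norm unchanged; both evolutions exploit this.\<close>

lemma gauss_normsq_sum:
  fixes b :: "'j \<Rightarrow> real ^ 'n"
  assumes J: "finite J"
  shows "complex_of_real (L2_normsq gauss_measure (\<lambda>v. \<Sum>j\<in>J. a j * cis (- (b j \<bullet> v))))
    = (\<Sum>j\<in>J. \<Sum>l\<in>J. a j * cnj (a l) * complex_of_real (gauss_char (b j - b l)))"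
proof -
  have "complex_of_real (L2_normsq gauss_measure (\<lambda>v. \<Sum>j\<in>J. a j * cis (- (b j \<bullet> v))))
    = (\<integral>v. (\<Sum>j\<in>J. \<Sum>l\<in>J. a j * cnj (a l) * cis (- ((b j - b l) \<bullet> v))) \<partial>gauss_measure)"
    unfolding L2_normsq_eq_integral
  proof (intro Bochner_Integration.integral_cong refl)
    fix v
    have "(\<Sum>j\<in>J. a j * cis (- (b j \<bullet> v))) * cnj (\<Sum>j\<in>J. a j * cis (- (b j \<bullet> v)))
      = (\<Sum>j\<in>J. \<Sum>l\<in>J. (a j * cis (- (b j \<bullet> v))) * cnj (a l * cis (- (b l \<bullet> v))))"
      by (simp add: sum_product)
    also have "\<dots> = (\<Sum>j\<in>J. \<Sum>l\<in>J. a j * cnj (a l) * cis (- ((b j - b l) \<bullet> v)))"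
    proof (intro sum.cong refl)
      fix j l
      have "cis (- (b j \<bullet> v)) * cnj (cis (- (b l \<bullet> v))) = cis (- ((b j - b l) \<bullet> v))"
        by (simp add: cis_cnj cis_mult inner_diff_left)
      then show "(a j * cis (- (b j \<bullet> v))) * cnj (a l * cis (- (b l \<bullet> v))) = a j * cnj (a l) * cis (- ((b j - b l) \<bullet> v))"
        by (simp add: mult_ac)
    qed
    finally show "(\<Sum>j\<in>J. a j * cis (- (b j \<bullet> v))) * cnj (\<Sum>j\<in>J. a j * cis (- (b j \<bullet> v)))
      = (\<Sum>j\<in>J. \<Sum>l\<in>J. a j * cnj (a l) * cis (- ((b j - b l) \<bullet> v)))" .
  qed
  also have "\<dots> = (\<Sum>j\<in>J. \<Sum>l\<in>J. a j * cnj (a l) * complex_of_real (gauss_char (b j - b l)))"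
    by (simp add: integrable_gauss_cis integral_gauss_cis' del: minus_diff_eq inner_diff_left)
  finally show ?thesis .
qed

lemma gauss_char_eq: "gauss_char \<eta> = exp (- (\<eta> \<bullet> \<eta>) / 2)"
  by (simp add: gauss_char_def power2_norm_eq_inner)

text \<open>The pointwise step of the mode estimate: \<open>\<eta> \<mapsto> exp (- (q / 2 * |\<eta>|\<^sup>2 + a * (\<eta> \<bullet> k)))\<close> is, up to the factor
  \<open>exp (|b|\<^sup>2 / 2)\<close>, the Gaussian Fourier transform of a unimodular function, so that Cauchy--Schwarz applies.\<close>

lemma gauss_rank_one_bound:
  fixes k :: "real ^ 'n"
  assumes H: "finite H" and q: "0 \<le> q" and b: "sqrt q *\<^sub>R b = a *\<^sub>R k"
  shows "(norm (\<Sum>\<eta>\<in>H. d \<eta> * complex_of_real (exp (- (q * (norm \<eta>)\<^sup>2 / 2 + a * (\<eta> \<bullet> k))))))\<^sup>2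
    \<le> exp ((norm b)\<^sup>2) * L2_normsq gauss_measure (\<lambda>v. \<Sum>\<eta>\<in>H. d \<eta> * cis (- ((sqrt q *\<^sub>R \<eta>) \<bullet> v)))"
proof -
  let ?p = "\<lambda>v. \<Sum>\<eta>\<in>H. d \<eta> * cis (- ((sqrt q *\<^sub>R \<eta>) \<bullet> v))"
  let ?h = "\<lambda>v. complex_of_real (exp ((norm b)\<^sup>2 / 2)) * cis (- (b \<bullet> v))"
  have "(\<integral>v. ?p v * ?h v \<partial>gauss_measure)
    = (\<integral>v. (\<Sum>\<eta>\<in>H. d \<eta> * complex_of_real (exp ((norm b)\<^sup>2 / 2)) * cis (- ((sqrt q *\<^sub>R \<eta> + b) \<bullet> v))) \<partial>gauss_measure)"
  proof (intro Bochner_Integration.integral_cong refl)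
    fix v
    have "cis (- ((sqrt q *\<^sub>R \<eta>) \<bullet> v)) * cis (- (b \<bullet> v)) = cis (- ((sqrt q *\<^sub>R \<eta> + b) \<bullet> v))" for \<eta>
      by (simp add: cis_mult inner_add_left)
    then show "?p v * ?h v = (\<Sum>\<eta>\<in>H. d \<eta> * complex_of_real (exp ((norm b)\<^sup>2 / 2)) * cis (- ((sqrt q *\<^sub>R \<eta> + b) \<bullet> v)))"
      unfolding sum_distrib_right by (intro sum.cong refl) (simp add: mult_ac)
  qed
  also have "\<dots> = (\<Sum>\<eta>\<in>H. d \<eta> * complex_of_real (exp ((norm b)\<^sup>2 / 2)) * complex_of_real (gauss_char (sqrt q *\<^sub>R \<eta> + b)))"
    by (simp add: integrable_gauss_cis integral_gauss_cis' del: inner_add_left of_real_exp)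
  also have "\<dots> = (\<Sum>\<eta>\<in>H. d \<eta> * complex_of_real (exp (- (q * (norm \<eta>)\<^sup>2 / 2 + a * (\<eta> \<bullet> k)))))"
  proof (intro sum.cong refl)
    fix \<eta>
    have "(sqrt q *\<^sub>R \<eta>) \<bullet> b = \<eta> \<bullet> (sqrt q *\<^sub>R b)" by simp
    also have "\<dots> = a * (\<eta> \<bullet> k)" unfolding b by simp
    finally have ip: "(sqrt q *\<^sub>R \<eta>) \<bullet> b = a * (\<eta> \<bullet> k)" .
    have "(sqrt q *\<^sub>R \<eta> + b) \<bullet> (sqrt q *\<^sub>R \<eta> + b) = q * (norm \<eta>)\<^sup>2 + 2 * (a * (\<eta> \<bullet> k)) + (norm b)\<^sup>2"
    proof -
      have "(sqrt q *\<^sub>R \<eta> + b) \<bullet> (sqrt q *\<^sub>R \<eta> + b)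
        = (sqrt q *\<^sub>R \<eta>) \<bullet> (sqrt q *\<^sub>R \<eta>) + 2 * ((sqrt q *\<^sub>R \<eta>) \<bullet> b) + b \<bullet> b"
        by (simp add: inner_add_left inner_add_right inner_commute)
      also have "(sqrt q *\<^sub>R \<eta>) \<bullet> (sqrt q *\<^sub>R \<eta>) = q * (norm \<eta>)\<^sup>2"
        using q by (simp add: power2_norm_eq_inner mult.assoc[symmetric])
      finally show ?thesis unfolding ip by (simp add: power2_norm_eq_inner)
    qed
    then have "exp ((norm b)\<^sup>2 / 2) * gauss_char (sqrt q *\<^sub>R \<eta> + b) = exp (- (q * (norm \<eta>)\<^sup>2 / 2 + a * (\<eta> \<bullet> k)))"
      unfolding gauss_char_eq exp_add[symmetric] by (simp add: field_simps)
    then show "d \<eta> * complex_of_real (exp ((norm b)\<^sup>2 / 2)) * complex_of_real (gauss_char (sqrt q *\<^sub>R \<eta> + b))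
      = d \<eta> * complex_of_real (exp (- (q * (norm \<eta>)\<^sup>2 / 2 + a * (\<eta> \<bullet> k))))"
      by (metis mult.assoc of_real_mult)
  qed
  finally have eq: "(\<Sum>\<eta>\<in>H. d \<eta> * complex_of_real (exp (- (q * (norm \<eta>)\<^sup>2 / 2 + a * (\<eta> \<bullet> k))))) = (\<integral>v. ?p v * ?h v \<partial>gauss_measure)"
    by simp
  have h2: "L2_fun gauss_measure ?h" by (intro L2_fun_cmult gauss.L2_fun_bounded[where B = 1]) auto
  have "L2_norm gauss_measure ?h = exp ((norm b)\<^sup>2 / 2) * L2_norm gauss_measure (\<lambda>v. cis (- (b \<bullet> v)))"
    unfolding L2_norm_cmult by simp
  also have "L2_norm gauss_measure (\<lambda>v. cis (- (b \<bullet> v))) = 1"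
    using gauss.prob_space by (simp add: L2_norm_def L2_normsq_def)
  finally have hn: "L2_norm gauss_measure ?h = exp ((norm b)\<^sup>2 / 2)" by simp
  have "norm (\<integral>v. ?p v * ?h v \<partial>gauss_measure) \<le> L2_norm gauss_measure ?p * exp ((norm b)\<^sup>2 / 2)"
    using L2_Cauchy_Schwarz[OF L2_gauss_sum[OF H, of d "\<lambda>\<eta>. sqrt q *\<^sub>R \<eta>"] h2] unfolding hn .
  then have "(norm (\<integral>v. ?p v * ?h v \<partial>gauss_measure))\<^sup>2 \<le> (L2_norm gauss_measure ?p * exp ((norm b)\<^sup>2 / 2))\<^sup>2"
    by (intro power_mono) auto
  also have "\<dots> = exp ((norm b)\<^sup>2) * L2_normsq gauss_measure ?p"
    by (simp add: power_mult_distrib L2_norm_power2 exp_double[symmetric])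
  finally show ?thesis unfolding eq .
qed

lemma gauss_char_scale_split:
  "gauss_char \<eta> = gauss_char (y *\<^sub>R \<eta>) * gauss_char (sqrt (1 - y\<^sup>2) *\<^sub>R \<eta>)" if "y\<^sup>2 \<le> 1"
proof -
  have "(y *\<^sub>R \<eta>) \<bullet> (y *\<^sub>R \<eta>) + (sqrt (1 - y\<^sup>2) *\<^sub>R \<eta>) \<bullet> (sqrt (1 - y\<^sup>2) *\<^sub>R \<eta>) = \<eta> \<bullet> \<eta>"
    using that by (simp add: mult.assoc[symmetric] power2_eq_square[symmetric] left_diff_distrib)
  then show ?thesis unfolding gauss_char_eq exp_add[symmetric] by (simp add: field_simps)
qed

text \<open>The Gaussian kernel splits into one of scale \<open>y\<close> and one of scale
  \<open>sqrt (1 - y\<^sup>2)\<close>. For a fixed point \<open>w\<close> the transported sum is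
  bounded through the kernel of the second scale, and integrating over \<open>w\<close> restores the
  first. For \<open>y = exp (- T)\<close>, \<open>q\<close> and \<open>a\<close> are the
  coefficients of the damping exponent that depend on \<open>\<eta>\<close>; completing the square
  costs \<open>a\<^sup>2 / q\<close> times the squared norm of \<open>k\<close>.\<close>

lemma gauss_mode_bound:
  fixes k :: "real ^ 'n"
  assumes H: "finite H" and y: "0 < y" "y \<le> 1"
  defines "a \<equiv> (1 - y)\<^sup>2" and "q \<equiv> 1 - y\<^sup>2"
  shows "L2_normsq gauss_measure (\<lambda>v. \<Sum>\<eta>\<in>H. c \<eta> * complex_of_real (exp (- (q * (norm \<eta>)\<^sup>2 / 2 + a * (\<eta> \<bullet> k))))
        * cis (- ((y *\<^sub>R \<eta>) \<bullet> v)))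
    \<le> exp ((1 - y)^3 / (1 + y) * (norm k)\<^sup>2) * L2_normsq gauss_measure (\<lambda>v. \<Sum>\<eta>\<in>H. c \<eta> * cis (- (\<eta> \<bullet> v)))"
    (is "L2_normsq _ ?P \<le> ?C * L2_normsq _ ?R")
proof -
  have y2: "y\<^sup>2 \<le> 1" using y by (simp add: power_le_one)
  then have q: "0 \<le> q" by (simp add: q_def)
  define b where "b = (a / sqrt q) *\<^sub>R k"
  \<comment> \<open>At \<open>y = 1\<close> both \<open>a\<close> and \<open>q\<close> vanish and
    \<open>a / sqrt q\<close> takes the default value \<open>0\<close>, so \<open>b\<close> still
    satisfies the relation required of it.\<close>
  have q0: "a = 0" if "q = 0"
  proof -
    have "y\<^sup>2 = 1" using that by (simp add: q_def)
    then have "y = 1" using y by (simp add: power2_eq_1_iff)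
    then show ?thesis by (simp add: a_def)
  qed
  have b: "sqrt q *\<^sub>R b = a *\<^sub>R k" using q0 by (cases "q = 0") (auto simp: b_def)
  have nb: "(norm b)\<^sup>2 = (1 - y)^3 / (1 + y) * (norm k)\<^sup>2"
  proof (cases "q = 0")
    case True
    then have "y = 1" using q0 by (simp add: a_def)
    then show ?thesis using True by (simp add: b_def)
  next
    case False
    have "(norm b)\<^sup>2 = a\<^sup>2 / q * (norm k)\<^sup>2" using q by (simp add: b_def power_mult_distrib power_divide)
    also have "a\<^sup>2 / q = (1 - y)^3 / (1 + y)"
    proof -
      have "1 - y \<noteq> 0" "q = (1 - y) * (1 + y)" using False by (auto simp: q_def algebra_simps power2_eq_square)
      moreover have "a\<^sup>2 = (1 - y) * (1 - y)^3" by (simp add: a_def power_mult[symmetric] power_Suc[symmetric])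
      ultimately show ?thesis by simp
    qed
    finally show ?thesis .
  qed
  define e where "e \<eta> = exp (- (q * (norm \<eta>)\<^sup>2 / 2 + a * (\<eta> \<bullet> k)))" for \<eta>
  \<comment> \<open>\<open>D w\<close> is a sum at the second scale whose coefficients contain the
    phases of the first scale, evaluated at \<open>w\<close>.\<close>
  define D where "D w v = (\<Sum>\<eta>\<in>H. (c \<eta> * cis (- ((y *\<^sub>R \<eta>) \<bullet> w))) * cis (- ((sqrt q *\<^sub>R \<eta>) \<bullet> v)))" for w v
  have point: "(norm (?P w))\<^sup>2 \<le> ?C * L2_normsq gauss_measure (D w)" for w
  proof -
    have "?P w = (\<Sum>\<eta>\<in>H. (c \<eta> * cis (- ((y *\<^sub>R \<eta>) \<bullet> w))) * complex_of_real (e \<eta>))"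
      by (intro sum.cong refl) (simp add: e_def mult_ac)
    then show ?thesis
      using gauss_rank_one_bound[OF H q b, of "\<lambda>\<eta>. c \<eta> * cis (- ((y *\<^sub>R \<eta>) \<bullet> w))"]
      unfolding nb e_def D_def by simp
  qed
  have Dw: "complex_of_real (L2_normsq gauss_measure (D w))
      = (\<Sum>\<eta>\<in>H. \<Sum>\<eta>'\<in>H. c \<eta> * cnj (c \<eta>') * complex_of_real (gauss_char (sqrt q *\<^sub>R (\<eta> - \<eta>'))) * cis (- ((y *\<^sub>R (\<eta> - \<eta>')) \<bullet> w)))" for w
  proof -
    have "cis (- ((y *\<^sub>R \<eta>) \<bullet> w)) * cnj (cis (- ((y *\<^sub>R \<eta>') \<bullet> w))) = cis (- ((y *\<^sub>R (\<eta> - \<eta>')) \<bullet> w))" for \<eta> \<eta>'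
      by (simp add: cis_cnj cis_mult inner_diff_left right_diff_distrib)
    then show ?thesis
      unfolding D_def gauss_normsq_sum[OF H]
      by (intro sum.cong refl) (simp add: scaleR_right_diff_distrib mult_ac)
  qed
  have Dint: "integrable gauss_measure (\<lambda>w. complex_of_real (L2_normsq gauss_measure (D w)))"
    unfolding Dw by (intro Bochner_Integration.integrable_sum integrable_mult_right integrable_gauss_cis)
  have "(\<integral>w. complex_of_real (L2_normsq gauss_measure (D w)) \<partial>gauss_measure)
      = (\<Sum>\<eta>\<in>H. \<Sum>\<eta>'\<in>H. c \<eta> * cnj (c \<eta>') * complex_of_real (gauss_char (sqrt q *\<^sub>R (\<eta> - \<eta>'))) * complex_of_real (gauss_char (y *\<^sub>R (\<eta> - \<eta>'))))"
    unfolding Dw by (simp add: integrable_gauss_cis integral_gauss_cis' del: inner_scaleR_left)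
  also have "\<dots> = complex_of_real (L2_normsq gauss_measure ?R)"
    unfolding gauss_normsq_sum[OF H]
    by (intro sum.cong refl) (simp add: gauss_char_scale_split[OF y2, of "_ - _"] q_def[symmetric] mult_ac)
  finally have "(\<integral>w. L2_normsq gauss_measure (D w) \<partial>gauss_measure) = L2_normsq gauss_measure ?R"
    unfolding integral_complex_of_real of_real_eq_iff .
  moreover have "L2_normsq gauss_measure ?P \<le> (\<integral>w. ?C * L2_normsq gauss_measure (D w) \<partial>gauss_measure)"
    unfolding L2_normsq_def[of gauss_measure ?P]
  proof (rule integral_mono)
    have "L2_fun gauss_measure ?P"
      by (rule L2_gauss_sum[OF H, of "\<lambda>\<eta>. c \<eta> * complex_of_real (exp (- (q * (norm \<eta>)\<^sup>2 / 2 + a * (\<eta> \<bullet> k))))" "\<lambda>\<eta>. y *\<^sub>R \<eta>"])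
    then show "integrable gauss_measure (\<lambda>w. (norm (?P w))\<^sup>2)" by (simp add: L2_fun_def)
    show "integrable gauss_measure (\<lambda>w. ?C * L2_normsq gauss_measure (D w))"
      using Dint unfolding complex_of_real_integrable_eq by (rule integrable_mult_right)
  qed (rule point)
  ultimately show ?thesis by simp
qed


section \<open>The spatially constant mode\<close>

lemma gauss_exp_kernel_nonneg:
  fixes H :: "(real ^ 'n) set" and d :: "real ^ 'n \<Rightarrow> complex"
  assumes H: "finite H" and s: "0 \<le> s"
  shows "0 \<le> (\<Sum>\<eta>\<in>H. \<Sum>\<eta>'\<in>H. Re (d \<eta> * cnj (d \<eta>')) * exp (s * (\<eta> \<bullet> \<eta>')))"
proof -
  \<comment> \<open>Moving \<open>exp (s * (\<eta> \<bullet> \<eta>) / 2)\<close> into the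
    coefficients turns the exponential kernel into the Gram kernel of waves with frequencies
    \<open>sqrt s *\<^sub>R \<eta>\<close>, so the form is a squared norm.\<close>
  define a where "a \<eta> = d \<eta> * complex_of_real (exp (s * (\<eta> \<bullet> \<eta>) / 2))" for \<eta>
  have e: "exp (s * (\<eta> \<bullet> \<eta>) / 2) * exp (s * (\<eta>' \<bullet> \<eta>') / 2) * gauss_char (sqrt s *\<^sub>R \<eta> - sqrt s *\<^sub>R \<eta>')
      = exp (s * (\<eta> \<bullet> \<eta>'))" for \<eta> \<eta>' :: "real ^ 'n"
  proof -
    have "(sqrt s *\<^sub>R \<eta> - sqrt s *\<^sub>R \<eta>') \<bullet> (sqrt s *\<^sub>R \<eta> - sqrt s *\<^sub>R \<eta>') = s * (\<eta> \<bullet> \<eta>) - 2 * (s * (\<eta> \<bullet> \<eta>')) + s * (\<eta>' \<bullet> \<eta>')"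
      using s by (simp add: inner_diff_left inner_diff_right inner_commute mult.assoc[symmetric])
    then show ?thesis unfolding gauss_char_eq exp_add[symmetric] by (simp add: field_simps)
  qed
  have "a \<eta> * cnj (a \<eta>') * complex_of_real (gauss_char (sqrt s *\<^sub>R \<eta> - sqrt s *\<^sub>R \<eta>'))
      = d \<eta> * cnj (d \<eta>') * complex_of_real (exp (s * (\<eta> \<bullet> \<eta>')))" for \<eta> \<eta>' :: "real ^ 'n"
  proof -
    have "a \<eta> * cnj (a \<eta>') * complex_of_real g = d \<eta> * cnj (d \<eta>') *
        complex_of_real (exp (s * (\<eta> \<bullet> \<eta>) / 2) * exp (s * (\<eta>' \<bullet> \<eta>') / 2) * g)" for g
      unfolding a_def complex_cnj_mult complex_cnj_complex_of_real of_real_mult by (simp only: mult_ac)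
    from this[of "gauss_char (sqrt s *\<^sub>R \<eta> - sqrt s *\<^sub>R \<eta>')"] show ?thesis unfolding e .
  qed
  then have "complex_of_real (L2_normsq gauss_measure (\<lambda>v. \<Sum>\<eta>\<in>H. a \<eta> * cis (- ((sqrt s *\<^sub>R \<eta>) \<bullet> v))))
      = (\<Sum>\<eta>\<in>H. \<Sum>\<eta>'\<in>H. d \<eta> * cnj (d \<eta>') * complex_of_real (exp (s * (\<eta> \<bullet> \<eta>'))))"
    unfolding gauss_normsq_sum[OF H] by simp
  from arg_cong[OF this, of Re] have "L2_normsq gauss_measure (\<lambda>v. \<Sum>\<eta>\<in>H. a \<eta> * cis (- ((sqrt s *\<^sub>R \<eta>) \<bullet> v)))
      = Re (\<Sum>\<eta>\<in>H. \<Sum>\<eta>'\<in>H. d \<eta> * cnj (d \<eta>') * complex_of_real (exp (s * (\<eta> \<bullet> \<eta>'))))"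
    unfolding Re_complex_of_real .
  then show ?thesis
    using L2_normsq_nonneg[of gauss_measure "\<lambda>v. \<Sum>\<eta>\<in>H. a \<eta> * cis (- ((sqrt s *\<^sub>R \<eta>) \<bullet> v))"] by simp
qed

text \<open>Two derivatives multiply the kernel by
  \<open>(\<eta> \<bullet> \<eta>')\<^sup>2\<close>. Expanding this square over pairs of coordinates
  moves it into the coefficients and leaves a sum of nonnegative forms with the exponential
  kernel.\<close>

lemma exp_kernel_convex:
  fixes H :: "(real ^ 'n) set" and d :: "real ^ 'n \<Rightarrow> complex"
  assumes H: "finite H"
  shows "convex_on {0..} (\<lambda>s. \<Sum>\<eta>\<in>H. \<Sum>\<eta>'\<in>H. Re (d \<eta> * cnj (d \<eta>')) * exp (s * (\<eta> \<bullet> \<eta>')))"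
proof (rule f''_ge0_imp_convex)
  let ?r = "\<lambda>\<eta> \<eta>'. Re (d \<eta> * cnj (d \<eta>'))"
  show "((\<lambda>s. \<Sum>\<eta>\<in>H. \<Sum>\<eta>'\<in>H. ?r \<eta> \<eta>' * exp (s * (\<eta> \<bullet> \<eta>'))) has_real_derivative
      (\<Sum>\<eta>\<in>H. \<Sum>\<eta>'\<in>H. ?r \<eta> \<eta>' * ((\<eta> \<bullet> \<eta>') * exp (s * (\<eta> \<bullet> \<eta>'))))) (at s)" for s
    by (intro DERIV_sum DERIV_cmult) (auto intro!: derivative_eq_intros)
  show "((\<lambda>s. \<Sum>\<eta>\<in>H. \<Sum>\<eta>'\<in>H. ?r \<eta> \<eta>' * ((\<eta> \<bullet> \<eta>') * exp (s * (\<eta> \<bullet> \<eta>')))) has_real_derivative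
      (\<Sum>\<eta>\<in>H. \<Sum>\<eta>'\<in>H. ?r \<eta> \<eta>' * ((\<eta> \<bullet> \<eta>') * ((\<eta> \<bullet> \<eta>') * exp (s * (\<eta> \<bullet> \<eta>')))))) (at s)" for s
    by (intro DERIV_sum DERIV_cmult) (auto intro!: derivative_eq_intros)
  show "0 \<le> (\<Sum>\<eta>\<in>H. \<Sum>\<eta>'\<in>H. ?r \<eta> \<eta>' * ((\<eta> \<bullet> \<eta>') * ((\<eta> \<bullet> \<eta>') * exp (s * (\<eta> \<bullet> \<eta>')))))"
    if "s \<in> {0..}" for s
  proof -
    define D where "D i j \<eta> = d \<eta> * complex_of_real (\<eta> $ i * \<eta> $ j)" for i j and \<eta> :: "real^'n"
    have "(\<Sum>\<eta>\<in>H. \<Sum>\<eta>'\<in>H. ?r \<eta> \<eta>' * ((\<eta> \<bullet> \<eta>') * ((\<eta> \<bullet> \<eta>') * exp (s * (\<eta> \<bullet> \<eta>')))))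
      = (\<Sum>\<eta>\<in>H. \<Sum>\<eta>'\<in>H. \<Sum>i\<in>UNIV. \<Sum>j\<in>UNIV. Re (D i j \<eta> * cnj (D i j \<eta>')) * exp (s * (\<eta> \<bullet> \<eta>')))"
    proof (intro sum.cong refl)
      fix \<eta> \<eta>' :: "real^'n"
      have "(\<eta> \<bullet> \<eta>') * (\<eta> \<bullet> \<eta>') = (\<Sum>i\<in>UNIV. \<Sum>j\<in>UNIV. (\<eta> $ i * \<eta>' $ i) * (\<eta> $ j * \<eta>' $ j))"
        by (simp add: inner_vec_def sum_product)
      moreover have "?r \<eta> \<eta>' * ((\<eta> \<bullet> \<eta>') * ((\<eta> \<bullet> \<eta>') * exp (s * (\<eta> \<bullet> \<eta>'))))
        = ((\<eta> \<bullet> \<eta>') * (\<eta> \<bullet> \<eta>')) * (?r \<eta> \<eta>' * exp (s * (\<eta> \<bullet> \<eta>')))"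
        by (simp only: mult_ac)
      ultimately have "?r \<eta> \<eta>' * ((\<eta> \<bullet> \<eta>') * ((\<eta> \<bullet> \<eta>') * exp (s * (\<eta> \<bullet> \<eta>'))))
        = (\<Sum>i\<in>UNIV. \<Sum>j\<in>UNIV. (\<eta> $ i * \<eta>' $ i) * (\<eta> $ j * \<eta>' $ j)) * (?r \<eta> \<eta>' * exp (s * (\<eta> \<bullet> \<eta>')))"
        by (simp only:)
      also have "\<dots> = (\<Sum>i\<in>UNIV. \<Sum>j\<in>UNIV. Re (D i j \<eta> * cnj (D i j \<eta>')) * exp (s * (\<eta> \<bullet> \<eta>')))"
        unfolding sum_distrib_right D_def by (intro sum.cong refl) (simp add: algebra_simps)
      finally show "?r \<eta> \<eta>' * ((\<eta> \<bullet> \<eta>') * ((\<eta> \<bullet> \<eta>') * exp (s * (\<eta> \<bullet> \<eta>'))))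
        = (\<Sum>i\<in>UNIV. \<Sum>j\<in>UNIV. Re (D i j \<eta> * cnj (D i j \<eta>')) * exp (s * (\<eta> \<bullet> \<eta>')))" .
    qed
    also have "\<dots> = (\<Sum>i\<in>UNIV. \<Sum>j\<in>UNIV. \<Sum>\<eta>\<in>H. \<Sum>\<eta>'\<in>H. Re (D i j \<eta> * cnj (D i j \<eta>')) * exp (s * (\<eta> \<bullet> \<eta>')))"
      unfolding sum.swap[of _ UNIV H] ..
    also have "0 \<le> \<dots>"
      using that by (intro sum_nonneg gauss_exp_kernel_nonneg H) auto
    finally show ?thesis .
  qed
qed simp

text \<open>The evolved squared norm is \<open>g (y\<^sup>2)\<close> for a convex \<open>g\<close>
  whose value at \<open>0\<close> is the squared mean and whose value at \<open>1\<close> is the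
  original squared norm. Convexity between these points is the spectral gap of the
  Ornstein--Uhlenbeck semigroup, with the factor \<open>y\<^sup>2\<close> and no constant
  lost.\<close>

lemma gauss_zero_mode_bound:
  fixes H :: "(real ^ 'n) set" and c :: "real ^ 'n \<Rightarrow> complex"
  assumes H: "finite H" and y: "0 \<le> y" "y \<le> 1"
  defines "S \<equiv> \<Sum>\<eta>\<in>H. c \<eta> * complex_of_real (gauss_char \<eta>)"
  shows "L2_normsq gauss_measure (\<lambda>v. \<Sum>\<eta>\<in>H. c \<eta> * complex_of_real (exp (- ((1 - y\<^sup>2) * (norm \<eta>)\<^sup>2 / 2))) * cis (- ((y *\<^sub>R \<eta>) \<bullet> v)))
      - (norm S)\<^sup>2
    \<le> y\<^sup>2 * L2_normsq gauss_measure (\<lambda>v. \<Sum>\<eta>\<in>H. c \<eta> * cis (- (\<eta> \<bullet> v)))"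
proof -
  define d where "d \<eta> = c \<eta> * complex_of_real (gauss_char \<eta>)" for \<eta>
  define g where "g s = (\<Sum>\<eta>\<in>H. \<Sum>\<eta>'\<in>H. Re (d \<eta> * cnj (d \<eta>')) * exp (s * (\<eta> \<bullet> \<eta>')))" for s
  have norm_eq: "L2_normsq gauss_measure (\<lambda>v. \<Sum>\<eta>\<in>H. c \<eta> * complex_of_real (exp (- ((1 - y\<^sup>2) * (norm \<eta>)\<^sup>2 / 2))) * cis (- ((y *\<^sub>R \<eta>) \<bullet> v)))
      = g (y\<^sup>2)" for y
  proof -
    have "exp (- ((1 - y\<^sup>2) * (norm \<eta>)\<^sup>2 / 2)) * exp (- ((1 - y\<^sup>2) * (norm \<eta>')\<^sup>2 / 2)) * gauss_char (y *\<^sub>R \<eta> - y *\<^sub>R \<eta>')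
      = gauss_char \<eta> * gauss_char \<eta>' * exp (y\<^sup>2 * (\<eta> \<bullet> \<eta>'))" for \<eta> \<eta>' :: "real^'n"
      unfolding gauss_char_eq exp_add[symmetric] power2_norm_eq_inner
      by (simp add: inner_diff_left inner_diff_right inner_commute power2_eq_square field_simps)
    then have k: "complex_of_real (exp (- ((1 - y\<^sup>2) * (norm \<eta>)\<^sup>2 / 2))) * complex_of_real (exp (- ((1 - y\<^sup>2) * (norm \<eta>')\<^sup>2 / 2))) * complex_of_real (gauss_char (y *\<^sub>R \<eta> - y *\<^sub>R \<eta>'))
      = complex_of_real (gauss_char \<eta>) * complex_of_real (gauss_char \<eta>') * complex_of_real (exp (y\<^sup>2 * (\<eta> \<bullet> \<eta>')))" for \<eta> \<eta>' :: "real^'n"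
      unfolding of_real_mult[symmetric] by simp
    then have "(c \<eta> * complex_of_real (exp (- ((1 - y\<^sup>2) * (norm \<eta>)\<^sup>2 / 2)))) * cnj (c \<eta>' * complex_of_real (exp (- ((1 - y\<^sup>2) * (norm \<eta>')\<^sup>2 / 2)))) * complex_of_real (gauss_char (y *\<^sub>R \<eta> - y *\<^sub>R \<eta>'))
      = d \<eta> * cnj (d \<eta>') * complex_of_real (exp (y\<^sup>2 * (\<eta> \<bullet> \<eta>')))" for \<eta> \<eta>'
    proof -
      have r: "(x * A) * cnj (x' * A') * G = (x * cnj x') * (A * cnj A' * G)" for x x' A A' G :: complex
        by simp
      show ?thesis
        unfolding r d_def complex_cnj_complex_of_real using k[of \<eta> \<eta>']
        by (simp only: complex_cnj_complex_of_real)
    qed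
    then have "complex_of_real (L2_normsq gauss_measure (\<lambda>v. \<Sum>\<eta>\<in>H. c \<eta> * complex_of_real (exp (- ((1 - y\<^sup>2) * (norm \<eta>)\<^sup>2 / 2))) * cis (- ((y *\<^sub>R \<eta>) \<bullet> v))))
      = (\<Sum>\<eta>\<in>H. \<Sum>\<eta>'\<in>H. d \<eta> * cnj (d \<eta>') * complex_of_real (exp (y\<^sup>2 * (\<eta> \<bullet> \<eta>'))))"
      unfolding gauss_normsq_sum[OF H] by simp
    from arg_cong[OF this, of Re] have "L2_normsq gauss_measure (\<lambda>v. \<Sum>\<eta>\<in>H. c \<eta> * complex_of_real (exp (- ((1 - y\<^sup>2) * (norm \<eta>)\<^sup>2 / 2))) * cis (- ((y *\<^sub>R \<eta>) \<bullet> v)))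
      = Re (\<Sum>\<eta>\<in>H. \<Sum>\<eta>'\<in>H. d \<eta> * cnj (d \<eta>') * complex_of_real (exp (y\<^sup>2 * (\<eta> \<bullet> \<eta>'))))"
      unfolding Re_complex_of_real .
    then show ?thesis by (simp add: g_def)
  qed
  have g1: "L2_normsq gauss_measure (\<lambda>v. \<Sum>\<eta>\<in>H. c \<eta> * cis (- (\<eta> \<bullet> v))) = g 1"
    using norm_eq[of 1] by simp
  have g0: "g 0 = (norm S)\<^sup>2"
  proof -
    have "complex_of_real ((norm S)\<^sup>2) = S * cnj S" by (rule complex_norm_square)
    also have "\<dots> = (\<Sum>\<eta>\<in>H. \<Sum>\<eta>'\<in>H. d \<eta> * cnj (d \<eta>'))" by (simp add: S_def d_def sum_product)
    finally have fin: "complex_of_real ((norm S)\<^sup>2) = (\<Sum>\<eta>\<in>H. \<Sum>\<eta>'\<in>H. d \<eta> * cnj (d \<eta>'))" .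
    from arg_cong[OF fin, of Re] have "(norm S)\<^sup>2 = Re (\<Sum>\<eta>\<in>H. \<Sum>\<eta>'\<in>H. d \<eta> * cnj (d \<eta>'))" unfolding Re_complex_of_real .
    then show ?thesis by (simp add: g_def)
  qed
  have "convex_on {0..} g" using exp_kernel_convex[OF H, of d] by (simp add: g_def[abs_def])
  moreover have "0 \<le> y\<^sup>2" "y\<^sup>2 \<le> 1" using y by (auto simp: power_le_one)
  ultimately have "g ((1 - y\<^sup>2) *\<^sub>R 0 + y\<^sup>2 *\<^sub>R 1) \<le> (1 - y\<^sup>2) * g 0 + y\<^sup>2 * g 1"
    by (intro convex_onD) auto
  then have "g (y\<^sup>2) - g 0 \<le> y\<^sup>2 * g 1 - y\<^sup>2 * g 0" by (simp add: algebra_simps)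
  also have "\<dots> \<le> y\<^sup>2 * g 1" unfolding g0 by simp
  finally show ?thesis unfolding norm_eq g1 g0 .
qed

text \<open>This is \<open>t - 2 tanh (t / 2)\<close>, with derivative the square of
  \<open>tanh (t / 2)\<close>. It is of order \<open>t^3\<close> at \<open>0\<close> and grows
  linearly at infinity.\<close>

definition fp_gap :: "real \<Rightarrow> real" where
  "fp_gap t = t - 2 * ((1 - exp (- t)) / (1 + exp (- t)))"

lemma DERIV_fp_gap: "(fp_gap has_real_derivative ((1 - exp (- t)) / (1 + exp (- t)))\<^sup>2) (at t)"
proof -
  have p: "1 + exp (- t) \<noteq> 0" using exp_gt_zero[of "- t"] by linarith
  have "(fp_gap has_real_derivative 1 - 2 * ((exp (- t) * (1 + exp (- t)) - (1 - exp (- t)) * (- exp (- t))) / (1 + exp (- t))\<^sup>2)) (at t)"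
    unfolding fp_gap_def[abs_def] using p
    by (auto intro!: derivative_eq_intros simp: power2_eq_square)
  moreover have "1 - 2 * ((E * (1 + E) - (1 - E) * (- E)) / (1 + E)\<^sup>2) = ((1 - E) / (1 + E))\<^sup>2" if "1 + E \<noteq> 0" for E :: real
    using that by (simp add: power_divide divide_simps) (simp add: power2_eq_square algebra_simps)
  ultimately show ?thesis using p by simp
qed

lemma fp_gap_mono: "s \<le> t \<Longrightarrow> fp_gap s \<le> fp_gap t"
  by (rule DERIV_nonneg_imp_nondecreasing[of s t fp_gap]) (auto intro!: exI[of _ "_ ^ 2"] DERIV_fp_gap)

lemma fp_gap_nonneg: "0 \<le> t \<Longrightarrow> 0 \<le> fp_gap t"
  using fp_gap_mono[of 0 t] by (simp add: fp_gap_def)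

text \<open>Away from \<open>0\<close> the derivative is bounded below, so the increment over
  \<open>[t / 2, t]\<close> alone is already linear in \<open>t\<close>.\<close>

lemma fp_gap_linear_lower_bound:
  assumes "0 < t0"
  shows "\<exists>c>0. \<forall>t\<ge>t0. c * t \<le> fp_gap t"
\<comment> \<open>The interval \<open>[t / 2, t]\<close> has length \<open>t / 2\<close>. On it the
  argument exceeds \<open>t0 / 2\<close> and the denominator is at most \<open>2\<close>, so the
  slope is at least \<open>((1 - exp (- t0 / 2)) / 2)\<^sup>2\<close>; the product gives the
  constant.\<close>
proof (intro exI[of _ "(1 - exp (- t0 / 2))\<^sup>2 / 8"] conjI allI impI)
  show "0 < (1 - exp (- t0 / 2))\<^sup>2 / 8" using assms by simp
  fix t assume t: "t0 \<le> t"
  then have "\<exists>z>t / 2. z < t \<and> fp_gap t - fp_gap (t / 2) = (t - t / 2) * ((1 - exp (- z)) / (1 + exp (- z)))\<^sup>2"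
    using assms by (intro MVT2 DERIV_fp_gap) auto
  then obtain z where z: "t / 2 < z" "fp_gap t - fp_gap (t / 2) = (t - t / 2) * ((1 - exp (- z)) / (1 + exp (- z)))\<^sup>2"
    by blast
  have "exp (- z) \<le> exp (- t0 / 2)" "exp (- z) \<le> 1" "exp (- t0 / 2) \<le> 1" "0 < exp (- z)" using z t assms by auto
  then have "(1 - exp (- t0 / 2)) / 2 \<le> (1 - exp (- z)) / (1 + exp (- z))"
    by (intro frac_le) (auto intro: add_pos_pos)
  then have "((1 - exp (- t0 / 2)) / 2)\<^sup>2 \<le> ((1 - exp (- z)) / (1 + exp (- z)))\<^sup>2"
    using assms by (intro power_mono) auto
  then have "(t / 2) * ((1 - exp (- t0 / 2)) / 2)\<^sup>2 \<le> (t / 2) * ((1 - exp (- z)) / (1 + exp (- z)))\<^sup>2"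
    using t assms by (intro mult_left_mono) auto
  also have "\<dots> \<le> fp_gap t" using z fp_gap_nonneg[of "t / 2"] t assms by simp
  finally show "(1 - exp (- t0 / 2))\<^sup>2 / 8 * t \<le> fp_gap t" by (simp add: power_divide mult.commute)
qed

text \<open>The threshold \<open>t0\<close> is the time with
  \<open>exp (2 * t0) = 1 + \<epsilon>\<close>. Up to \<open>t0\<close> the trivial bound
  \<open>1\<close> is enough; afterwards the exponent is at least
  \<open>2 \<kappa>\<^sup>2 c t\<close>, and \<open>\<kappa>\<^sup>2 c \<ge> 1\<close> is all that
  is asked of the frequency.\<close>

lemma fp_mode_decay:
  assumes "0 < \<epsilon>"
  shows "\<exists>N>0. \<forall>\<kappa>\<ge>N. \<forall>t\<ge>0. exp (- (2 * \<kappa>\<^sup>2 * fp_gap t)) \<le> (1 + \<epsilon>) * exp (- (2 * t))"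
proof -
  define t0 where "t0 = ln (1 + \<epsilon>) / 2"
  have t0: "0 < t0" using assms by (simp add: t0_def)
  obtain c where c: "0 < c" "\<And>t. t0 \<le> t \<Longrightarrow> c * t \<le> fp_gap t" using fp_gap_linear_lower_bound[OF t0] by blast
  show ?thesis
  proof (intro exI[of _ "1 / sqrt c"] conjI allI impI)
    show "0 < 1 / sqrt c" using c by simp
    fix \<kappa> t :: real assume \<kappa>: "1 / sqrt c \<le> \<kappa>" and t: "0 \<le> t"
    show "exp (- (2 * \<kappa>\<^sup>2 * fp_gap t)) \<le> (1 + \<epsilon>) * exp (- (2 * t))"
    proof (cases "t \<le> t0")
      case True
      have "exp (- (2 * \<kappa>\<^sup>2 * fp_gap t)) \<le> 1" using fp_gap_nonneg[OF t] by simp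
      also have "1 \<le> exp (2 * t0 - 2 * t)" using True by simp
      also have "\<dots> = (1 + \<epsilon>) * exp (- (2 * t))"
      proof -
        have "exp (2 * t0) = 1 + \<epsilon>" using assms by (simp add: t0_def)
        moreover have "exp (2 * t0 - 2 * t) = exp (2 * t0) * exp (- (2 * t))" by (simp add: exp_add[symmetric])
        ultimately show ?thesis by simp
      qed
      finally show ?thesis .
    next
      case False
      have "(1 / sqrt c)\<^sup>2 \<le> \<kappa>\<^sup>2" using \<kappa> c by (intro power_mono) auto
      then have "1 \<le> \<kappa>\<^sup>2 * c" using c by (simp add: power_divide divide_le_eq)
      then have "1 * t \<le> (\<kappa>\<^sup>2 * c) * t" using t by (intro mult_right_mono)
      also have "\<dots> = \<kappa>\<^sup>2 * (c * t)" by simp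
      also have "\<dots> \<le> \<kappa>\<^sup>2 * fp_gap t" using c(2)[of t] False by (intro mult_left_mono) auto
      finally have "exp (- (2 * \<kappa>\<^sup>2 * fp_gap t)) \<le> 1 * exp (- (2 * t))" by simp
      also have "\<dots> \<le> (1 + \<epsilon>) * exp (- (2 * t))" using assms by (intro mult_right_mono) auto
      finally show ?thesis .
    qed
  qed
qed

section \<open>Decay for the Fokker--Planck operator\<close>

lemma L2_phase_wave_sum:
  fixes c :: "real ^ 'n \<Rightarrow> 'j \<Rightarrow> complex"
  shows "0 < L \<Longrightarrow> L2_fun (phase L) (\<lambda>z. \<Sum>k\<in>K. \<Sum>j\<in>J. c k j * wave k (b k j) z)"
  by (intro L2_fun_sum L2_fun_cmult L2_fun_wave)

lemma integrable_wave:
  assumes "0 < L" shows "integrable (phase L) (wave k \<eta>)"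
proof -
  interpret finite_measure "phase L" by (rule finite_measure_phase[OF assms])
  show ?thesis by (rule integrable_const_bound[where B = 1]) auto
qed

text \<open>Parseval in the space variable: products of waves with different \<open>k\<close>
  integrate to zero, so the modes decouple and only Gaussian norms in velocity remain.\<close>

lemma wave_sum_normsq:
  fixes c :: "real ^ 'n \<Rightarrow> 'j \<Rightarrow> complex"
  assumes L: "0 < L" and K: "finite K" "K \<subseteq> dual_lattice L" and J: "finite J"
  shows "L2_normsq (phase L) (\<lambda>z. \<Sum>k\<in>K. \<Sum>j\<in>J. c k j * wave k (b k j) z)
    = L ^ CARD('n) * (\<Sum>k\<in>K. L2_normsq gauss_measure (\<lambda>v. \<Sum>j\<in>J. c k j * cis (- (b k j \<bullet> v))))"
proof -
  let ?p = "\<lambda>z. \<Sum>k\<in>K. \<Sum>j\<in>J. c k j * wave k (b k j) z"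
  have "complex_of_real (L2_normsq (phase L) ?p) = (\<integral>z. (\<Sum>k\<in>K. \<Sum>k'\<in>K. \<Sum>j\<in>J. \<Sum>l\<in>J.
      (c k j * cnj (c k' l)) * wave (k - k') (b k j - b k' l) z) \<partial>phase L)"
    unfolding L2_normsq_eq_integral
  proof (intro Bochner_Integration.integral_cong refl)
    fix z
    have "?p z * cnj (?p z) = (\<Sum>k\<in>K. \<Sum>k'\<in>K. \<Sum>j\<in>J. \<Sum>l\<in>J. (c k j * wave k (b k j) z) * cnj (c k' l * wave k' (b k' l) z))"
      unfolding cnj_sum sum_product ..
    also have "\<dots> = (\<Sum>k\<in>K. \<Sum>k'\<in>K. \<Sum>j\<in>J. \<Sum>l\<in>J. (c k j * cnj (c k' l)) * wave (k - k') (b k j - b k' l) z)"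
    proof (intro sum.cong refl)
      fix k k' j l
      have "wave k (b k j) z * cnj (wave k' (b k' l) z) = wave (k - k') (b k j - b k' l) z"
        by (simp add: cnj_wave wave_mult)
      then show "(c k j * wave k (b k j) z) * cnj (c k' l * wave k' (b k' l) z)
          = (c k j * cnj (c k' l)) * wave (k - k') (b k j - b k' l) z"
        by (simp add: mult_ac)
    qed
    finally show "?p z * cnj (?p z) = (\<Sum>k\<in>K. \<Sum>k'\<in>K. \<Sum>j\<in>J. \<Sum>l\<in>J. (c k j * cnj (c k' l)) * wave (k - k') (b k j - b k' l) z)" .
  qed
  also have "\<dots> = (\<Sum>k\<in>K. \<Sum>k'\<in>K. \<Sum>j\<in>J. \<Sum>l\<in>J. (c k j * cnj (c k' l)) * (\<integral>z. wave (k - k') (b k j - b k' l) z \<partial>phase L))"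
    by (simp add: integrable_wave[OF L])
  also have "\<dots> = (\<Sum>k\<in>K. \<Sum>k'\<in>K. if k' = k then \<Sum>j\<in>J. \<Sum>l\<in>J. (c k j * cnj (c k l)) * complex_of_real (L ^ CARD('n) * gauss_char (b k j - b k l)) else 0)"
  proof (intro sum.cong refl)
    fix k k' assume "k \<in> K" "k' \<in> K"
    then have "k - k' \<in> dual_lattice L" using K by (auto intro: dual_lattice_diff)
    from integral_wave[OF L this]
    show "(\<Sum>j\<in>J. \<Sum>l\<in>J. (c k j * cnj (c k' l)) * (\<integral>z. wave (k - k') (b k j - b k' l) z \<partial>phase L))
      = (if k' = k then \<Sum>j\<in>J. \<Sum>l\<in>J. (c k j * cnj (c k l)) * complex_of_real (L ^ CARD('n) * gauss_char (b k j - b k l)) else 0)"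
      by simp
  qed
  also have "\<dots> = (\<Sum>k\<in>K. \<Sum>j\<in>J. \<Sum>l\<in>J. (c k j * cnj (c k l)) * complex_of_real (L ^ CARD('n) * gauss_char (b k j - b k l)))"
    using K(1) by (simp del: of_real_mult of_real_power)
  also have "\<dots> = complex_of_real (L ^ CARD('n) * (\<Sum>k\<in>K. L2_normsq gauss_measure (\<lambda>v. \<Sum>j\<in>J. c k j * cis (- (b k j \<bullet> v)))))"
    unfolding of_real_mult of_real_sum gauss_normsq_sum[OF J]
    by (simp add: sum_distrib_left mult_ac)
  finally show ?thesis unfolding of_real_eq_iff .
qed

lemma integral_wave_sum:
  fixes c :: "real ^ 'n \<Rightarrow> 'j \<Rightarrow> complex"
  assumes L: "0 < L" and K: "finite K" "K \<subseteq> dual_lattice L"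
  shows "(\<integral>z. (\<Sum>k\<in>K. \<Sum>j\<in>J. c k j * wave k (b k j) z) \<partial>phase L)
    = complex_of_real (L ^ CARD('n)) * (if 0 \<in> K then \<Sum>j\<in>J. c 0 j * complex_of_real (gauss_char (b 0 j)) else 0)"
proof -
  have "(\<integral>z. (\<Sum>k\<in>K. \<Sum>j\<in>J. c k j * wave k (b k j) z) \<partial>phase L)
    = (\<Sum>k\<in>K. \<Sum>j\<in>J. c k j * (\<integral>z. wave k (b k j) z \<partial>phase L))"
    by (simp add: integrable_wave[OF L])
  also have "\<dots> = (\<Sum>k\<in>K. if k = 0 then complex_of_real (L ^ CARD('n)) * (\<Sum>j\<in>J. c 0 j * complex_of_real (gauss_char (b 0 j))) else 0)"
  proof (intro sum.cong refl)
    fix k assume "k \<in> K"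
    then have "k \<in> dual_lattice L" using K by auto
    from integral_wave[OF L this]
    show "(\<Sum>j\<in>J. c k j * (\<integral>z. wave k (b k j) z \<partial>phase L))
      = (if k = 0 then complex_of_real (L ^ CARD('n)) * (\<Sum>j\<in>J. c 0 j * complex_of_real (gauss_char (b 0 j))) else 0)"
      by (simp add: sum_distrib_left mult_ac)
  qed
  also have "\<dots> = complex_of_real (L ^ CARD('n)) * (if 0 \<in> K then \<Sum>j\<in>J. c 0 j * complex_of_real (gauss_char (b 0 j)) else 0)"
    using K(1) by simp
  finally show ?thesis .
qed

lemma measure_phase:
  assumes "0 < L"
  shows "measure (phase L :: ((real^'n) \<times> (real^'n)) measure) (cell L \<times> UNIV) = L ^ CARD('n)"
proof -
  have "complex_of_real (measure (phase L :: ((real^'n) \<times> (real^'n)) measure) (cell L \<times> UNIV)) = complex_of_real (L ^ CARD('n))"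
    using integral_wave[OF assms zero_in_dual_lattice, of "0 :: real^'n"] by (simp add: gauss_char_def scaleR_conv_of_real)
  then show ?thesis unfolding of_real_eq_iff .
qed

text \<open>A function with mean zero only sees the fluctuating part of its test function.\<close>

lemma pairing_mean_zero_le:
  fixes g w :: "(real^'n) \<times> (real^'n) \<Rightarrow> complex"
  assumes L: "0 < L" and g: "L2_fun (phase L) g" and w: "L2_fun (phase L) w" and zero: "pairing L g (wave 0 0) = 0"
  shows "(norm (pairing L g w))\<^sup>2
    \<le> L2_normsq (phase L) g * (L2_normsq (phase L) w - (norm (\<integral>z. w z \<partial>phase L))\<^sup>2 / L ^ CARD('n))"
proof -
  interpret finite_measure "phase L :: ((real^'n) \<times> (real^'n)) measure" by (rule finite_measure_phase[OF L])
  define I where "I = (\<integral>z. w z \<partial>phase L)"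
  define V where "V = L ^ CARD('n)"
  have V: "0 < V" using L by (simp add: V_def)
  \<comment> \<open>\<open>a\<close> is the mean of \<open>w\<close>, and the squared norm of
    \<open>w - a\<close> is the variance expression in the claim.\<close>
  define a where "a = I / complex_of_real V"
  have one: "L2_fun (phase L) (\<lambda>z :: (real^'n) \<times> (real^'n). 1)" by (rule L2_fun_bounded[where B = 1]) auto
  have a2: "L2_fun (phase L) (\<lambda>z :: (real^'n) \<times> (real^'n). a)" using L2_fun_cmult[OF one, of a] by simp
  have wi: "integrable (phase L) w" using L2_fun_mult_integrable[OF w one] by simp
  have wci: "integrable (phase L) (\<lambda>z. cnj (w z))" using L2_fun_mult_integrable[OF L2_fun_cnj[OF w] one] by simp
  have "pairing L g (\<lambda>z. w z - a) = pairing L g w"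
  proof -
    have "pairing L g (\<lambda>z. a) = a * pairing L g (wave 0 0)" using pairing_cmult_right[of L g a "wave 0 0"] by simp
    then show ?thesis using zero by (simp add: pairing_diff_right[OF g w a2])
  qed
  then have "norm (pairing L g w) \<le> L2_norm (phase L) g * L2_norm (phase L) (\<lambda>z. w z - a)"
    using pairing_le[OF g L2_fun_diff[OF w a2]] by simp
  then have "(norm (pairing L g w))\<^sup>2 \<le> (L2_norm (phase L) g * L2_norm (phase L) (\<lambda>z. w z - a))\<^sup>2"
    by (intro power_mono) auto
  also have "\<dots> = L2_normsq (phase L) g * L2_normsq (phase L) (\<lambda>z. w z - a)"
    by (simp add: power_mult_distrib L2_norm_power2)
  also have "L2_normsq (phase L) (\<lambda>z. w z - a) = L2_normsq (phase L) w - (norm I)\<^sup>2 / V"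
  proof -
    have "complex_of_real (L2_normsq (phase L) (\<lambda>z. w z - a))
      = (\<integral>z. w z * cnj (w z) - cnj a * w z - a * cnj (w z) + a * cnj a \<partial>phase L)"
      unfolding L2_normsq_eq_integral by (simp add: algebra_simps)
    also have "\<dots> = complex_of_real (L2_normsq (phase L) w) - cnj a * I - a * cnj I + a * cnj a * complex_of_real V"
    proof -
      have m: "measure (phase L) (cell L \<times> (UNIV :: (real^'n) set)) = V" using measure_phase[OF L] by (simp add: V_def)
      have "(\<integral>z. cnj (w z) \<partial>phase L) = cnj I" by (simp add: I_def)
      then show ?thesis
        using L2_fun_mult_integrable[OF w L2_fun_cnj[OF w]] wi wci
        by (simp add: I_def[symmetric] L2_normsq_eq_integral m scaleR_conv_of_real)
    qed
    also have "\<dots> = complex_of_real (L2_normsq (phase L) w - (norm I)\<^sup>2 / V)"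
      unfolding of_real_diff of_real_divide complex_norm_square a_def using V by (simp add: field_simps)
    finally show ?thesis unfolding of_real_eq_iff .
  qed
  finally show ?thesis by (simp add: I_def V_def)
qed

text \<open>The deviation from equilibrium after division by the Maxwellian; it has mean zero when
  \<open>m\<close> is the mean value of \<open>f\<close>.\<close>

definition fluctuation :: "complex \<Rightarrow> ((real ^ 'n) \<times> (real ^ 'n) \<Rightarrow> complex) \<Rightarrow> (real ^ 'n) \<times> (real ^ 'n) \<Rightarrow> complex" where
  "fluctuation m f z = over_M f z - m"

lemma L2_const_phase:
  assumes "0 < L" shows "L2_fun (phase L) (\<lambda>z. a)"
proof -
  interpret finite_measure "phase L" by (rule finite_measure_phase[OF assms])
  show ?thesis by (rule L2_fun_bounded[where B = "norm a"]) auto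
qed

lemma L2_fluctuation:
  "0 < L \<Longrightarrow> L2_fun (dx_dgamma L) f \<Longrightarrow> L2_fun (phase L) (fluctuation m f)"
  unfolding fluctuation_def[abs_def] by (intro L2_fun_diff L2_const_phase) (simp_all add: L2_fun_over_M)

lemma L2_normsq_fluctuation:
  fixes f :: "(real ^ 'n) \<times> (real ^ 'n) \<Rightarrow> complex"
  assumes L: "0 < L" and f: "L2_fun (dx_dgamma L) f"
  shows "L2_normsq (dx_dgamma L) (\<lambda>(x, v). f (x, v) - m * complex_of_real (maxwellian v))
    = L2_normsq (phase L) (fluctuation m f)"
proof -
  let ?g = "\<lambda>z. f z - m * complex_of_real (maxwellian (snd z))"
  have eq: "over_M ?g = fluctuation m f"
    by (simp add: over_M_def[abs_def] fluctuation_def[abs_def] diff_divide_distrib)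
  have "L2_fun (phase L) (over_M ?g)" unfolding eq by (rule L2_fluctuation[OF L f])
  then have "L2_fun (dx_dgamma L) ?g" by (simp add: L2_fun_over_M)
  from L2_normsq_over_M[OF this] show ?thesis unfolding eq by (simp add: case_prod_beta')
qed

lemma pairing_fluctuation:
  fixes f :: "(real ^ 'n) \<times> (real ^ 'n) \<Rightarrow> complex"
  assumes L: "0 < L" and f: "L2_fun (dx_dgamma L) f" and k: "k \<in> dual_lattice L"
  shows "pairing L (fluctuation m f) (wave k \<eta>)
    = pairing L (over_M f) (wave k \<eta>) - m * (if k = 0 then complex_of_real (L ^ CARD('n) * gauss_char \<eta>) else 0)"
proof -
  have "pairing L (fluctuation m f) (wave k \<eta>) = pairing L (over_M f) (wave k \<eta>) - pairing L (\<lambda>z. m) (wave k \<eta>)"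
    unfolding fluctuation_def[abs_def] using f
    by (intro pairing_diff_left L2_const_phase L L2_fun_wave) (simp add: L2_fun_over_M)
  also have "pairing L (\<lambda>z. m) (wave k \<eta>) = m * (\<integral>z. wave k \<eta> z \<partial>phase L)"
    by (simp add: pairing_def)
  finally show ?thesis unfolding integral_wave[OF L k] .
qed

text \<open>\<open>f 0\<close> and \<open>f0\<close> agree only almost everywhere for
  \<open>dx d\<gamma>\<close>. The weights are positive, so this measure, \<open>dx dv\<close> and
  \<open>phase L\<close> have the same null sets, and both mean and norm carry over.\<close>

lemma kinetic_solution_initial:
  fixes f0 :: "(real ^ 'n) \<times> (real ^ 'n) \<Rightarrow> complex"
  assumes L: "0 < L" and f0: "L2_fun (dx_dgamma L) f0" and sol: "kinetic_solution Lop L f0 f"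
  defines "m \<equiv> mean_value L f0"
  shows "pairing L (fluctuation m (f 0)) (wave 0 0) = 0"
    and "L2_normsq (phase L) (fluctuation m (f 0)) = L2_normsq (phase L) (fluctuation m f0)"
proof -
  have f2: "L2_fun (dx_dgamma L) (f 0)" using sol by (simp add: kinetic_solution_def)
  have "AE z in dx_dgamma L. f 0 z = f0 z" using sol by (simp add: kinetic_solution_def)
  then have "AE z in dx_dv L. f 0 z = f0 z"
    unfolding dx_dgamma_eq_density by (subst (asm) AE_density) auto
  then have ae: "AE z in phase L. f 0 z = f0 z"
    unfolding phase_eq_density by (subst AE_density) auto
  have ae1: "AE z in phase L. over_M (f 0) z = over_M f0 z" using ae by eventually_elim (simp add: over_M_def)
  have m1: "over_M (f 0) \<in> borel_measurable (phase L)" "over_M f0 \<in> borel_measurable (phase L)"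
    using f0 f2 unfolding L2_fun_over_M[symmetric] by (simp_all add: L2_fun_def)
  have "pairing L (over_M (f 0)) (wave 0 0) = (\<integral>z. over_M f0 z \<partial>phase L)"
    unfolding pairing_def using m1 ae1 by (auto intro: integral_cong_AE)
  also have "\<dots> = (\<integral>z. f0 z \<partial>dx_dv L)"
    using f0 by (intro integral_dx_dv_eq[symmetric]) (simp add: L2_fun_def measurable_dx_dgamma_iff)
  also have "\<dots> = m * complex_of_real (L ^ CARD('n))" using L by (simp add: m_def mean_value_def)
  finally show "pairing L (fluctuation m (f 0)) (wave 0 0) = 0"
    by (subst pairing_fluctuation[OF L f2]) (simp_all add: gauss_char_def)
  show "L2_normsq (phase L) (fluctuation m (f 0)) = L2_normsq (phase L) (fluctuation m f0)"
    unfolding L2_normsq_def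
  proof (rule integral_cong_AE)
    show "AE z in phase L. (norm (fluctuation m (f 0) z))\<^sup>2 = (norm (fluctuation m f0 z))\<^sup>2"
      using ae1 by eventually_elim (simp add: fluctuation_def)
  qed (use L2_fluctuation[OF L f0, of m] L2_fluctuation[OF L f2, of m] in \<open>auto simp: L2_fun_def\<close>)
qed

text \<open>On the dual lattice a constant has coefficients at \<open>k = 0\<close> only, and there
  damping and path compensate: \<open>exp (- fp_rate 0 \<eta> T) * gauss_char (fp_path 0 \<eta> T) =
  gauss_char \<eta>\<close>. Subtracting the equilibrium therefore preserves the solution
  formula.\<close>

lemma fokker_planck_fluctuation_wave:
  fixes k \<eta> :: "real ^ 'n"
  assumes sol: "kinetic_solution fokker_planck L f0 f" and L: "0 < L" and k: "k \<in> dual_lattice L" and T: "0 \<le> T"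
  shows "pairing L (fluctuation m (f T)) (wave k \<eta>)
    = complex_of_real (exp (- fp_rate k \<eta> T)) * pairing L (fluctuation m (f 0)) (wave k (fp_path k \<eta> T))"
proof -
  have f2: "L2_fun (dx_dgamma L) (f T)" "L2_fun (dx_dgamma L) (f 0)" using sol T by (simp_all add: kinetic_solution_def)
  have "exp (- fp_rate 0 \<eta> T) * gauss_char (fp_path 0 \<eta> T) = gauss_char \<eta>"
  proof -
    have "exp (- (2 * T)) = (exp (- T))\<^sup>2" by (simp add: exp_double[symmetric])
    then show ?thesis
      unfolding gauss_char_def fp_rate_def fp_path_def exp_add[symmetric]
      by (simp add: power_mult_distrib field_simps)
  qed
  then have "complex_of_real (exp (- fp_rate 0 \<eta> T)) * complex_of_real (gauss_char (fp_path 0 \<eta> T)) = complex_of_real (gauss_char \<eta>)"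
    unfolding of_real_mult[symmetric] by simp
  then show ?thesis
    unfolding pairing_fluctuation[OF L f2(1) k] pairing_fluctuation[OF L f2(2) k] fokker_planck_wave_formula[OF sol L k T]
    by (auto simp: right_diff_distrib simp del: of_real_exp)
qed

text \<open>The damping is \<open>exp (- |k|^2 \<theta>)\<close> times the factor handled by
  \<open>gauss_mode_bound\<close>, and the shift \<open>(1 - y) k\<close> of the path is common to
  all frequencies and drops out of the norm. Twice \<open>\<theta>\<close> minus the loss
  \<open>(1 - y)^3 / (1 + y)\<close> is exactly \<open>2 * fp_gap T\<close>.\<close>

lemma fp_mode_bound:
  fixes k :: "real ^ 'n"
  assumes H: "finite H" and T: "0 \<le> T"
  shows "L2_normsq gauss_measure (\<lambda>v. \<Sum>\<eta>\<in>H. c \<eta> * complex_of_real (exp (- fp_rate k \<eta> T)) * cis (- (fp_path k \<eta> T \<bullet> v)))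
    \<le> exp (- (2 * (norm k)\<^sup>2 * fp_gap T)) * L2_normsq gauss_measure (\<lambda>v. \<Sum>\<eta>\<in>H. c \<eta> * cis (- (\<eta> \<bullet> v)))"
proof -
  define y where "y = exp (- T)"
  have y: "0 < y" "y \<le> 1" using T by (auto simp: y_def)
  have y2: "exp (- (2 * T)) = y\<^sup>2" by (simp add: y_def exp_double[symmetric])
  define \<theta> where "\<theta> = T - 2 * (1 - y) + (1 - y\<^sup>2) / 2"
  define e where "e \<eta> = exp (- ((1 - y\<^sup>2) * (norm \<eta>)\<^sup>2 / 2 + (1 - y)\<^sup>2 * (\<eta> \<bullet> k)))" for \<eta>
  have rate: "exp (- fp_rate k \<eta> T) = exp (- ((norm k)\<^sup>2 * \<theta>)) * e \<eta>" for \<eta>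
    unfolding e_def fp_rate_def y2 y_def[symmetric] \<theta>_def exp_add[symmetric] by (simp add: algebra_simps)
  have path: "fp_path k \<eta> T - fp_path k \<eta>' T = y *\<^sub>R \<eta> - y *\<^sub>R \<eta>'" for \<eta> \<eta>'
    by (simp add: fp_path_def y_def)
  let ?a = "\<lambda>\<eta>. c \<eta> * complex_of_real (exp (- fp_rate k \<eta> T))"
  have "complex_of_real (L2_normsq gauss_measure (\<lambda>v. \<Sum>\<eta>\<in>H. ?a \<eta> * cis (- (fp_path k \<eta> T \<bullet> v))))
      = complex_of_real (L2_normsq gauss_measure (\<lambda>v. \<Sum>\<eta>\<in>H. ?a \<eta> * cis (- ((y *\<^sub>R \<eta>) \<bullet> v))))"
    unfolding gauss_normsq_sum[OF H] path ..
  then have "L2_normsq gauss_measure (\<lambda>v. \<Sum>\<eta>\<in>H. ?a \<eta> * cis (- (fp_path k \<eta> T \<bullet> v)))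
      = L2_normsq gauss_measure (\<lambda>v. \<Sum>\<eta>\<in>H. ?a \<eta> * cis (- ((y *\<^sub>R \<eta>) \<bullet> v)))"
    unfolding of_real_eq_iff .
  also have "(\<lambda>v. \<Sum>\<eta>\<in>H. ?a \<eta> * cis (- ((y *\<^sub>R \<eta>) \<bullet> v)))
      = (\<lambda>v. complex_of_real (exp (- ((norm k)\<^sup>2 * \<theta>))) * (\<Sum>\<eta>\<in>H. c \<eta> * complex_of_real (e \<eta>) * cis (- ((y *\<^sub>R \<eta>) \<bullet> v))))"
    unfolding rate of_real_mult sum_distrib_left by (intro ext sum.cong refl) (simp only: mult_ac)
  also have "L2_normsq gauss_measure \<dots> = (exp (- ((norm k)\<^sup>2 * \<theta>)))\<^sup>2 * L2_normsq gauss_measure (\<lambda>v. \<Sum>\<eta>\<in>H. c \<eta> * complex_of_real (e \<eta>) * cis (- ((y *\<^sub>R \<eta>) \<bullet> v)))"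
    unfolding L2_norm_power2[symmetric] L2_norm_cmult by (simp add: power_mult_distrib)
  also have "\<dots> \<le> (exp (- ((norm k)\<^sup>2 * \<theta>)))\<^sup>2 * (exp ((1 - y)^3 / (1 + y) * (norm k)\<^sup>2) * L2_normsq gauss_measure (\<lambda>v. \<Sum>\<eta>\<in>H. c \<eta> * cis (- (\<eta> \<bullet> v))))"
    unfolding e_def by (intro mult_left_mono gauss_mode_bound[OF H y]) simp
  also have "\<dots> = exp (- (2 * (norm k)\<^sup>2 * fp_gap T)) * L2_normsq gauss_measure (\<lambda>v. \<Sum>\<eta>\<in>H. c \<eta> * cis (- (\<eta> \<bullet> v)))"
  proof -
    have eq: "(1 - y)^3 / (1 + y) = 2 * \<theta> - 2 * fp_gap T"
      unfolding \<theta>_def fp_gap_def y_def[symmetric] using y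
      by (simp add: divide_simps) (simp add: power2_eq_square power3_eq_cube algebra_simps)
    have "2 * (- ((norm k)\<^sup>2 * \<theta>)) + (1 - y)^3 / (1 + y) * (norm k)\<^sup>2 = - (2 * (norm k)\<^sup>2 * fp_gap T)"
      unfolding eq by (simp add: algebra_simps)
    then have "(exp (- ((norm k)\<^sup>2 * \<theta>)))\<^sup>2 * exp ((1 - y)^3 / (1 + y) * (norm k)\<^sup>2) = exp (- (2 * (norm k)\<^sup>2 * fp_gap T))"
      unfolding exp_double[symmetric] exp_add[symmetric] by simp
    then show ?thesis by (simp add: mult.assoc[symmetric])
  qed
  finally show ?thesis .
qed

text \<open>The adjoint evolution keeps the modes separate, so each is estimated on its own. The
  data have mean zero, which allows the squared integral of the evolved test function to be
  subtracted; this integral comes from the mode \<open>0\<close>, the one mode whose estimate needs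
  the subtraction.\<close>

theorem fokker_planck_decay:
  fixes f0 :: "(real ^ 'n) \<times> (real ^ 'n) \<Rightarrow> complex"
  assumes L: "0 < L" and f0: "L2_fun (dx_dgamma L) f0" and sol: "kinetic_solution fokker_planck L f0 f"
    and T: "0 \<le> T" and C: "exp (- (2 * T)) \<le> C"
    and modes: "\<And>k :: real^'n. k \<in> dual_lattice L \<Longrightarrow> k \<noteq> 0 \<Longrightarrow> exp (- (2 * (norm k)\<^sup>2 * fp_gap T)) \<le> C"
  defines "m \<equiv> mean_value L f0"
  shows "L2_normsq (phase L) (fluctuation m (f T)) \<le> C * L2_normsq (phase L) (fluctuation m f0)"
proof -
  have f2: "L2_fun (dx_dgamma L) (f T)" "L2_fun (dx_dgamma L) (f 0)" using sol T by (simp_all add: kinetic_solution_def)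
  note g2 = L2_fluctuation[OF L f2(1), of m] L2_fluctuation[OF L f2(2), of m]
  note init = kinetic_solution_initial[OF L f0 sol, folded m_def]
  have C0: "0 \<le> C" using C exp_gt_zero[of "- (2 * T)"] by linarith
  let ?G0 = "L2_normsq (phase L) (fluctuation m f0)"
  have "L2_norm (phase L) (fluctuation m (f T)) \<le> sqrt (C * ?G0)"
  proof (rule L2_norm_le_by_duality[OF L g2(1)])
    show "0 \<le> sqrt (C * ?G0)" using C0 by simp
    fix p :: "(real ^ 'n) \<times> (real ^ 'n) \<Rightarrow> complex" assume "p \<in> wave_span L"
    from wave_span_normal_form[OF this] obtain K H c where K: "finite K" "K \<subseteq> dual_lattice L" and H: "finite H"
      and p: "p = (\<lambda>z. \<Sum>k\<in>K. \<Sum>\<eta>\<in>H. c k \<eta> * wave k \<eta> z)"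
      by (elim exE conjE)
    define w where "w z = (\<Sum>k\<in>K. \<Sum>\<eta>\<in>H. c k \<eta> * complex_of_real (exp (- fp_rate k \<eta> T)) * wave k (fp_path k \<eta> T) z)" for z
    have w2: "L2_fun (phase L) w" unfolding w_def[abs_def]
      using L2_phase_wave_sum[OF L, of "\<lambda>k \<eta>. c k \<eta> * complex_of_real (exp (- fp_rate k \<eta> T))" "\<lambda>k \<eta>. fp_path k \<eta> T"] .
    have pair: "pairing L g (\<lambda>z. \<Sum>k\<in>K. \<Sum>\<eta>\<in>H. a k \<eta> * wave k (b k \<eta>) z) = (\<Sum>k\<in>K. \<Sum>\<eta>\<in>H. a k \<eta> * pairing L g (wave k (b k \<eta>)))"
      if "L2_fun (phase L) g" for g and a :: "real^'n \<Rightarrow> real^'n \<Rightarrow> complex" and b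
      using that by (simp add: pairing_sum_right pairing_cmult_right L2_fun_sum L2_fun_cmult L2_fun_wave[OF L])
    have "pairing L (fluctuation m (f T)) p = pairing L (fluctuation m (f 0)) w"
      unfolding p w_def[abs_def] pair[OF g2(1)] pair[OF g2(2)]
      using K(2) by (intro sum.cong refl) (simp add: fokker_planck_fluctuation_wave[OF sol L _ T] subset_iff mult.assoc del: of_real_exp)
    then have "(norm (pairing L (fluctuation m (f T)) p))\<^sup>2
        \<le> ?G0 * (L2_normsq (phase L) w - (norm (\<integral>z. w z \<partial>phase L))\<^sup>2 / L ^ CARD('n))"
      using pairing_mean_zero_le[OF L g2(2) w2 init(1)] init(2) by simp
    also have "\<dots> \<le> ?G0 * (C * L2_normsq (phase L) p)"
    proof (rule mult_left_mono)
      define V where "V = L ^ CARD('n)"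
      have V: "0 < V" using L by (simp add: V_def)
      define N where "N k = L2_normsq gauss_measure (\<lambda>v. \<Sum>\<eta>\<in>H. c k \<eta> * cis (- (\<eta> \<bullet> v)))" for k
      define N' where "N' k = L2_normsq gauss_measure (\<lambda>v. \<Sum>\<eta>\<in>H. c k \<eta> * complex_of_real (exp (- fp_rate k \<eta> T)) * cis (- (fp_path k \<eta> T \<bullet> v)))" for k
      define S where "S = (\<Sum>\<eta>\<in>H. c 0 \<eta> * complex_of_real (gauss_char \<eta>))"
      have Np: "L2_normsq (phase L) p = V * (\<Sum>k\<in>K. N k)"
        unfolding p N_def V_def by (rule wave_sum_normsq[OF L K H])
      have Nw: "L2_normsq (phase L) w = V * (\<Sum>k\<in>K. N' k)"
        unfolding w_def[abs_def] N'_def V_def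
        using wave_sum_normsq[OF L K H, of "\<lambda>k \<eta>. c k \<eta> * complex_of_real (exp (- fp_rate k \<eta> T))" "\<lambda>k \<eta>. fp_path k \<eta> T"] .
      have y2: "(exp (- T))\<^sup>2 = exp (- (2 * T))" by (simp add: exp_double[symmetric])
      have rate0: "fp_rate 0 \<eta> T = (1 - (exp (- T))\<^sup>2) * (norm \<eta>)\<^sup>2 / 2" "fp_path 0 \<eta> T = exp (- T) *\<^sub>R \<eta>" for \<eta> :: "real^'n"
        by (simp_all add: fp_rate_def fp_path_def y2)
      \<comment> \<open>The adjoint evolution preserves the integral of the test function, so the
        subtracted quantity is the one appearing in the zero mode estimate.\<close>
      have S: "(\<Sum>\<eta>\<in>H. c 0 \<eta> * complex_of_real (exp (- fp_rate 0 \<eta> T)) * complex_of_real (gauss_char (fp_path 0 \<eta> T))) = S"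
        unfolding S_def
      proof (intro sum.cong refl)
        fix \<eta> :: "real^'n"
        have "exp (- fp_rate 0 \<eta> T) * gauss_char (fp_path 0 \<eta> T) = gauss_char \<eta>"
          unfolding rate0 gauss_char_def exp_add[symmetric] by (simp add: power_mult_distrib field_simps)
        then show "c 0 \<eta> * complex_of_real (exp (- fp_rate 0 \<eta> T)) * complex_of_real (gauss_char (fp_path 0 \<eta> T)) = c 0 \<eta> * complex_of_real (gauss_char \<eta>)"
          by (metis mult.assoc of_real_mult)
      qed
      have Iw: "(\<integral>z. w z \<partial>phase L) = complex_of_real V * (if 0 \<in> K then S else 0)"
        unfolding w_def V_def
        using integral_wave_sum[OF L K, where J = H and c = "\<lambda>k \<eta>. c k \<eta> * complex_of_real (exp (- fp_rate k \<eta> T))" and b = "\<lambda>k \<eta>. fp_path k \<eta> T"]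
        unfolding S .
      have zero: "N' 0 - (norm S)\<^sup>2 \<le> C * N 0"
      proof -
        have "N' 0 - (norm S)\<^sup>2 \<le> (exp (- T))\<^sup>2 * N 0"
          unfolding N'_def N_def S_def rate0 using T by (intro gauss_zero_mode_bound[OF H]) auto
        also have "\<dots> \<le> C * N 0" unfolding y2 using C by (intro mult_right_mono) (auto simp: N_def)
        finally show ?thesis .
      qed
      have nonzero: "N' k \<le> C * N k" if "k \<in> K" "k \<noteq> 0" for k
      proof -
        have "N' k \<le> exp (- (2 * (norm k)\<^sup>2 * fp_gap T)) * N k"
          unfolding N'_def N_def by (rule fp_mode_bound[OF H T])
        also have "\<dots> \<le> C * N k" using modes[of k] that K(2) by (intro mult_right_mono) (auto simp: N_def)
        finally show ?thesis .
      qed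
      have "(\<Sum>k\<in>K. N' k) - (if 0 \<in> K then (norm S)\<^sup>2 else 0) = (\<Sum>k\<in>K. N' k - (if k = 0 then (norm S)\<^sup>2 else 0))"
        using K(1) by (simp add: sum_subtractf)
      also have "\<dots> \<le> (\<Sum>k\<in>K. C * N k)"
        using zero nonzero by (intro sum_mono) auto
      finally have sum_le: "(\<Sum>k\<in>K. N' k) - (if 0 \<in> K then (norm S)\<^sup>2 else 0) \<le> C * (\<Sum>k\<in>K. N k)"
        by (simp add: sum_distrib_left)
      have "L2_normsq (phase L) w - (norm (\<integral>z. w z \<partial>phase L))\<^sup>2 / L ^ CARD('n)
        = V * ((\<Sum>k\<in>K. N' k) - (if 0 \<in> K then (norm S)\<^sup>2 else 0))"
        unfolding Nw Iw V_def[symmetric] using V by (simp add: norm_mult power_mult_distrib power2_eq_square right_diff_distrib)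
      also have "\<dots> \<le> V * (C * (\<Sum>k\<in>K. N k))" using V sum_le by (intro mult_left_mono) auto
      finally show "L2_normsq (phase L) w - (norm (\<integral>z. w z \<partial>phase L))\<^sup>2 / L ^ CARD('n) \<le> C * L2_normsq (phase L) p"
        unfolding Np by (simp add: mult_ac)
    qed simp
    finally have "(norm (pairing L (fluctuation m (f T)) p))\<^sup>2 \<le> (C * ?G0) * L2_normsq (phase L) p"
      by (simp add: mult_ac)
    then have "norm (pairing L (fluctuation m (f T)) p) \<le> sqrt (C * ?G0) * L2_norm (phase L) p"
      unfolding L2_norm_def real_sqrt_mult[symmetric] by (rule real_le_rsqrt)
    then show "norm (\<integral>z. fluctuation m (f T) z * p z \<partial>phase L) \<le> sqrt (C * ?G0) * L2_norm (phase L) p"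
      by (simp add: pairing_def)
  qed
  then have "(L2_norm (phase L) (fluctuation m (f T)))\<^sup>2 \<le> (sqrt (C * ?G0))\<^sup>2"
    by (intro power_mono) auto
  then show ?thesis using C0 by (simp add: L2_norm_power2)
qed

section \<open>Coefficients along lines in frequency space\<close>

text \<open>A time interval as a finite measure space of its own, so that the L2 lemmas, Fubini and
  the measurability rules apply to it as they do to phase space.\<close>

definition time_measure :: "real \<Rightarrow> real measure" where
  "time_measure T = restrict_space lborel {0..T}"

lemma space_time [simp]: "space (time_measure T) = {0..T}"
  by (simp add: time_measure_def space_restrict_space)

lemma finite_measure_time: "finite_measure (time_measure T)"
proof
  have "emeasure (time_measure T) {0..T} = emeasure lborel {0..T}"
    by (simp add: time_measure_def emeasure_restrict_space)
  also have "\<dots> \<noteq> \<infinity>" by (cases "0 \<le> T") auto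
  finally show "emeasure (time_measure T) (space (time_measure T)) \<noteq> \<infinity>" by simp
qed

interpretation time: finite_measure "time_measure T"
  by (rule finite_measure_time)

lemma measurable_time: "continuous_on {0..T} f \<Longrightarrow> f \<in> borel_measurable (time_measure T)"
  for f :: "real \<Rightarrow> 'a::topological_space"
proof -
  assume "continuous_on {0..T} f"
  then have "f \<in> borel_measurable (restrict_space borel {0..T})"
    by (intro borel_measurable_continuous_on_restrict)
  moreover have "sets (time_measure T) = sets (restrict_space borel {0..T})"
    by (simp add: time_measure_def sets_restrict_space)
  ultimately show ?thesis using measurable_cong_sets by blast
qed

lemma time_integrable_bounded:
  fixes f :: "real \<Rightarrow> 'b :: {banach, second_countable_topology}"
  assumes "f \<in> borel_measurable (time_measure T)" "\<And>s. s \<in> {0..T} \<Longrightarrow> norm (f s) \<le> B"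
  shows "integrable (time_measure T) f"
  using assms by (intro time.integrable_const_bound[where B = B]) auto

lemma time_integrable_continuous:
  fixes f :: "real \<Rightarrow> 'b :: {banach, second_countable_topology}"
  assumes "continuous_on {0..T} f"
  shows "integrable (time_measure T) f"
proof -
  have "bounded (f ` {0..T})" using assms by (intro compact_imp_bounded compact_continuous_image) auto
  then obtain B where "\<And>s. s \<in> {0..T} \<Longrightarrow> norm (f s) \<le> B" unfolding bounded_iff by blast
  then show ?thesis by (intro time_integrable_bounded measurable_time assms)
qed

lemma time_integral_eq:
  fixes f :: "real \<Rightarrow> 'b :: euclidean_space"
  assumes f: "continuous_on {0..T} f" and I: "(f has_integral I) {0..T}"
  shows "(\<integral>s. f s \<partial>time_measure T) = I"
proof -
  have int: "set_integrable lborel {0..T} f" by (rule borel_integrable_atLeastAtMost') (rule f)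
  have "(\<integral>s. f s \<partial>time_measure T) = (\<integral>s. indicator {0..T} s *\<^sub>R f s \<partial>lborel)"
    unfolding time_measure_def by (rule integral_restrict_space) simp
  also have "\<dots> = integral {0..T} f"
    using set_borel_integral_eq_integral(2)[OF int] by (simp add: set_lebesgue_integral_def)
  finally show ?thesis using I by (simp add: integral_unique)
qed

lemma time_mono:
  fixes f :: "real \<Rightarrow> real"
  assumes "0 \<le> t" "t \<le> T" "continuous_on {0..T} f" "\<And>s. s \<in> {0..T} \<Longrightarrow> 0 \<le> f s"
  shows "(\<integral>s. f s \<partial>time_measure t) \<le> (\<integral>s. f s \<partial>time_measure T)"
proof -
  have i: "f integrable_on {0..T}" "f integrable_on {0..t}"
    using assms by (auto intro!: integrable_continuous_interval continuous_on_subset[OF assms(3)])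
  have "integral {0..t} f \<le> integral {0..T} f"
    using assms i by (intro integral_subset_le) auto
  moreover have "continuous_on {0..t} f" using assms by (intro continuous_on_subset[OF assms(3)]) auto
  ultimately show ?thesis
    using time_integral_eq[OF assms(3) integrable_integral[OF i(1)]] time_integral_eq[OF _ integrable_integral[OF i(2)]] by simp
qed

section \<open>Schur test for the Gaussian convolution kernel\<close>

lemma gauss_char_scaleR_le: "gauss_char (u *\<^sub>R k) \<le> 2 / (1 + (norm k * u)\<^sup>2)"
proof -
  define x where "x = (norm k * u)\<^sup>2"
  have x: "0 \<le> x" by (simp add: x_def)
  have "1 + x / 2 \<le> exp (x / 2)" by (rule exp_ge_add_one_self)
  moreover have "1 \<le> exp (x / 2)" using x by simp
  ultimately have "1 + x \<le> 2 * exp (x / 2)" by linarith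
  then have "(1 + x) * exp (- (x / 2)) \<le> (2 * exp (x / 2)) * exp (- (x / 2))"
    by (intro mult_right_mono) auto
  also have "\<dots> = 2" by (simp add: exp_minus)
  finally have "exp (- (x / 2)) \<le> 2 / (1 + x)" using x by (simp add: pos_le_divide_eq mult.commute add_pos_nonneg)
  then show ?thesis by (simp add: gauss_char_def x_def power_mult_distrib mult.commute)
qed

lemma gauss_char_bounds: "0 \<le> gauss_char \<eta>" "gauss_char \<eta> \<le> 1"
  by (auto simp: gauss_char_def)

lemma continuous_on_gauss_char: "continuous_on A gauss_char"
  unfolding gauss_char_def[abs_def] by (intro continuous_intros) auto

lemma continuous_on_gauss_char_line: "continuous_on A (\<lambda>s. gauss_char (\<eta> + (c - s) *\<^sub>R k))"
  by (rule continuous_on_compose2[OF continuous_on_gauss_char[of UNIV]]) (auto intro!: continuous_intros)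

text \<open>The rational majorant has an arctangent as primitive, and its mass on the whole line is
  \<open>2 * pi / norm k\<close>; the bound is therefore uniform in \<open>c\<close> and
  \<open>T\<close>.\<close>

lemma integral_gauss_char_line:
  assumes k: "k \<noteq> 0" and T: "0 \<le> T"
  shows "(\<integral>s. gauss_char ((c - s) *\<^sub>R k) \<partial>time_measure T) \<le> 2 * pi / norm k"
proof -
  let ?n = "norm k"
  have n: "0 < ?n" using k by simp
  have p: "1 + (?n * (c - s))\<^sup>2 \<noteq> 0" for s
    by (metis add_pos_nonneg less_irrefl zero_le_power2 zero_less_one)
  have c1: "continuous_on {0..T} (\<lambda>s. gauss_char ((c - s) *\<^sub>R k))"
    using continuous_on_gauss_char_line[of _ 0 c k] by simp
  have c2: "continuous_on {0..T} (\<lambda>s. 2 / (1 + (?n * (c - s))\<^sup>2))"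
    using p by (intro continuous_intros) auto
  have "(\<integral>s. gauss_char ((c - s) *\<^sub>R k) \<partial>time_measure T) \<le> (\<integral>s. 2 / (1 + (?n * (c - s))\<^sup>2) \<partial>time_measure T)"
    by (intro integral_mono time_integrable_continuous c1 c2 gauss_char_scaleR_le)
  also have "\<dots> = - (2 / ?n * arctan (?n * (c - T))) - - (2 / ?n * arctan (?n * (c - 0)))"
  proof (intro time_integral_eq[OF c2] fundamental_theorem_of_calculus T)
    fix s assume "s \<in> {0..T}"
    have "((\<lambda>s. - (2 / ?n * arctan (?n * (c - s)))) has_real_derivative 2 / (1 + (?n * (c - s))\<^sup>2)) (at s within {0..T})"
    proof -
      have "((\<lambda>s. ?n * (c - s)) has_real_derivative - ?n) (at s within {0..T})"
        by (auto intro!: derivative_eq_intros)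
      from DERIV_minus[OF DERIV_cmult[OF DERIV_chain2[OF DERIV_arctan this], of "2 / ?n"]]
      show ?thesis by (rule DERIV_cong) (use n in \<open>simp add: divide_inverse\<close>)
    qed
    then show "((\<lambda>s. - (2 / ?n * arctan (?n * (c - s)))) has_vector_derivative 2 / (1 + (?n * (c - s))\<^sup>2)) (at s within {0..T})"
      by (simp add: has_real_derivative_iff_has_vector_derivative)
  qed
  also have "\<dots> = 2 / ?n * (arctan (?n * c) - arctan (?n * (c - T)))" by (simp add: algebra_simps)
  also have "\<dots> \<le> 2 / ?n * pi"
    using n arctan_bounded[of "?n * c"] arctan_bounded[of "?n * (c - T)"] by (intro mult_left_mono) auto
  finally show ?thesis by simp
qed

text \<open>Schur's test: \<open>2 * b s * b s'\<close> is at most the sum of the two squares, and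
  each square is integrated against the mass of the kernel in the other variable.\<close>

lemma gauss_char_schur:
  fixes b :: "real \<Rightarrow> real" and k :: "real ^ 'n"
  assumes b: "continuous_on {0..T} b" "\<And>s. s \<in> {0..T} \<Longrightarrow> 0 \<le> b s" and k: "k \<noteq> 0" and T: "0 \<le> T"
  shows "(\<integral>s. b s * (\<integral>s'. b s' * gauss_char ((s - s') *\<^sub>R k) \<partial>time_measure T) \<partial>time_measure T)
    \<le> 2 * pi / norm k * (\<integral>s. (b s)\<^sup>2 \<partial>time_measure T)"
proof -
  let ?M = "time_measure T"
  interpret pair_sigma_finite ?M ?M by standard
  have bm [measurable]: "b \<in> borel_measurable ?M" by (rule measurable_time[OF b(1)])
  have idm [measurable]: "(\<lambda>s. s) \<in> borel_measurable ?M" by (rule measurable_time) (intro continuous_intros)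
  have gm [measurable]: "gauss_char \<in> borel_measurable (borel :: (real^'n) measure)"
    by (rule borel_measurable_continuous_onI[OF continuous_on_gauss_char])
  let ?G = "\<lambda>s s'. gauss_char ((s - s') *\<^sub>R k)"
  have "bounded (b ` {0..T})" using b by (intro compact_imp_bounded compact_continuous_image) auto
  then obtain B where B: "\<And>s. s \<in> {0..T} \<Longrightarrow> \<bar>b s\<bar> \<le> B" unfolding bounded_iff real_norm_def by blast
  have int2: "integrable (?M \<Otimes>\<^sub>M ?M) (\<lambda>(s, s'). (b s')\<^sup>2 * ?G s s')"
  proof -
    interpret P: finite_measure "?M \<Otimes>\<^sub>M ?M"
      by (rule finite_measure_pair_measure) (rule finite_measure_time)+
    show ?thesis
    proof (rule P.integrable_const_bound[where B = "B\<^sup>2 * 1"])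
      show "AE x in ?M \<Otimes>\<^sub>M ?M. norm (case x of (s, s') \<Rightarrow> (b s')\<^sup>2 * ?G s s') \<le> B\<^sup>2 * 1"
      proof (rule AE_I2)
        fix x assume "x \<in> space (?M \<Otimes>\<^sub>M ?M)"
        then obtain s s' where x: "x = (s, s')" "s' \<in> {0..T}" by (cases x) (auto simp: space_pair_measure)
        have "\<bar>b s'\<bar>\<^sup>2 \<le> B\<^sup>2" by (intro power_mono B x(2)) simp
        then have "(b s')\<^sup>2 * \<bar>?G s s'\<bar> \<le> B\<^sup>2 * 1"
          using gauss_char_bounds[of "(s - s') *\<^sub>R k"] by (intro mult_mono) auto
        then show "norm (case x of (s, s') \<Rightarrow> (b s')\<^sup>2 * ?G s s') \<le> B\<^sup>2 * 1"
          by (simp add: x abs_mult)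
      qed
    qed measurable
  qed
  have g: "continuous_on {0..T} (\<lambda>s'. ?G s s')" for s using continuous_on_gauss_char_line[of _ 0 s k] by simp
  have g': "continuous_on {0..T} (\<lambda>s. ?G s s')" for s'
    by (rule continuous_on_compose2[OF continuous_on_gauss_char[of UNIV]]) (auto intro!: continuous_intros)
  have G_int: "(\<integral>s'. ?G s s' \<partial>?M) \<le> 2 * pi / norm k" for s by (rule integral_gauss_char_line[OF k T])
  have G_sym: "(\<integral>s. ?G s s' \<partial>?M) \<le> 2 * pi / norm k" for s'
  proof -
    have "?G s s' = gauss_char ((s' - s) *\<^sub>R k)" for s
      using gauss_char_uminus[of "(s - s') *\<^sub>R k"] by (simp add: scaleR_left_diff_distrib)
    then show ?thesis using integral_gauss_char_line[OF k T, of s'] by simp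
  qed
  have G_nonneg: "0 \<le> (\<integral>s'. ?G s s' \<partial>?M)" for s
    by (intro integral_nonneg_AE AE_I2 gauss_char_bounds)
  have b2: "integrable ?M (\<lambda>s. (b s)\<^sup>2)" by (intro time_integrable_continuous continuous_intros b)
  have first: "integrable ?M (\<lambda>s. (b s)\<^sup>2 * (\<integral>s'. ?G s s' \<partial>?M))"
  proof (rule Bochner_Integration.integrable_bound[OF integrable_mult_left[OF b2, of "2 * pi / norm k"]])
    show "AE s in ?M. norm ((b s)\<^sup>2 * (\<integral>s'. ?G s s' \<partial>?M)) \<le> norm ((b s)\<^sup>2 * (2 * pi / norm k))"
    proof (rule AE_I2)
      fix s
      have "0 \<le> (b s)\<^sup>2 * (\<integral>s'. ?G s s' \<partial>?M)" by (intro mult_nonneg_nonneg G_nonneg) simp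
      moreover have "(b s)\<^sup>2 * (\<integral>s'. ?G s s' \<partial>?M) \<le> (b s)\<^sup>2 * (2 * pi / norm k)"
        by (intro mult_left_mono G_int) simp
      ultimately show "norm ((b s)\<^sup>2 * (\<integral>s'. ?G s s' \<partial>?M)) \<le> norm ((b s)\<^sup>2 * (2 * pi / norm k))"
        unfolding real_norm_def by linarith
    qed
  qed measurable
  have second: "integrable ?M (\<lambda>s. \<integral>s'. (b s')\<^sup>2 * ?G s s' \<partial>?M)"
    using integrable_fst'[OF int2] by simp
  have "(\<integral>s. b s * (\<integral>s'. b s' * ?G s s' \<partial>?M) \<partial>?M)
    \<le> (\<integral>s. ((b s)\<^sup>2 * (\<integral>s'. ?G s s' \<partial>?M)) / 2 + (\<integral>s'. (b s')\<^sup>2 * ?G s s' \<partial>?M) / 2 \<partial>?M)"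
  proof (rule integral_mono')
    show "integrable ?M (\<lambda>s. ((b s)\<^sup>2 * (\<integral>s'. ?G s s' \<partial>?M)) / 2 + (\<integral>s'. (b s')\<^sup>2 * ?G s s' \<partial>?M) / 2)"
      using first second by simp
    fix s assume s: "s \<in> space ?M"
    have c: "continuous_on {0..T} (\<lambda>s'. b s' * ?G s s')" by (intro continuous_intros b g)
    have "b s * (\<integral>s'. b s' * ?G s s' \<partial>?M) = (\<integral>s'. b s * (b s' * ?G s s') \<partial>?M)" by simp
    also have "\<dots> \<le> (\<integral>s'. (b s)\<^sup>2 / 2 * ?G s s' + (b s')\<^sup>2 * ?G s s' / 2 \<partial>?M)"
    proof (rule integral_mono)
      show "integrable ?M (\<lambda>s'. b s * (b s' * ?G s s'))" "integrable ?M (\<lambda>s'. (b s)\<^sup>2 / 2 * ?G s s' + (b s')\<^sup>2 * ?G s s' / 2)"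
        by (intro time_integrable_continuous continuous_intros b g; simp)+
      fix s'
      have "b s * b s' * ?G s s' \<le> ((b s)\<^sup>2 / 2 + (b s')\<^sup>2 / 2) * ?G s s'"
        using sum_squares_bound[of "b s" "b s'"] gauss_char_bounds by (intro mult_right_mono) auto
      then show "b s * (b s' * ?G s s') \<le> (b s)\<^sup>2 / 2 * ?G s s' + (b s')\<^sup>2 * ?G s s' / 2" by (simp add: algebra_simps)
    qed
    also have "\<dots> = ((b s)\<^sup>2 * (\<integral>s'. ?G s s' \<partial>?M)) / 2 + (\<integral>s'. (b s')\<^sup>2 * ?G s s' \<partial>?M) / 2"
    proof -
      have "integrable ?M (\<lambda>s'. (b s)\<^sup>2 / 2 * ?G s s')" "integrable ?M (\<lambda>s'. (b s')\<^sup>2 * ?G s s' / 2)"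
        by (intro time_integrable_continuous continuous_intros b g; simp)+
      from Bochner_Integration.integral_add[OF this] show ?thesis by simp
    qed
    finally show "b s * (\<integral>s'. b s' * ?G s s' \<partial>?M) \<le> ((b s)\<^sup>2 * (\<integral>s'. ?G s s' \<partial>?M)) / 2 + (\<integral>s'. (b s')\<^sup>2 * ?G s s' \<partial>?M) / 2" .
  next
    fix s assume "s \<in> space ?M"
    then show "0 \<le> ((b s)\<^sup>2 * (\<integral>s'. ?G s s' \<partial>?M)) / 2 + (\<integral>s'. (b s')\<^sup>2 * ?G s s' \<partial>?M) / 2"
      using G_nonneg gauss_char_bounds by (intro add_nonneg_nonneg divide_nonneg_pos mult_nonneg_nonneg integral_nonneg_AE) auto
  qed
  also have "\<dots> = (\<integral>s. (b s)\<^sup>2 * (\<integral>s'. ?G s s' \<partial>?M) \<partial>?M) / 2 + (\<integral>s. \<integral>s'. (b s')\<^sup>2 * ?G s s' \<partial>?M \<partial>?M) / 2"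
    using first second by simp
  \<comment> \<open>After the exchange the inner integral runs over the first variable of the
    kernel; since \<open>gauss_char\<close> is even, its mass there obeys the same bound.\<close>
  also have "(\<integral>s. \<integral>s'. (b s')\<^sup>2 * ?G s s' \<partial>?M \<partial>?M) = (\<integral>s'. \<integral>s. (b s')\<^sup>2 * ?G s s' \<partial>?M \<partial>?M)"
    using Fubini_integral[OF int2] by simp
  also have "(\<integral>s. (b s)\<^sup>2 * (\<integral>s'. ?G s s' \<partial>?M) \<partial>?M) / 2 + (\<integral>s'. \<integral>s. (b s')\<^sup>2 * ?G s s' \<partial>?M \<partial>?M) / 2
     \<le> (\<integral>s. (b s)\<^sup>2 * (2 * pi / norm k) \<partial>?M) / 2 + (\<integral>s'. (b s')\<^sup>2 * (2 * pi / norm k) \<partial>?M) / 2"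
  proof (intro add_mono divide_right_mono)
    show "(\<integral>s. (b s)\<^sup>2 * (\<integral>s'. ?G s s' \<partial>?M) \<partial>?M) \<le> (\<integral>s. (b s)\<^sup>2 * (2 * pi / norm k) \<partial>?M)"
      by (intro integral_mono first integrable_mult_left b2 mult_left_mono G_int zero_le_power2)
    show "(\<integral>s'. \<integral>s. (b s')\<^sup>2 * ?G s s' \<partial>?M \<partial>?M) \<le> (\<integral>s'. (b s')\<^sup>2 * (2 * pi / norm k) \<partial>?M)"
    proof (rule integral_mono')
      show "(\<integral>s. (b s')\<^sup>2 * ?G s s' \<partial>?M) \<le> (b s')\<^sup>2 * (2 * pi / norm k)" for s'
        unfolding integral_mult_right_zero by (intro mult_left_mono G_sym zero_le_power2)
    qed (auto intro!: integrable_mult_left b2)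
  qed auto
  also have "\<dots> = 2 * pi / norm k * (\<integral>s. (b s)\<^sup>2 \<partial>?M)" by simp
  finally show ?thesis .
qed


section \<open>Square summability of coefficients along lines\<close>

lemma continuous_on_pairing_wave_line:
  fixes k \<eta> :: "real ^ 'n"
  assumes L: "0 < L" and w: "L2_fun (phase L) w"
  shows "continuous_on A (\<lambda>s. pairing L w (wave k (\<eta> + s *\<^sub>R k)))"
  unfolding continuous_on_sequentially comp_def
proof (intro allI ballI impI, elim conjE)
  fix x a assume x: "x \<longlonglongrightarrow> (a::real)"
  show "(\<lambda>n. pairing L w (wave k (\<eta> + x n *\<^sub>R k))) \<longlonglongrightarrow> pairing L w (wave k (\<eta> + a *\<^sub>R k))"
    unfolding pairing_def
  proof (rule integral_dominated_convergence[where w = "\<lambda>z. norm (w z)"])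
    have wm: "w \<in> borel_measurable (phase L)" using w by auto
    then show "(\<lambda>z. w z * wave k (\<eta> + a *\<^sub>R k) z) \<in> borel_measurable (phase L)"
      "\<And>n. (\<lambda>z. w z * wave k (\<eta> + x n *\<^sub>R k) z) \<in> borel_measurable (phase L)" by measurable
    show "integrable (phase L) (\<lambda>z. norm (w z))"
      using integrable_norm[OF L2_fun_mult_integrable[OF w L2_const_phase[OF L, of 1]]] by simp
    show "AE z in phase L. (\<lambda>n. w z * wave k (\<eta> + x n *\<^sub>R k) z) \<longlonglongrightarrow> w z * wave k (\<eta> + a *\<^sub>R k) z"
    proof (rule AE_I2)
      fix z
      have c: "isCont cis y" for y using continuous_on_cis[OF continuous_on_id, of UNIV] by (simp add: continuous_on_eq_continuous_at)
      have "(\<lambda>n. - (k \<bullet> fst z + (\<eta> + x n *\<^sub>R k) \<bullet> snd z)) \<longlonglongrightarrow> - (k \<bullet> fst z + (\<eta> + a *\<^sub>R k) \<bullet> snd z)"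
        by (intro tendsto_intros x)
      from tendsto_mult[OF tendsto_const isCont_tendsto_compose[OF c this], of "w z"]
      show "(\<lambda>n. w z * wave k (\<eta> + x n *\<^sub>R k) z) \<longlonglongrightarrow> w z * wave k (\<eta> + a *\<^sub>R k) z"
        unfolding wave_def .
    qed
  qed (auto simp: norm_mult)
qed

text \<open>\<open>synthesis\<close> is the adjoint of the map sending \<open>w\<close> to its coefficients along the lines \<open>(s + \<alpha>) k\<close>; the
  coefficients are estimated by a \<open>T T\<^sup>*\<close> argument.\<close>

definition synthesis :: "real \<Rightarrow> real \<Rightarrow> (real ^ 'n) set \<Rightarrow> (real ^ 'n \<Rightarrow> real \<Rightarrow> complex)
    \<Rightarrow> (real ^ 'n) \<times> (real ^ 'n) \<Rightarrow> complex" where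
  "synthesis T \<alpha> K a z = (\<Sum>k\<in>K. \<integral>s. a k s * wave k ((s + \<alpha>) *\<^sub>R k) z \<partial>time_measure T)"

text \<open>Fubini for a time integral of waves: \<open>a\<close> is bounded and \<open>w\<close> is
  integrable on the finite measure space. The wave is rewritten as a \<open>cis\<close> of an
  explicit expression to make it jointly measurable in \<open>s\<close> and
  \<open>z\<close>.\<close>

lemma
  fixes a :: "real \<Rightarrow> complex" and k :: "real ^ 'n"
  assumes L: "0 < L" and a: "continuous_on {0..T} a" and w: "L2_fun (phase L) w"
  shows pairing_time_integral: "pairing L w (\<lambda>z. \<integral>s. a s * wave k ((s + \<alpha>) *\<^sub>R k) z \<partial>time_measure T)
      = (\<integral>s. a s * pairing L w (wave k ((s + \<alpha>) *\<^sub>R k)) \<partial>time_measure T)" (is ?A)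
    and L2_time_integral: "L2_fun (phase L) (\<lambda>z. \<integral>s. a s * wave k ((s + \<alpha>) *\<^sub>R k) z \<partial>time_measure T)" (is ?B)
proof -
  let ?M = "time_measure T" and ?P = "phase L :: ((real^'n) \<times> (real^'n)) measure"
  interpret P: finite_measure ?P by (rule finite_measure_phase[OF L])
  interpret pair_sigma_finite ?M ?P by standard
  interpret swap: pair_sigma_finite ?P ?M by standard
  have wm [measurable]: "w \<in> borel_measurable ?P" using w by auto
  have am [measurable]: "a \<in> borel_measurable ?M" by (rule measurable_time[OF a])
  have idm [measurable]: "(\<lambda>s. s) \<in> borel_measurable ?M" by (rule measurable_time) (intro continuous_intros)
  have [measurable]: "(\<lambda>z. k \<bullet> fst z) \<in> borel_measurable ?P" "(\<lambda>z. k \<bullet> snd z) \<in> borel_measurable ?P"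
    by (auto intro!: measurable_phase borel_measurable_continuous_onI continuous_intros)
  have wave_eq: "wave k ((s + \<alpha>) *\<^sub>R k) z = cis (- (k \<bullet> fst z + (s + \<alpha>) * (k \<bullet> snd z)))" for s z
    by (simp add: wave_def)
  have m1: "(\<lambda>(s, z). wave k ((s + \<alpha>) *\<^sub>R k) z) \<in> borel_measurable (?M \<Otimes>\<^sub>M ?P)"
    unfolding wave_eq by measurable
  have m2: "(\<lambda>(z, s). wave k ((s + \<alpha>) *\<^sub>R k) z) \<in> borel_measurable (?P \<Otimes>\<^sub>M ?M)"
    unfolding wave_eq by measurable
  have "bounded (a ` {0..T})" using a by (intro compact_imp_bounded compact_continuous_image) auto
  then obtain B where B: "\<And>s. s \<in> {0..T} \<Longrightarrow> norm (a s) \<le> B" unfolding bounded_iff by blast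
  have nw: "integrable ?P (\<lambda>z. norm (w z))"
    using integrable_norm[OF L2_fun_mult_integrable[OF w L2_const_phase[OF L, of 1]]] by simp
  have int: "integrable (?M \<Otimes>\<^sub>M ?P) (\<lambda>(s, z). a s * (w z * wave k ((s + \<alpha>) *\<^sub>R k) z))"
  proof (rule Fubini_integrable)
    show "(\<lambda>(s, z). a s * (w z * wave k ((s + \<alpha>) *\<^sub>R k) z)) \<in> borel_measurable (?M \<Otimes>\<^sub>M ?P)"
      unfolding wave_eq by measurable
    have "integrable ?M (\<lambda>s. norm (a s) * (\<integral>z. norm (w z) \<partial>?P))"
      by (intro integrable_mult_left integrable_norm time_integrable_continuous a)
    then show "integrable ?M (\<lambda>s. \<integral>z. norm (case (s, z) of (s, z) \<Rightarrow> a s * (w z * wave k ((s + \<alpha>) *\<^sub>R k) z)) \<partial>?P)"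
      by (simp add: norm_mult)
    show "AE s in ?M. integrable ?P (\<lambda>z. case (s, z) of (s, z) \<Rightarrow> a s * (w z * wave k ((s + \<alpha>) *\<^sub>R k) z))"
      by (intro AE_I2) (simp add: L2_fun_mult_integrable w L2_fun_wave[OF L])
  qed
  have "pairing L w (\<lambda>z. \<integral>s. a s * wave k ((s + \<alpha>) *\<^sub>R k) z \<partial>?M)
      = (\<integral>z. \<integral>s. a s * (w z * wave k ((s + \<alpha>) *\<^sub>R k) z) \<partial>?M \<partial>?P)"
    unfolding pairing_def
  proof (intro Bochner_Integration.integral_cong refl)
    fix z
    have "w z * (\<integral>s. a s * wave k ((s + \<alpha>) *\<^sub>R k) z \<partial>?M) = (\<integral>s. w z * (a s * wave k ((s + \<alpha>) *\<^sub>R k) z) \<partial>?M)"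
      by simp
    then show "w z * (\<integral>s. a s * wave k ((s + \<alpha>) *\<^sub>R k) z \<partial>?M) = (\<integral>s. a s * (w z * wave k ((s + \<alpha>) *\<^sub>R k) z) \<partial>?M)"
      by (simp only: mult.left_commute)
  qed
  also have "\<dots> = (\<integral>s. \<integral>z. a s * (w z * wave k ((s + \<alpha>) *\<^sub>R k) z) \<partial>?P \<partial>?M)"
    by (rule Fubini_integral[OF int])
  finally show ?A by (simp add: pairing_def)
  show ?B
  proof (rule P.L2_fun_bounded)
    show "(\<lambda>z. \<integral>s. a s * wave k ((s + \<alpha>) *\<^sub>R k) z \<partial>?M) \<in> borel_measurable ?P"
      unfolding wave_eq by measurable
    show "norm (\<integral>s. a s * wave k ((s + \<alpha>) *\<^sub>R k) z \<partial>?M) \<le> (\<integral>s. norm (a s) \<partial>?M)" for z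
      using integral_norm_bound[of ?M "\<lambda>s. a s * wave k ((s + \<alpha>) *\<^sub>R k) z"] by (simp add: norm_mult)
  qed
qed

lemma
  fixes K :: "(real ^ 'n) set"
  assumes L: "0 < L" and K: "finite K" and a: "\<And>k. k \<in> K \<Longrightarrow> continuous_on {0..T} (a k)"
  shows L2_synthesis: "L2_fun (phase L) (synthesis T \<alpha> K a)"
    and pairing_synthesis: "L2_fun (phase L) w \<Longrightarrow> pairing L w (synthesis T \<alpha> K a)
      = (\<Sum>k\<in>K. \<integral>s. a k s * pairing L w (wave k ((s + \<alpha>) *\<^sub>R k)) \<partial>time_measure T)"
proof -
  have L2: "L2_fun (phase L) (\<lambda>z. \<integral>s. a k s * wave k ((s + \<alpha>) *\<^sub>R k) z \<partial>time_measure T)" if "k \<in> K" for k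
    by (rule L2_time_integral[OF L a[OF that] L2_const_phase[OF L]])
  then show "L2_fun (phase L) (synthesis T \<alpha> K a)"
    unfolding synthesis_def[abs_def] by (rule L2_fun_sum)
  assume w: "L2_fun (phase L) w"
  show "pairing L w (synthesis T \<alpha> K a)
      = (\<Sum>k\<in>K. \<integral>s. a k s * pairing L w (wave k ((s + \<alpha>) *\<^sub>R k)) \<partial>time_measure T)"
    unfolding synthesis_def[abs_def]
    by (subst pairing_sum_right[OF w L2]) (auto intro!: sum.cong pairing_time_integral L a w)
qed

text \<open>Different space frequencies are orthogonal. For one \<open>k\<close> the Gram kernel in
  time is a multiple of \<open>gauss_char ((s - s') *\<^sub>R k)\<close>, in which the offset
  \<open>\<alpha>\<close> has cancelled, and Schur's test bounds this block by its mass
  \<open>2 * pi / norm k\<close>.\<close>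

lemma synthesis_normsq_le:
  fixes K :: "(real ^ 'n) set"
  assumes L: "0 < L" and K: "finite K" "K \<subseteq> dual_lattice L" "0 \<notin> K" and T: "0 \<le> T"
    and \<gamma>: "\<And>k. k \<in> K \<Longrightarrow> 2 * pi / norm k \<le> \<gamma>"
    and a: "\<And>k. k \<in> K \<Longrightarrow> continuous_on {0..T} (a k)"
  shows "L2_normsq (phase L) (synthesis T \<alpha> K a)
    \<le> L ^ CARD('n) * \<gamma> * (\<Sum>k\<in>K. \<integral>s. (norm (a k s))\<^sup>2 \<partial>time_measure T)"
proof -
  let ?M = "time_measure T" and ?\<Phi> = "synthesis T \<alpha> K a"
  define V where "V = L ^ CARD('n)"
  have V: "0 < V" using L by (simp add: V_def)
  note \<Phi>2 = L2_synthesis[OF L K(1) a]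
  define I where "I k s = (\<integral>s'. a k s' * complex_of_real (gauss_char ((s - s') *\<^sub>R k)) \<partial>?M)" for k s
  have coeff: "pairing L (\<lambda>z. cnj (?\<Phi> z)) (wave k ((s + \<alpha>) *\<^sub>R k)) = complex_of_real V * cnj (I k s)"
    if k: "k \<in> K" for k s
  proof -
    have "pairing L (\<lambda>z. cnj (wave k ((s + \<alpha>) *\<^sub>R k) z)) ?\<Phi>
      = (\<Sum>k'\<in>K. \<integral>s'. a k' s' * pairing L (\<lambda>z. cnj (wave k ((s + \<alpha>) *\<^sub>R k) z)) (wave k' ((s' + \<alpha>) *\<^sub>R k')) \<partial>?M)"
      by (rule pairing_synthesis[OF L K(1) a L2_fun_cnj[OF L2_fun_wave[OF L]]])
    also have "\<dots> = (\<Sum>k'\<in>K. if k' = k then complex_of_real V * I k s else 0)"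
    proof (intro sum.cong refl)
      fix k' assume k': "k' \<in> K"
      have pw: "pairing L (\<lambda>z. cnj (wave k ((s + \<alpha>) *\<^sub>R k) z)) (wave k' ((s' + \<alpha>) *\<^sub>R k'))
          = (if k' = k then complex_of_real (V * gauss_char ((s - s') *\<^sub>R k)) else 0)" for s'
      proof -
        have "pairing L (\<lambda>z. cnj (wave k ((s + \<alpha>) *\<^sub>R k) z)) (wave k' ((s' + \<alpha>) *\<^sub>R k'))
          = (\<integral>z. wave k' ((s' + \<alpha>) *\<^sub>R k') z * cnj (wave k ((s + \<alpha>) *\<^sub>R k) z) \<partial>phase L)"
          unfolding pairing_def by (simp only: mult.commute)
        also have "\<dots> = (if k' = k then complex_of_real (V * gauss_char ((s' + \<alpha>) *\<^sub>R k' - (s + \<alpha>) *\<^sub>R k)) else 0)"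
          unfolding V_def using k k' K(2) by (intro integral_wave_mult_cnj[OF L]) auto
        also have "gauss_char ((s' + \<alpha>) *\<^sub>R k - (s + \<alpha>) *\<^sub>R k) = gauss_char ((s - s') *\<^sub>R k)"
          using gauss_char_uminus[of "(s - s') *\<^sub>R k"] by (simp add: scaleR_left_diff_distrib scaleR_left_distrib)
        then have "(if k' = k then complex_of_real (V * gauss_char ((s' + \<alpha>) *\<^sub>R k' - (s + \<alpha>) *\<^sub>R k)) else 0)
          = (if k' = k then complex_of_real (V * gauss_char ((s - s') *\<^sub>R k)) else 0)" by simp
        finally show ?thesis .
      qed
      have "(\<integral>s'. a k s' * complex_of_real (V * gauss_char ((s - s') *\<^sub>R k)) \<partial>?M)
          = (\<integral>s'. complex_of_real V * (a k s' * complex_of_real (gauss_char ((s - s') *\<^sub>R k))) \<partial>?M)"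
        by (intro Bochner_Integration.integral_cong refl) simp
      also have "\<dots> = complex_of_real V * I k s" unfolding I_def by simp
      finally show "(\<integral>s'. a k' s' * pairing L (\<lambda>z. cnj (wave k ((s + \<alpha>) *\<^sub>R k) z)) (wave k' ((s' + \<alpha>) *\<^sub>R k')) \<partial>?M)
          = (if k' = k then complex_of_real V * I k s else 0)"
        unfolding pw by simp
    qed
    also have "\<dots> = complex_of_real V * I k s" using k K(1) by simp
    finally have e: "pairing L (\<lambda>z. cnj (wave k ((s + \<alpha>) *\<^sub>R k) z)) ?\<Phi> = complex_of_real V * I k s" .
    have "pairing L (\<lambda>z. cnj (?\<Phi> z)) (wave k ((s + \<alpha>) *\<^sub>R k)) = (\<integral>z. cnj (cnj (wave k ((s + \<alpha>) *\<^sub>R k) z) * ?\<Phi> z) \<partial>phase L)"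
      unfolding pairing_def by (simp add: mult.commute)
    also have "\<dots> = cnj (pairing L (\<lambda>z. cnj (wave k ((s + \<alpha>) *\<^sub>R k) z)) ?\<Phi>)"
      unfolding pairing_def by (simp del: complex_cnj_mult complex_cnj_cnj)
    finally show ?thesis unfolding e by simp
  qed
  have "complex_of_real (L2_normsq (phase L) ?\<Phi>) = pairing L (\<lambda>z. cnj (?\<Phi> z)) ?\<Phi>"
    unfolding L2_normsq_eq_integral pairing_def by (simp only: mult.commute)
  also have "\<dots> = (\<Sum>k\<in>K. \<integral>s. a k s * pairing L (\<lambda>z. cnj (?\<Phi> z)) (wave k ((s + \<alpha>) *\<^sub>R k)) \<partial>?M)"
    by (rule pairing_synthesis[OF L K(1) a L2_fun_cnj[OF \<Phi>2]])
  also have "\<dots> = (\<Sum>k\<in>K. \<integral>s. complex_of_real V * (a k s * cnj (I k s)) \<partial>?M)"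
    using coeff by (intro sum.cong refl Bochner_Integration.integral_cong) simp_all
  finally have eq: "complex_of_real (L2_normsq (phase L) ?\<Phi>) = (\<Sum>k\<in>K. \<integral>s. complex_of_real V * (a k s * cnj (I k s)) \<partial>?M)" .
  have "L2_normsq (phase L) ?\<Phi> = norm (complex_of_real (L2_normsq (phase L) ?\<Phi>))" by simp
  also have "\<dots> \<le> (\<Sum>k\<in>K. norm (\<integral>s. complex_of_real V * (a k s * cnj (I k s)) \<partial>?M))"
    unfolding eq by (rule norm_sum)
  also have "\<dots> \<le> (\<Sum>k\<in>K. V * (\<gamma> * (\<integral>s. (norm (a k s))\<^sup>2 \<partial>?M)))"
  proof (rule sum_mono)
    fix k assume k: "k \<in> K"
    have k0: "k \<noteq> 0" using k K(3) by auto
    have ac: "continuous_on {0..T} (\<lambda>s. norm (a k s))" by (intro continuous_intros a k)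
    have gm: "continuous_on {0..T} (\<lambda>s'. gauss_char ((s - s') *\<^sub>R k))" for s
      using continuous_on_gauss_char_line[of _ 0 s k] by simp
    have I_le: "norm (I k s) \<le> (\<integral>s'. norm (a k s') * gauss_char ((s - s') *\<^sub>R k) \<partial>?M)" for s
      unfolding I_def
      by (rule order_trans[OF integral_norm_bound]) (simp add: norm_mult abs_of_nonneg[OF gauss_char_bounds(1)])
    have Jb: "(\<integral>s'. norm (a k s') * gauss_char ((s - s') *\<^sub>R k) \<partial>?M) \<le> (\<integral>s'. norm (a k s') \<partial>?M)" for s
      by (intro integral_mono time_integrable_continuous[OF ac] time_integrable_continuous[OF continuous_on_mult[OF ac gm]]
          mult_left_le gauss_char_bounds norm_ge_zero)
    have Jint: "integrable ?M (\<lambda>s. norm (a k s) * (\<integral>s'. norm (a k s') * gauss_char ((s - s') *\<^sub>R k) \<partial>?M))"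
    proof (rule Bochner_Integration.integrable_bound)
      show "integrable ?M (\<lambda>s. norm (a k s) * (\<integral>s'. norm (a k s') \<partial>?M))"
        by (intro integrable_mult_left time_integrable_continuous ac)
      have [measurable]: "(\<lambda>s. s) \<in> borel_measurable ?M" by (rule measurable_time) (intro continuous_intros)
      have [measurable]: "a k \<in> borel_measurable ?M" by (rule measurable_time[OF a[OF k]])
      have [measurable]: "gauss_char \<in> borel_measurable (borel :: (real^'n) measure)"
        by (rule borel_measurable_continuous_onI[OF continuous_on_gauss_char])
      show "(\<lambda>s. norm (a k s) * (\<integral>s'. norm (a k s') * gauss_char ((s - s') *\<^sub>R k) \<partial>?M)) \<in> borel_measurable ?M"
        by measurable
      have "0 \<le> (\<integral>s'. norm (a k s') * gauss_char ((s - s') *\<^sub>R k) \<partial>?M)" for s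
        by (intro integral_nonneg_AE AE_I2 mult_nonneg_nonneg gauss_char_bounds norm_ge_zero)
      then show "AE s in ?M. norm (norm (a k s) * (\<integral>s'. norm (a k s') * gauss_char ((s - s') *\<^sub>R k) \<partial>?M))
          \<le> norm (norm (a k s) * (\<integral>s'. norm (a k s') \<partial>?M))"
        using Jb by (intro AE_I2) (auto simp: abs_mult intro!: mult_left_mono)
    qed
    have "norm (\<integral>s. complex_of_real V * (a k s * cnj (I k s)) \<partial>?M) = V * norm (\<integral>s. a k s * cnj (I k s) \<partial>?M)"
      using V by (simp add: norm_mult)
    also have "norm (\<integral>s. a k s * cnj (I k s) \<partial>?M) \<le> (\<integral>s. norm (a k s * cnj (I k s)) \<partial>?M)"
      by (rule integral_norm_bound)
    also have "\<dots> \<le> (\<integral>s. norm (a k s) * (\<integral>s'. norm (a k s') * gauss_char ((s - s') *\<^sub>R k) \<partial>?M) \<partial>?M)"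
      using I_le by (intro integral_mono' Jint) (auto simp: norm_mult intro!: mult_left_mono mult_nonneg_nonneg order_trans[OF norm_ge_zero I_le])
    also have "\<dots> \<le> 2 * pi / norm k * (\<integral>s. (norm (a k s))\<^sup>2 \<partial>?M)"
      by (rule gauss_char_schur[OF ac _ k0 T]) simp
    also have "\<dots> \<le> \<gamma> * (\<integral>s. (norm (a k s))\<^sup>2 \<partial>?M)"
      by (intro mult_right_mono \<gamma>[OF k]) simp
    finally show "norm (\<integral>s. complex_of_real V * (a k s * cnj (I k s)) \<partial>?M) \<le> V * (\<gamma> * (\<integral>s. (norm (a k s))\<^sup>2 \<partial>?M))"
      using V by simp
  qed
  also have "\<dots> = V * \<gamma> * (\<Sum>k\<in>K. \<integral>s. (norm (a k s))\<^sup>2 \<partial>?M)" by (simp add: sum_distrib_left mult.assoc)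
  finally show ?thesis by (simp add: V_def)
qed

text \<open>Synthesise from the conjugated coefficients of \<open>w\<close> itself: the pairing of
  \<open>w\<close> with the result is the sum \<open>S\<close> to be bounded. Cauchy--Schwarz and
  the synthesis estimate bound \<open>S\<^sup>2\<close> by a multiple of \<open>S\<close>, and one
  factor \<open>S\<close> cancels.\<close>

theorem wave_coefficients_bound:
  fixes K :: "(real ^ 'n) set"
  assumes L: "0 < L" and K: "finite K" "K \<subseteq> dual_lattice L" "0 \<notin> K" and T: "0 \<le> T"
    and \<gamma>: "0 \<le> \<gamma>" "\<And>k. k \<in> K \<Longrightarrow> 2 * pi / norm k \<le> \<gamma>"
    and w: "L2_fun (phase L) w"
  shows "(\<Sum>k\<in>K. \<integral>s. (norm (pairing L w (wave k ((s + \<alpha>) *\<^sub>R k))))\<^sup>2 \<partial>time_measure T)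
    \<le> L ^ CARD('n) * \<gamma> * L2_normsq (phase L) w"
proof -
  let ?M = "time_measure T"
  define B where "B k s = pairing L w (wave k ((s + \<alpha>) *\<^sub>R k))" for k s
  define S where "S = (\<Sum>k\<in>K. \<integral>s. (norm (B k s))\<^sup>2 \<partial>?M)"
  have Bc: "continuous_on {0..T} (B k)" for k
    using continuous_on_pairing_wave_line[OF L w, of _ k "\<alpha> *\<^sub>R k"] by (simp add: B_def[abs_def] scaleR_left_distrib add.commute)
  define a where "a k s = cnj (B k s)" for k s
  have ac: "continuous_on {0..T} (a k)" for k unfolding a_def[abs_def] by (intro continuous_intros Bc)
  note \<Phi>2 = L2_synthesis[OF L K(1) ac, of \<alpha>]
  have "complex_of_real S = (\<Sum>k\<in>K. \<integral>s. a k s * B k s \<partial>?M)"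
    unfolding S_def of_real_sum integral_complex_of_real[symmetric] complex_norm_square a_def by (simp only: mult.commute)
  also have "\<dots> = pairing L w (synthesis T \<alpha> K a)"
    unfolding B_def by (rule pairing_synthesis[OF L K(1) ac w, symmetric])
  finally have "norm (complex_of_real S) \<le> L2_norm (phase L) w * L2_norm (phase L) (synthesis T \<alpha> K a)"
    using pairing_le[OF w \<Phi>2] by simp
  moreover have S0: "0 \<le> S" unfolding S_def by (intro sum_nonneg) simp
  ultimately have "S\<^sup>2 \<le> (L2_norm (phase L) w * L2_norm (phase L) (synthesis T \<alpha> K a))\<^sup>2"
    by (intro power_mono) auto
  also have "\<dots> = L2_normsq (phase L) w * L2_normsq (phase L) (synthesis T \<alpha> K a)"
    by (simp add: power_mult_distrib L2_norm_power2)
  also have "\<dots> \<le> L2_normsq (phase L) w * (L ^ CARD('n) * \<gamma> * S)"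
    using synthesis_normsq_le[OF L K T \<gamma>(2) ac, of \<alpha>]
    by (intro mult_left_mono) (simp_all add: S_def a_def)
  finally have "S * S \<le> (L ^ CARD('n) * \<gamma> * L2_normsq (phase L) w) * S" by (simp add: power2_eq_square mult_ac)
  moreover have "0 \<le> L ^ CARD('n) * \<gamma> * L2_normsq (phase L) w" using L \<gamma>(1) by simp
  ultimately have "S \<le> L ^ CARD('n) * \<gamma> * L2_normsq (phase L) w"
    using S0 mult_right_le_imp_le[of S S] by (cases "S = 0") auto
  then show ?thesis by (simp add: S_def B_def)
qed

section \<open>Decay for the linear BGK operator\<close>

text \<open>At \<open>k = 0\<close> and \<open>\<eta> = 0\<close> gain and loss cancel and there is
  no transport.\<close>

lemma linear_bgk_mass:
  fixes f0 :: "(real ^ 'n) \<times> (real ^ 'n) \<Rightarrow> complex"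
  assumes sol: "kinetic_solution linear_bgk L f0 f" and L: "0 < L" and T: "0 \<le> T"
  shows "pairing L (over_M (f T)) (wave 0 0) = pairing L (over_M (f 0)) (wave 0 0)"
proof -
  define U where "U s = pairing L (over_M (f s)) (wave 0 0)" for s
  have der: "(U has_vector_derivative 0) (at s within {0..T})" if "s \<in> {0..T}" for s
  proof -
    have s: "0 \<le> s" using that by simp
    have gen: "(\<lambda>z. complex_of_real (gauss_char 0) * wave 0 0 z - (1 + \<i> * complex_of_real (0 \<bullet> snd z)) * wave 0 0 z)
        = (\<lambda>z :: (real^'n) \<times> (real^'n). 0)"
      by (simp add: gauss_char_def)
    have zero: "pairing L (over_M (f s)) (\<lambda>z. 0) = 0" by (simp add: pairing_def)
    have "(U has_vector_derivative 0) (at s within {0..})"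
      using linear_bgk_wave[OF sol L zero_in_dual_lattice s, of 0] unfolding gen zero U_def[abs_def] .
    then show ?thesis by (rule has_vector_derivative_within_subset) auto
  qed
  obtain c where "\<And>s. s \<in> {0..T} \<Longrightarrow> U s = c"
    by (rule has_vector_derivative_zero_constant[of "{0..T}" U, OF _ der]) auto
  then have "U T = U 0" using T by simp
  then show ?thesis by (simp add: U_def)
qed

text \<open>The mass is constant, so the source in the solution formula is an explicit exponential.
  Its integral is exactly what subtracting the equilibrium removes, and the fluctuation is purely
  damped in this mode.\<close>

lemma linear_bgk_zero_mode:
  fixes f0 :: "(real ^ 'n) \<times> (real ^ 'n) \<Rightarrow> complex"
  assumes sol: "kinetic_solution linear_bgk L f0 f" and L: "0 < L" and T: "0 \<le> T"
    and zero: "pairing L (fluctuation m (f 0)) (wave 0 0) = 0"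
  shows "complex_of_real (exp T) * pairing L (fluctuation m (f T)) (wave 0 \<eta>) = pairing L (fluctuation m (f 0)) (wave 0 \<eta>)"
proof -
  have f2: "L2_fun (dx_dgamma L) (f t)" if "0 \<le> t" for t using sol that by (simp add: kinetic_solution_def)
  define M where "M = m * complex_of_real (L ^ CARD('n))"
  have mass: "pairing L (over_M (f s)) (wave 0 0) = M" if "0 \<le> s" for s
    using zero linear_bgk_mass[OF sol L that]
    by (simp add: pairing_fluctuation[OF L f2[OF order_refl] zero_in_dual_lattice] gauss_char_def M_def)
  have "((\<lambda>s. complex_of_real (exp s) * (complex_of_real (gauss_char \<eta>) * M))
    has_integral complex_of_real (exp T) * pairing L (over_M (f T)) (wave 0 \<eta>)
      - pairing L (over_M (f 0)) (wave 0 (\<eta> + T *\<^sub>R 0))) {0..T}"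
    by (rule has_integral_eq[OF _ linear_bgk_wave_formula[OF sol L zero_in_dual_lattice T]]) (simp add: mass)
  then have "((\<lambda>s. complex_of_real (exp s) * (complex_of_real (gauss_char \<eta>) * M))
    has_integral complex_of_real (exp T) * pairing L (over_M (f T)) (wave 0 \<eta>) - pairing L (over_M (f 0)) (wave 0 \<eta>)) {0..T}"
    by simp
  moreover have "((\<lambda>s. complex_of_real (exp s) * (complex_of_real (gauss_char \<eta>) * M))
    has_integral complex_of_real (exp T) * (complex_of_real (gauss_char \<eta>) * M) - complex_of_real (exp 0) * (complex_of_real (gauss_char \<eta>) * M)) {0..T}"
  proof (rule fundamental_theorem_of_calculus[OF T])
    fix s assume "s \<in> {0..T}"
    have "(exp has_real_derivative exp s) (at s within {0..T})" by (auto intro!: derivative_eq_intros)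
    then have "((\<lambda>s. complex_of_real (exp s)) has_vector_derivative complex_of_real (exp s)) (at s within {0..T})"
      by (intro has_vector_derivative_of_real) (simp add: has_real_derivative_iff_has_vector_derivative)
    then show "((\<lambda>s. complex_of_real (exp s) * (complex_of_real (gauss_char \<eta>) * M)) has_vector_derivative
        complex_of_real (exp s) * (complex_of_real (gauss_char \<eta>) * M)) (at s within {0..T})"
      by (rule has_vector_derivative_mult_left)
  qed
  ultimately have "complex_of_real (exp T) * pairing L (over_M (f T)) (wave 0 \<eta>) - pairing L (over_M (f 0)) (wave 0 \<eta>)
      = complex_of_real (exp T) * (complex_of_real (gauss_char \<eta>) * M) - complex_of_real (exp 0) * (complex_of_real (gauss_char \<eta>) * M)"
    by (rule has_integral_unique)
  then show ?thesis
    unfolding pairing_fluctuation[OF L f2[OF T] zero_in_dual_lattice] pairing_fluctuation[OF L f2[OF order_refl] zero_in_dual_lattice]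
    by (simp add: M_def algebra_simps)
qed

text \<open>Constants have no coefficient at a nonzero \<open>k\<close>, so fluctuation and solution
  agree there. In terms of the rescaled density \<open>r\<close> the formula contains no exponential
  weight, and for \<open>\<eta> = 0\<close> it closes to a Volterra equation for
  \<open>r\<close>.\<close>

lemma linear_bgk_nonzero_mode:
  fixes f0 :: "(real ^ 'n) \<times> (real ^ 'n) \<Rightarrow> complex" and m :: complex and k \<eta> :: "real ^ 'n"
    and f :: "real \<Rightarrow> (real ^ 'n) \<times> (real ^ 'n) \<Rightarrow> complex"
  assumes sol: "kinetic_solution linear_bgk L f0 f" and L: "0 < L" and T: "0 \<le> T"
    and k: "k \<in> dual_lattice L" "k \<noteq> 0"
  defines "r \<equiv> \<lambda>s. complex_of_real (exp s) * pairing L (fluctuation m (f s)) (wave k 0)"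
  shows "complex_of_real (exp T) * pairing L (fluctuation m (f T)) (wave k \<eta>)
      = pairing L (fluctuation m (f 0)) (wave k (\<eta> + T *\<^sub>R k))
        + (\<integral>s. r s * complex_of_real (gauss_char (\<eta> + (T - s) *\<^sub>R k)) \<partial>time_measure T)" (is ?A)
    and "continuous_on {0..} r" (is ?B)
proof -
  have f2: "L2_fun (dx_dgamma L) (f t)" if "0 \<le> t" for t using sol that by (simp add: kinetic_solution_def)
  have fl: "pairing L (fluctuation m (f s)) (wave k \<eta>) = pairing L (over_M (f s)) (wave k \<eta>)" if "0 \<le> s" for s \<eta>
    using pairing_fluctuation[OF L f2[OF that] k(1)] k(2) by simp
  have "continuous_on {0..} (\<lambda>s. complex_of_real (exp s) * pairing L (over_M (f s)) (wave k 0))"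
    by (intro continuous_intros L2_curve_pairing_continuous[OF kinetic_solution_curve[OF sol]] L2_fun_wave L)
  then show ?B by (rule continuous_on_eq) (simp add: r_def fl)
  then have rc: "continuous_on {0..T} r" by (rule continuous_on_subset) auto
  have "((\<lambda>s. r s * complex_of_real (gauss_char (\<eta> + (T - s) *\<^sub>R k))) has_integral
      complex_of_real (exp T) * pairing L (over_M (f T)) (wave k \<eta>) - pairing L (over_M (f 0)) (wave k (\<eta> + T *\<^sub>R k))) {0..T}"
    by (rule has_integral_eq[OF _ linear_bgk_wave_formula[OF sol L k(1) T]]) (simp add: r_def fl)
  then have "(\<integral>s. r s * complex_of_real (gauss_char (\<eta> + (T - s) *\<^sub>R k)) \<partial>time_measure T)
      = complex_of_real (exp T) * pairing L (over_M (f T)) (wave k \<eta>) - pairing L (over_M (f 0)) (wave k (\<eta> + T *\<^sub>R k))"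
    by (intro time_integral_eq continuous_intros rc continuous_on_gauss_char_line)
  then show ?A by (simp add: fl[OF T] fl[OF order_refl])
qed

text \<open>The Volterra equation \<open>r = b + G * r\<close> has a kernel of small mass, so \<open>r\<close> is controlled by \<open>b\<close> in \<open>L\<^sup>2\<close>.\<close>

lemma volterra_bound:
  fixes r b :: "real \<Rightarrow> complex" and k :: "real ^ 'n"
  assumes T: "0 \<le> T" and k: "k \<noteq> 0" "2 * pi / norm k \<le> 1 / 4"
    and r: "continuous_on {0..T} r" and b: "continuous_on {0..T} b"
    and eq: "\<And>t. t \<in> {0..T} \<Longrightarrow> r t = b t + (\<integral>s. r s * complex_of_real (gauss_char ((t - s) *\<^sub>R k)) \<partial>time_measure t)"
  shows "(\<integral>s. (norm (r s))\<^sup>2 \<partial>time_measure T) \<le> 2 * (\<integral>s. (norm (b s))\<^sup>2 \<partial>time_measure T)"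
proof -
  let ?M = "time_measure T"
  \<comment> \<open>The Volterra integral over \<open>[0, t]\<close> is enlarged to all of
    \<open>[0, T]\<close>; the resulting kernel is symmetric and Schur's test applies.\<close>
  let ?J = "\<lambda>s. \<integral>s'. norm (r s') * gauss_char ((s - s') *\<^sub>R k) \<partial>?M"
  have rn: "continuous_on {0..T} (\<lambda>s. norm (r s))"
    by (intro continuous_intros r)
  have gm: "continuous_on A (\<lambda>s'. gauss_char ((s - s') *\<^sub>R k))" for s A
    using continuous_on_gauss_char_line[of A 0 s k] by simp
  have rg: "continuous_on {0..T} (\<lambda>s'. norm (r s') * gauss_char ((s - s') *\<^sub>R k))" for s
    by (rule continuous_on_mult[OF rn gm])
  have J0: "0 \<le> ?J s" for s by (intro integral_nonneg_AE AE_I2 mult_nonneg_nonneg gauss_char_bounds norm_ge_zero)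
  have le: "norm (r t) \<le> norm (b t) + ?J t" if t: "t \<in> {0..T}" for t
  proof -
    have "norm (r t) \<le> norm (b t) + norm (\<integral>s. r s * complex_of_real (gauss_char ((t - s) *\<^sub>R k)) \<partial>time_measure t)"
      using eq[OF t] norm_triangle_ineq by metis
    also have "norm (\<integral>s. r s * complex_of_real (gauss_char ((t - s) *\<^sub>R k)) \<partial>time_measure t)
        \<le> (\<integral>s. norm (r s) * gauss_char ((t - s) *\<^sub>R k) \<partial>time_measure t)"
      by (rule order_trans[OF integral_norm_bound]) (simp add: norm_mult abs_of_nonneg[OF gauss_char_bounds(1)])
    also have "\<dots> \<le> ?J t"
      using t by (intro time_mono rg mult_nonneg_nonneg gauss_char_bounds norm_ge_zero) auto
    finally show ?thesis by simp
  qed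
  have Jb: "?J s \<le> (\<integral>s'. norm (r s') \<partial>?M)" for s
    by (intro integral_mono time_integrable_continuous[OF rn] time_integrable_continuous[OF rg]
        mult_left_le gauss_char_bounds norm_ge_zero)
  have Jint: "integrable ?M (\<lambda>s. norm (r s) * ?J s)"
  proof (rule Bochner_Integration.integrable_bound)
    show "integrable ?M (\<lambda>s. norm (r s) * (\<integral>s'. norm (r s') \<partial>?M))"
      by (intro integrable_mult_left time_integrable_continuous rn)
    have [measurable]: "(\<lambda>s. s) \<in> borel_measurable ?M" by (rule measurable_time) (intro continuous_intros)
    have [measurable]: "r \<in> borel_measurable ?M" by (rule measurable_time[OF r])
    have [measurable]: "gauss_char \<in> borel_measurable (borel :: (real^'n) measure)"
      by (rule borel_measurable_continuous_onI[OF continuous_on_gauss_char])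
    show "(\<lambda>s. norm (r s) * ?J s) \<in> borel_measurable ?M" by measurable
    show "AE s in ?M. norm (norm (r s) * ?J s) \<le> norm (norm (r s) * (\<integral>s'. norm (r s') \<partial>?M))"
      using Jb J0 by (intro AE_I2) (auto simp: abs_mult intro!: mult_left_mono)
  qed
  define R where "R = (\<integral>s. (norm (r s))\<^sup>2 \<partial>?M)"
  define N where "N = (\<integral>s. (norm (b s))\<^sup>2 \<partial>?M)"
  have r2: "integrable ?M (\<lambda>s. (norm (r s))\<^sup>2)" and b2: "integrable ?M (\<lambda>s. (norm (b s))\<^sup>2)"
    by (intro time_integrable_continuous continuous_intros r b)+
  \<comment> \<open>A quarter of \<open>R\<close> comes from splitting
    \<open>norm (r s) * norm (b s)\<close> and another quarter from the kernel mass; half of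
    \<open>R\<close> survives on the left, whence the factor \<open>2\<close>.\<close>
  have "R \<le> (\<integral>s. (norm (r s))\<^sup>2 / 4 + (norm (b s))\<^sup>2 + norm (r s) * ?J s \<partial>?M)"
    unfolding R_def
  proof (rule integral_mono[OF r2])
    show "integrable ?M (\<lambda>s. (norm (r s))\<^sup>2 / 4 + (norm (b s))\<^sup>2 + norm (r s) * ?J s)"
      using r2 b2 Jint by simp
    fix s assume "s \<in> space ?M"
    then have "norm (r s) * norm (r s) \<le> norm (r s) * (norm (b s) + ?J s)" using le by (intro mult_left_mono) auto
    moreover have "norm (r s) * norm (b s) \<le> (norm (r s))\<^sup>2 / 4 + (norm (b s))\<^sup>2"
      using zero_le_power2[of "norm (r s) / 2 - norm (b s)"] by (simp add: power2_diff power_divide)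
    ultimately show "(norm (r s))\<^sup>2 \<le> (norm (r s))\<^sup>2 / 4 + (norm (b s))\<^sup>2 + norm (r s) * ?J s"
      by (simp add: power2_eq_square distrib_left)
  qed
  also have "\<dots> = R / 4 + N + (\<integral>s. norm (r s) * ?J s \<partial>?M)"
    using r2 b2 Jint by (simp add: R_def N_def)
  also have "(\<integral>s. norm (r s) * ?J s \<partial>?M) \<le> 2 * pi / norm k * R"
    unfolding R_def by (rule gauss_char_schur[OF rn _ k(1) T]) simp
  also have "2 * pi / norm k * R \<le> 1 / 4 * R" using k(2) by (intro mult_right_mono) (simp_all add: R_def)
  finally show ?thesis by (simp add: R_def N_def)
qed

lemma dual_lattice_norm_ge:
  fixes k :: "real ^ 'n"
  assumes L: "0 < L" and k: "k \<in> dual_lattice L" "k \<noteq> 0"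
  shows "2 * pi / L \<le> norm k"
proof -
  obtain i where i: "k $ i \<noteq> 0" using k(2) by (auto simp: vec_eq_iff)
  obtain j :: int where j: "k $ i = 2 * pi / L * real_of_int j" using k(1) unfolding dual_lattice_def by blast
  then have "1 \<le> \<bar>real_of_int j\<bar>" using i by (cases "j = 0") auto
  then have "2 * pi / L * 1 \<le> 2 * pi / L * \<bar>real_of_int j\<bar>" using L by (intro mult_left_mono) auto
  also have "\<dots> = \<bar>k $ i\<bar>" using L by (simp add: j abs_mult)
  also have "\<dots> \<le> norm k" by (rule component_le_norm_cart)
  finally show ?thesis by simp
qed

text \<open>On the adjoint side the test function is transported freely, which preserves its norm,
  and a correction pairs the densities \<open>r\<close> of the solution with the densities
  \<open>\<mu>\<close> of the test function. Summed over the modes, both have squared time norms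
  with a factor of order \<open>L\<close>, so the correction is of relative size
  \<open>2 * L\<close>.\<close>

theorem linear_bgk_decay:
  fixes f0 :: "(real ^ 'n) \<times> (real ^ 'n) \<Rightarrow> complex"
  assumes L: "0 < L" "L \<le> 1 / 4" and f0: "L2_fun (dx_dgamma L) f0" and sol: "kinetic_solution linear_bgk L f0 f"
    and T: "0 \<le> T"
  defines "m \<equiv> mean_value L f0"
  shows "L2_normsq (phase L) (fluctuation m (f T)) \<le> (1 + 2 * L)\<^sup>2 * exp (- (2 * T)) * L2_normsq (phase L) (fluctuation m f0)"
proof -
  let ?M = "time_measure T"
  have f2: "L2_fun (dx_dgamma L) (f T)" "L2_fun (dx_dgamma L) (f 0)" using sol T by (simp_all add: kinetic_solution_def)
  note g2 = L2_fluctuation[OF L(1) f2(1), of m] L2_fluctuation[OF L(1) f2(2), of m]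
  note init = kinetic_solution_initial[OF L(1) f0 sol, folded m_def]
  define V where "V = L ^ CARD('n)"
  have V: "0 < V" using L by (simp add: V_def)
  let ?gT = "fluctuation m (f T)" and ?gi = "fluctuation m (f 0)"
  let ?Ni = "L2_norm (phase L) ?gi"
  have lattice: "2 * pi / norm k \<le> L" if "k \<in> dual_lattice L" "k \<noteq> 0" for k :: "real^'n"
  proof -
    have "2 * pi \<le> L * norm k"
      using dual_lattice_norm_ge[OF L(1) that] L(1) by (simp add: pos_divide_le_eq mult.commute)
    then show ?thesis using that(2) by (simp add: pos_divide_le_eq)
  qed
  have "L2_norm (phase L) ?gT \<le> (1 + 2 * L) * exp (- T) * ?Ni"
  proof (rule L2_norm_le_by_duality[OF L(1) g2(1)])
    show "0 \<le> (1 + 2 * L) * exp (- T) * ?Ni" using L by simp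
    fix p :: "(real ^ 'n) \<times> (real ^ 'n) \<Rightarrow> complex" assume "p \<in> wave_span L"
    from wave_span_normal_form[OF this] obtain K H c where K: "finite K" and H: "finite H" and KL: "K \<subseteq> dual_lattice L"
      and p: "p = (\<lambda>z. \<Sum>k\<in>K. \<Sum>\<eta>\<in>H. c k \<eta> * wave k \<eta> z)"
      by (elim exE conjE)
    have p2: "L2_fun (phase L) p" unfolding p by (rule L2_phase_wave_sum[OF L(1)])
    define K' where "K' = K - {0}"
    have K': "finite K'" "K' \<subseteq> dual_lattice L" "0 \<notin> K'" using K KL by (auto simp: K'_def)
    define r where "r k s = complex_of_real (exp s) * pairing L (fluctuation m (f s)) (wave k 0)" for k s
    \<comment> \<open>The offset \<open>0\<close> is written out to match the shape of
      \<open>wave_coefficients_bound\<close>.\<close>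
    define b where "b k s = pairing L ?gi (wave k ((s + 0) *\<^sub>R k))" for k s
    define \<mu> where "\<mu> k s = (\<Sum>\<eta>\<in>H. c k \<eta> * complex_of_real (gauss_char (\<eta> + (T - s) *\<^sub>R k)))" for k s
    define w where "w z = (\<Sum>k\<in>K. \<Sum>\<eta>\<in>H. c k \<eta> * wave k (\<eta> + T *\<^sub>R k) z)" for z
    have w2: "L2_fun (phase L) w" unfolding w_def[abs_def]
      using L2_phase_wave_sum[OF L(1), of c "\<lambda>k \<eta>. \<eta> + T *\<^sub>R k"] .
    have pair: "pairing L g (\<lambda>z. \<Sum>k\<in>K. \<Sum>\<eta>\<in>H. c k \<eta> * wave k (q k \<eta>) z) = (\<Sum>k\<in>K. \<Sum>\<eta>\<in>H. c k \<eta> * pairing L g (wave k (q k \<eta>)))"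
      if "L2_fun (phase L) g" for g and q :: "real^'n \<Rightarrow> real^'n \<Rightarrow> real^'n"
      using that by (simp add: pairing_sum_right pairing_cmult_right L2_fun_sum L2_fun_cmult L2_fun_wave[OF L(1)])
    have rc: "continuous_on {0..T} (r k)" if "k \<in> K'" for k
    proof -
      have "continuous_on {0..} (r k)"
        using linear_bgk_nonzero_mode(2)[OF sol L(1) T, of k m] that K' unfolding r_def[abs_def] by auto
      then show ?thesis by (rule continuous_on_subset) auto
    qed
    have bc: "continuous_on {0..T} (b k)" for k
      unfolding b_def using continuous_on_pairing_wave_line[OF L(1) g2(2), of _ k 0] by simp
    have \<mu>c: "continuous_on {0..T} (\<mu> k)" for k
      unfolding \<mu>_def by (intro continuous_intros continuous_on_gauss_char_line)
    have expand: "complex_of_real (exp T) * pairing L ?gT p = pairing L ?gi w + (\<Sum>k\<in>K'. \<integral>s. r k s * \<mu> k s \<partial>?M)"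
    proof -
      have mode: "(\<Sum>\<eta>\<in>H. c k \<eta> * (complex_of_real (exp T) * pairing L ?gT (wave k \<eta>)))
          = (\<Sum>\<eta>\<in>H. c k \<eta> * pairing L ?gi (wave k (\<eta> + T *\<^sub>R k))) + (if k = 0 then 0 else \<integral>s. r k s * \<mu> k s \<partial>?M)"
        if k: "k \<in> K" for k
      proof (cases "k = 0")
        case True
        then show ?thesis using linear_bgk_zero_mode[OF sol L(1) T init(1)] by simp
      next
        case False
        then have k': "k \<in> dual_lattice L" "k \<in> K'" using k KL by (auto simp: K'_def)
        note rc[OF k'(2), continuous_intros]
        have "(\<integral>s. r k s * \<mu> k s \<partial>?M) = (\<integral>s. (\<Sum>\<eta>\<in>H. c k \<eta> * (r k s * complex_of_real (gauss_char (\<eta> + (T - s) *\<^sub>R k)))) \<partial>?M)"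
          unfolding \<mu>_def sum_distrib_left by (intro Bochner_Integration.integral_cong refl sum.cong) simp_all
        also have "\<dots> = (\<Sum>\<eta>\<in>H. c k \<eta> * (\<integral>s. r k s * complex_of_real (gauss_char (\<eta> + (T - s) *\<^sub>R k)) \<partial>?M))"
          by (subst Bochner_Integration.integral_sum)
            (intro integrable_mult_right time_integrable_continuous continuous_intros continuous_on_gauss_char_line, simp)
        finally have "(\<integral>s. r k s * \<mu> k s \<partial>?M) = (\<Sum>\<eta>\<in>H. c k \<eta> * (\<integral>s. r k s * complex_of_real (gauss_char (\<eta> + (T - s) *\<^sub>R k)) \<partial>?M))" .
        then show ?thesis
          using False linear_bgk_nonzero_mode(1)[OF sol L(1) T k'(1) False, of m]
          by (simp add: r_def distrib_left sum.distrib)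
      qed
      have "complex_of_real (exp T) * pairing L ?gT p = (\<Sum>k\<in>K. \<Sum>\<eta>\<in>H. c k \<eta> * (complex_of_real (exp T) * pairing L ?gT (wave k \<eta>)))"
        unfolding p pair[OF g2(1)] sum_distrib_left by (simp only: mult.left_commute)
      also have "\<dots> = (\<Sum>k\<in>K. (\<Sum>\<eta>\<in>H. c k \<eta> * pairing L ?gi (wave k (\<eta> + T *\<^sub>R k))) + (if k = 0 then 0 else \<integral>s. r k s * \<mu> k s \<partial>?M))"
        by (intro sum.cong refl mode)
      also have "\<dots> = pairing L ?gi w + (\<Sum>k\<in>K. if k = 0 then 0 else \<integral>s. r k s * \<mu> k s \<partial>?M)"
        unfolding sum.distrib w_def[abs_def] pair[OF g2(2)] ..
      also have "(\<Sum>k\<in>K. if k = 0 then 0 else \<integral>s. r k s * \<mu> k s \<partial>?M) = (\<Sum>k\<in>K'. \<integral>s. r k s * \<mu> k s \<partial>?M)"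
        unfolding K'_def using K by (intro sum.mono_neutral_cong_right) auto
      finally show ?thesis .
    qed
    \<comment> \<open>Within one mode the shift \<open>T *\<^sub>R k\<close> is common to all
      frequencies, so free transport is an isometry.\<close>
    have w_norm: "L2_norm (phase L) w = L2_norm (phase L) p"
    proof -
      have "complex_of_real (L2_normsq gauss_measure (\<lambda>v. \<Sum>\<eta>\<in>H. c k \<eta> * cis (- ((\<eta> + T *\<^sub>R k) \<bullet> v))))
        = complex_of_real (L2_normsq gauss_measure (\<lambda>v. \<Sum>\<eta>\<in>H. c k \<eta> * cis (- (\<eta> \<bullet> v))))" for k
        unfolding gauss_normsq_sum[OF H] by simp
      then show ?thesis
        unfolding L2_norm_def w_def[abs_def] p wave_sum_normsq[OF L(1) K KL H] of_real_eq_iff by simp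
    qed
    have first: "norm (pairing L ?gi w) \<le> ?Ni * L2_norm (phase L) p"
      using pairing_le[OF g2(2) w2] by (simp add: w_norm)
    have R: "(\<Sum>k\<in>K'. L2_normsq ?M (r k)) \<le> 2 * (V * L * ?Ni\<^sup>2)"
    proof -
      have "L2_normsq ?M (r k) \<le> 2 * L2_normsq ?M (b k)" if k: "k \<in> K'" for k
        unfolding L2_normsq_def
      proof (rule volterra_bound[OF T _ _ rc[OF k] bc])
        show k0: "k \<noteq> 0" using k K' by auto
        have kd: "k \<in> dual_lattice L" using k K' by auto
        show "2 * pi / norm k \<le> 1 / 4" by (rule order_trans[OF lattice[OF kd k0] L(2)])
        fix t assume t: "t \<in> {0..T}"
        show "r k t = b k t + (\<integral>s. r k s * complex_of_real (gauss_char ((t - s) *\<^sub>R k)) \<partial>time_measure t)"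
          using linear_bgk_nonzero_mode(1)[OF sol L(1) _ kd k0, of t m 0] t
          unfolding r_def b_def by simp
      qed
      then have "(\<Sum>k\<in>K'. L2_normsq ?M (r k)) \<le> (\<Sum>k\<in>K'. 2 * L2_normsq ?M (b k))" by (rule sum_mono)
      also have "\<dots> = 2 * (\<Sum>k\<in>K'. L2_normsq ?M (b k))" by (simp add: sum_distrib_left)
      also have "(\<Sum>k\<in>K'. L2_normsq ?M (b k)) \<le> V * L * ?Ni\<^sup>2"
        unfolding L2_normsq_def[of ?M] b_def V_def L2_norm_power2
        using L lattice K' by (intro wave_coefficients_bound K' T g2(2)) auto
      finally show ?thesis by simp
    qed
    have M: "(\<Sum>k\<in>K'. L2_normsq ?M (\<mu> k)) \<le> L / V * (L2_norm (phase L) p)\<^sup>2"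
    proof -
      \<comment> \<open>The pairing has no conjugate, so the component of \<open>p\<close> at
        \<open>k\<close> is read off by a wave with space frequency \<open>- k\<close>; the offset
        \<open>- T\<close> produces the line \<open>(T - s) *\<^sub>R k\<close> of velocity
        frequencies.\<close>
      define K'' where "K'' = uminus ` K'"
      have K'': "finite K''" "K'' \<subseteq> dual_lattice L" "0 \<notin> K''"
        using K' dual_lattice_uminus unfolding K''_def by auto
      have coeff: "pairing L p (wave (- k) ((s + - T) *\<^sub>R - k)) = complex_of_real V * \<mu> k s" if k: "k \<in> K'" for k s
      proof -
        have "pairing L p (wave (- k) ((s + - T) *\<^sub>R - k)) = pairing L (wave (- k) ((s + - T) *\<^sub>R - k)) p"
          unfolding pairing_def by (simp only: mult.commute)
        also have "\<dots> = (\<Sum>k'\<in>K. \<Sum>\<eta>\<in>H. c k' \<eta> * pairing L (wave (- k) ((s + - T) *\<^sub>R - k)) (wave k' \<eta>))"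
          unfolding p by (rule pair[OF L2_fun_wave[OF L(1)]])
        also have "\<dots> = (\<Sum>k'\<in>K. if k' = k then complex_of_real V * \<mu> k s else 0)"
        proof (intro sum.cong refl)
          fix k' assume k': "k' \<in> K"
          have "- k + k' \<in> dual_lattice L" using k k' K' KL dual_lattice_diff[of k' L k] by auto
          from integral_wave[OF L(1) this]
          have "pairing L (wave (- k) ((s + - T) *\<^sub>R - k)) (wave k' \<eta>)
              = (if k' = k then complex_of_real V * complex_of_real (gauss_char (\<eta> + (T - s) *\<^sub>R k)) else 0)" for \<eta>
            unfolding pairing_def wave_mult V_def by (simp add: algebra_simps)
          then show "(\<Sum>\<eta>\<in>H. c k' \<eta> * pairing L (wave (- k) ((s + - T) *\<^sub>R - k)) (wave k' \<eta>)) = (if k' = k then complex_of_real V * \<mu> k s else 0)"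
            by (simp add: \<mu>_def sum_distrib_left mult_ac)
        qed
        also have "\<dots> = complex_of_real V * \<mu> k s" using k K unfolding K'_def by simp
        finally show ?thesis .
      qed
      have "V\<^sup>2 * (\<Sum>k\<in>K'. L2_normsq ?M (\<mu> k)) = (\<Sum>k\<in>K'. \<integral>s. (norm (pairing L p (wave (- k) ((s + - T) *\<^sub>R - k))))\<^sup>2 \<partial>?M)"
        unfolding sum_distrib_left L2_normsq_def
        by (intro sum.cong refl) (simp only: coeff norm_mult norm_of_real power_mult_distrib power2_abs Bochner_Integration.integral_mult_right_zero)
      also have "\<dots> = (\<Sum>k\<in>K''. \<integral>s. (norm (pairing L p (wave k ((s + - T) *\<^sub>R k))))\<^sup>2 \<partial>?M)"
        unfolding K''_def by (subst sum.reindex) (auto simp: inj_on_def)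
      also have "\<dots> \<le> V * L * L2_normsq (phase L) p"
        unfolding V_def using L lattice K'' by (intro wave_coefficients_bound K'' T p2) auto
      finally have "(V * (\<Sum>k\<in>K'. L2_normsq ?M (\<mu> k))) * V \<le> (L * L2_normsq (phase L) p) * V"
        by (simp add: power2_eq_square mult_ac)
      then have "V * (\<Sum>k\<in>K'. L2_normsq ?M (\<mu> k)) \<le> L * L2_normsq (phase L) p" by (rule mult_right_le_imp_le[OF _ V])
      then have "(\<Sum>k\<in>K'. L2_normsq ?M (\<mu> k)) \<le> (L * L2_normsq (phase L) p) / V"
        by (subst pos_le_divide_eq[OF V]) (simp only: mult.commute)
      then show ?thesis by (simp add: L2_norm_power2)
    qed
    have second: "norm (\<Sum>k\<in>K'. \<integral>s. r k s * \<mu> k s \<partial>?M) \<le> 2 * L * (?Ni * L2_norm (phase L) p)"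
    proof -
      have L2t: "L2_fun ?M h" if "continuous_on {0..T} h" for h
      proof -
        have "continuous_on {0..T} (\<lambda>s. (norm (h s))\<^sup>2)" by (intro continuous_intros that)
        then show ?thesis using that by (simp add: L2_fun_def measurable_time time_integrable_continuous)
      qed
      have "norm (\<Sum>k\<in>K'. \<integral>s. r k s * \<mu> k s \<partial>?M) \<le> (\<Sum>k\<in>K'. norm (\<integral>s. r k s * \<mu> k s \<partial>?M))" by (rule norm_sum)
      also have "\<dots> \<le> (\<Sum>k\<in>K'. \<bar>L2_norm ?M (r k)\<bar> * \<bar>L2_norm ?M (\<mu> k)\<bar>)"
        using rc \<mu>c by (intro sum_mono) (simp add: L2_Cauchy_Schwarz L2t)
      also have "\<dots> \<le> L2_set (\<lambda>k. L2_norm ?M (r k)) K' * L2_set (\<lambda>k. L2_norm ?M (\<mu> k)) K'"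
        by (rule L2_set_mult_ineq)
      also have "\<dots> = sqrt ((\<Sum>k\<in>K'. L2_normsq ?M (r k)) * (\<Sum>k\<in>K'. L2_normsq ?M (\<mu> k)))"
        by (simp add: L2_set_def L2_norm_power2 real_sqrt_mult)
      also have "\<dots> \<le> sqrt ((2 * L * (?Ni * L2_norm (phase L) p))\<^sup>2)"
      proof (rule real_sqrt_le_mono)
        \<comment> \<open>The volume factors \<open>V\<close> cancel between the two estimates, and
          the coefficient \<open>2\<close> is rounded up to \<open>4\<close> to obtain a perfect
          square.\<close>
        have "(\<Sum>k\<in>K'. L2_normsq ?M (r k)) * (\<Sum>k\<in>K'. L2_normsq ?M (\<mu> k))
          \<le> (2 * (V * L * ?Ni\<^sup>2)) * (L / V * (L2_norm (phase L) p)\<^sup>2)"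
          using V L by (intro mult_mono R M sum_nonneg) auto
        also have "\<dots> = 2 * (L * (?Ni * L2_norm (phase L) p))\<^sup>2" using V by (simp add: power_mult_distrib power2_eq_square)
        also have "\<dots> \<le> 4 * (L * (?Ni * L2_norm (phase L) p))\<^sup>2" by simp
        also have "\<dots> = (2 * L * (?Ni * L2_norm (phase L) p))\<^sup>2" by (simp add: power_mult_distrib)
        finally show "(\<Sum>k\<in>K'. L2_normsq ?M (r k)) * (\<Sum>k\<in>K'. L2_normsq ?M (\<mu> k)) \<le> (2 * L * (?Ni * L2_norm (phase L) p))\<^sup>2" .
      qed
      also have "\<dots> = 2 * L * (?Ni * L2_norm (phase L) p)" using L by simp
      finally show ?thesis .
    qed
    have "exp T * norm (pairing L ?gT p) = norm (complex_of_real (exp T) * pairing L ?gT p)" by (simp add: norm_mult)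
    also have "\<dots> \<le> norm (pairing L ?gi w) + norm (\<Sum>k\<in>K'. \<integral>s. r k s * \<mu> k s \<partial>?M)"
      unfolding expand by (rule norm_triangle_ineq)
    also have "\<dots> \<le> ?Ni * L2_norm (phase L) p + 2 * L * (?Ni * L2_norm (phase L) p)" by (rule add_mono[OF first second])
    finally have "exp T * norm (pairing L ?gT p) \<le> (1 + 2 * L) * (?Ni * L2_norm (phase L) p)" by (simp add: distrib_right)
    then have "exp (- T) * (exp T * norm (pairing L ?gT p)) \<le> exp (- T) * ((1 + 2 * L) * (?Ni * L2_norm (phase L) p))"
      by (intro mult_left_mono) auto
    also have "exp (- T) * (exp T * norm (pairing L ?gT p)) = norm (pairing L ?gT p)" by (simp add: exp_minus)
    also have "exp (- T) * ((1 + 2 * L) * (?Ni * L2_norm (phase L) p)) = (1 + 2 * L) * exp (- T) * ?Ni * L2_norm (phase L) p"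
      by (simp only: mult_ac)
    finally show "norm (\<integral>z. ?gT z * p z \<partial>phase L) \<le> (1 + 2 * L) * exp (- T) * ?Ni * L2_norm (phase L) p"
      unfolding pairing_def .
  qed
  then have "(L2_norm (phase L) ?gT)\<^sup>2 \<le> ((1 + 2 * L) * exp (- T) * ?Ni)\<^sup>2"
    by (intro power_mono) auto
  also have "\<dots> = (1 + 2 * L)\<^sup>2 * exp (- (2 * T)) * L2_normsq (phase L) ?gi"
    by (simp add: power_mult_distrib L2_norm_power2 exp_double[symmetric])
  finally show ?thesis by (simp add: L2_norm_power2 init(2))
qed

theorem proposition4:
  fixes Lop :: "(real ^ 'n \<Rightarrow> complex) \<Rightarrow> real ^ 'n \<Rightarrow> complex"
  assumes "Lop = fokker_planck \<or> Lop = linear_bgk"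
  shows "\<forall>\<epsilon>>0. \<exists>L\<^sub>\<epsilon>>0. \<forall>L. 0 < L \<and> L \<le> L\<^sub>\<epsilon> \<longrightarrow>
    (\<forall>f0 f. L2_fun (dx_dgamma L) f0 \<longrightarrow> kinetic_solution Lop L f0 f \<longrightarrow>
      (\<forall>t\<ge>0.
        L2_normsq (dx_dgamma L) (\<lambda>(x, v). f t (x, v) - mean_value L f0 * complex_of_real (maxwellian v))
        \<le> (1 + \<epsilon>)
          * L2_normsq (dx_dgamma L) (\<lambda>(x, v). f0 (x, v) - mean_value L f0 * complex_of_real (maxwellian v))
          * exp (- (min 2 (lambda_star Lop - \<epsilon>) * t))))"
proof (intro allI impI)
  fix \<epsilon> :: real assume \<epsilon>: "0 < \<epsilon>"
  have "\<exists>L0>0. \<forall>L. 0 < L \<and> L \<le> L0 \<longrightarrow> (\<forall>f0 f. L2_fun (dx_dgamma L) f0 \<longrightarrow> kinetic_solution Lop L f0 f \<longrightarrow>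
      (\<forall>t\<ge>0. L2_normsq (phase L) (fluctuation (mean_value L f0) (f t))
        \<le> (1 + \<epsilon>) * exp (- (2 * t)) * L2_normsq (phase L) (fluctuation (mean_value L f0) f0)))"
    using assms
  proof
    assume Lop: "Lop = fokker_planck"
    obtain N where N: "0 < N" "\<And>\<kappa> t. N \<le> \<kappa> \<Longrightarrow> 0 \<le> t \<Longrightarrow> exp (- (2 * \<kappa>\<^sup>2 * fp_gap t)) \<le> (1 + \<epsilon>) * exp (- (2 * t))"
      using fp_mode_decay[OF \<epsilon>] by blast
    show ?thesis
    \<comment> \<open>This bound on \<open>L\<close> forces
      \<open>norm k \<ge> 2 * pi / L \<ge> N\<close> for every nonzero lattice vector.\<close>
    proof (intro exI[of _ "2 * pi / N"] conjI allI impI)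
      show "0 < 2 * pi / N" using N by simp
      fix L f0 f and t :: real
      assume L: "0 < L \<and> L \<le> 2 * pi / N" and f0: "L2_fun (dx_dgamma L) f0" and sol: "kinetic_solution Lop L f0 f" and t: "0 \<le> t"
      have "N \<le> 2 * pi / L" using L N(1) by (simp add: pos_le_divide_eq mult.commute)
      then have "N \<le> norm k" if "k \<in> dual_lattice L" "k \<noteq> 0" for k :: "real^'n"
        using dual_lattice_norm_ge[of L k] L that by auto
      then show "L2_normsq (phase L) (fluctuation (mean_value L f0) (f t))
          \<le> (1 + \<epsilon>) * exp (- (2 * t)) * L2_normsq (phase L) (fluctuation (mean_value L f0) f0)"
        using L f0 sol t \<epsilon> N(2) unfolding Lop by (intro fokker_planck_decay) auto
    qed
  next
    assume Lop: "Lop = linear_bgk"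
    \<comment> \<open>For \<open>L \<le> 1 / 4\<close> one has
      \<open>(1 + 2 * L)\<^sup>2 \<le> 1 + 5 * L\<close>, hence \<open>\<epsilon> / 5\<close>; the
      bound \<open>1 / 4\<close> is also the kernel mass allowed in the Volterra estimate.\<close>
    define L0 where "L0 = min (1 / 4) (\<epsilon> / 5)"
    show ?thesis
    proof (intro exI[of _ L0] conjI allI impI)
      show "0 < L0" using \<epsilon> by (simp add: L0_def)
      fix L f0 f and t :: real
      assume L: "0 < L \<and> L \<le> L0" and f0: "L2_fun (dx_dgamma L) f0" and sol: "kinetic_solution Lop L f0 f" and t: "0 \<le> t"
      have L': "0 < L" "L \<le> 1 / 4" "5 * L \<le> \<epsilon>" using L by (auto simp: L0_def)
      have "L * L \<le> 1 / 4 * L" using L' by (intro mult_right_mono) auto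
      moreover have "(1 + 2 * L)\<^sup>2 = 1 + 4 * L + 4 * (L * L)" by (simp add: power2_eq_square algebra_simps)
      ultimately have "(1 + 2 * L)\<^sup>2 \<le> 1 + \<epsilon>" using L' by linarith
      then have "(1 + 2 * L)\<^sup>2 * (exp (- (2 * t)) * L2_normsq (phase L) (fluctuation (mean_value L f0) f0))
          \<le> (1 + \<epsilon>) * (exp (- (2 * t)) * L2_normsq (phase L) (fluctuation (mean_value L f0) f0))"
        by (intro mult_right_mono) auto
      from order_trans[OF linear_bgk_decay[OF L'(1,2) f0 sol[unfolded Lop] t, unfolded mult.assoc] this]
      show "L2_normsq (phase L) (fluctuation (mean_value L f0) (f t))
          \<le> (1 + \<epsilon>) * exp (- (2 * t)) * L2_normsq (phase L) (fluctuation (mean_value L f0) f0)"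
        unfolding mult.assoc .
    qed
  qed
  then obtain L0 where L0: "0 < L0"
    "\<And>L f0 f t. 0 < L \<Longrightarrow> L \<le> L0 \<Longrightarrow> L2_fun (dx_dgamma L) f0 \<Longrightarrow> kinetic_solution Lop L f0 f \<Longrightarrow> 0 \<le> t \<Longrightarrow>
      L2_normsq (phase L) (fluctuation (mean_value L f0) (f t))
        \<le> (1 + \<epsilon>) * exp (- (2 * t)) * L2_normsq (phase L) (fluctuation (mean_value L f0) f0)"
    by blast
  show "\<exists>L\<^sub>\<epsilon>>0. \<forall>L. 0 < L \<and> L \<le> L\<^sub>\<epsilon> \<longrightarrow>
    (\<forall>f0 f. L2_fun (dx_dgamma L) f0 \<longrightarrow> kinetic_solution Lop L f0 f \<longrightarrow>
      (\<forall>t\<ge>0.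
        L2_normsq (dx_dgamma L) (\<lambda>(x, v). f t (x, v) - mean_value L f0 * complex_of_real (maxwellian v))
        \<le> (1 + \<epsilon>)
          * L2_normsq (dx_dgamma L) (\<lambda>(x, v). f0 (x, v) - mean_value L f0 * complex_of_real (maxwellian v))
          * exp (- (min 2 (lambda_star Lop - \<epsilon>) * t))))"
  proof (intro exI[of _ L0] conjI allI impI)
    fix L f0 f and t :: real
    assume L: "0 < L \<and> L \<le> L0" and f0: "L2_fun (dx_dgamma L) f0" and sol: "kinetic_solution Lop L f0 f" and t: "0 \<le> t"
    have ft: "L2_fun (dx_dgamma L) (f t)" using sol t by (simp add: kinetic_solution_def)
    let ?N0 = "L2_normsq (phase L) (fluctuation (mean_value L f0) f0)"
    have "min 2 (lambda_star Lop - \<epsilon>) * t \<le> 2 * t" using t by (intro mult_right_mono) auto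
    then have "(1 + \<epsilon>) * ?N0 * exp (- (2 * t)) \<le> (1 + \<epsilon>) * ?N0 * exp (- (min 2 (lambda_star Lop - \<epsilon>) * t))"
      using \<epsilon> by (intro mult_left_mono) auto
    moreover have "L2_normsq (phase L) (fluctuation (mean_value L f0) (f t)) \<le> (1 + \<epsilon>) * ?N0 * exp (- (2 * t))"
      using L0(2)[OF _ _ f0 sol t] L by (simp add: mult_ac)
    ultimately show "L2_normsq (dx_dgamma L) (\<lambda>(x, v). f t (x, v) - mean_value L f0 * complex_of_real (maxwellian v))
        \<le> (1 + \<epsilon>)
          * L2_normsq (dx_dgamma L) (\<lambda>(x, v). f0 (x, v) - mean_value L f0 * complex_of_real (maxwellian v))
          * exp (- (min 2 (lambda_star Lop - \<epsilon>) * t))"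
      using L by (simp add: L2_normsq_fluctuation f0 ft)
  qed (rule L0(1))
qed

end
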